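(* Let $K$ be an algebraically closed field, $\Lambda=K\langle x_1,\dots,x_N\rangle/I$ a finitely generated $K$-algebra, and $\tau\in\mathrm{rep}_\Lambda^m(K)$. Every irreducible component $X\subset X_{d,u}$ can be written uniquely (up to reordering) as a direct sum $X=\overline{X_1\oplus\cdots\oplus X_n}$ of generically indecomposable irreducible components $X_i\subset X_{d_i,u_i}$, where $d=\sum_id_i$ and $u=\sum_iu_i$.
   Context: For a commutative $K$-algebra $R$, $\mathrm{rep}_\Lambda^d(R)=\{\rho=(\rho_1,\dots,\rho_N)\in\mathbb M_d(R)^N: h(\rho)=0\ \forall h\in I\}$, equivalently the set of $K$-algebra homomorphisms $\rho\colon\Lambda\to\mathbb M_d(R)$; $M_\rho$ denotes the associated module over $\Lambda^R=\Lambda\otimes_KR$ with underlying $R$-module $R^d$. $\mathrm{GL}_d$ acts by conjugation, and $\rho\oplus\sigma$ is the block-diagonal direct sum. Put $M=M_\tau$ and $M^L=M\otimes_KL$. For $\rho\in\mathrm{rep}_\Lambda^d(R)$ let $\Phi(\rho)\colon\mathbb M_{m\times d}(R)\to\mathbb M_{m\times d}(R)^N$, $\phi\mapsto(\phi\rho_j-\tau_j\phi)_j$; this defines a morphism of schemes $\Phi\colon\mathrm{rep}_\Lambda^d\to\mathbb M_{dmN\times dm}$. The scheme $X_{d,u}\subset\mathrm{rep}_\Lambda^d$ is the preimage under $\Phi$ of the locally closed subscheme $\mathrm{rank}_{dm-u}$ (matrices whose $(dm-u+1)$-minors vanish and whose $(dm-u)$-minors generate the unit ideal). For a field $L\supset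 K$, $X_{d,u}(L)=\{\rho\in\mathrm{rep}_\Lambda^d(L):\dim_L\mathrm{Hom}_{\Lambda^L}(M_\rho,M^L)=u\}$. For irreducible components $X_i\subset X_{d_i,u_i}$, $\overline{X_1\oplus\cdots\oplus X_n}$ denotes the closure in $X_{d,u}$ ($d=\sum d_i$, $u=\sum u_i$) of the image of $\mathrm{GL}_d\times X_1\times\cdots\times X_n$ under $(g,\rho_1,\dots,\rho_n)\mapsto g\cdot(\rho_1\oplus\cdots\oplus\rho_n)$. An irreducible component is generically indecomposable if it contains a dense open subset all of whose points $\rho$ correspond to indecomposable modules $M_\rho$. *)

theory Defs
  imports
    "HOL-Library.Poly_Mapping"
    "HOL-Analysis.Abstract_Topology"
    "Jordan_Normal_Form.VS_Connect"
begin

section \<open>The free algebra and its matrix representations\<close>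

datatype 'a free_monoid = Word (letters: "'a list")

instantiation free_monoid :: (type) monoid_add
begin

definition zero_free_monoid :: "'a free_monoid" where
  "0 = Word []"

definition plus_free_monoid :: "'a free_monoid \<Rightarrow> 'a free_monoid \<Rightarrow> 'a free_monoid" where
  "v + w = Word (letters v @ letters w)"

instance
  by standard (simp_all add: zero_free_monoid_def plus_free_monoid_def)

end

text \<open>
  The monoid algebra of the free monoid is the free associative algebra; its multiplication,
  inherited from \<^theory>\<open>HOL-Library.Poly_Mapping\<close>, is the bilinear extension of concatenation.
  The algebra \<open>K\<langle>x\<^sub>1,\<dots>,x\<^sub>N\<rangle>\<close> consists of the elements whose words only use the letters \<open>0,\<dots>,N-1\<close>.
\<close>

type_synonym 'k nc_poly = "nat free_monoid \<Rightarrow>\<^sub>0 'k"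

definition free_alg :: "nat \<Rightarrow> 'k::field nc_poly set" where
  "free_alg N = {h. \<forall>w\<in>Poly_Mapping.keys h. set (letters w) \<subseteq> {..<N}}"

definition two_sided_ideal :: "nat \<Rightarrow> 'k::field nc_poly set \<Rightarrow> bool" where
  "two_sided_ideal N I \<longleftrightarrow>
     I \<subseteq> free_alg N \<and> 0 \<in> I \<and> (\<forall>f\<in>I. \<forall>g\<in>I. f + g \<in> I) \<and>
     (\<forall>f\<in>I. \<forall>a\<in>free_alg N. a * f \<in> I \<and> f * a \<in> I)"

definition mat_tuples :: "nat \<Rightarrow> nat \<Rightarrow> 'k::field mat list set" where
  "mat_tuples N d = {\<rho>. length \<rho> = N \<and> set \<rho> \<subseteq> carrier_mat d d}"

definition eval_word :: "nat \<Rightarrow> 'k::field mat list \<Rightarrow> nat free_monoid \<Rightarrow> 'k mat" where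
  "eval_word d \<rho> w = foldr (\<lambda>j A. \<rho> ! j * A) (letters w) (1\<^sub>m d)"

definition eval_nc :: "nat \<Rightarrow> 'k::field mat list \<Rightarrow> 'k nc_poly \<Rightarrow> 'k mat" where
  "eval_nc d \<rho> h = mat d d (\<lambda>(a, b).
     \<Sum>w\<in>Poly_Mapping.keys h. Poly_Mapping.lookup h w * eval_word d \<rho> w $$ (a, b))"

definition rep :: "nat \<Rightarrow> 'k::field nc_poly set \<Rightarrow> nat \<Rightarrow> 'k mat list set" where
  "rep N I d = {\<rho> \<in> mat_tuples N d. \<forall>h\<in>I. eval_nc d \<rho> h = 0\<^sub>m d d}"

section \<open>Modules\<close>

text \<open>
  For \<open>\<rho> \<in> rep N I d\<close> the module \<open>M\<^sub>\<rho>\<close> is \<open>K\<^sup>d\<close>, on which the class of \<open>h\<close> in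
  \<open>\<Lambda> = K\<langle>x\<^sub>1,\<dots>,x\<^sub>N\<rangle>/I\<close> acts as \<open>h(\<rho>)\<close>. Stability under scalars is included
  in \<open>rep_submodule\<close>, since the scalars are constants of the free algebra.
\<close>

definition rep_submodule :: "nat \<Rightarrow> nat \<Rightarrow> 'k::field mat list \<Rightarrow> 'k vec set \<Rightarrow> bool" where
  "rep_submodule N d \<rho> W \<longleftrightarrow>
     W \<subseteq> carrier_vec d \<and> 0\<^sub>v d \<in> W \<and> (\<forall>v\<in>W. \<forall>w\<in>W. v + w \<in> W) \<and>
     (\<forall>h\<in>free_alg N. \<forall>w\<in>W. eval_nc d \<rho> h *\<^sub>v w \<in> W)"

definition indecomposable :: "nat \<Rightarrow> nat \<Rightarrow> 'k::field mat list \<Rightarrow> bool" where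
  "indecomposable N d \<rho> \<longleftrightarrow>
     d > 0 \<and>
     (\<forall>V W. rep_submodule N d \<rho> V \<longrightarrow> rep_submodule N d \<rho> W \<longrightarrow>
        V \<inter> W = {0\<^sub>v d} \<longrightarrow> {v + w |v w. v \<in> V \<and> w \<in> W} = carrier_vec d \<longrightarrow>
        V = {0\<^sub>v d} \<or> W = {0\<^sub>v d})"

text \<open>The kernel of \<open>\<Phi>(\<rho>)\<close>, that is, \<open>Hom\<^sub>\<Lambda>(M\<^sub>\<rho>, M\<^sub>\<tau>)\<close>.\<close>

definition hom_space :: "nat \<Rightarrow> nat \<Rightarrow> nat \<Rightarrow> 'k::field mat list \<Rightarrow> 'k mat list \<Rightarrow> 'k mat set" where
  "hom_space N d m \<rho> \<tau> = {\<phi> \<in> carrier_mat m d. \<forall>j<N. \<phi> * \<rho> ! j - \<tau> ! j * \<phi> = 0\<^sub>m m d}"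

abbreviation hom_module ::
  "nat \<Rightarrow> nat \<Rightarrow> nat \<Rightarrow> 'k::field mat list \<Rightarrow> 'k mat list \<Rightarrow> ('k, 'k mat) module" where
  "hom_module N d m \<rho> \<tau> \<equiv> (module_mat TYPE('k) m d)\<lparr>carrier := hom_space N d m \<rho> \<tau>\<rparr>"

definition hom_dim :: "nat \<Rightarrow> nat \<Rightarrow> nat \<Rightarrow> 'k::field mat list \<Rightarrow> 'k mat list \<Rightarrow> nat" where
  "hom_dim N d m \<rho> \<tau> = vectorspace.dim class_ring (hom_module N d m \<rho> \<tau>)"

text \<open>\<open>hom_dim\<close> is the dimension of a genuine vector space.\<close>

lemma vectorspace_hom_module:
  fixes \<rho> \<tau> :: "'k::field mat list"
  assumes \<rho>: "\<rho> \<in> mat_tuples N d" and \<tau>: "\<tau> \<in> mat_tuples N m"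
  shows "vectorspace class_ring (hom_module N d m \<rho> \<tau>)"
proof -
  have \<rho>j: "\<rho> ! j \<in> carrier_mat d d" and \<tau>j: "\<tau> ! j \<in> carrier_mat m m" if "j < N" for j
    using that \<rho> \<tau> by (auto simp: mat_tuples_def)
  have eq: "A - B = 0\<^sub>m m d \<longleftrightarrow> A = B"
    if A: "A \<in> carrier_mat m d" and B: "B \<in> carrier_mat m d" for A B :: "'k mat"
  proof
    assume z: "A - B = 0\<^sub>m m d"
    have "A $$ (a, b) - B $$ (a, b) = 0" if "a < m" "b < d" for a b
      using arg_cong[OF z, of "\<lambda>C. C $$ (a, b)"] that A B by simp
    then show "A = B"
      using A B by (intro eq_matI) auto
  qed (use A B in auto)
  have hs: "hom_space N d m \<rho> \<tau> =
      {\<phi> \<in> carrier_mat m d. \<forall>j<N. \<phi> * \<rho> ! j = \<tau> ! j * \<phi>}"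
    unfolding hom_space_def
    using eq[OF mult_carrier_mat[OF _ \<rho>j] mult_carrier_mat[OF \<tau>j]] by blast
  have smult: "k \<cdot>\<^sub>m \<phi> \<in> hom_space N d m \<rho> \<tau>" if \<phi>: "\<phi> \<in> hom_space N d m \<rho> \<tau>" for k \<phi>
  proof -
    have c: "\<phi> \<in> carrier_mat m d" and e: "\<And>j. j < N \<Longrightarrow> \<phi> * \<rho> ! j = \<tau> ! j * \<phi>"
      using \<phi> by (auto simp: hs)
    have "k \<cdot>\<^sub>m \<phi> * \<rho> ! j = \<tau> ! j * (k \<cdot>\<^sub>m \<phi>)" if j: "j < N" for j
      unfolding mult_smult_assoc_mat[OF c \<rho>j[OF j]] mult_smult_distrib[OF \<tau>j[OF j] c] e[OF j] ..
    then show ?thesis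
      using c by (simp add: hs)
  qed
  have add: "\<phi> + \<psi> \<in> hom_space N d m \<rho> \<tau>"
    if \<phi>: "\<phi> \<in> hom_space N d m \<rho> \<tau>" and \<psi>: "\<psi> \<in> hom_space N d m \<rho> \<tau>" for \<phi> \<psi>
  proof -
    have c: "\<phi> \<in> carrier_mat m d" "\<psi> \<in> carrier_mat m d"
      and e: "\<And>j. j < N \<Longrightarrow> \<phi> * \<rho> ! j = \<tau> ! j * \<phi>" "\<And>j. j < N \<Longrightarrow> \<psi> * \<rho> ! j = \<tau> ! j * \<psi>"
      using \<phi> \<psi> by (auto simp: hs)
    have "(\<phi> + \<psi>) * \<rho> ! j = \<tau> ! j * (\<phi> + \<psi>)" if j: "j < N" for j
      unfolding add_mult_distrib_mat[OF c \<rho>j[OF j]] mult_add_distrib_mat[OF \<tau>j[OF j] c]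
        e(1)[OF j] e(2)[OF j] ..
    then show ?thesis
      using c by (simp add: hs)
  qed
  have zero: "0\<^sub>m m d \<in> hom_space N d m \<rho> \<tau>"
    using left_mult_zero_mat[OF \<rho>j] right_mult_zero_mat[OF \<tau>j] by (simp add: hs)
  interpret V: vectorspace class_ring "module_mat TYPE('k) m d"
    by (rule matrix_vs)
  have "submodule class_ring (hom_space N d m \<rho> \<tau>) (module_mat TYPE('k) m d)"
  proof (rule submodule.intro)
    show "module class_ring (module_mat TYPE('k) m d)"
      by (rule V.module_axioms)
    show "hom_space N d m \<rho> \<tau> \<subseteq> carrier (module_mat TYPE('k) m d)"
      by (auto simp: hom_space_def module_mat_simps)
  qed (use add zero smult in \<open>auto simp: module_mat_simps\<close>)
  with V.vectorspace_axioms
  have "subspace class_ring (hom_space N d m \<rho> \<tau>) (module_mat TYPE('k) m d)"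
    by (rule subspace.intro)
  then show ?thesis
    by (rule V.subspace_is_vs)
qed

section \<open>The Zariski topology on tuples of matrices\<close>

inductive_set poly_funs :: "nat \<Rightarrow> nat \<Rightarrow> ('k::field mat list \<Rightarrow> 'k) set" for N d where
  const: "(\<lambda>_. c) \<in> poly_funs N d"
| coord: "j < N \<Longrightarrow> a < d \<Longrightarrow> b < d \<Longrightarrow> (\<lambda>\<rho>. \<rho> ! j $$ (a, b)) \<in> poly_funs N d"
| add: "f \<in> poly_funs N d \<Longrightarrow> g \<in> poly_funs N d \<Longrightarrow> (\<lambda>\<rho>. f \<rho> + g \<rho>) \<in> poly_funs N d"
| mult: "f \<in> poly_funs N d \<Longrightarrow> g \<in> poly_funs N d \<Longrightarrow> (\<lambda>\<rho>. f \<rho> * g \<rho>) \<in> poly_funs N d"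

definition zariski_closed :: "nat \<Rightarrow> nat \<Rightarrow> 'k::field mat list set \<Rightarrow> bool" where
  "zariski_closed N d C \<longleftrightarrow>
     (\<exists>F\<subseteq>poly_funs N d. C = {\<rho> \<in> mat_tuples N d. \<forall>f\<in>F. f \<rho> = 0})"

definition zariski :: "nat \<Rightarrow> nat \<Rightarrow> 'k::field mat list topology" where
  "zariski N d = topology (\<lambda>U. U \<subseteq> mat_tuples N d \<and> zariski_closed N d (mat_tuples N d - U))"

lemma istopology_zariski:
  "istopology (\<lambda>U. U \<subseteq> mat_tuples N d \<and>
     zariski_closed N d (mat_tuples N d - U :: 'k::field mat list set))"
  unfolding istopology_def
proof (intro conjI allI impI)
  fix S T :: "'k mat list set"
  assume S: "S \<subseteq> mat_tuples N d \<and> zariski_closed N d (mat_tuples N d - S)"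
    and T: "T \<subseteq> mat_tuples N d \<and> zariski_closed N d (mat_tuples N d - T)"
  from S obtain F where F: "F \<subseteq> poly_funs N d"
    "mat_tuples N d - S = {\<rho> \<in> mat_tuples N d. \<forall>f\<in>F. f \<rho> = 0}"
    by (auto simp: zariski_closed_def)
  from T obtain G where G: "G \<subseteq> poly_funs N d"
    "mat_tuples N d - T = {\<rho> \<in> mat_tuples N d. \<forall>f\<in>G. f \<rho> = 0}"
    by (auto simp: zariski_closed_def)
  let ?H = "{\<lambda>\<rho>. f \<rho> * g \<rho> |f g. f \<in> F \<and> g \<in> G}"
  have "mat_tuples N d - (S \<inter> T) =
      {\<rho> \<in> mat_tuples N d. \<forall>f\<in>F. f \<rho> = 0} \<union> {\<rho> \<in> mat_tuples N d. \<forall>f\<in>G. f \<rho> = 0}"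
    using F(2) G(2) by blast
  also have "\<dots> = {\<rho> \<in> mat_tuples N d. \<forall>f\<in>?H. f \<rho> = 0}" (is "?A = ?B")
  proof (intro subset_antisym subsetI)
    fix \<rho> assume r: "\<rho> \<in> ?B"
    then have H: "h \<rho> = 0" if "h \<in> ?H" for h
      using that by (simp only: mem_Collect_eq[of \<rho>] Ball_def)
    have "f \<rho> * g \<rho> = 0" if "f \<in> F" "g \<in> G" for f g
      using H[of "\<lambda>\<rho>. f \<rho> * g \<rho>"] that by blast
    then have "(\<forall>f\<in>F. f \<rho> = 0) \<or> (\<forall>g\<in>G. g \<rho> = 0)"
      by (metis mult_eq_0_iff)
    then show "\<rho> \<in> ?A"
      using r by blast
  next
    fix \<rho> assume "\<rho> \<in> ?A"
    then show "\<rho> \<in> ?B"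
      by auto
  qed
  finally have "zariski_closed N d (mat_tuples N d - (S \<inter> T))"
    unfolding zariski_closed_def using F(1) G(1)
    by (intro exI[of _ ?H]) (auto intro: poly_funs.mult)
  then show "zariski_closed N d (mat_tuples N d - (S \<inter> T))" .
  show "S \<inter> T \<subseteq> mat_tuples N d"
    using S by auto
next
  fix \<K> :: "'k mat list set set"
  assume K: "\<forall>U\<in>\<K>. U \<subseteq> mat_tuples N d \<and> zariski_closed N d (mat_tuples N d - U)"
  then show "\<Union>\<K> \<subseteq> mat_tuples N d"
    by auto
  from K have "\<forall>U\<in>\<K>. \<exists>F. F \<subseteq> poly_funs N d \<and>
      mat_tuples N d - U = {\<rho> \<in> mat_tuples N d. \<forall>f\<in>F. f \<rho> = 0}"
    by (simp add: zariski_closed_def)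
  from bchoice[OF this] obtain F where F: "\<forall>U\<in>\<K>. F U \<subseteq> poly_funs N d \<and>
      mat_tuples N d - U = {\<rho> \<in> mat_tuples N d. \<forall>f\<in>F U. f \<rho> = 0}" ..
  have "\<rho> \<notin> U \<longleftrightarrow> (\<forall>f\<in>F U. f \<rho> = 0)" if "U \<in> \<K>" "\<rho> \<in> mat_tuples N d" for U \<rho>
    using bspec[OF F that(1), THEN conjunct2] that(2) by blast
  then have "mat_tuples N d - \<Union>\<K> = {\<rho> \<in> mat_tuples N d. \<forall>f\<in>\<Union>(F ` \<K>). f \<rho> = 0}"
    by auto
  moreover have "\<Union>(F ` \<K>) \<subseteq> poly_funs N d"
    using F by auto
  ultimately show "zariski_closed N d (mat_tuples N d - \<Union>\<K>)"
    unfolding zariski_closed_def by (intro exI[of _ "\<Union>(F ` \<K>)"] conjI)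
qed

definition irreducible_in :: "'a topology \<Rightarrow> 'a set \<Rightarrow> bool" where
  "irreducible_in T S \<longleftrightarrow>
     S \<subseteq> topspace T \<and> S \<noteq> {} \<and>
     (\<forall>A B. closedin T A \<longrightarrow> closedin T B \<longrightarrow> S \<subseteq> A \<union> B \<longrightarrow> S \<subseteq> A \<or> S \<subseteq> B)"

definition irreducible_components :: "'a topology \<Rightarrow> 'a set set" where
  "irreducible_components T =
     {S. irreducible_in T S \<and> (\<forall>S'. irreducible_in T S' \<longrightarrow> S \<subseteq> S' \<longrightarrow> S' = S)}"

section \<open>The strata and direct sums of components\<close>

text \<open>
  The space of \<open>K\<close>-valued points of the scheme \<open>X\<^sub>d\<^sub>,\<^sub>u\<close>. Over an algebraically closed field these are
  the closed points, which are very dense in the scheme, so that taking \<open>K\<close>-points identifies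
  closed sets, irreducible components and dense open subsets on both sides.
\<close>

definition X_points ::
  "nat \<Rightarrow> 'k::field nc_poly set \<Rightarrow> nat \<Rightarrow> 'k mat list \<Rightarrow> nat \<Rightarrow> nat \<Rightarrow> 'k mat list set" where
  "X_points N I m \<tau> d u = {\<rho> \<in> rep N I d. hom_dim N d m \<rho> \<tau> = u}"

definition X_space ::
  "nat \<Rightarrow> 'k::field nc_poly set \<Rightarrow> nat \<Rightarrow> 'k mat list \<Rightarrow> nat \<Rightarrow> nat \<Rightarrow> 'k mat list topology" where
  "X_space N I m \<tau> d u = subtopology (zariski N d) (X_points N I m \<tau> d u)"

definition generically_indecomposable :: "nat \<Rightarrow> nat \<Rightarrow> 'k::field mat list set \<Rightarrow> bool" where
  "generically_indecomposable N d X \<longleftrightarrow>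
     (\<exists>U. openin (subtopology (zariski N d) X) U \<and>
          Abstract_Topology.closure_of (subtopology (zariski N d) X) U = X \<and>
          (\<forall>\<rho>\<in>U. indecomposable N d \<rho>))"

definition rep_sum :: "nat \<Rightarrow> 'k::field mat list list \<Rightarrow> 'k mat list" where
  "rep_sum N \<rho>s = map (\<lambda>j. diag_block_mat (map (\<lambda>\<rho>. \<rho> ! j) \<rho>s)) [0..<N]"

text \<open>The image of \<open>GL\<^sub>d \<times> X\<^sub>1 \<times> \<dots> \<times> X\<^sub>n\<close>; the matrix \<open>h\<close> is the inverse of \<open>g\<close>.\<close>

definition sum_image :: "nat \<Rightarrow> nat \<Rightarrow> 'k::field mat list set list \<Rightarrow> 'k mat list set" where
  "sum_image N d Xs =
     {map (\<lambda>A. g * A * h) (rep_sum N \<rho>s) |g h \<rho>s.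
        g \<in> carrier_mat d d \<and> h \<in> carrier_mat d d \<and> g * h = 1\<^sub>m d \<and> h * g = 1\<^sub>m d \<and>
        \<rho>s \<in> listset Xs}"

text \<open>
  A summand is recorded as a triple \<open>(d\<^sub>i, u\<^sub>i, X\<^sub>i)\<close>, \<open>X\<^sub>i\<close> being a component of \<open>X\<close> for \<open>d\<^sub>i\<close> and \<open>u\<^sub>i\<close>.
  The empty list is allowed: it decomposes the one point space for \<open>d = 0\<close>, the zero module
  not being indecomposable.
\<close>

definition component_decomposition ::
  "nat \<Rightarrow> 'k::field nc_poly set \<Rightarrow> nat \<Rightarrow> 'k mat list \<Rightarrow> nat \<Rightarrow> nat \<Rightarrow> 'k mat list set \<Rightarrow>
   (nat \<times> nat \<times> 'k mat list set) list \<Rightarrow> bool" where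
  "component_decomposition N I m \<tau> d u X Xs \<longleftrightarrow>
     (\<forall>(d\<^sub>i, u\<^sub>i, X\<^sub>i)\<in>set Xs.
        X\<^sub>i \<in> irreducible_components (X_space N I m \<tau> d\<^sub>i u\<^sub>i) \<and>
        generically_indecomposable N d\<^sub>i X\<^sub>i) \<and>
     d = (\<Sum>(d\<^sub>i, u\<^sub>i, X\<^sub>i)\<leftarrow>Xs. d\<^sub>i) \<and>
     u = (\<Sum>(d\<^sub>i, u\<^sub>i, X\<^sub>i)\<leftarrow>Xs. u\<^sub>i) \<and>
     X = Abstract_Topology.closure_of (X_space N I m \<tau> d u)
           (sum_image N d (map (\<lambda>(d\<^sub>i, u\<^sub>i, X\<^sub>i). X\<^sub>i) Xs))"

end

theory Submission
  imports Defs "Jordan_Normal_Form.Char_Poly"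
begin

text \<open>
  The block sum map from \<open>GL d\<close> and a product of irreducible sets is a morphism, so that its image is
  irreducible, and \<open>hom_dim\<close> is additive on direct sums, so that the image stays in one stratum.
  If a component is not generically indecomposable, its decomposable points are dense in it. They
  are covered by the finitely many images of pairs of components of smaller dimension, hence one such image
  is dense in the component; induction on the dimension gives existence.

  For uniqueness, replace every summand by a dense open subset of indecomposable points lying on no
  other of the finitely many summands involved. The two resulting images are dense in the given
  component, and they are constructible by Chevalley's theorem, so that they share a point. The
  Krull-Schmidt theorem matches the indecomposable summands of this point, and these determine
  the components on which they lie.
\<close>

section \<open>Regular functions and constructible sets\<close>

text \<open>Spaces are sets of points with a generating set of functions, so irreducibility, density
  and constructibility become statements about values of functions, and products and images need
  neither coordinate rings nor dimension theory. Strata need not be closed, so components and images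
  are only constructible. Hence quantifier elimination carries the argument: the sets in question
  are given by formulas with quantifiers over matrices, and such formulas define constructible sets.
  Density of two images alone does not force a common point. A dense constructible subset of an
  irreducible set contains a nonempty open part, and this does. The isomorphism class of a generic
  summand has to determine its component. Components are stable under conjugation since the group is
  irreducible, and u is the dimension of Hom into M, so only components of one stratum have to be
  told apart, by a generic choice. Krull-Schmidt is obtained by counting: a multiplicity is a
  difference of two dimensions, additive on direct sums and invariant under isomorphism, so no
  exchange argument occurs.\<close>

text \<open>The first component generates the algebra of regular functions, the second is the set of points.\<close>

type_synonym ('p, 'k) space = "('p \<Rightarrow> 'k) set \<times> 'p set"

abbreviation pts :: "('p, 'k) space \<Rightarrow> 'p set" where
  "pts S \<equiv> snd S"

text \<open>HOL functions are total, so two functions may agree on the points and differ elsewhere.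
  The rule \<open>cong\<close> identifies them: membership depends only on the values on
  \<open>pts S\<close>.\<close>

inductive_set reg :: "('p, 'k::field) space \<Rightarrow> ('p \<Rightarrow> 'k) set" for S where
  const: "(\<lambda>_. c) \<in> reg S"
| gen: "x \<in> fst S \<Longrightarrow> x \<in> reg S"
| add: "f \<in> reg S \<Longrightarrow> g \<in> reg S \<Longrightarrow> (\<lambda>p. f p + g p) \<in> reg S"
| mult: "f \<in> reg S \<Longrightarrow> g \<in> reg S \<Longrightarrow> (\<lambda>p. f p * g p) \<in> reg S"
| cong: "f \<in> reg S \<Longrightarrow> (\<And>p. p \<in> pts S \<Longrightarrow> g p = f p) \<Longrightarrow> g \<in> reg S"

lemma reg_cmult: "f \<in> reg S \<Longrightarrow> (\<lambda>p. c * f p) \<in> reg S"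
  by (rule reg.mult[OF reg.const])

lemma reg_uminus: "f \<in> reg S \<Longrightarrow> (\<lambda>p. - f p) \<in> reg S"
  using reg_cmult[of f S "-1"] by simp

lemma reg_diff: "f \<in> reg S \<Longrightarrow> g \<in> reg S \<Longrightarrow> (\<lambda>p. f p - g p) \<in> reg S"
  using reg.add[of f S, OF _ reg_uminus[of g]] by simp

lemma reg_sum: "(\<And>i. i \<in> I \<Longrightarrow> f i \<in> reg S) \<Longrightarrow> (\<lambda>p. \<Sum>i\<in>I. f i p) \<in> reg S"
  by (induction I rule: infinite_finite_induct) (auto intro: reg.const reg.add)

section \<open>Morphisms and products\<close>

definition morphism :: "('p, 'k::field) space \<Rightarrow> ('q, 'k) space \<Rightarrow> ('p \<Rightarrow> 'q) \<Rightarrow> bool" where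
  "morphism S T \<phi> \<longleftrightarrow> (\<forall>p\<in>pts S. \<phi> p \<in> pts T) \<and> (\<forall>y\<in>fst T. (\<lambda>p. y (\<phi> p)) \<in> reg S)"

lemma morphism_reg:
  assumes "morphism S T \<phi>" and "f \<in> reg T"
  shows "(\<lambda>p. f (\<phi> p)) \<in> reg S"
  using assms(2)
proof induction
  case (cong f g)
  show ?case
    by (rule reg.cong[OF cong.IH]) (use cong assms(1) in \<open>auto simp: morphism_def\<close>)
qed (use assms(1) in \<open>auto intro: reg.intros simp: morphism_def\<close>)

lemma morphism_pts: "morphism S T \<phi> \<Longrightarrow> p \<in> pts S \<Longrightarrow> \<phi> p \<in> pts T"
  by (auto simp: morphism_def)

lemma morphism_comp:
  assumes "morphism S T \<phi>" and "morphism T U \<psi>"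
  shows "morphism S U (\<lambda>p. \<psi> (\<phi> p))"
  using assms(1) morphism_reg[OF assms(1)] assms(2) unfolding morphism_def by blast

text \<open>Pulling back the generators of both factors yields all finite sums of products f(p)
  g(q), which is the image of the tensor product of the two algebras in the functions on the
  product.\<close>

definition prod_space :: "('p, 'k::field) space \<Rightarrow> ('q, 'k) space \<Rightarrow> ('p \<times> 'q, 'k) space"
    (infixr \<open>\<otimes>\<^sub>s\<close> 75) where
  "S \<otimes>\<^sub>s T = ((\<lambda>x z. x (fst z)) ` fst S \<union> (\<lambda>y z. y (snd z)) ` fst T, pts S \<times> pts T)"

lemma dom_prod_space [simp]: "pts (S \<otimes>\<^sub>s T) = pts S \<times> pts T"
  by (simp add: prod_space_def)

lemma morphism_fst: "morphism (S \<otimes>\<^sub>s T) S fst"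
  by (auto simp: morphism_def prod_space_def intro: reg.gen)

lemma morphism_snd: "morphism (S \<otimes>\<^sub>s T) T snd"
  by (auto simp: morphism_def prod_space_def intro: reg.gen)

lemmas reg_fst = morphism_reg[OF morphism_fst] and reg_snd = morphism_reg[OF morphism_snd]

lemma morphism_Pair:
  assumes "morphism R S \<phi>" and "morphism R T \<psi>"
  shows "morphism R (S \<otimes>\<^sub>s T) (\<lambda>p. (\<phi> p, \<psi> p))"
  using assms by (auto simp: morphism_def prod_space_def)

lemma morphism_const: "q \<in> pts T \<Longrightarrow> morphism S T (\<lambda>_. q)"
  by (auto simp: morphism_def intro: reg.const)

lemma morphism_id: "morphism S S (\<lambda>p. p)"
  by (auto simp: morphism_def intro: reg.gen)

section \<open>Irreducibility and density, tested by functions\<close>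

text \<open>\<open>irr S C\<close> expresses irreducibility of \<open>C\<close>, \<open>dense_in S C' C\<close> density of \<open>C'\<close> in \<open>C\<close>,
  both for the topology whose closed sets are the zero sets of regular functions.\<close>

definition irr :: "('p, 'k::field) space \<Rightarrow> 'p set \<Rightarrow> bool" where
  "irr S C \<longleftrightarrow> C \<subseteq> pts S \<and> C \<noteq> {} \<and>
     (\<forall>f\<in>reg S. \<forall>g\<in>reg S. (\<exists>p\<in>C. f p \<noteq> 0) \<longrightarrow> (\<exists>p\<in>C. g p \<noteq> 0) \<longrightarrow> (\<exists>p\<in>C. f p \<noteq> 0 \<and> g p \<noteq> 0))"

definition dense_in :: "('p, 'k::field) space \<Rightarrow> 'p set \<Rightarrow> 'p set \<Rightarrow> bool" where
  "dense_in S C' C \<longleftrightarrow> C' \<subseteq> C \<and> C \<subseteq> pts S \<and> (\<forall>f\<in>reg S. (\<exists>p\<in>C. f p \<noteq> 0) \<longrightarrow> (\<exists>p\<in>C'. f p \<noteq> 0))"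

lemma irrD:
  "irr S C \<Longrightarrow> f \<in> reg S \<Longrightarrow> g \<in> reg S \<Longrightarrow> p \<in> C \<Longrightarrow> f p \<noteq> 0 \<Longrightarrow> q \<in> C \<Longrightarrow> g q \<noteq> 0 \<Longrightarrow>
    \<exists>p\<in>C. f p \<noteq> 0 \<and> g p \<noteq> 0"
  unfolding irr_def by blast

lemma dense_inD: "dense_in S C' C \<Longrightarrow> f \<in> reg S \<Longrightarrow> p \<in> C \<Longrightarrow> f p \<noteq> 0 \<Longrightarrow> \<exists>p\<in>C'. f p \<noteq> 0"
  unfolding dense_in_def by blast

lemma irr_singleton: "p \<in> pts S \<Longrightarrow> irr S {p}"
  by (auto simp: irr_def)

lemma dense_in_refl: "C \<subseteq> pts S \<Longrightarrow> dense_in S C C"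
  by (auto simp: dense_in_def)

lemma dense_in_trans: "dense_in S A B \<Longrightarrow> dense_in S B C \<Longrightarrow> dense_in S A C"
  unfolding dense_in_def by blast

lemma irr_dense_superset:
  assumes "irr S C'" and "dense_in S C' C"
  shows "irr S C"
  unfolding irr_def
proof (intro conjI ballI impI)
  show "C \<subseteq> pts S" "C \<noteq> {}"
    using assms by (auto simp: irr_def dense_in_def)
  fix f g assume fg: "f \<in> reg S" "g \<in> reg S" and "\<exists>p\<in>C. f p \<noteq> 0" "\<exists>p\<in>C. g p \<noteq> 0"
  then have "\<exists>p\<in>C'. f p \<noteq> 0" "\<exists>p\<in>C'. g p \<noteq> 0"
    using assms(2) fg by (simp_all add: dense_in_def)
  then have "\<exists>p\<in>C'. f p \<noteq> 0 \<and> g p \<noteq> 0"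
    using assms(1) fg by (simp add: irr_def)
  then show "\<exists>p\<in>C. f p \<noteq> 0 \<and> g p \<noteq> 0"
    using assms(2) by (auto simp: dense_in_def)
qed

lemma reg_slice1: "f \<in> reg (S \<otimes>\<^sub>s T) \<Longrightarrow> b \<in> pts T \<Longrightarrow> (\<lambda>a. f (a, b)) \<in> reg S"
  by (rule morphism_reg[OF morphism_Pair[OF morphism_id morphism_const]])

lemma reg_slice2: "f \<in> reg (S \<otimes>\<^sub>s T) \<Longrightarrow> a \<in> pts S \<Longrightarrow> (\<lambda>b. f (a, b)) \<in> reg T"
  by (rule morphism_reg[OF morphism_Pair[OF morphism_const morphism_id]])

text \<open>Slicing twice: fixing the second coordinate at \<open>b\<close> and \<open>b'\<close>
  gives two functions on \<open>A\<close> with a common nonzero point \<open>c\<close>; fixing the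
  first coordinate at \<open>c\<close> gives two functions on \<open>B\<close>. The topology is the
  one given by \<open>reg\<close>, in general finer than the product topology, so slices replace
  rectangles.\<close>

lemma irr_prod:
  assumes A: "irr S A" and B: "irr T B"
  shows "irr (S \<otimes>\<^sub>s T) (A \<times> B)"
  unfolding irr_def
proof (intro conjI ballI impI)
  show "A \<times> B \<subseteq> pts (S \<otimes>\<^sub>s T)" "A \<times> B \<noteq> {}"
    using A B by (auto simp: irr_def)
  fix f g assume f: "f \<in> reg (S \<otimes>\<^sub>s T)" and g: "g \<in> reg (S \<otimes>\<^sub>s T)"
    and "\<exists>p\<in>A \<times> B. f p \<noteq> 0" "\<exists>p\<in>A \<times> B. g p \<noteq> 0"
  then obtain a b a' b' where ab: "a \<in> A" "b \<in> B" "f (a, b) \<noteq> 0" "a' \<in> A" "b' \<in> B" "g (a', b') \<noteq> 0"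
    by auto
  have dom: "A \<subseteq> pts S" "B \<subseteq> pts T"
    using A B by (auto simp: irr_def)
  obtain c where c: "c \<in> A" "f (c, b) \<noteq> 0" "g (c, b') \<noteq> 0"
    using irrD[OF A reg_slice1[OF f, of b] reg_slice1[OF g, of b'], of a a'] ab dom by blast
  obtain e where "e \<in> B" "f (c, e) \<noteq> 0" "g (c, e) \<noteq> 0"
    using irrD[OF B reg_slice2[OF f, of c] reg_slice2[OF g, of c], of b b'] ab c dom by blast
  then show "\<exists>p\<in>A \<times> B. f p \<noteq> 0 \<and> g p \<noteq> 0"
    using c by auto
qed

lemma dense_in_prod:
  assumes A: "dense_in S A' A" and B: "dense_in T B' B"
  shows "dense_in (S \<otimes>\<^sub>s T) (A' \<times> B') (A \<times> B)"
  unfolding dense_in_def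
proof (intro conjI ballI impI)
  show "A' \<times> B' \<subseteq> A \<times> B" "A \<times> B \<subseteq> pts (S \<otimes>\<^sub>s T)"
    using A B by (auto simp: dense_in_def)
  fix f assume f: "f \<in> reg (S \<otimes>\<^sub>s T)" and "\<exists>p\<in>A \<times> B. f p \<noteq> 0"
  then obtain a b where ab: "a \<in> A" "b \<in> B" "f (a, b) \<noteq> 0"
    by auto
  have dom: "A \<subseteq> pts S" "B \<subseteq> pts T" "A' \<subseteq> A"
    using A B by (auto simp: dense_in_def)
  obtain c where c: "c \<in> A'" "f (c, b) \<noteq> 0"
    using dense_inD[OF A reg_slice1[OF f, of b], of a] ab dom by blast
  obtain e where "e \<in> B'" "f (c, e) \<noteq> 0"
    using dense_inD[OF B reg_slice2[OF f, of c], of b] ab c dom by blast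
  then show "\<exists>p\<in>A' \<times> B'. f p \<noteq> 0"
    using c by auto
qed

lemma irr_image:
  assumes "irr S A" and "morphism S T \<phi>"
  shows "irr T (\<phi> ` A)"
  unfolding irr_def
proof (intro conjI ballI impI)
  show "\<phi> ` A \<subseteq> pts T" "\<phi> ` A \<noteq> {}"
    using assms by (auto simp: irr_def morphism_def)
  fix f g assume fg: "f \<in> reg T" "g \<in> reg T" and "\<exists>p\<in>\<phi> ` A. f p \<noteq> 0" "\<exists>p\<in>\<phi> ` A. g p \<noteq> 0"
  then show "\<exists>p\<in>\<phi> ` A. f p \<noteq> 0 \<and> g p \<noteq> 0"
    using irrD[OF assms(1) morphism_reg[OF assms(2) fg(1)] morphism_reg[OF assms(2) fg(2)]] by auto
qed

lemma dense_in_image: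
  assumes "dense_in S A' A" and "morphism S T \<phi>"
  shows "dense_in T (\<phi> ` A') (\<phi> ` A)"
  unfolding dense_in_def
proof (intro conjI ballI impI)
  show "\<phi> ` A' \<subseteq> \<phi> ` A" "\<phi> ` A \<subseteq> pts T"
    using assms by (auto simp: dense_in_def morphism_def)
  fix f assume f: "f \<in> reg T" and "\<exists>p\<in>\<phi> ` A. f p \<noteq> 0"
  then show "\<exists>p\<in>\<phi> ` A'. f p \<noteq> 0"
    using dense_inD[OF assms(1) morphism_reg[OF assms(2) f]] by auto
qed

section \<open>Constructible sets\<close>

inductive_set constr :: "('p, 'k::field) space \<Rightarrow> 'p set set" for S where
  zero: "f \<in> reg S \<Longrightarrow> {p \<in> pts S. f p = 0} \<in> constr S"
| diff: "C \<in> constr S \<Longrightarrow> pts S - C \<in> constr S"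
| inter: "C \<in> constr S \<Longrightarrow> D \<in> constr S \<Longrightarrow> C \<inter> D \<in> constr S"

lemma constr_subset: "C \<in> constr S \<Longrightarrow> C \<subseteq> pts S"
  by (induction rule: constr.induct) auto

lemma constr_union:
  assumes "C \<in> constr S" "D \<in> constr S"
  shows "C \<union> D \<in> constr S"
proof -
  have "C \<union> D = pts S - ((pts S - C) \<inter> (pts S - D))"
    using assms[THEN constr_subset] by auto
  then show ?thesis
    using assms by (metis constr.diff constr.inter)
qed

lemma constr_pts: "pts S \<in> constr S"
  using constr.zero[OF reg.const[of 0]] by simp

lemma constr_empty: "{} \<in> constr S"
  using constr.diff[OF constr_pts] by simp

lemma constr_eq:
  assumes "f \<in> reg S" "g \<in> reg S"
  shows "{p \<in> pts S. f p = g p} \<in> constr S"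
  using constr.zero[OF reg_diff[OF assms]] by simp

lemma constr_neq:
  assumes "f \<in> reg S"
  shows "{p \<in> pts S. f p \<noteq> 0} \<in> constr S"
proof -
  have "{p \<in> pts S. f p \<noteq> 0} = pts S - {p \<in> pts S. f p = 0}"
    by auto
  then show ?thesis
    using constr.diff[OF constr.zero[OF assms]] by simp
qed

lemma constr_ball:
  assumes "finite J" and "\<And>j. j \<in> J \<Longrightarrow> {p \<in> pts S. P j p} \<in> constr S"
  shows "{p \<in> pts S. \<forall>j\<in>J. P j p} \<in> constr S"
  using assms
proof (induction rule: finite_induct)
  case empty
  then show ?case
    by (simp add: constr_pts)
next
  case (insert j J)
  have "{p \<in> pts S. \<forall>j\<in>insert j J. P j p} = {p \<in> pts S. P j p} \<inter> {p \<in> pts S. \<forall>j\<in>J. P j p}"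
    by auto
  then show ?case
    using insert by (auto intro: constr.inter)
qed

text \<open>Together with \<open>constr_ball\<close> the next rules let a set written by a formula
  be proved constructible by following its syntax.\<close>

lemma constr_not: "{p \<in> pts S. P p} \<in> constr S \<Longrightarrow> {p \<in> pts S. \<not> P p} \<in> constr S"
  using constr.diff[of "{p \<in> pts S. P p}" S] by (simp add: set_diff_eq cong: conj_cong)

lemma constr_conj:
  "{p \<in> pts S. P p} \<in> constr S \<Longrightarrow> {p \<in> pts S. Q p} \<in> constr S \<Longrightarrow>
    {p \<in> pts S. P p \<and> Q p} \<in> constr S"
  using constr.inter[of "{p \<in> pts S. P p}" S "{p \<in> pts S. Q p}"] by (simp add: Collect_conj_eq Int_ac)

lemma constr_imp:
  "{p \<in> pts S. P p} \<in> constr S \<Longrightarrow> {p \<in> pts S. Q p} \<in> constr S \<Longrightarrow>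
    {p \<in> pts S. P p \<longrightarrow> Q p} \<in> constr S"
  using constr_not[OF constr_conj[OF _ constr_not], of S P Q] by simp

lemma constr_preimage:
  assumes \<phi>: "morphism S T \<phi>" and "C \<in> constr T"
  shows "{p \<in> pts S. \<phi> p \<in> C} \<in> constr S"
  using assms(2)
proof induction
  case (zero f)
  have "{p \<in> pts S. \<phi> p \<in> {p \<in> pts T. f p = 0}} = {p \<in> pts S. f (\<phi> p) = 0}"
    using morphism_pts[OF \<phi>] by auto
  then show ?case
    using constr.zero[OF morphism_reg[OF \<phi> zero]] by simp
next
  case (diff C)
  have "{p \<in> pts S. \<phi> p \<in> pts T - C} = {p \<in> pts S. \<not> \<phi> p \<in> C}"
    using morphism_pts[OF \<phi>] by auto
  then show ?case
    using constr_not[OF diff.IH] by simp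
next
  case (inter C D)
  then show ?case
    using constr_conj[OF inter.IH] by simp
qed

text \<open>The alternative "contains or misses a nonempty principal open subset of
  \<open>C\<close>" is symmetric under complement, and it survives intersections because
  irreducibility lets the two functions be multiplied.\<close>

lemma constr_generic:
  assumes C: "irr S C" and "D \<in> constr S"
  shows "\<exists>f\<in>reg S. (\<exists>p\<in>C. f p \<noteq> 0) \<and>
    ((\<forall>p\<in>C. f p \<noteq> 0 \<longrightarrow> p \<in> D) \<or> (\<forall>p\<in>C. f p \<noteq> 0 \<longrightarrow> p \<notin> D))"
  using assms(2)
proof induction
  case (zero f)
  have one: "(\<lambda>_. 1) \<in> reg S" "C \<noteq> {}" "C \<subseteq> pts S"
    using C by (auto intro: reg.const simp: irr_def)
  show ?case
  proof (cases "\<exists>p\<in>C. f p \<noteq> 0")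
    case True
    then show ?thesis
      using zero by (intro bexI[of _ f] conjI disjI2) simp_all
  next
    case False
    then have "\<forall>p\<in>C. p \<in> {p \<in> pts S. f p = 0}"
      using one by auto
    then show ?thesis
      using one by (intro bexI[of _ "\<lambda>_. 1"] conjI disjI1) auto
  qed
next
  case (diff D)
  from diff.IH obtain f where "f \<in> reg S" and f: "(\<exists>p\<in>C. f p \<noteq> 0) \<and>
      ((\<forall>p\<in>C. f p \<noteq> 0 \<longrightarrow> p \<in> D) \<or> (\<forall>p\<in>C. f p \<noteq> 0 \<longrightarrow> p \<notin> D))"
    by (rule bexE)
  moreover have "C \<subseteq> pts S"
    using C by (simp add: irr_def)
  ultimately show ?case
    by (intro bexI[of _ f]) auto
next
  case (inter D E)
  from inter.IH(1) obtain f where f: "f \<in> reg S" and f': "(\<exists>p\<in>C. f p \<noteq> 0) \<and>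
      ((\<forall>p\<in>C. f p \<noteq> 0 \<longrightarrow> p \<in> D) \<or> (\<forall>p\<in>C. f p \<noteq> 0 \<longrightarrow> p \<notin> D))"
    by (rule bexE)
  from inter.IH(2) obtain g where g: "g \<in> reg S" and g': "(\<exists>p\<in>C. g p \<noteq> 0) \<and>
      ((\<forall>p\<in>C. g p \<noteq> 0 \<longrightarrow> p \<in> E) \<or> (\<forall>p\<in>C. g p \<noteq> 0 \<longrightarrow> p \<notin> E))"
    by (rule bexE)
  have "\<exists>p\<in>C. f p \<noteq> 0 \<and> g p \<noteq> 0"
    using C f g f' g' by (simp add: irr_def)
  then have "\<exists>p\<in>C. f p * g p \<noteq> 0"
    by simp
  moreover have "(\<forall>p\<in>C. f p * g p \<noteq> 0 \<longrightarrow> p \<in> D \<inter> E) \<or> (\<forall>p\<in>C. f p * g p \<noteq> 0 \<longrightarrow> p \<notin> D \<inter> E)"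
    using f' g' by auto
  ultimately show ?case
    using f g by (intro bexI[of _ "\<lambda>p. f p * g p"] conjI reg.mult)
qed

text \<open>Density of \<open>C'\<close> rules out the second alternative of
  \<open>constr_generic\<close>. Applied to a dense constructible image, this yields an open part
  that every other dense image must meet.\<close>

lemma constr_dense_generic:
  assumes "irr S C" and "dense_in S C' C" and "D \<in> constr S" and "C' \<subseteq> D"
  shows "\<exists>f\<in>reg S. (\<exists>p\<in>C. f p \<noteq> 0) \<and> (\<forall>p\<in>C. f p \<noteq> 0 \<longrightarrow> p \<in> D)"
proof -
  from constr_generic[OF assms(1,3)] obtain f where f: "f \<in> reg S" and f': "(\<exists>p\<in>C. f p \<noteq> 0) \<and>
      ((\<forall>p\<in>C. f p \<noteq> 0 \<longrightarrow> p \<in> D) \<or> (\<forall>p\<in>C. f p \<noteq> 0 \<longrightarrow> p \<notin> D))"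
    by (rule bexE)
  have "\<exists>p\<in>C'. f p \<noteq> 0"
    using assms(2) f f' by (simp add: dense_in_def)
  then have "\<forall>p\<in>C. f p \<noteq> 0 \<longrightarrow> p \<in> D"
    using f' assms(2,4) by (auto simp: dense_in_def)
  then show ?thesis
    using f f' by (intro bexI[of _ f]) simp_all
qed

lemma dense_in_open:
  assumes "irr S C" and "f \<in> reg S" and "\<exists>p\<in>C. f p \<noteq> 0"
  shows "dense_in S {p \<in> C. f p \<noteq> 0} C"
  using assms by (simp add: irr_def dense_in_def subset_iff) blast

section \<open>Projections of constructible sets\<close>

text \<open>The bound \<open>n\<close> is a formal degree: the true degree drops where coefficients
  vanish, so the coefficient at \<open>n\<close> is treated as the leading one and its vanishing is
  a separate case.\<close>

definition poly_fam :: "('p, 'k::field) space \<Rightarrow> nat \<Rightarrow> ('p \<Rightarrow> 'k poly) \<Rightarrow> bool" where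
  "poly_fam S n P \<longleftrightarrow> (\<forall>p. degree (P p) \<le> n) \<and> (\<forall>i. (\<lambda>p. coeff (P p) i) \<in> reg S)"

lemma poly_fam_mono: "poly_fam S n P \<Longrightarrow> n \<le> n' \<Longrightarrow> poly_fam S n' P"
  by (auto simp: poly_fam_def intro: order_trans)

lemma poly_fam_add:
  assumes "poly_fam S n P" "poly_fam S n Q"
  shows "poly_fam S n (\<lambda>p. P p + Q p)"
  using assms by (auto simp: poly_fam_def intro: reg.add degree_add_le)

lemma poly_fam_mult:
  assumes "poly_fam S n P" "poly_fam S m Q"
  shows "poly_fam S (n + m) (\<lambda>p. P p * Q p)"
proof -
  have "degree (P p * Q p) \<le> n + m" for p
    using assms by (intro order_trans[OF degree_mult_le] add_mono) (auto simp: poly_fam_def)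
  then show ?thesis
    using assms unfolding poly_fam_def coeff_mult by (auto intro!: reg_sum reg.mult)
qed

lemma poly_fam_smult:
  assumes "f \<in> reg S" "poly_fam S n P"
  shows "poly_fam S n (\<lambda>p. Polynomial.smult (f p) (P p))"
  using assms unfolding poly_fam_def
  by (auto intro!: reg.mult intro: order_trans[OF degree_smult_le])

lemma poly_fam_diff:
  assumes "poly_fam S n P" "poly_fam S n Q"
  shows "poly_fam S n (\<lambda>p. P p - Q p)"
  using assms by (auto simp: poly_fam_def intro: reg_diff degree_diff_le)

lemma poly_fam_monom:
  assumes "f \<in> reg S"
  shows "poly_fam S n (\<lambda>p. monom (f p) n)"
proof -
  have "(\<lambda>p. coeff (monom (f p) n) i) \<in> reg S" for i
    using assms by (cases "n = i") (auto intro: reg.const)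
  then show ?thesis
    by (auto simp: poly_fam_def degree_monom_le)
qed

lemma poly_fam_power: "poly_fam S n P \<Longrightarrow> poly_fam S (k * n) (\<lambda>p. P p ^ k)"
proof (induction k)
  case 0
  then show ?case
    using poly_fam_monom[OF reg.const[of 1], of S 0] by (simp add: monom_0 one_pCons)
next
  case (Suc k)
  then show ?case
    using poly_fam_mult[of S n P "k * n" "\<lambda>p. P p ^ k"] by simp
qed

lemma poly_fam_lower:
  assumes "poly_fam S n P" and "\<And>p. coeff (P p) n = 0"
  shows "poly_fam S (n - 1) P"
proof -
  have "degree (P p) \<le> n - 1" for p
  proof (rule degree_le, intro allI impI)
    fix i assume "n - 1 < i"
    then consider "i = n" | "n < i"
      by linarith
    then show "coeff (P p) i = 0"
    proof cases
      case 2
      have "degree (P p) \<le> n"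
        using assms(1) by (simp add: poly_fam_def)
      with 2 show ?thesis
        by (intro coeff_eq_0) simp
    qed (simp add: assms(2))
  qed
  then show ?thesis
    using assms by (auto simp: poly_fam_def)
qed

definition truncate_fam :: "nat \<Rightarrow> ('p \<Rightarrow> 'k::field poly) \<Rightarrow> 'p \<Rightarrow> 'k poly" where
  "truncate_fam n P p = P p - monom (coeff (P p) n) n"

lemma poly_fam_truncate:
  assumes "poly_fam S n P"
  shows "poly_fam S (n - 1) (truncate_fam n P)"
proof (rule poly_fam_lower)
  have "poly_fam S n (\<lambda>p. P p - monom (coeff (P p) n) n)"
    using assms by (intro poly_fam_diff poly_fam_monom) (auto simp: poly_fam_def)
  then show "poly_fam S n (truncate_fam n P)"
    by (simp add: truncate_fam_def[abs_def])
qed (simp add: truncate_fam_def)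

lemma truncate_fam_eq: "coeff (P p) n = 0 \<Longrightarrow> truncate_fam n P p = P p"
  by (simp add: truncate_fam_def)

text \<open>One step of pseudo-division: the leading term of \<open>Q\<close> is cancelled after
  multiplying \<open>Q\<close> by the leading coefficient of \<open>P\<close>, so no denominator
  enters the regular coefficients.\<close>

definition reduce_fam :: "nat \<Rightarrow> nat \<Rightarrow> ('p \<Rightarrow> 'k::field poly) \<Rightarrow> ('p \<Rightarrow> 'k poly) \<Rightarrow> 'p \<Rightarrow> 'k poly" where
  "reduce_fam n m P Q p =
     Polynomial.smult (coeff (P p) n) (Q p) - monom (coeff (Q p) m) (m - n) * P p"

lemma poly_fam_reduce:
  assumes P: "poly_fam S n P" and Q: "poly_fam S m Q" and "n \<le> m"
  shows "poly_fam S (m - 1) (reduce_fam n m P Q)"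
proof (rule poly_fam_lower)
  have "poly_fam S (m - n + n) (\<lambda>p. monom (coeff (Q p) m) (m - n) * P p)"
    using Q by (intro poly_fam_mult[OF poly_fam_monom P]) (auto simp: poly_fam_def)
  then have "poly_fam S m (\<lambda>p. Polynomial.smult (coeff (P p) n) (Q p) - monom (coeff (Q p) m) (m - n) * P p)"
    using assms by (intro poly_fam_diff poly_fam_smult) (auto simp: poly_fam_def)
  then show "poly_fam S m (reduce_fam n m P Q)"
    by (simp add: reduce_fam_def[abs_def])
  have "coeff (monom c (m - n) * P p) m = c * coeff (P p) n" for c p
    using \<open>n \<le> m\<close> by (simp add: coeff_monom_mult)
  then show "coeff (reduce_fam n m P Q p) m = 0" for p
    by (simp add: reduce_fam_def)
qed

lemma constr_poly_fam_0:
  assumes "poly_fam S n P"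
  shows "{p \<in> pts S. P p = 0} \<in> constr S"
proof -
  have "P p = 0 \<longleftrightarrow> (\<forall>i\<in>{..n}. coeff (P p) i = 0)" for p
  proof
    assume "\<forall>i\<in>{..n}. coeff (P p) i = 0"
    then show "P p = 0"
      using assms unfolding poly_fam_def by (metis atMost_iff leading_coeff_0_iff)
  qed simp
  then have "{p \<in> pts S. P p = 0} = {p \<in> pts S. \<forall>i\<in>{..n}. coeff (P p) i = 0}"
    by simp
  also have "\<dots> \<in> constr S"
    using assms by (intro constr_ball constr.zero) (auto simp: poly_fam_def)
  finally show ?thesis .
qed

text \<open>Every elimination below splits the parameters by the vanishing of one leading
  coefficient; each branch has its own equivalent of \<open>Q\<close>.\<close>

lemma constr_cases:
  assumes "f \<in> reg S" and "{p \<in> pts S. A p} \<in> constr S" and "{p \<in> pts S. B p} \<in> constr S"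
    and "\<And>p. p \<in> pts S \<Longrightarrow> f p = 0 \<Longrightarrow> Q p \<longleftrightarrow> A p"
    and "\<And>p. p \<in> pts S \<Longrightarrow> f p \<noteq> 0 \<Longrightarrow> Q p \<longleftrightarrow> B p"
  shows "{p \<in> pts S. Q p} \<in> constr S"
proof -
  have "{p \<in> pts S. Q p} = {p \<in> pts S. f p = 0 \<and> A p} \<union> {p \<in> pts S. f p \<noteq> 0 \<and> B p}"
    using assms(4,5) by blast
  then show ?thesis
    using constr_union[OF constr_conj[OF constr.zero[OF assms(1)] assms(2)]
      constr_conj[OF constr_neq[OF assms(1)] assms(3)]] by simp
qed

text \<open>Euclid's algorithm run on families. Where the leading coefficient of \<open>P\<close>
  vanishes, \<open>P\<close> is truncated; where it does not, \<open>Q\<close> is reduced modulo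
  \<open>P\<close>, which preserves divisibility since that coefficient is a unit. The sum of the
  formal degrees drops each time, until \<open>P\<close> is constant or its formal degree exceeds
  that of \<open>Q\<close>.\<close>

lemma constr_dvd:
  assumes "poly_fam S n P" "poly_fam S m Q"
  shows "{p \<in> pts S. P p dvd Q p} \<in> constr S"
  using assms
proof (induction "n + m" arbitrary: n m P Q rule: less_induct)
  case less
  note P = less.prems(1) and Q = less.prems(2)
  have lc: "(\<lambda>p. coeff (P p) n) \<in> reg S"
    using P by (simp add: poly_fam_def)
  have degP: "degree (P p) = n" if "coeff (P p) n \<noteq> 0" for p
    using le_degree[OF that] P by (intro antisym) (auto simp: poly_fam_def)
  show ?case
  proof (cases "n = 0")
    case True
    show ?thesis
    proof (rule constr_cases[OF lc constr_poly_fam_0[OF Q], where B = "\<lambda>_. True"])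
      show "{p \<in> pts S. True} \<in> constr S"
        by (simp add: constr_pts)
      fix p
      show "P p dvd Q p \<longleftrightarrow> Q p = 0" if "coeff (P p) n = 0"
      proof -
        have "P p = 0"
          using that P True leading_coeff_0_iff[of "P p"] by (simp add: poly_fam_def)
        then show ?thesis
          by simp
      qed
      show "P p dvd Q p \<longleftrightarrow> True" if "coeff (P p) n \<noteq> 0"
      proof -
        have "P p \<noteq> 0" "degree (P p) = 0"
          using degP[OF that] that True by auto
        then have "is_unit (P p)"
          using is_unit_iff_degree by blast
        then show ?thesis
          by (simp add: unit_imp_dvd)
      qed
    qed
  next
    case n: False
    have A: "{p \<in> pts S. truncate_fam n P p dvd Q p} \<in> constr S"
      using n by (intro less.hyps[OF _ poly_fam_truncate[OF P] Q]) auto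
    have A': "P p dvd Q p \<longleftrightarrow> truncate_fam n P p dvd Q p" if "coeff (P p) n = 0" for p
      using that by (simp add: truncate_fam_eq)
    show ?thesis
    proof (cases "m < n")
      case True
      have "P p dvd Q p \<longleftrightarrow> Q p = 0" if "coeff (P p) n \<noteq> 0" for p
      proof
        assume "P p dvd Q p"
        moreover have "degree (Q p) < degree (P p)"
          using degP[OF that] Q True unfolding poly_fam_def by (metis le_less_trans)
        ultimately show "Q p = 0"
          using dvd_imp_degree_le by (metis leD)
      qed simp
      then show ?thesis
        using constr_cases[OF lc A constr_poly_fam_0[OF Q] A'] by blast
    next
      case False
      have B: "{p \<in> pts S. P p dvd reduce_fam n m P Q p} \<in> constr S"
        using n False by (intro less.hyps[OF _ P poly_fam_reduce[OF P Q]]) auto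
      have "P p dvd Q p \<longleftrightarrow> P p dvd reduce_fam n m P Q p" if "coeff (P p) n \<noteq> 0" for p
        using that by (simp add: reduce_fam_def dvd_diff_left_iff dvd_smult_iff)
      then show ?thesis
        using constr_cases[OF lc A B A'] by blast
    qed
  qed
qed

section \<open>Eliminating one variable over an algebraically closed field\<close>

lemma infinite_UNIV_alg_closed: "infinite (UNIV :: 'k::alg_closed_field set)"
proof
  assume fin: "finite (UNIV :: 'k set)"
  \<comment> \<open>Euclid's argument: over a finite field the product of all X - a, plus 1, is a
    nonconstant polynomial without roots.\<close>
  define p where "p = (\<Prod>a\<in>UNIV. [:- a, 1:]) + (1 :: 'k poly)"
  have "degree (\<Prod>a\<in>UNIV. [:- a, 1 :: 'k:]) = card (UNIV :: 'k set)"
    by (subst degree_prod_eq_sum_degree) auto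
  moreover have "card (UNIV :: 'k set) > 0"
    using fin by (simp add: card_gt_0_iff)
  ultimately have "degree p > 0"
    unfolding p_def by (subst degree_add_eq_left) auto
  then obtain x where "poly p x = 0"
    using alg_closed_imp_poly_has_root by blast
  moreover have "poly p x = 1"
    using fin by (auto simp: p_def poly_prod)
  ultimately show False
    by simp
qed

text \<open>The Nullstellensatz in one variable: all roots of \<open>P\<close> are roots of
  \<open>Q\<close> exactly if \<open>P\<close> divides a power of \<open>Q\<close>, and any bound on
  the degree serves as exponent because it bounds the multiplicities. The quantifier over the field
  thus becomes a divisibility. For P = 0 the claim rests on the field being infinite.\<close>

lemma ex_root_not_root_iff:
  fixes P Q :: "'k::alg_closed_field poly"
  assumes "degree P \<le> n" "0 < n"
  shows "(\<exists>x. poly P x = 0 \<and> poly Q x \<noteq> 0) \<longleftrightarrow> \<not> P dvd Q ^ n"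
proof (cases "P = 0")
  case True
  have "(\<exists>x. poly Q x \<noteq> 0) \<longleftrightarrow> Q \<noteq> 0"
    using poly_roots_finite[of Q] infinite_UNIV_alg_closed ex_new_if_finite by fastforce
  then show ?thesis
    using True \<open>0 < n\<close> by auto
next
  case False
  have "P dvd Q ^ n" if "\<forall>x. poly P x = 0 \<longrightarrow> poly Q x = 0" "P \<noteq> 0" "degree P \<le> n" for P n
    using that
  proof (induction n arbitrary: P)
    case 0
    then have "is_unit P"
      using is_unit_iff_degree[of P] by simp
    then show ?case
      by (simp add: unit_imp_dvd)
  next
    case (Suc n)
    show ?case
    proof (cases "degree P = 0")
      case True
      then show ?thesis
        using Suc.prems is_unit_iff_degree[of P] unit_imp_dvd[of P] by blast
    next
      case False
      then obtain x where x: "poly P x = 0"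
        using alg_closed_imp_poly_has_root[of P] by auto
      \<comment> \<open>One linear factor of \<open>P\<close> is split off against one factor
        \<open>Q\<close> of the power.\<close>
      then obtain P' where P': "P = [:-x, 1:] * P'"
        by (metis dvdE poly_eq_0_iff_dvd)
      have "P' \<noteq> 0"
        using P' Suc.prems by auto
      then have "degree P = Suc (degree P')"
        unfolding P' by (subst degree_mult_eq) auto
      then have "P' dvd Q ^ n"
        using Suc.prems \<open>P' \<noteq> 0\<close> by (intro Suc.IH) (auto simp: P')
      moreover have "[:-x, 1:] dvd Q"
        using Suc.prems x by (metis poly_eq_0_iff_dvd)
      ultimately show ?thesis
        unfolding P' power_Suc by (intro mult_dvd_mono)
    qed
  qed
  moreover have "poly Q x = 0" if dvd: "P dvd Q ^ n" and x: "poly P x = 0" for x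
  proof -
    obtain R where "Q ^ n = P * R"
      using dvd by (rule dvdE)
    then have "poly Q x ^ n = 0"
      using x by (simp flip: poly_power)
    then show ?thesis
      by (simp add: power_eq_0_iff)
  qed
  ultimately show ?thesis
    using False assms(1) by metis
qed

lemma constr_ex_root1:
  fixes S :: "('p, 'k::alg_closed_field) space"
  assumes "poly_fam S n P" "poly_fam S m Q"
  shows "{p \<in> pts S. \<exists>x. poly (P p) x = 0 \<and> poly (Q p) x \<noteq> 0} \<in> constr S"
proof -
  have "(\<exists>x. poly (P p) x = 0 \<and> poly (Q p) x \<noteq> 0) \<longleftrightarrow> \<not> P p dvd Q p ^ Suc n" for p
    using assms by (intro ex_root_not_root_iff) (auto simp: poly_fam_def le_SucI)
  then show ?thesis
    using constr_not[OF constr_dvd[OF assms(1) poly_fam_power[OF assms(2), of "Suc n"]]] by simp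
qed

text \<open>Reduction to a single equation: two equations are replaced by two of smaller total
  degree with the same common roots. The measure counts \<open>Suc n\<close> for each equation, so
  discarding a constant equation lowers it too; once one equation is left,
  \<open>constr_ex_root1\<close> applies.\<close>

lemma constr_ex_roots:
  fixes S :: "('p, 'k::alg_closed_field) space"
  assumes "\<forall>(n, P)\<in>set Ps. poly_fam S n P" "poly_fam S m Q"
  shows "{p \<in> pts S. \<exists>x. (\<forall>(n, P)\<in>set Ps. poly (P p) x = 0) \<and> poly (Q p) x \<noteq> 0} \<in> constr S"
  using assms(1)
proof (induction "\<Sum>(n, P)\<leftarrow>Ps. Suc n" arbitrary: Ps rule: less_induct)
  case less
  let ?ex = "\<lambda>Ps p. \<exists>x. (\<forall>(n, P)\<in>set Ps. poly (P p) x = 0) \<and> poly (Q p) x \<noteq> 0"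
  consider "Ps = []" | n P where "Ps = [(n, P)]"
    | n P k R rest where "Ps = (n, P) # (k, R) # rest"
    by (metis neq_Nil_conv surj_pair)
  then show ?case
  proof cases
    case 1
    then show ?thesis
      \<comment> \<open>No equation at all is the same as the equation 0 = 0.\<close>
      using constr_ex_root1[of S 0 "\<lambda>_. 0" m Q] assms(2) by (auto simp: poly_fam_def intro: reg.const)
  next
    case 2
    then show ?thesis
      using constr_ex_root1[OF _ assms(2), of n P] less.prems by simp
  next
    case Ps: 3
    \<comment> \<open>Stated for \<open>n \<le> k\<close>, so that the equation of larger formal
      degree is the one reduced; the other order follows by swapping the two equations.\<close>
    have *: "{p \<in> pts S. ?ex ((n, P) # (k, R) # rest) p} \<in> constr S"
      if P: "poly_fam S n P" and R: "poly_fam S k R" and rest: "\<forall>(n, P)\<in>set rest. poly_fam S n P"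
        and le: "n \<le> k"
        and meas: "Suc n + Suc k + (\<Sum>(n, P)\<leftarrow>rest. Suc n) \<le> (\<Sum>(n, P)\<leftarrow>Ps. Suc n)"
      for n P k R
    proof -
      have lc: "(\<lambda>p. coeff (P p) n) \<in> reg S"
        using P by (simp add: poly_fam_def)
      have hyps: "{p \<in> pts S. ?ex Ps' p} \<in> constr S"
        if "\<forall>(n, P)\<in>set Ps'. poly_fam S n P"
          "(\<Sum>(n, P)\<leftarrow>Ps'. Suc n) < Suc n + Suc k + (\<Sum>(n, P)\<leftarrow>rest. Suc n)" for Ps'
        using less.hyps[of Ps'] that meas by linarith
      show ?thesis
      proof (cases "n = 0")
        case True
        \<comment> \<open>A constant equation holds for all x or for none, so it moves into the
          condition on the parameter.\<close>
        have "poly (P p) x = coeff (P p) n" for p x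
        proof -
          have "degree (P p) = 0"
            using P True by (simp add: poly_fam_def)
          then obtain c where "P p = [:c:]"
            by (rule degree_eq_zeroE)
          then show ?thesis
            using True by simp
        qed
        then have PR: "?ex ((n, P) # (k, R) # rest) p \<longleftrightarrow> coeff (P p) n = 0 \<and> ?ex ((k, R) # rest) p" for p
          by simp
        show ?thesis
        proof (rule constr_cases[OF lc])
          show "{p \<in> pts S. ?ex ((k, R) # rest) p} \<in> constr S"
            by (rule hyps) (use R rest True in auto)
          show "{p \<in> pts S. False} \<in> constr S"
            by (simp add: constr_empty)
        qed (simp_all only: PR simp_thms)
      next
        case n: False
        show ?thesis
        proof (rule constr_cases[OF lc])
          show "{p \<in> pts S. ?ex ((n - 1, truncate_fam n P) # (k, R) # rest) p} \<in> constr S"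
            by (rule hyps) (use n R rest poly_fam_truncate[OF P] in auto)
          show "{p \<in> pts S. ?ex ((n, P) # (k - 1, reduce_fam n k P R) # rest) p} \<in> constr S"
            by (rule hyps) (use n le P rest poly_fam_reduce[OF P R le] in auto)
          show "?ex ((n, P) # (k, R) # rest) p \<longleftrightarrow> ?ex ((n - 1, truncate_fam n P) # (k, R) # rest) p"
            if "coeff (P p) n = 0" for p
            using that by (simp add: truncate_fam_eq)
          show "?ex ((n, P) # (k, R) # rest) p \<longleftrightarrow> ?ex ((n, P) # (k - 1, reduce_fam n k P R) # rest) p"
            if "coeff (P p) n \<noteq> 0" for p
            using that by (auto simp: reduce_fam_def)
        qed
      qed
    qed
    have prem: "poly_fam S n P" "poly_fam S k R" "\<forall>(n, P)\<in>set rest. poly_fam S n P"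
      using less.prems Ps by auto
    show ?thesis
    proof (cases "n \<le> k")
      case True
      then show ?thesis
        using *[OF prem(1,2,3)] Ps by simp
    next
      case False
      have "{p \<in> pts S. ?ex ((k, R) # (n, P) # rest) p} \<in> constr S"
        using *[OF prem(2,1,3)] Ps False by simp
      moreover have "?ex ((k, R) # (n, P) # rest) p = ?ex Ps p" for p
        using Ps by auto
      ultimately show ?thesis
        by simp
    qed
  qed
qed

section \<open>Projection along the affine line\<close>

definition line :: "('k, 'k::field) space" where
  "line = ({\<lambda>x. x}, UNIV)"

lemma dom_line [simp]: "pts line = UNIV"
  by (simp add: line_def)

text \<open>Grouping by powers of the fibre coordinate hands the fibre over to the elimination in
  one variable.\<close>

lemma reg_line_poly_fam:
  assumes "f \<in> reg (S \<otimes>\<^sub>s line)"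
  shows "\<exists>n P. poly_fam S n P \<and> (\<forall>p\<in>pts S. \<forall>x. f (p, x) = poly (P p) x)"
  using assms
proof induction
  case (const c)
  then show ?case
    using poly_fam_monom[OF reg.const[of c], of S 0] by (auto simp: monom_0 intro!: exI[of _ 0] exI[of _ "\<lambda>_. [:c:]"])
next
  case (gen x)
  then consider g where "g \<in> fst S" "x = (\<lambda>z. g (fst z))" | "x = snd"
    by (auto simp: prod_space_def line_def)
  then show ?case
  proof cases
    case 1
    then show ?thesis
      using poly_fam_monom[OF reg.gen[of g S], of 0]
      by (auto simp: monom_0 intro!: exI[of _ 0] exI[of _ "\<lambda>p. [:g p:]"])
  next
    case 2
    then show ?thesis
      using poly_fam_monom[OF reg.const[of 1], of S 1]
      by (auto simp: monom_altdef intro!: exI[of _ 1] exI[of _ "\<lambda>p. [:0, 1:]"])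
  qed
next
  case (add f g)
  then obtain n P m Q where P: "poly_fam S n P" "\<forall>p\<in>pts S. \<forall>x. f (p, x) = poly (P p) x"
    and Q: "poly_fam S m Q" "\<forall>p\<in>pts S. \<forall>x. g (p, x) = poly (Q p) x"
    by blast
  then show ?case
    using poly_fam_add[OF poly_fam_mono[OF P(1), of "max n m"] poly_fam_mono[OF Q(1), of "max n m"]]
    by (intro exI[of _ "max n m"] exI[of _ "\<lambda>p. P p + Q p"]) auto
next
  case (mult f g)
  then obtain n P m Q where P: "poly_fam S n P" "\<forall>p\<in>pts S. \<forall>x. f (p, x) = poly (P p) x"
    and Q: "poly_fam S m Q" "\<forall>p\<in>pts S. \<forall>x. g (p, x) = poly (Q p) x"
    by blast
  then show ?case
    using poly_fam_mult[OF P(1) Q(1)]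
    by (intro exI[of _ "n + m"] exI[of _ "\<lambda>p. P p * Q p"]) auto
next
  case (cong f g)
  then show ?case
    by auto
qed

text \<open>One inequation is enough, since a conjunction of inequations is the nonvanishing of a
  product.\<close>

definition basic_set :: "('p, 'k::field) space \<Rightarrow> ('p \<Rightarrow> 'k) list \<Rightarrow> ('p \<Rightarrow> 'k) \<Rightarrow> 'p set" where
  "basic_set S fs g = {p \<in> pts S. (\<forall>f\<in>set fs. f p = 0) \<and> g p \<noteq> 0}"

definition basic_union :: "('p, 'k::field) space \<Rightarrow> 'p set \<Rightarrow> bool" where
  "basic_union S C \<longleftrightarrow> (\<exists>B. (\<forall>(fs, g)\<in>set B. set fs \<subseteq> reg S \<and> g \<in> reg S) \<and>
     C = (\<Union>(fs, g)\<in>set B. basic_set S fs g))"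

lemma basic_union_union:
  assumes "basic_union S C" "basic_union S D"
  shows "basic_union S (C \<union> D)"
proof -
  obtain B B' where "\<forall>(fs, g)\<in>set B. set fs \<subseteq> reg S \<and> g \<in> reg S" "C = (\<Union>(fs, g)\<in>set B. basic_set S fs g)"
    "\<forall>(fs, g)\<in>set B'. set fs \<subseteq> reg S \<and> g \<in> reg S" "D = (\<Union>(fs, g)\<in>set B'. basic_set S fs g)"
    using assms by (auto simp: basic_union_def)
  then show ?thesis
    unfolding basic_union_def by (intro exI[of _ "B @ B'"]) auto
qed

lemma basic_union_basic:
  assumes "set fs \<subseteq> reg S" "g \<in> reg S"
  shows "basic_union S (basic_set S fs g)"
  using assms unfolding basic_union_def by (intro exI[of _ "[(fs, g)]"]) auto

lemma basic_union_empty: "basic_union S {}"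
  unfolding basic_union_def by (intro exI[of _ "[]"]) auto

lemma basic_union_UN:
  assumes "finite J" "\<And>j. j \<in> J \<Longrightarrow> basic_union S (C j)"
  shows "basic_union S (\<Union>j\<in>J. C j)"
  using assms by (induction rule: finite_induct) (auto intro: basic_union_empty basic_union_union)

lemma basic_set_inter:
  "basic_set S fs g \<inter> basic_set S fs' g' = basic_set S (fs @ fs') (\<lambda>p. g p * g' p)"
  by (auto simp: basic_set_def)

lemma basic_union_inter:
  assumes "basic_union S C" "basic_union S D"
  shows "basic_union S (C \<inter> D)"
proof -
  obtain B B' where B: "\<forall>(fs, g)\<in>set B. set fs \<subseteq> reg S \<and> g \<in> reg S" "C = (\<Union>(fs, g)\<in>set B. basic_set S fs g)"
    "\<forall>(fs, g)\<in>set B'. set fs \<subseteq> reg S \<and> g \<in> reg S" "D = (\<Union>(fs, g)\<in>set B'. basic_set S fs g)"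
    using assms by (auto simp: basic_union_def)
  have "C \<inter> D = (\<Union>b\<in>set B. \<Union>b'\<in>set B'. basic_set S (fst b @ fst b') (\<lambda>p. snd b p * snd b' p))"
    unfolding B basic_set_inter[symmetric] by (auto simp: case_prod_unfold)
  also have "basic_union S \<dots>"
    using B by (intro basic_union_UN basic_union_basic) (fastforce intro!: reg.mult)+
  finally show ?thesis .
qed

lemma basic_union_diff_basic:
  assumes "set fs \<subseteq> reg S" "g \<in> reg S"
  shows "basic_union S (pts S - basic_set S fs g)"
proof -
  have "pts S - basic_set S fs g = basic_set S [g] (\<lambda>_. 1) \<union> (\<Union>f\<in>set fs. basic_set S [] f)"
    by (auto simp: basic_set_def)
  also have "basic_union S \<dots>"
    using assms by (intro basic_union_UN basic_union_basic basic_union_union) (auto intro: reg.const)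
  finally show ?thesis .
qed

lemma basic_union_pts: "basic_union S (pts S)"
  using basic_union_basic[of "[]" S "\<lambda>_. 1"] by (auto simp: basic_set_def intro: reg.const)

lemma basic_union_INT:
  assumes "finite J" "\<And>j. j \<in> J \<Longrightarrow> basic_union S (C j)"
  shows "basic_union S (pts S \<inter> (\<Inter>j\<in>J. C j))"
  using assms
proof (induction rule: finite_induct)
  case empty
  then show ?case
    by (simp add: basic_union_pts)
next
  case (insert j J)
  have "pts S \<inter> (\<Inter>j\<in>insert j J. C j) = C j \<inter> (pts S \<inter> (\<Inter>j\<in>J. C j))"
    by auto
  then show ?case
    using insert by (auto intro: basic_union_inter)
qed

text \<open>Disjunctive normal form. An existential quantifier distributes over the union, which
  leaves one block of equations and one inequation to eliminate.\<close>

lemma constr_basic_union: "C \<in> constr S \<Longrightarrow> basic_union S C"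
proof (induction rule: constr.induct)
  case (zero f)
  then show ?case
    using basic_union_basic[of "[f]" S "\<lambda>_. 1"] by (auto simp: basic_set_def intro: reg.const)
next
  case (diff C)
  then obtain B where B: "\<forall>(fs, g)\<in>set B. set fs \<subseteq> reg S \<and> g \<in> reg S"
    "C = (\<Union>(fs, g)\<in>set B. basic_set S fs g)"
    by (auto simp: basic_union_def)
  have "pts S - C = pts S \<inter> (\<Inter>b\<in>set B. pts S - basic_set S (fst b) (snd b))"
    unfolding B by auto
  also have "basic_union S \<dots>"
    using B by (intro basic_union_INT basic_union_diff_basic) fastforce+
  finally show ?case .
qed (rule basic_union_inter)

text \<open>Chevalley's theorem for one fibre coordinate: normal form, then
  \<open>constr_ex_roots\<close> on each block.\<close>

lemma constr_proj_line:
  fixes S :: "('p, 'k::alg_closed_field) space"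
  assumes "C \<in> constr (S \<otimes>\<^sub>s line)"
  shows "{p \<in> pts S. \<exists>x. (p, x) \<in> C} \<in> constr S"
proof -
  obtain B where B: "\<forall>(fs, g)\<in>set B. set fs \<subseteq> reg (S \<otimes>\<^sub>s line) \<and> g \<in> reg (S \<otimes>\<^sub>s line)"
    "C = (\<Union>(fs, g)\<in>set B. basic_set (S \<otimes>\<^sub>s line) fs g)"
    using constr_basic_union[OF assms] unfolding basic_union_def by (elim exE conjE)
  have basic: "{p \<in> pts S. \<exists>x. (p, x) \<in> basic_set (S \<otimes>\<^sub>s line) fs g} \<in> constr S"
    if fs: "set fs \<subseteq> reg (S \<otimes>\<^sub>s line)" and g: "g \<in> reg (S \<otimes>\<^sub>s line)" for fs g
  proof -
    have "\<forall>f\<in>set fs. \<exists>nP. poly_fam S (fst nP) (snd nP) \<and> (\<forall>p\<in>pts S. \<forall>x. f (p, x) = poly (snd nP p) x)"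
    proof
      fix f assume "f \<in> set fs"
      then have "f \<in> reg (S \<otimes>\<^sub>s line)"
        using fs by auto
      from reg_line_poly_fam[OF this] obtain n P
        where "poly_fam S n P \<and> (\<forall>p\<in>pts S. \<forall>x. f (p, x) = poly (P p) x)"
        by (elim exE)
      then show "\<exists>nP. poly_fam S (fst nP) (snd nP) \<and> (\<forall>p\<in>pts S. \<forall>x. f (p, x) = poly (snd nP p) x)"
        by (intro exI[of _ "(n, P)"]) simp
    qed
    from bchoice[OF this] obtain F where F: "\<forall>f\<in>set fs. poly_fam S (fst (F f)) (snd (F f)) \<and>
        (\<forall>p\<in>pts S. \<forall>x. f (p, x) = poly (snd (F f) p) x)" ..
    obtain m Q where Q: "poly_fam S m Q" "\<forall>p\<in>pts S. \<forall>x. g (p, x) = poly (Q p) x"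
      using reg_line_poly_fam[OF g] by (elim exE conjE)
    have "(p, x) \<in> basic_set (S \<otimes>\<^sub>s line) fs g \<longleftrightarrow>
        (\<forall>(n, P)\<in>set (map F fs). poly (P p) x = 0) \<and> poly (Q p) x \<noteq> 0" if "p \<in> pts S" for p x
      using F Q that by (simp add: basic_set_def case_prod_unfold)
    then have "{p \<in> pts S. \<exists>x. (p, x) \<in> basic_set (S \<otimes>\<^sub>s line) fs g} =
        {p \<in> pts S. \<exists>x. (\<forall>(n, P)\<in>set (map F fs). poly (P p) x = 0) \<and> poly (Q p) x \<noteq> 0}"
      by (simp cong: conj_cong)
    also have "\<dots> \<in> constr S"
      by (rule constr_ex_roots[OF _ Q(1)]) (use F in \<open>simp add: case_prod_unfold\<close>)
    finally show ?thesis .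
  qed
  have "{p \<in> pts S. \<exists>x. (p, x) \<in> C} =
      pts S - {p \<in> pts S. \<forall>b\<in>set B. \<not> (\<exists>x. (p, x) \<in> basic_set (S \<otimes>\<^sub>s line) (fst b) (snd b))}"
    unfolding B(2) case_prod_unfold by blast
  also have "\<dots> \<in> constr S"
    using B(1) by (intro constr.diff constr_ball constr_not basic) (auto simp: case_prod_unfold)
  finally show ?thesis .
qed

text \<open>Affine space with coordinates indexed by \<open>W\<close>, carried by all functions on
  the index type. Values off \<open>W\<close> are invisible to regular functions, so adding an index
  leaves the set of points alone and the induction over \<open>W\<close> stays in one type.\<close>

definition env_space :: "'i set \<Rightarrow> ('i \<Rightarrow> 'k, 'k::field) space" where
  "env_space W = ((\<lambda>i e. e i) ` W, UNIV)"

lemma dom_env_space [simp]: "pts (env_space W) = UNIV"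
  by (simp add: env_space_def)

lemma constr_proj_env:
  fixes S :: "('p, 'k::alg_closed_field) space"
  assumes "finite W" and "C \<in> constr (S \<otimes>\<^sub>s env_space W)"
  shows "{p \<in> pts S. \<exists>e. (p, e) \<in> C} \<in> constr S"
  using assms
proof (induction arbitrary: C rule: finite_induct)
  case empty
  \<comment> \<open>Without coordinates regular functions do not see the environment, hence neither
    do constructible sets, and any environment can serve as witness.\<close>
  have *: "f (p, e) = f (p, e')" if "f \<in> reg (S \<otimes>\<^sub>s env_space {})" "p \<in> pts S" for f p e and e' :: "'a \<Rightarrow> 'k"
    using that(1) by induction (use that(2) in \<open>auto simp: prod_space_def env_space_def\<close>)
  have **: "(p, e) \<in> C \<longleftrightarrow> (p, e') \<in> C" if "p \<in> pts S" for p e and e' :: "'a \<Rightarrow> 'k"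
    using empty
  proof induction
    case (zero f)
    then show ?case
      using *[OF zero that, of e e'] by simp
  qed (use that in auto)
  have "{p \<in> pts S. \<exists>e. (p, e) \<in> C} = {p \<in> pts S. (p, \<lambda>_. 0) \<in> C}"
    using ** by blast
  also have "\<dots> \<in> constr S"
    by (rule constr_preimage[OF morphism_Pair[OF morphism_id morphism_const] empty]) simp
  finally show ?case .
next
  case (insert i W)
  \<comment> \<open>Overwriting the value at \<open>i\<close> maps environments over
    \<open>W\<close> together with a point of the line onto environments over
    \<open>insert i W\<close>; the line is projected away before the induction hypothesis is
    used.\<close>
  have "morphism ((S \<otimes>\<^sub>s env_space W) \<otimes>\<^sub>s line) (S \<otimes>\<^sub>s env_space (insert i W))
      (\<lambda>z. (fst (fst z), (snd (fst z))(i := snd z)))"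
  proof (rule morphism_Pair[OF morphism_comp[OF morphism_fst morphism_fst]])
    have "(\<lambda>z. ((snd (fst z))(i := snd z)) j) \<in> reg ((S \<otimes>\<^sub>s env_space W) \<otimes>\<^sub>s line)" if "j \<in> insert i W" for j
    proof (cases "j = i")
      case True
      then show ?thesis
        using reg_snd[OF reg.gen, of "\<lambda>x. x" line "S \<otimes>\<^sub>s env_space W"] by (simp add: line_def)
    next
      case False
      then show ?thesis
        using reg_fst[OF reg_snd[OF reg.gen, of "\<lambda>e. e j" "env_space W" S], of line] that
        by (simp add: env_space_def)
    qed
    then show "morphism ((S \<otimes>\<^sub>s env_space W) \<otimes>\<^sub>s line) (env_space (insert i W)) (\<lambda>z. (snd (fst z))(i := snd z))"
      by (simp add: morphism_def env_space_def del: fun_upd_apply)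
  qed
  from constr_proj_line[OF constr_preimage[OF this insert.prems]]
  have "{p \<in> pts (S \<otimes>\<^sub>s env_space W). \<exists>x. (fst p, (snd p)(i := x)) \<in> C} \<in> constr (S \<otimes>\<^sub>s env_space W)"
    by (auto simp: conj_commute)
  from insert.IH[OF this] have "{p \<in> pts S. \<exists>e x. (p, e(i := x)) \<in> C} \<in> constr S"
    by simp
  moreover have "(\<exists>e x. (p, e(i := x)) \<in> C) \<longleftrightarrow> (\<exists>e. (p, e) \<in> C)" for p
    by (metis fun_upd_triv)
  ultimately show ?case
    by simp
qed

text \<open>The one family of affine spaces used below: it holds representations, pairs of inverse
  matrices, candidate bases and rows of coefficients.\<close>

definition mat_space :: "nat \<Rightarrow> nat \<Rightarrow> nat \<Rightarrow> ('k mat list, 'k::field) space" where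
  "mat_space k m d = ({\<lambda>l. l ! j $$ (a, b) |j a b. j < k \<and> a < m \<and> b < d},
     {l. length l = k \<and> set l \<subseteq> carrier_mat m d})"

lemma dom_mat_space: "l \<in> pts (mat_space k m d) \<longleftrightarrow> length l = k \<and> (\<forall>j<k. l ! j \<in> carrier_mat m d)"
  by (auto simp: mat_space_def set_conv_nth)

text \<open>The entries are projected away by \<open>constr_proj_env\<close>. Together with the
  Boolean rules this makes every set given by a first-order formula with quantifiers over matrices
  constructible, which is how strata and images are treated.\<close>

lemma constr_ex_mats:
  fixes S :: "('p, 'k::alg_closed_field) space"
  assumes "{z \<in> pts (S \<otimes>\<^sub>s mat_space k m d). Q (fst z) (snd z)} \<in> constr (S \<otimes>\<^sub>s mat_space k m d)"
  shows "{p \<in> pts S. \<exists>l\<in>pts (mat_space k m d). Q p l} \<in> constr S"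
proof -
  define W where "W = {..<k} \<times> {..<m} \<times> {..<d}"
  define tup where "tup = (\<lambda>e. map (\<lambda>j. mat m d (\<lambda>(a, b). e (j, a, b) :: 'k)) [0..<k])"
  have tup_pts: "tup e \<in> pts (mat_space k m d)" for e
    by (auto simp: tup_def mat_space_def)
  have tup_surj: "\<exists>e. l = tup e" if "l \<in> pts (mat_space k m d)" for l
    using that by (intro exI[of _ "\<lambda>(j, a, b). l ! j $$ (a, b)"] nth_equalityI eq_matI)
      (auto simp: tup_def dom_mat_space)
  have "(\<lambda>e. tup e ! j $$ (a, b)) \<in> reg (env_space W)" if "j < k" "a < m" "b < d" for j a b
  proof -
    have "(\<lambda>e. tup e ! j $$ (a, b)) = (\<lambda>e. e (j, a, b))"
      using that by (auto simp: tup_def)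
    then show ?thesis
      using that by (auto intro!: reg.gen simp: env_space_def W_def)
  qed
  then have tup: "morphism (env_space W) (mat_space k m d) tup"
    using tup_pts by (auto simp: morphism_def mat_space_def)
  have *: "{p \<in> pts S. \<exists>e. (p, e) \<in> {z \<in> pts (S \<otimes>\<^sub>s env_space W).
      (fst z, tup (snd z)) \<in> {z \<in> pts (S \<otimes>\<^sub>s mat_space k m d). Q (fst z) (snd z)}}} \<in> constr S"
    by (rule constr_proj_env[OF _ constr_preimage[OF morphism_Pair[OF morphism_fst
        morphism_comp[OF morphism_snd tup]] assms]]) (simp add: W_def)
  have "(\<exists>l\<in>pts (mat_space k m d). Q p l) \<longleftrightarrow> (\<exists>e. Q p (tup e))" for p
    using tup_pts tup_surj by blast
  then have "{p \<in> pts S. \<exists>l\<in>pts (mat_space k m d). Q p l} =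
      {p \<in> pts S. \<exists>e. (p, e) \<in> {z \<in> pts (S \<otimes>\<^sub>s env_space W).
        (fst z, tup (snd z)) \<in> {z \<in> pts (S \<otimes>\<^sub>s mat_space k m d). Q (fst z) (snd z)}}}"
    using tup_pts by auto
  then show ?thesis
    using * by simp
qed

lemma constr_all_mats:
  fixes S :: "('p, 'k::alg_closed_field) space"
  assumes "{z \<in> pts (S \<otimes>\<^sub>s mat_space k m d). Q (fst z) (snd z)} \<in> constr (S \<otimes>\<^sub>s mat_space k m d)"
  shows "{p \<in> pts S. \<forall>l\<in>pts (mat_space k m d). Q p l} \<in> constr S"
  using constr_not[OF constr_ex_mats[OF constr_not[OF assms]]] by simp

section \<open>Noetherian induction\<close>

text \<open>Elements grow by one multiple of a generator at a time, so facts about finitely many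
  generators, such as \<open>ideal_gen_range\<close>, are plain inductions.\<close>

inductive_set ideal_gen :: "('p, 'k::field) space \<Rightarrow> ('p \<Rightarrow> 'k) set \<Rightarrow> ('p \<Rightarrow> 'k) set" for S G where
  zero: "(\<lambda>_. 0) \<in> ideal_gen S G"
| step: "f \<in> ideal_gen S G \<Longrightarrow> r \<in> reg S \<Longrightarrow> g \<in> G \<Longrightarrow> (\<lambda>p. f p + r p * g p) \<in> ideal_gen S G"
| cong: "f \<in> ideal_gen S G \<Longrightarrow> (\<And>p. p \<in> pts S \<Longrightarrow> g p = f p) \<Longrightarrow> g \<in> ideal_gen S G"

lemma ideal_gen_mult:
  assumes "f \<in> ideal_gen S G" and r: "r \<in> reg S"
  shows "(\<lambda>p. r p * f p) \<in> ideal_gen S G"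
  using assms(1)
proof induction
  case zero
  then show ?case
    by (simp add: ideal_gen.zero)
next
  case (step f s g)
  have "(\<lambda>p. r p * f p + (r p * s p) * g p) \<in> ideal_gen S G"
    by (rule ideal_gen.step[OF step.IH reg.mult[OF r step.hyps(2)] step.hyps(3)])
  then show ?case
    by (simp add: algebra_simps)
next
  case (cong f g)
  show ?case
    by (rule ideal_gen.cong[OF cong.IH]) (simp add: cong.hyps(2))
qed

lemma ideal_gen_add:
  assumes f: "f \<in> ideal_gen S G" and "g \<in> ideal_gen S G"
  shows "(\<lambda>p. f p + g p) \<in> ideal_gen S G"
  using assms(2)
proof induction
  case zero
  then show ?case
    using f by simp
next
  case (step g s h)
  have "(\<lambda>p. (f p + g p) + s p * h p) \<in> ideal_gen S G"
    by (rule ideal_gen.step[OF step.IH step.hyps(2,3)])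
  then show ?case
    by (simp add: algebra_simps)
next
  case (cong g h)
  show ?case
    by (rule ideal_gen.cong[OF cong.IH]) (simp add: cong.hyps(2))
qed

lemma ideal_gen_diff:
  assumes f: "f \<in> ideal_gen S G" and "g \<in> ideal_gen S G"
  shows "(\<lambda>p. f p - g p) \<in> ideal_gen S G"
  using ideal_gen_add[OF f ideal_gen_mult[OF assms(2) reg.const[of "-1"]]] by simp

lemma ideal_gen_gen:
  assumes "g \<in> G"
  shows "g \<in> ideal_gen S G"
  using ideal_gen.step[OF ideal_gen.zero reg.const[of 1] assms] by simp

lemma ideal_gen_subset:
  assumes "G \<subseteq> ideal_gen S G'"
  shows "ideal_gen S G \<subseteq> ideal_gen S G'"
proof
  fix f assume "f \<in> ideal_gen S G"
  then show "f \<in> ideal_gen S G'"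
  proof induction
    case (step f r g)
    have "g \<in> ideal_gen S G'"
      using step.hyps(3) assms by (rule subsetD[rotated])
    then show ?case
      by (rule ideal_gen_add[OF step.IH ideal_gen_mult[OF _ step.hyps(2)]])
  next
    case (cong f g)
    show ?case
      by (rule ideal_gen.cong[OF cong.IH cong.hyps(2)])
  qed (rule ideal_gen.zero)
qed

lemma ideal_gen_mono: "G \<subseteq> G' \<Longrightarrow> ideal_gen S G \<subseteq> ideal_gen S G'"
  by (rule ideal_gen_subset) (auto intro: ideal_gen_gen)

lemma ideal_gen_range:
  assumes "f \<in> ideal_gen S (range a)"
  shows "\<exists>M::nat. f \<in> ideal_gen S (a ` {..<M})"
  using assms
proof induction
  case zero
  then show ?case
    by (simp add: ideal_gen.zero)
next
  case (step f r g)
  then obtain M n where M: "f \<in> ideal_gen S (a ` {..<M})" and n: "g = a n"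
    by (elim exE rangeE)
  have "f \<in> ideal_gen S (a ` {..<max M (Suc n)})"
    by (rule subsetD[OF ideal_gen_mono M]) auto
  then have "(\<lambda>p. f p + r p * g p) \<in> ideal_gen S (a ` {..<max M (Suc n)})"
    by (rule ideal_gen.step[OF _ step.hyps(2)]) (auto simp: n)
  then show ?case ..
next
  case (cong f g)
  from cong.IH obtain M where "f \<in> ideal_gen S (a ` {..<M})" ..
  then have "g \<in> ideal_gen S (a ` {..<M})"
    by (rule ideal_gen.cong[OF _ cong.hyps(2)])
  then show ?case ..
qed

lemma ideal_gen_reg:
  assumes "f \<in> ideal_gen S G" and "G \<subseteq> reg S"
  shows "f \<in> reg S"
  using assms(1)
proof induction
  case (step f r g)
  have "g \<in> reg S"
    using step.hyps(3) assms(2) by (rule subsetD[rotated])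
  then show ?case
    by (rule reg.add[OF step.IH reg.mult[OF step.hyps(2)]])
next
  case (cong f g)
  show ?case
    by (rule reg.cong[OF cong.IH cong.hyps(2)])
qed (rule reg.const)

lemma ideal_gen_vanish:
  assumes "f \<in> ideal_gen S G" and "p \<in> pts S" and "\<And>g. g \<in> G \<Longrightarrow> g p = 0"
  shows "f p = 0"
  using assms(1) by induction (use assms(2,3) in auto)

text \<open>The ascending chain condition for sequences: the ideals generated by longer and longer
  initial segments cannot grow strictly at every step. The proofs by contradiction below produce and
  consume such sequences directly.\<close>

definition noeth :: "('p, 'k::field) space \<Rightarrow> bool" where
  "noeth S \<longleftrightarrow> (\<forall>a. (\<forall>n::nat. a n \<in> reg S) \<longrightarrow> (\<exists>m. a m \<in> ideal_gen S (a ` {..<m})))"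

text \<open>The regular functions are the constants, so either \<open>a 0\<close> is zero or it
  divides \<open>a 1\<close>.\<close>

lemma noeth_no_gens: "noeth (({}, A) :: ('p, 'k::field) space)"
  unfolding noeth_def
proof (intro allI impI)
  fix a :: "nat \<Rightarrow> 'p \<Rightarrow> 'k" assume a: "\<forall>n. a n \<in> reg ({}, A)"
  have const: "\<exists>c. \<forall>p\<in>A. f p = c" if "f \<in> reg ({}, A)" for f :: "'p \<Rightarrow> 'k"
    using that by induction auto
  obtain c where c: "\<forall>p\<in>A. a 0 p = c"
    using const[OF a[rule_format]] ..
  show "\<exists>m. a m \<in> ideal_gen ({}, A) (a ` {..<m})"
  proof (cases "c = 0")
    case True
    have "a 0 \<in> ideal_gen ({}, A) (a ` {..<0})"
      by (rule ideal_gen.cong[OF ideal_gen.zero]) (use c True in simp)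
    then show ?thesis ..
  next
    case False
    obtain c' where c': "\<forall>p\<in>A. a 1 p = c'"
      using const[OF a[rule_format]] ..
    have "a 0 \<in> a ` {..<1}"
      by auto
    from ideal_gen_mult[OF ideal_gen_gen[OF this] reg.const[of "c' / c"], of "({}, A)"]
    have "a 1 \<in> ideal_gen ({}, A) (a ` {..<1})"
      by (rule ideal_gen.cong) (use c c' False in simp)
    then show ?thesis ..
  qed
qed

text \<open>\<open>f\<close> is a polynomial in \<open>x\<close> of degree less than
  \<open>n\<close>. Since \<open>x\<close> may satisfy relations on the points, the expression is
  not unique and only such a bound makes sense; \<open>n = 0\<close> says that \<open>f\<close>
  vanishes.\<close>

definition low :: "('p, 'k::field) space \<Rightarrow> ('p \<Rightarrow> 'k) \<Rightarrow> nat \<Rightarrow> ('p \<Rightarrow> 'k) \<Rightarrow> bool" where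
  "low S x n f \<longleftrightarrow> (\<exists>c. (\<forall>i. c i \<in> reg S) \<and> (\<forall>p\<in>pts S. f p = (\<Sum>i<n. c i p * x p ^ i)))"

lemma lowI: "(\<And>i. c i \<in> reg S) \<Longrightarrow> (\<And>p. p \<in> pts S \<Longrightarrow> f p = (\<Sum>i<n. c i p * x p ^ i)) \<Longrightarrow> low S x n f"
  unfolding low_def by (intro exI[of _ c]) simp

lemma lowE:
  assumes "low S x n f"
  obtains c where "\<forall>i. c i \<in> reg S" "\<forall>p\<in>pts S. f p = (\<Sum>i<n. c i p * x p ^ i)"
proof -
  from assms obtain c where "(\<forall>i. c i \<in> reg S) \<and> (\<forall>p\<in>pts S. f p = (\<Sum>i<n. c i p * x p ^ i))"
    unfolding low_def ..
  then show ?thesis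
    by (intro that[of c]) simp_all
qed

lemma low_cong:
  assumes "low S x n f" "\<And>p. p \<in> pts S \<Longrightarrow> g p = f p"
  shows "low S x n g"
  using assms(1) by (rule lowE) (rule lowI, auto simp: assms(2))

lemma low_zero: "low S x n (\<lambda>_. 0)"
  by (rule lowI[of "\<lambda>_ _. 0"]) (auto intro: reg.const)

lemma low_add:
  assumes "low S x n f" "low S x n g"
  shows "low S x n (\<lambda>p. f p + g p)"
proof -
  obtain c where c: "\<forall>i. c i \<in> reg S" "\<forall>p\<in>pts S. f p = (\<Sum>i<n. c i p * x p ^ i)"
    by (rule lowE[OF assms(1)])
  obtain c' where c': "\<forall>i. c' i \<in> reg S" "\<forall>p\<in>pts S. g p = (\<Sum>i<n. c' i p * x p ^ i)"
    by (rule lowE[OF assms(2)])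
  show ?thesis using c c'
    by (intro lowI[of "\<lambda>i p. c i p + c' i p"]) (auto intro: reg.add simp: algebra_simps sum.distrib)
qed

lemma low_mult_reg:
  assumes "low S x n f" "r \<in> reg S"
  shows "low S x n (\<lambda>p. r p * f p)"
proof -
  obtain c where "\<forall>i. c i \<in> reg S" "\<forall>p\<in>pts S. f p = (\<Sum>i<n. c i p * x p ^ i)"
    by (rule lowE[OF assms(1)])
  then show ?thesis
    using assms(2)
    by (intro lowI[of "\<lambda>i p. r p * c i p"]) (auto intro: reg.mult simp: sum_distrib_left mult.assoc)
qed

lemma low_diff: "low S x n f \<Longrightarrow> low S x n g \<Longrightarrow> low S x n (\<lambda>p. f p - g p)"
  using low_add[of S x n f, OF _ low_mult_reg[of S x n g, OF _ reg.const[of "-1"]]] by simp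

lemma low_Suc:
  assumes "low S x n f"
  shows "low S x (Suc n) f"
proof -
  obtain c where "\<forall>i. c i \<in> reg S" "\<forall>p\<in>pts S. f p = (\<Sum>i<n. c i p * x p ^ i)"
    by (rule lowE[OF assms(1)])
  then show ?thesis
    by (intro lowI[of "\<lambda>i. if i < n then c i else (\<lambda>_. 0)"]) (auto intro: reg.const)
qed

lemma low_mono: "low S x n f \<Longrightarrow> n \<le> m \<Longrightarrow> low S x m f"
  by (induction m) (auto simp: le_Suc_eq intro: low_Suc)

lemma low_shift:
  assumes "low S x n f"
  shows "low S x (Suc n) (\<lambda>p. x p * f p)"
proof -
  obtain c where "\<forall>i. c i \<in> reg S" "\<forall>p\<in>pts S. f p = (\<Sum>i<n. c i p * x p ^ i)"
    by (rule lowE[OF assms(1)])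
  then show ?thesis
    by (intro lowI[of "case_nat (\<lambda>_. 0) c"])
      (auto intro: reg.const split: nat.split simp: sum.lessThan_Suc_shift sum_distrib_left algebra_simps
        simp del: sum.lessThan_Suc)
qed

lemma low_shift_power: "low S x n f \<Longrightarrow> low S x (n + k) (\<lambda>p. x p ^ k * f p)"
proof (induction k)
  case (Suc k)
  then show ?case
    using low_shift[of S x "n + k" "\<lambda>p. x p ^ k * f p"] by (simp add: mult.assoc)
qed simp

lemma low_sum: "(\<And>i. i \<in> J \<Longrightarrow> low S x n (f i)) \<Longrightarrow> low S x n (\<lambda>p. \<Sum>i\<in>J. f i p)"
  by (induction J rule: infinite_finite_induct) (auto intro: low_zero low_add)

lemma low_mult:
  assumes "low S x n f" "low S x m g"
  shows "low S x (n + m) (\<lambda>p. f p * g p)"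
proof -
  obtain c where c: "\<forall>i. c i \<in> reg S" "\<forall>p\<in>pts S. f p = (\<Sum>i<n. c i p * x p ^ i)"
    by (rule lowE[OF assms(1)])
  have "low S x (n + m) (\<lambda>p. c i p * (x p ^ i * g p))" if "i < n" for i
    by (rule low_mult_reg[OF low_mono[OF low_shift_power[OF assms(2), of i]] c(1)[rule_format]]) (use that in simp)
  then have "low S x (n + m) (\<lambda>p. \<Sum>i<n. c i p * (x p ^ i * g p))"
    by (intro low_sum) simp
  then show ?thesis
    by (rule low_cong) (simp add: c(2) sum_distrib_right mult.assoc)
qed

lemma low_reg_const: "f \<in> reg S \<Longrightarrow> low S x 1 f"
  by (rule lowI[of "\<lambda>i. f"]) auto

lemma reg_insert_low:
  assumes "f \<in> reg (insert x X, A)"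
  shows "\<exists>n. low (X, A) x n f"
  using assms
proof induction
  case (const c)
  show ?case
    by (rule exI, rule low_reg_const, rule reg.const)
next
  case (gen y)
  show ?case
  proof (cases "y = x")
    case True
    have "low (X, A) x (Suc 1) (\<lambda>p. x p * 1)"
      by (rule low_shift[OF low_reg_const[OF reg.const]])
    then show ?thesis
      unfolding True by (intro exI[of _ "Suc 1"]) simp
  next
    case False
    then have "y \<in> reg (X, A)"
      using gen by (intro reg.gen) simp
    then show ?thesis
      by (intro exI[of _ 1] low_reg_const)
  qed
next
  case (add f g)
  then obtain n m where "low (X, A) x n f" "low (X, A) x m g"
    by (elim exE)
  then have "low (X, A) x (max n m) (\<lambda>p. f p + g p)"
    by (intro low_add) (auto elim: low_mono)
  then show ?case ..
next
  case (mult f g)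
  then obtain n m where "low (X, A) x n f" "low (X, A) x m g"
    by (elim exE)
  then show ?case
    by (intro exI[of _ "n + m"] low_mult)
next
  case (cong f g)
  from cong.IH obtain n where "low (X, A) x n f" ..
  then have "low (X, A) x n g"
    by (rule low_cong) (use cong.hyps(2) in simp)
  then show ?case ..
qed

lemma reg_insert: "f \<in> reg (X, A) \<Longrightarrow> f \<in> reg (insert x X, A)"
proof (induction rule: reg.induct)
  case (cong f g)
  show ?case
    by (rule reg.cong[OF cong.IH]) (use cong.hyps(2) in simp)
qed (auto intro: reg.intros)

text \<open>Hilbert's basis theorem. The sequence \<open>f\<close> is built by choosing elements of minimal degree
  outside of the ideal generated by the previous ones.\<close>

lemma noeth_insert:
  fixes x :: "'p \<Rightarrow> 'k::field"
  assumes noeth: "noeth (X, A)"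
  shows "noeth (insert x X, A)"
  unfolding noeth_def
proof (intro allI impI, rule ccontr)
  let ?S = "(X, A)" and ?S' = "(insert x X, A)"
  fix a :: "nat \<Rightarrow> 'p \<Rightarrow> 'k" assume a: "\<forall>n. a n \<in> reg ?S'"
    and contra: "\<nexists>m. a m \<in> ideal_gen ?S' (a ` {..<m})"
  define J where "J = ideal_gen ?S' (range a)"
  \<comment> \<open>The least length of an expression in \<open>x\<close>; it replaces the degree,
    which is not defined in the presence of relations.\<close>
  define deg where "deg f = (LEAST n. low ?S x n f)" for f
  have J_reg: "J \<subseteq> reg ?S'"
    using a by (auto simp: J_def intro: ideal_gen_reg)
  have deg: "low ?S x (deg f) f" if "f \<in> J" for f
    unfolding deg_def by (rule LeastI_ex, rule reg_insert_low) (use that J_reg in auto)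
  have deg_le: "deg f \<le> n" if "low ?S x n f" for f n
    unfolding deg_def using that by (rule Least_le)
  \<comment> \<open>A finite generating list of \<open>J\<close> would lie in the ideal of finitely
    many terms of \<open>a\<close>, and the next term of \<open>a\<close> would violate the
    assumption.\<close>
  have ex: "\<exists>f. f \<in> J \<and> f \<notin> ideal_gen ?S' (set l)" if "set l \<subseteq> J" for l
  proof (rule ccontr)
    assume J: "\<nexists>f. f \<in> J \<and> f \<notin> ideal_gen ?S' (set l)"
    have "\<exists>M. set l \<subseteq> ideal_gen ?S' (a ` {..<M})"
      using \<open>set l \<subseteq> J\<close>
    proof (induction l)
      case (Cons f l)
      then obtain M where M: "set l \<subseteq> ideal_gen ?S' (a ` {..<M})"
        by auto
      obtain M' where M': "f \<in> ideal_gen ?S' (a ` {..<M'})"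
        using ideal_gen_range[of f ?S' a] Cons.prems by (auto simp: J_def)
      have "ideal_gen ?S' (a ` {..<M}) \<subseteq> ideal_gen ?S' (a ` {..<max M M'})"
        "ideal_gen ?S' (a ` {..<M'}) \<subseteq> ideal_gen ?S' (a ` {..<max M M'})"
        by (intro ideal_gen_mono image_mono; simp)+
      then show ?case
        using M M' by (intro exI[of _ "max M M'"]) auto
    qed simp
    then obtain M where M: "set l \<subseteq> ideal_gen ?S' (a ` {..<M})" ..
    have "a M \<in> J"
      unfolding J_def by (rule ideal_gen_gen) simp
    then have "a M \<in> ideal_gen ?S' (set l)"
      using J by auto
    also have "\<dots> \<subseteq> ideal_gen ?S' (a ` {..<M})"
      by (rule ideal_gen_subset[OF M])
    finally show False
      using contra by auto
  qed
  define pick where "pick l = arg_min deg (\<lambda>f. f \<in> J \<and> f \<notin> ideal_gen ?S' (set l))" for l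
  have pick: "pick l \<in> J" "pick l \<notin> ideal_gen ?S' (set l)"
    "\<And>f. f \<in> J \<Longrightarrow> f \<notin> ideal_gen ?S' (set l) \<Longrightarrow> deg (pick l) \<le> deg f"
    if "set l \<subseteq> J" for l
  proof -
    from ex[OF that] obtain f where "f \<in> J \<and> f \<notin> ideal_gen ?S' (set l)" ..
    from arg_min_natI[of "\<lambda>f. f \<in> J \<and> f \<notin> ideal_gen ?S' (set l)", OF this, of deg]
    show "pick l \<in> J" "pick l \<notin> ideal_gen ?S' (set l)"
      by (auto simp: pick_def)
    show "deg (pick l) \<le> deg f" if "f \<in> J" "f \<notin> ideal_gen ?S' (set l)" for f
      using arg_min_nat_le[of "\<lambda>f. f \<in> J \<and> f \<notin> ideal_gen ?S' (set l)" f deg] that by (simp add: pick_def)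
  qed
  \<comment> \<open>\<open>h k\<close> lists the first k choices, so that the recursion for
    \<open>f\<close> has access to its own history.\<close>
  define h where "h = rec_nat [] (\<lambda>_ l. l @ [pick l])"
  define f where "f k = pick (h k)" for k
  have h: "set (h k) = f ` {..<k}" for k
    by (induction k) (auto simp: h_def f_def lessThan_Suc)
  have hJ: "set (h k) \<subseteq> J" for k
    by (induction k) (use pick(1) in \<open>auto simp: h_def\<close>)
  have fJ: "f k \<in> J" and fI: "f k \<notin> ideal_gen ?S' (f ` {..<k})"
    and fmin: "\<And>g. g \<in> J \<Longrightarrow> g \<notin> ideal_gen ?S' (f ` {..<k}) \<Longrightarrow> deg (f k) \<le> deg g" for k
    using pick[OF hJ[of k]] by (simp_all add: f_def h)
  have "deg (f k) \<noteq> 0" for k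
  proof
    assume "deg (f k) = 0"
    then have "low ?S x 0 (f k)"
      using deg[OF fJ[of k]] by simp
    then have "f k \<in> ideal_gen ?S' (f ` {..<k})"
      by (rule lowE) (rule ideal_gen.cong[OF ideal_gen.zero], simp)
    then show False
      using fI by simp
  qed
  then have "\<forall>k. \<exists>e. deg (f k) = Suc e"
    by (metis not0_implies_Suc)
  from choice[OF this] obtain e where e: "\<forall>k. deg (f k) = Suc (e k)" ..
  \<comment> \<open>\<open>b k\<close> is the leading coefficient of a shortest expression of
    \<open>f k\<close>; the chain condition of the smaller algebra is applied to this
    sequence.\<close>
  have "\<exists>b. b \<in> reg ?S \<and> low ?S x (e k) (\<lambda>p. f k p - b p * x p ^ e k)" for k
  proof -
    obtain c where c: "\<forall>i. c i \<in> reg ?S" "\<forall>p\<in>pts ?S. f k p = (\<Sum>i<deg (f k). c i p * x p ^ i)"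
      by (rule lowE[OF deg[OF fJ[of k]]])
    have "low ?S x (e k) (\<lambda>p. f k p - c (e k) p * x p ^ e k)"
      by (rule lowI[OF c(1)[rule_format]]) (use c(2) e in simp)
    then show ?thesis
      using c(1) by (intro exI[of _ "c (e k)"] conjI) simp_all
  qed
  then have "\<forall>k. \<exists>b. b \<in> reg ?S \<and> low ?S x (e k) (\<lambda>p. f k p - b p * x p ^ e k)"
    by (rule allI)
  from choice[OF this] obtain b
    where b: "\<forall>k. b k \<in> reg ?S \<and> low ?S x (e k) (\<lambda>p. f k p - b k p * x p ^ e k)" ..
  from noeth[unfolded noeth_def, rule_format, of b] b obtain m
    where m: "b m \<in> ideal_gen ?S (b ` {..<m})"
    by auto
  define D where "D = e m"
  \<comment> \<open>\<open>f m\<close> was still available when \<open>f j\<close> was chosen, so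
    minimality bounds the degree of \<open>f j\<close>.\<close>
  have e_le: "e j \<le> D" if "j < m" for j
  proof -
    have "ideal_gen ?S' (f ` {..<j}) \<subseteq> ideal_gen ?S' (f ` {..<m})"
      using that by (intro ideal_gen_mono image_mono) auto
    then have "f m \<notin> ideal_gen ?S' (f ` {..<j})"
      using fI[of m] by (rule contra_subsetD)
    then have "deg (f j) \<le> deg (f m)"
      by (rule fmin[OF fJ])
    then show ?thesis
      using e by (simp add: D_def)
  qed
  \<comment> \<open>Relations among leading coefficients lift: each \<open>f j\<close> is multiplied
    by the power of \<open>x\<close> that raises its degree to \<open>D\<close>.\<close>
  have "\<exists>g. g \<in> ideal_gen ?S' (f ` {..<m}) \<and> low ?S x D (\<lambda>p. g p - r p * x p ^ D)"
    if "r \<in> ideal_gen ?S (b ` {..<m})" for r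
    using that
  proof induction
    case zero
    then show ?case
      by (intro exI[of _ "\<lambda>_. 0"]) (simp add: ideal_gen.zero low_zero)
  next
    case (step r s bj)
    from step.hyps(3) obtain j where j: "j < m" and bj: "bj = b j"
      by auto
    from step.IH obtain g where g: "g \<in> ideal_gen ?S' (f ` {..<m}) \<and> low ?S x D (\<lambda>p. g p - r p * x p ^ D)" ..
    have xD: "(\<lambda>p. s p * x p ^ k) \<in> reg ?S'" for k
    proof (induction k)
      case 0
      then show ?case
        using reg_insert[OF step.hyps(2)] by simp
    next
      case (Suc k)
      have "(\<lambda>p. (s p * x p ^ k) * x p) \<in> reg ?S'"
        by (rule reg.mult[OF Suc.IH reg.gen]) simp
      then show ?case
        by (simp add: mult_ac)
    qed
    have "low ?S x (e j + (D - e j)) (\<lambda>p. x p ^ (D - e j) * (f j p - b j p * x p ^ e j))"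
      using b by (intro low_shift_power) simp
    moreover have "e j + (D - e j) = D"
      using e_le[OF j] by simp
    ultimately have "low ?S x D (\<lambda>p. x p ^ (D - e j) * (f j p - b j p * x p ^ e j))"
      by simp
    then have "low ?S x D (\<lambda>p. s p * (x p ^ (D - e j) * (f j p - b j p * x p ^ e j)))"
      by (rule low_mult_reg[OF _ step.hyps(2)])
    from low_add[OF conjunct2[OF g] this]
    have "low ?S x D (\<lambda>p. (g p + (s p * x p ^ (D - e j)) * f j p) - (r p + s p * bj p) * x p ^ D)"
      by (rule low_cong) (use e_le[OF j] in \<open>simp add: bj algebra_simps flip: power_add\<close>)
    moreover have "(\<lambda>p. g p + (s p * x p ^ (D - e j)) * f j p) \<in> ideal_gen ?S' (f ` {..<m})"
      by (rule ideal_gen.step[OF conjunct1[OF g] xD]) (use j in simp)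
    ultimately show ?case
      by (intro exI[of _ "\<lambda>p. g p + (s p * x p ^ (D - e j)) * f j p"] conjI)
  next
    case (cong r r')
    from cong.IH obtain g where g: "g \<in> ideal_gen ?S' (f ` {..<m}) \<and> low ?S x D (\<lambda>p. g p - r p * x p ^ D)" ..
    from conjunct2[OF g] have "low ?S x D (\<lambda>p. g p - r' p * x p ^ D)"
      by (rule low_cong) (use cong.hyps(2) in simp)
    then show ?case
      using g by (intro exI[of _ g]) simp
  qed
  from this[OF m] obtain g
    where g: "g \<in> ideal_gen ?S' (f ` {..<m}) \<and> low ?S x D (\<lambda>p. g p - b m p * x p ^ D)" ..
  \<comment> \<open>The leading terms of \<open>f m\<close> and \<open>g\<close> cancel, so
    \<open>h\<close> is shorter than \<open>f m\<close> and still lies outside the ideal of the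
    earlier choices.\<close>
  define h where "h p = f m p - g p" for p
  have "low ?S x D (\<lambda>p. f m p - b m p * x p ^ D)"
    using b by (simp add: D_def)
  from low_diff[OF this conjunct2[OF g]] have "low ?S x D h"
    by (rule low_cong) (simp add: h_def)
  then have "deg h \<le> D"
    by (rule deg_le)
  moreover have "h \<in> J"
  proof -
    have "f ` {..<m} \<subseteq> J"
      using fJ by auto
    then have "ideal_gen ?S' (f ` {..<m}) \<subseteq> J"
      unfolding J_def by (rule ideal_gen_subset)
    then have "g \<in> J"
      using g by auto
    then show ?thesis
      using ideal_gen_diff[OF fJ[unfolded J_def], of g m] unfolding h_def[abs_def] J_def by simp
  qed
  moreover have "h \<notin> ideal_gen ?S' (f ` {..<m})"
  proof
    assume "h \<in> ideal_gen ?S' (f ` {..<m})"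
    from ideal_gen_add[OF this conjunct1[OF g]] have "f m \<in> ideal_gen ?S' (f ` {..<m})"
      by (simp add: h_def)
    then show False
      using fI by simp
  qed
  ultimately show False
    using fmin[of h m] e by (simp add: D_def)
qed

lemma noeth_finite_gens:
  assumes "finite X"
  shows "noeth (X, A)"
  using assms by (induction rule: finite_induct) (auto intro: noeth_no_gens noeth_insert)

section \<open>Zero sets, descending chains and irreducible covers\<close>

definition zeros :: "('p, 'k::field) space \<Rightarrow> ('p \<Rightarrow> 'k) set \<Rightarrow> 'p set" where
  "zeros S F = {p \<in> pts S. \<forall>f\<in>F. f p = 0}"

text \<open>Strict inclusion of closed sets, stated for the sets of equations so that an induction
  step can adjoin an equation.\<close>

definition closed_rel :: "('p, 'k::field) space \<Rightarrow> (('p \<Rightarrow> 'k) set \<times> ('p \<Rightarrow> 'k) set) set" where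
  "closed_rel S = {(F, G). F \<subseteq> reg S \<and> G \<subseteq> reg S \<and> zeros S F \<subset> zeros S G}"

text \<open>Along an infinite descent choose \<open>a i\<close> among the equations of stage i + 1
  so that it does not vanish on stage i. If \<open>a m\<close> were a combination of its
  predecessors, it would vanish on stage m, where all of them vanish.\<close>

lemma wf_closed_rel:
  assumes "finite (fst S)"
  shows "wf (closed_rel S)"
  unfolding wf_iff_no_infinite_down_chain
proof
  assume "\<exists>F. \<forall>i. (F (Suc i), F i) \<in> closed_rel S"
  then obtain F where F: "\<forall>i. (F (Suc i), F i) \<in> closed_rel S" ..
  have "\<exists>f. f \<in> F (Suc i) \<and> (\<exists>p\<in>zeros S (F i). f p \<noteq> 0)" for i
  proof -
    from F have "zeros S (F (Suc i)) \<subset> zeros S (F i)"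
      by (simp add: closed_rel_def)
    then obtain p where p: "p \<in> zeros S (F i)" "p \<notin> zeros S (F (Suc i))"
      by auto
    then have "\<not> (\<forall>f\<in>F (Suc i). f p = 0)"
      by (simp add: zeros_def)
    then show ?thesis
      using p(1) by (metis (full_types))
  qed
  then have "\<forall>i. \<exists>f. f \<in> F (Suc i) \<and> (\<exists>p\<in>zeros S (F i). f p \<noteq> 0)"
    by (rule allI)
  from choice[OF this] obtain a where a: "\<forall>i. a i \<in> F (Suc i) \<and> (\<exists>p\<in>zeros S (F i). a i p \<noteq> 0)" ..
  have "a i \<in> reg S" for i
    using a F by (auto simp: closed_rel_def)
  moreover have "noeth S"
    using noeth_finite_gens[OF assms, of "pts S"] by simp
  ultimately obtain m where m: "a m \<in> ideal_gen S (a ` {..<m})"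
    unfolding noeth_def by auto
  from a obtain p where p: "p \<in> zeros S (F m)" "a m p \<noteq> 0"
    by (meson bexE)
  have dec: "zeros S (F (Suc i + k)) \<subseteq> zeros S (F (Suc i))" for i k
  proof (induction k)
    case (Suc k)
    have "zeros S (F (Suc i + Suc k)) \<subseteq> zeros S (F (Suc i + k))"
      using F by (simp add: closed_rel_def less_imp_le)
    then show ?case
      using Suc.IH by (rule order_trans)
  qed simp
  have "a i p = 0" if "i < m" for i
  proof -
    have "p \<in> zeros S (F (Suc i))"
      using p dec[of i "m - Suc i"] that by auto
    then show ?thesis
      using a by (simp add: zeros_def)
  qed
  then have "a m p = 0"
    by (intro ideal_gen_vanish[OF m]) (use p in \<open>auto simp: zeros_def\<close>)
  then show False
    using p by simp
qed

text \<open>Take a finite subset of \<open>F\<close> with minimal zero set: adjoining any further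
  element of \<open>F\<close> cannot shrink it.\<close>

lemma zeros_finite:
  assumes fin: "finite (fst S)" and "F \<subseteq> reg S"
  shows "\<exists>G\<subseteq>F. finite G \<and> zeros S F = zeros S G"
proof -
  obtain G where G: "G \<in> {G. G \<subseteq> F \<and> finite G}"
    and min: "\<And>G'. (G', G) \<in> closed_rel S \<Longrightarrow> G' \<notin> {G. G \<subseteq> F \<and> finite G}"
    using wfE_min[OF wf_closed_rel[OF fin], of "{}" "{G. G \<subseteq> F \<and> finite G}"] by auto
  have "zeros S G \<subseteq> zeros S {f}" if "f \<in> F" for f
  proof -
    have "zeros S (insert f G) = zeros S G"
    proof (rule ccontr)
      assume "zeros S (insert f G) \<noteq> zeros S G"
      then have "(insert f G, G) \<in> closed_rel S"
        using G that assms(2) by (auto simp: closed_rel_def zeros_def)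
      from min[OF this] show False
        using G that by simp
    qed
    then show ?thesis
      by (auto simp: zeros_def)
  qed
  then have "zeros S G \<subseteq> zeros S F"
    by (auto simp: zeros_def)
  moreover have "zeros S F \<subseteq> zeros S G"
    using G by (auto simp: zeros_def)
  ultimately show ?thesis
    using G by (intro exI[of _ G]) auto
qed

lemma constr_zeros:
  assumes "finite (fst S)" and "F \<subseteq> reg S"
  shows "zeros S F \<in> constr S"
proof -
  from zeros_finite[OF assms] obtain G where G: "G \<subseteq> F \<and> finite G \<and> zeros S F = zeros S G" ..
  then show ?thesis
    unfolding zeros_def using assms(2) by (auto intro!: constr_ball constr.zero)
qed

text \<open>Noetherian induction on the closed set cut out by \<open>F\<close>. If \<open>P\<close>
  meets it in a reducible set, two functions with product zero on that set split it into traces of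
  two smaller closed sets, and every irreducible subset lies in one of them. \<open>P\<close> is any
  set of points, which matters because strata need not be closed.\<close>

lemma finite_irr_cover:
  assumes fin: "finite (fst S)" and P: "P \<subseteq> pts S"
  shows "\<exists>\<Z>. finite \<Z> \<and> (\<forall>Z\<in>\<Z>. irr S Z \<and> Z \<subseteq> P) \<and> (\<forall>Y. irr S Y \<longrightarrow> Y \<subseteq> P \<longrightarrow> (\<exists>Z\<in>\<Z>. Y \<subseteq> Z))"
proof -
  have "\<exists>\<Z>. finite \<Z> \<and> (\<forall>Z\<in>\<Z>. irr S Z \<and> Z \<subseteq> P) \<and>
      (\<forall>Y. irr S Y \<longrightarrow> Y \<subseteq> P \<inter> zeros S F \<longrightarrow> (\<exists>Z\<in>\<Z>. Y \<subseteq> Z))" if "F \<subseteq> reg S" for F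
    using wf_closed_rel[OF fin] that
  proof (induction F rule: wf_induct_rule)
    case (less F)
    let ?C = "P \<inter> zeros S F"
    consider "?C = {}" | "irr S ?C" | "?C \<noteq> {}" "\<not> irr S ?C"
      by auto
    then show ?case
    proof cases
      case 1
      then show ?thesis
        by (intro exI[of _ "{}"]) (auto simp: irr_def)
    next
      case 2
      then show ?thesis
        by (intro exI[of _ "{?C}"]) auto
    next
      case 3
      then have "\<not> (\<forall>f\<in>reg S. \<forall>g\<in>reg S. (\<exists>p\<in>?C. f p \<noteq> 0) \<longrightarrow> (\<exists>p\<in>?C. g p \<noteq> 0) \<longrightarrow>
          (\<exists>p\<in>?C. f p \<noteq> 0 \<and> g p \<noteq> 0))"
        using P unfolding irr_def by auto
      then obtain f g where f: "f \<in> reg S" "\<exists>p\<in>?C. f p \<noteq> 0" and g: "g \<in> reg S" "\<exists>p\<in>?C. g p \<noteq> 0"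
        and fg: "\<not> (\<exists>p\<in>?C. f p \<noteq> 0 \<and> g p \<noteq> 0)"
        unfolding Ball_def not_all not_imp by (elim exE conjE) simp
      have rel: "(insert h F, F) \<in> closed_rel S" if "h \<in> reg S" "\<exists>p\<in>?C. h p \<noteq> 0" for h
      proof -
        from that(2) obtain p where "p \<in> ?C" "h p \<noteq> 0" ..
        then have "p \<in> zeros S F" "p \<notin> zeros S (insert h F)"
          by (auto simp: zeros_def)
        moreover have "zeros S (insert h F) \<subseteq> zeros S F"
          by (auto simp: zeros_def)
        ultimately have "zeros S (insert h F) \<subset> zeros S F"
          by auto
        then show ?thesis
          using that(1) less.prems by (simp add: closed_rel_def)
      qed
      from less.IH[OF rel[OF f]] f(1) less.prems obtain \<Z>1 where Z1: "finite \<Z>1"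
        "\<forall>Z\<in>\<Z>1. irr S Z \<and> Z \<subseteq> P"
        "\<forall>Y. irr S Y \<longrightarrow> Y \<subseteq> P \<inter> zeros S (insert f F) \<longrightarrow> (\<exists>Z\<in>\<Z>1. Y \<subseteq> Z)"
        by auto
      from less.IH[OF rel[OF g]] g(1) less.prems obtain \<Z>2 where Z2: "finite \<Z>2"
        "\<forall>Z\<in>\<Z>2. irr S Z \<and> Z \<subseteq> P"
        "\<forall>Y. irr S Y \<longrightarrow> Y \<subseteq> P \<inter> zeros S (insert g F) \<longrightarrow> (\<exists>Z\<in>\<Z>2. Y \<subseteq> Z)"
        by auto
      have "\<exists>Z\<in>\<Z>1 \<union> \<Z>2. Y \<subseteq> Z" if Y: "irr S Y" "Y \<subseteq> ?C" for Y
      proof -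
        have "(\<forall>p\<in>Y. f p = 0) \<or> (\<forall>p\<in>Y. g p = 0)"
        proof (rule ccontr)
          assume "\<not> ?thesis"
          then have "\<exists>p\<in>Y. f p \<noteq> 0 \<and> g p \<noteq> 0"
            using Y(1) f(1) g(1) by (simp add: irr_def)
          then show False
            using fg Y(2) by auto
        qed
        then have "Y \<subseteq> P \<inter> zeros S (insert f F) \<or> Y \<subseteq> P \<inter> zeros S (insert g F)"
          using Y(2) P by (elim disjE) (auto simp: zeros_def)
        then show ?thesis
        proof
          assume "Y \<subseteq> P \<inter> zeros S (insert f F)"
          from Z1(3)[rule_format, OF Y(1) this] show ?thesis
            by auto
        next
          assume "Y \<subseteq> P \<inter> zeros S (insert g F)"
          from Z2(3)[rule_format, OF Y(1) this] show ?thesis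
            by auto
        qed
      qed
      then show ?thesis
        using Z1(1,2) Z2(1,2) by (intro exI[of _ "\<Z>1 \<union> \<Z>2"]) auto
    qed
  qed
  \<comment> \<open>No equations: the zero set is the whole space.\<close>
  from this[of "{}"] show ?thesis
    using P by (simp add: zeros_def Int_absorb2 inf.absorb1)
qed

section \<open>Bases of spaces of matrices\<close>

definition lin_comb :: "nat \<Rightarrow> nat \<Rightarrow> nat \<Rightarrow> (nat \<Rightarrow> 'k::field) \<Rightarrow> (nat \<Rightarrow> 'k mat) \<Rightarrow> 'k mat" where
  "lin_comb m d k c \<phi> = mat m d (\<lambda>(a, b). \<Sum>i<k. c i * \<phi> i $$ (a, b))"

definition mat_subspace :: "nat \<Rightarrow> nat \<Rightarrow> 'k::field mat set \<Rightarrow> bool" where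
  "mat_subspace m d S \<longleftrightarrow> S \<subseteq> carrier_mat m d \<and> 0\<^sub>m m d \<in> S \<and>
     (\<forall>A\<in>S. \<forall>B\<in>S. A + B \<in> S) \<and> (\<forall>c. \<forall>A\<in>S. c \<cdot>\<^sub>m A \<in> S)"

text \<open>Bases are indexed families, not sets: a candidate is then a point of
  \<open>mat_space k m d\<close>, and being a basis becomes a formula in its entries.\<close>

definition is_basis :: "nat \<Rightarrow> nat \<Rightarrow> 'k::field mat set \<Rightarrow> nat \<Rightarrow> (nat \<Rightarrow> 'k mat) \<Rightarrow> bool" where
  "is_basis m d S k \<phi> \<longleftrightarrow> (\<forall>i<k. \<phi> i \<in> S) \<and> (\<forall>A\<in>S. \<exists>c. A = lin_comb m d k c \<phi>) \<and>
     (\<forall>c. lin_comb m d k c \<phi> = 0\<^sub>m m d \<longrightarrow> (\<forall>i<k. c i = 0))"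

definition sdim :: "nat \<Rightarrow> nat \<Rightarrow> 'k::field mat set \<Rightarrow> nat" where
  "sdim m d S = vectorspace.dim class_ring ((module_mat TYPE('k) m d)\<lparr>carrier := S\<rparr>)"

lemma lin_comb_carrier [simp]: "lin_comb m d k c \<phi> \<in> carrier_mat m d"
  "dim_row (lin_comb m d k c \<phi>) = m" "dim_col (lin_comb m d k c \<phi>) = d"
  by (simp_all add: lin_comb_def)

lemma index_lin_comb [simp]:
  "a < m \<Longrightarrow> b < d \<Longrightarrow> lin_comb m d k c \<phi> $$ (a, b) = (\<Sum>i<k. c i * \<phi> i $$ (a, b))"
  by (simp add: lin_comb_def)

lemma lin_comb_eq_0_iff:
  "lin_comb m d k c \<phi> = 0\<^sub>m m d \<longleftrightarrow> (\<forall>a<m. \<forall>b<d. (\<Sum>i<k. c i * \<phi> i $$ (a, b)) = 0)"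
  by (auto simp: mat_eq_iff)

lemma mat_subspaceD:
  assumes "mat_subspace m d S"
  shows "A \<in> S \<Longrightarrow> A \<in> carrier_mat m d" "0\<^sub>m m d \<in> S" "A \<in> S \<Longrightarrow> B \<in> S \<Longrightarrow> A + B \<in> S"
    "A \<in> S \<Longrightarrow> c \<cdot>\<^sub>m A \<in> S"
  using assms by (auto simp: mat_subspace_def)

lemma lin_comb_in_subspace:
  assumes S: "mat_subspace m d S" and "\<And>i. i < k \<Longrightarrow> \<phi> i \<in> S"
  shows "lin_comb m d k c \<phi> \<in> S"
  using assms(2)
proof (induction k)
  case 0
  have "lin_comb m d 0 c \<phi> = 0\<^sub>m m d"
    by (simp add: lin_comb_eq_0_iff)
  then show ?case
    using mat_subspaceD[OF S] by simp
next
  case (Suc k)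
  have "\<phi> k \<in> carrier_mat m d"
    using mat_subspaceD(1)[OF S] Suc.prems by simp
  then have "lin_comb m d (Suc k) c \<phi> = lin_comb m d k c \<phi> + c k \<cdot>\<^sub>m \<phi> k"
    by (intro eq_matI) auto
  moreover have "lin_comb m d k c \<phi> \<in> S"
    using Suc by simp
  ultimately show ?case
    using mat_subspaceD(3,4)[OF S] Suc.prems by simp
qed

text \<open>Padding with zero rows gives a singular square matrix: its transpose kills the unit
  vector at the first padded row.\<close>

lemma wide_mat_kernel:
  fixes A :: "'k::field mat"
  assumes A: "A \<in> carrier_mat d z" and "d < z"
  shows "\<exists>v\<in>carrier_vec z. v \<noteq> 0\<^sub>v z \<and> A *\<^sub>v v = 0\<^sub>v d"
proof -
  define M where "M = mat z z (\<lambda>(i, j). if i < d then A $$ (i, j) else 0)"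
  have M: "M \<in> carrier_mat z z"
    by (simp add: M_def)
  have "det (transpose_mat M) = 0"
  proof (subst det_0_iff_vec_prod_zero_field[of _ z])
    let ?e = "unit_vec z d :: 'k vec"
    have "transpose_mat M *\<^sub>v ?e = 0\<^sub>v z"
    proof (rule eq_vecI)
      fix i assume i: "i < dim_vec (0\<^sub>v z :: 'k vec)"
      have "(transpose_mat M *\<^sub>v ?e) $ i = transpose_mat M $$ (i, d)"
        using i M \<open>d < z\<close> by (simp add: scalar_prod_right_unit)
      then show "(transpose_mat M *\<^sub>v ?e) $ i = 0\<^sub>v z $ i"
        using i \<open>d < z\<close> by (simp add: M_def)
    qed (simp add: M_def)
    moreover have "?e \<noteq> 0\<^sub>v z"
      using \<open>d < z\<close> unit_vec_nonzero by simp
    ultimately show "\<exists>v. v \<in> carrier_vec z \<and> v \<noteq> 0\<^sub>v z \<and> transpose_mat M *\<^sub>v v = 0\<^sub>v z"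
      by (intro exI[of _ ?e]) simp
  qed (simp add: M_def)
  then have "det M = 0"
    using M by (simp add: det_transpose)
  then obtain v where v: "v \<in> carrier_vec z" "v \<noteq> 0\<^sub>v z" "M *\<^sub>v v = 0\<^sub>v z"
    using M by (auto simp: det_0_iff_vec_prod_zero_field)
  have "A *\<^sub>v v = 0\<^sub>v d"
  proof (rule eq_vecI)
    fix i assume "i < dim_vec (0\<^sub>v d :: 'k vec)"
    then have i: "i < d"
      by simp
    have "row A i = row M i"
      using A i \<open>d < z\<close> by (intro eq_vecI) (auto simp: M_def)
    then have "(A *\<^sub>v v) $ i = (M *\<^sub>v v) $ i"
      using A M i \<open>d < z\<close> by simp
    then show "(A *\<^sub>v v) $ i = 0\<^sub>v d $ i"
      using v(3) i \<open>d < z\<close> by simp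
  qed (use A in simp)
  then show ?thesis
    using v(1,2) by auto
qed

lemma lin_comb_dependent:
  fixes \<phi> :: "nat \<Rightarrow> 'k::field mat"
  assumes "m * d < k"
  shows "\<exists>c. lin_comb m d k c \<phi> = 0\<^sub>m m d \<and> (\<exists>i<k. c i \<noteq> 0)"
proof -
  \<comment> \<open>Row \<open>a * d + b\<close> of \<open>A\<close> records the entry (a, b) of
    every \<open>\<phi> i\<close>, so kernel vectors are linear relations.\<close>
  define A where "A = mat (m * d) k (\<lambda>(r, i). \<phi> i $$ (r div d, r mod d))"
  obtain v where v: "v \<in> carrier_vec k" "v \<noteq> 0\<^sub>v k" "A *\<^sub>v v = 0\<^sub>v (m * d)"
    using wide_mat_kernel[of A "m * d" k] assms by (auto simp: A_def)
  have "(\<Sum>i<k. v $ i * \<phi> i $$ (a, b)) = 0" if "a < m" "b < d" for a b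
  proof -
    have r: "a * d + b < m * d"
      using that by (metis add.commute add_mult_distrib2 less_le_trans mult.commute mult_le_mono1 nat_add_left_cancel_less
          not_less_eq not_less mult_Suc Suc_leI)
    have "(\<Sum>i<k. v $ i * \<phi> i $$ (a, b)) = (A *\<^sub>v v) $ (a * d + b)"
      using r v(1) that by (simp add: A_def scalar_prod_def lessThan_atLeast0 mult.commute)
    then show ?thesis
      using v(3) r by simp
  qed
  moreover have "\<exists>i<k. v $ i \<noteq> 0"
    using v(1,2) by (metis carrier_vecD eq_vecI index_zero_vec)
  ultimately show ?thesis
    by (intro exI[of _ "\<lambda>i. v $ i"]) (simp add: lin_comb_eq_0_iff)
qed

text \<open>A longest independent family spans; lengths are bounded by \<open>m * d\<close> through
  \<open>lin_comb_dependent\<close>.\<close>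

lemma is_basis_exists:
  fixes S :: "'k::field mat set"
  assumes S: "mat_subspace m d S"
  shows "\<exists>k \<phi>. is_basis m d S k \<phi>"
proof -
  define ind where "ind k \<phi> \<longleftrightarrow> (\<forall>i<k. \<phi> i \<in> S) \<and> (\<forall>c. lin_comb m d k c \<phi> = 0\<^sub>m m d \<longrightarrow> (\<forall>i<k. c i = 0))"
    for k and \<phi> :: "nat \<Rightarrow> 'k mat"
  have "\<exists>\<phi>. ind 0 \<phi>"
    by (simp add: ind_def)
  moreover have "k \<le> m * d" if "\<exists>\<phi>. ind k \<phi>" for k
  proof (rule ccontr)
    assume "\<not> k \<le> m * d"
    from that obtain \<phi> where \<phi>: "ind k \<phi>" ..
    from lin_comb_dependent[of m d k \<phi>] \<open>\<not> k \<le> m * d\<close>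
    obtain c where "lin_comb m d k c \<phi> = 0\<^sub>m m d \<and> (\<exists>i<k. c i \<noteq> 0)"
      by auto
    then show False
      using \<phi> by (simp add: ind_def) blast
  qed
  ultimately obtain k where k: "\<exists>\<phi>. ind k \<phi>" and max: "\<forall>k'. (\<exists>\<phi>. ind k' \<phi>) \<longrightarrow> k' \<le> k"
    using ex_has_greatest_nat[of "\<lambda>k. \<exists>\<phi>. ind k \<phi>" 0 "\<lambda>k. k" "Suc (m * d)"]
    by (auto simp: less_Suc_eq_le)
  from k obtain \<phi> where \<phi>: "ind k \<phi>" ..
  have "\<exists>c. A = lin_comb m d k c \<phi>" if "A \<in> S" for A
  proof -
    let ?\<phi> = "\<phi>(k := A)"
    have "\<not> ind (Suc k) ?\<phi>"
      using max[rule_format, of "Suc k"] by auto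
    moreover have "\<forall>i<Suc k. ?\<phi> i \<in> S"
      using \<phi> that by (simp add: ind_def less_Suc_eq)
    ultimately obtain c :: "nat \<Rightarrow> 'k" and i where c: "lin_comb m d (Suc k) c ?\<phi> = 0\<^sub>m m d" and i: "i < Suc k" "c i \<noteq> 0"
      unfolding ind_def by auto
    have A: "A \<in> carrier_mat m d"
      using mat_subspaceD(1)[OF S that] .
    have entry: "(\<Sum>i<k. c i * \<phi> i $$ (a, b)) + c k * A $$ (a, b) = 0" if "a < m" "b < d" for a b
      using c that by (simp add: lin_comb_eq_0_iff)
    have "c k \<noteq> 0"
    proof
      assume "c k = 0"
      then have "lin_comb m d k c \<phi> = 0\<^sub>m m d"
        using entry by (simp add: lin_comb_eq_0_iff)
      then have "\<forall>i<k. c i = 0"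
        using \<phi> by (simp add: ind_def)
      then show False
        using i \<open>c k = 0\<close> by (auto simp: less_Suc_eq)
    qed
    have "A $$ (a, b) = (\<Sum>i<k. (- c i / c k) * \<phi> i $$ (a, b))" if "a < m" "b < d" for a b
    proof -
      have "(\<Sum>i<k. (- c i / c k) * \<phi> i $$ (a, b)) = - (\<Sum>i<k. c i * \<phi> i $$ (a, b)) / c k"
        by (simp add: sum_divide_distrib sum_negf flip: divide_inverse)
      also have "\<dots> = A $$ (a, b)"
        using entry[OF that] \<open>c k \<noteq> 0\<close> by (simp add: field_simps add_eq_0_iff)
      finally show ?thesis ..
    qed
    then have "A = lin_comb m d k (\<lambda>i. - c i / c k) \<phi>"
      using A by (intro eq_matI) auto
    then show ?thesis
      by (rule exI[of _ "\<lambda>i. - c i / c k"])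
  qed
  then show ?thesis
    using \<phi> unfolding is_basis_def ind_def by (intro exI[of _ k] exI[of _ \<phi>]) simp
qed

lemma subspace_vectorspace:
  fixes S :: "'k::field mat set"
  assumes S: "mat_subspace m d S"
  shows "vectorspace class_ring ((module_mat TYPE('k) m d)\<lparr>carrier := S\<rparr>)"
proof -
  interpret V: vectorspace class_ring "module_mat TYPE('k) m d"
    by (rule matrix_vs)
  have "submodule class_ring S (module_mat TYPE('k) m d)"
    by (rule submodule.intro[OF V.module_axioms])
      (use mat_subspaceD[OF S] in \<open>auto simp: module_mat_simps\<close>)
  with V.vectorspace_axioms have "subspace class_ring S (module_mat TYPE('k) m d)"
    by (rule subspace.intro)
  then show ?thesis
    by (rule V.subspace_is_vs)
qed

text \<open>The link to the abstract dimension: the family is injective by independence, its image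
  is a basis of the module, and sums over the image are reindexed along the family.\<close>

lemma sdim_eq:
  fixes S :: "'k::field mat set"
  assumes S: "mat_subspace m d S" and basis: "is_basis m d S k \<phi>"
  shows "sdim m d S = k"
proof -
  let ?V = "(module_mat TYPE('k) m d)\<lparr>carrier := S\<rparr>"
  interpret V: vectorspace class_ring ?V
    by (rule subspace_vectorspace[OF S])
  have V_simps: "carrier ?V = S" "add ?V = (+)" "zero ?V = 0\<^sub>m m d" "module.smult ?V = (\<cdot>\<^sub>m)"
    by (simp_all add: module_mat_simps)
  have lincomb: "V.lincomb a B \<in> S \<and> (\<forall>x<m. \<forall>y<d. V.lincomb a B $$ (x, y) = (\<Sum>v\<in>B. a v * v $$ (x, y)))"
    if "finite B" "B \<subseteq> S" for a B
    using that
  proof (induction rule: finite_induct)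
    case empty
    then show ?case
      using mat_subspaceD(2)[OF S] by (simp add: V.lincomb_def module_mat_simps)
  next
    case (insert v B)
    have cl: "(\<lambda>v. a v \<cdot>\<^sub>m v) \<in> B \<rightarrow> carrier ?V" "a v \<cdot>\<^sub>m v \<in> carrier ?V"
      using insert.prems mat_subspaceD(4)[OF S] by auto
    have "V.lincomb a (insert v B) = a v \<cdot>\<^sub>m v + V.lincomb a B"
      unfolding V.lincomb_def using V.finsum_insert[OF insert.hyps(1,2) cl] by (simp add: module_mat_simps)
    moreover have "v \<in> carrier_mat m d" "V.lincomb a B \<in> carrier_mat m d"
      using insert mat_subspaceD(1)[OF S] by auto
    ultimately show ?case
      using insert mat_subspaceD(3,4)[OF S] by auto
  qed
  have \<phi>: "\<And>i. i < k \<Longrightarrow> \<phi> i \<in> S" and span: "\<And>A. A \<in> S \<Longrightarrow> \<exists>c. A = lin_comb m d k c \<phi>"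
    and ind: "\<And>c i. lin_comb m d k c \<phi> = 0\<^sub>m m d \<Longrightarrow> i < k \<Longrightarrow> c i = 0"
    using basis by (auto simp: is_basis_def)
  let ?B = "\<phi> ` {..<k}"
  have inj: "inj_on \<phi> {..<k}"
  proof (rule inj_onI, rule ccontr)
    fix i j assume ij: "i \<in> {..<k}" "j \<in> {..<k}" "\<phi> i = \<phi> j" "i \<noteq> j"
    \<comment> \<open>The relation expressing that the i-th and the j-th member coincide.\<close>
    let ?c = "\<lambda>l. (if l = i then 1 else 0) - (if l = j then 1 else 0) :: 'k"
    have "lin_comb m d k ?c \<phi> = 0\<^sub>m m d"
      using ij by (simp add: lin_comb_eq_0_iff left_diff_distrib sum_subtractf if_distrib[of "\<lambda>x. x * _"] cong: if_cong)
    from ind[OF this, of i] show False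
      using ij by simp
  qed
  have sub: "?B \<subseteq> S"
    using \<phi> by auto
  have "V.span ?B = S"
  proof
    show "V.span ?B \<subseteq> S"
    proof
      fix A assume "A \<in> V.span ?B"
      then obtain a A' where "A = V.lincomb a A'" "finite A'" "A' \<subseteq> ?B"
        unfolding V.span_def by (elim CollectE exE conjE)
      then show "A \<in> S"
        using lincomb[of A' a] sub by (metis order_trans)
    qed
    show "S \<subseteq> V.span ?B"
    proof
      fix A assume A: "A \<in> S"
      then obtain c where c: "A = lin_comb m d k c \<phi>"
        using span by blast
      let ?a = "\<lambda>v. c (the_inv_into {..<k} \<phi> v)"
      have L: "V.lincomb ?a ?B \<in> carrier_mat m d"
        using lincomb[OF _ sub] mat_subspaceD(1)[OF S] by simp
      have "A = V.lincomb ?a ?B"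
      proof (rule eq_matI)
        fix x y assume "x < dim_row (V.lincomb ?a ?B)" "y < dim_col (V.lincomb ?a ?B)"
        then have xy: "x < m" "y < d"
          using L by auto
        then have "V.lincomb ?a ?B $$ (x, y) = (\<Sum>v\<in>?B. ?a v * v $$ (x, y))"
          using lincomb[OF _ sub] by simp
        also have "\<dots> = (\<Sum>i<k. c i * \<phi> i $$ (x, y))"
          using inj by (simp add: sum.reindex the_inv_into_f_f)
        finally show "A $$ (x, y) = V.lincomb ?a ?B $$ (x, y)"
          using c xy by simp
      qed (use L c in auto)
      then show "A \<in> V.span ?B"
        unfolding V.span_def by (intro CollectI exI[of _ ?a] exI[of _ ?B]) simp
    qed
  qed
  moreover have "V.lin_indpt ?B"
  proof
    assume "V.lin_dep ?B"
    then obtain A a v where A: "finite A" "A \<subseteq> ?B" "V.lincomb a A = 0\<^sub>m m d" "v \<in> A" "a v \<noteq> 0"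
      unfolding V.lin_dep_def by (auto simp: module_mat_simps)
    let ?c = "\<lambda>i. if \<phi> i \<in> A then a (\<phi> i) else 0"
    have "(\<Sum>i<k. ?c i * \<phi> i $$ (x, y)) = 0" if "x < m" "y < d" for x y
    proof -
      have "(\<Sum>i<k. ?c i * \<phi> i $$ (x, y)) = (\<Sum>v\<in>?B. (if v \<in> A then a v else 0) * v $$ (x, y))"
        using inj by (simp add: sum.reindex)
      also have "\<dots> = (\<Sum>v\<in>?B. if v \<in> A then a v * v $$ (x, y) else 0)"
        by (intro sum.cong) auto
      also have "\<dots> = (\<Sum>v\<in>A. a v * v $$ (x, y))"
        using A(1,2) by (simp add: sum.If_cases Int_absorb1)
      also have "\<dots> = V.lincomb a A $$ (x, y)"
        using lincomb[of A a] A(1,2) sub that by auto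
      finally show ?thesis
        using A(3) that by simp
    qed
    then have "lin_comb m d k ?c \<phi> = 0\<^sub>m m d"
      by (simp add: lin_comb_eq_0_iff)
    note zero = ind[OF this]
    from A(2,4) obtain i where "i < k" "v = \<phi> i"
      by auto
    with zero[of i] show False
      using A(4,5) by simp
  qed
  ultimately have "V.basis ?B"
    using sub unfolding V.basis_def by simp
  then have "V.dim = card ?B"
    by (intro V.dim_basis) auto
  then show ?thesis
    using inj by (simp add: sdim_def card_image)
qed

lemma sdim_eq_iff:
  assumes "mat_subspace m d S"
  shows "sdim m d S = k \<longleftrightarrow> (\<exists>\<phi>. is_basis m d S k \<phi>)"
  using is_basis_exists[OF assms] sdim_eq[OF assms] by blast

lemma sdim_basis:
  assumes "mat_subspace m d S"
  obtains \<phi> where "is_basis m d S (sdim m d S) \<phi>"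
  using sdim_eq_iff[OF assms] by blast

lemma sdim_image:
  assumes S: "mat_subspace m d S" and T: "mat_subspace m' d' (f ` S)"
    and lin: "\<And>k c \<phi>. (\<And>i. i < k \<Longrightarrow> \<phi> i \<in> S) \<Longrightarrow> f (lin_comb m d k c \<phi>) = lin_comb m' d' k c (\<lambda>i. f (\<phi> i))"
    and inj: "\<And>A. A \<in> S \<Longrightarrow> f A = 0\<^sub>m m' d' \<Longrightarrow> A = 0\<^sub>m m d"
  shows "sdim m' d' (f ` S) = sdim m d S"
proof -
  obtain \<phi> where \<phi>: "is_basis m d S (sdim m d S) \<phi>"
    by (rule sdim_basis[OF S])
  then have \<phi>S: "\<And>i. i < sdim m d S \<Longrightarrow> \<phi> i \<in> S"
    by (simp add: is_basis_def)
  have "is_basis m' d' (f ` S) (sdim m d S) (\<lambda>i. f (\<phi> i))"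
    unfolding is_basis_def
  proof (intro conjI allI impI ballI)
    show "f (\<phi> i) \<in> f ` S" if "i < sdim m d S" for i
      using \<phi>S[OF that] by simp
    show "\<exists>c. A = lin_comb m' d' (sdim m d S) c (\<lambda>i. f (\<phi> i))" if "A \<in> f ` S" for A
    proof -
      from that obtain B where B: "B \<in> S" "A = f B"
        by auto
      then obtain c where "B = lin_comb m d (sdim m d S) c \<phi>"
        using \<phi> by (auto simp: is_basis_def)
      then show ?thesis
        using B lin[of "sdim m d S" \<phi> c, OF \<phi>S] by auto
    qed
    fix c i assume c: "lin_comb m' d' (sdim m d S) c (\<lambda>i. f (\<phi> i)) = 0\<^sub>m m' d'" and i: "i < sdim m d S"
    have "lin_comb m d (sdim m d S) c \<phi> = 0\<^sub>m m d"
      using lin[of "sdim m d S" \<phi> c, OF \<phi>S] c by (intro inj lin_comb_in_subspace[OF S] \<phi>S) auto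
    then show "c i = 0"
      using \<phi> i by (simp add: is_basis_def)
  qed
  then show ?thesis
    by (rule sdim_eq[OF T])
qed

section \<open>Block rows and additivity of the dimension\<close>

definition hcat :: "'k::zero mat \<Rightarrow> 'k mat \<Rightarrow> 'k mat" where
  "hcat A B = four_block_mat A B (0\<^sub>m 0 (dim_col A)) (0\<^sub>m 0 (dim_col B))"

lemma hcat_carrier [simp]:
  "A \<in> carrier_mat m d1 \<Longrightarrow> B \<in> carrier_mat m d2 \<Longrightarrow> hcat A B \<in> carrier_mat m (d1 + d2)"
  "dim_row (hcat A B) = dim_row A" "dim_col (hcat A B) = dim_col A + dim_col B"
  by (auto simp: hcat_def)

lemma index_hcat [simp]:
  "a < dim_row A \<Longrightarrow> b < dim_col A + dim_col B \<Longrightarrow>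
    hcat A B $$ (a, b) = (if b < dim_col A then A $$ (a, b) else B $$ (a, b - dim_col A))"
  by (simp add: hcat_def)

lemma hcat_inject:
  assumes "A \<in> carrier_mat m d1" "B \<in> carrier_mat m d2" "A' \<in> carrier_mat m d1" "B' \<in> carrier_mat m d2"
  shows "hcat A B = hcat A' B' \<longleftrightarrow> A = A' \<and> B = B'"
proof
  assume eq: "hcat A B = hcat A' B'"
  have "A $$ (a, b) = A' $$ (a, b)" if "a < m" "b < d1" for a b
    using arg_cong[OF eq, of "\<lambda>C. C $$ (a, b)"] that assms by simp
  moreover have "B $$ (a, b) = B' $$ (a, b)" if "a < m" "b < d2" for a b
    using arg_cong[OF eq, of "\<lambda>C. C $$ (a, d1 + b)"] that assms by simp
  ultimately show "A = A' \<and> B = B'"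
    using assms by (auto intro!: eq_matI)
qed simp

lemma hcat_split:
  assumes "C \<in> carrier_mat m (d1 + d2)"
  shows "\<exists>A\<in>carrier_mat m d1. \<exists>B\<in>carrier_mat m d2. C = hcat A B"
  using assms by (intro bexI[of _ "mat m d1 (\<lambda>(a, b). C $$ (a, b))"] bexI[of _ "mat m d2 (\<lambda>(a, b). C $$ (a, d1 + b))"] eq_matI) auto

lemma hcat_zero: "hcat (0\<^sub>m m d1) (0\<^sub>m m d2) = 0\<^sub>m m (d1 + d2)"
  by (rule eq_matI) auto

lemma mat_subspace_hcat:
  assumes S: "mat_subspace m d1 S" and T: "mat_subspace m d2 T"
  shows "mat_subspace m (d1 + d2) {hcat A B |A B. A \<in> S \<and> B \<in> T}"
  unfolding mat_subspace_def
proof (intro conjI ballI allI)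
  note S = mat_subspaceD[OF S] and T = mat_subspaceD[OF T]
  show "{hcat A B |A B. A \<in> S \<and> B \<in> T} \<subseteq> carrier_mat m (d1 + d2)"
    using S(1) T(1) by auto
  show "0\<^sub>m m (d1 + d2) \<in> {hcat A B |A B. A \<in> S \<and> B \<in> T}"
    using S(2) T(2) hcat_zero by (metis (mono_tags, lifting) mem_Collect_eq)
  fix C c assume "C \<in> {hcat A B |A B. A \<in> S \<and> B \<in> T}"
  then obtain A B where AB: "A \<in> S" "B \<in> T" "C = hcat A B"
    by auto
  have "c \<cdot>\<^sub>m C = hcat (c \<cdot>\<^sub>m A) (c \<cdot>\<^sub>m B)"
    using S(1)[OF AB(1)] T(1)[OF AB(2)] AB(3) by (intro eq_matI) auto
  then show "c \<cdot>\<^sub>m C \<in> {hcat A B |A B. A \<in> S \<and> B \<in> T}"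
    using S(4)[OF AB(1)] T(4)[OF AB(2)] by auto
  fix C' assume "C' \<in> {hcat A B |A B. A \<in> S \<and> B \<in> T}"
  then obtain A' B' where AB': "A' \<in> S" "B' \<in> T" "C' = hcat A' B'"
    by auto
  have "C + C' = hcat (A + A') (B + B')"
    using S(1)[OF AB(1)] T(1)[OF AB(2)] AB(3) S(1)[OF AB'(1)] T(1)[OF AB'(2)] AB'(3) by (intro eq_matI) auto
  then show "C + C' \<in> {hcat A B |A B. A \<in> S \<and> B \<in> T}"
    using S(3)[OF AB(1) AB'(1)] T(3)[OF AB(2) AB'(2)] by auto
qed

text \<open>\<open>hcat\<close> identifies the set with a direct sum of \<open>S\<close> and
  \<open>T\<close>, so the two bases, padded by zero blocks and placed one after the other, form a
  basis.\<close>

lemma sdim_hcat: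
  fixes S T :: "'k::field mat set"
  assumes S: "mat_subspace m d1 S" and T: "mat_subspace m d2 T"
  shows "sdim m (d1 + d2) {hcat A B |A B. A \<in> S \<and> B \<in> T} = sdim m d1 S + sdim m d2 T"
proof -
  let ?k = "sdim m d1 S" and ?l = "sdim m d2 T"
  obtain \<phi> where \<phi>: "is_basis m d1 S ?k \<phi>"
    by (rule sdim_basis[OF S])
  obtain \<psi> where \<psi>: "is_basis m d2 T ?l \<psi>"
    by (rule sdim_basis[OF T])
  have \<phi>S: "\<And>i. i < ?k \<Longrightarrow> \<phi> i \<in> S" and \<psi>T: "\<And>i. i < ?l \<Longrightarrow> \<psi> i \<in> T"
    using \<phi> \<psi> by (simp_all add: is_basis_def)
  note \<phi>c = mat_subspaceD(1)[OF S \<phi>S] and \<psi>c = mat_subspaceD(1)[OF T \<psi>T]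
  have dims: "\<And>i. i < ?k \<Longrightarrow> dim_row (\<phi> i) = m" "\<And>i. i < ?k \<Longrightarrow> dim_col (\<phi> i) = d1"
    "\<And>i. i < ?l \<Longrightarrow> dim_row (\<psi> i) = m" "\<And>i. i < ?l \<Longrightarrow> dim_col (\<psi> i) = d2"
    using \<phi>c \<psi>c by auto
  let ?\<chi> = "\<lambda>i. if i < ?k then hcat (\<phi> i) (0\<^sub>m m d2) else hcat (0\<^sub>m m d1) (\<psi> (i - ?k))"
  have split: "(\<Sum>i<k + l. g i) = (\<Sum>i<k. g i) + (\<Sum>i<l. g (k + i))" for g :: "nat \<Rightarrow> 'k" and k l
    by (induction l) (simp_all add: add.assoc)
  have lc: "lin_comb m (d1 + d2) (?k + ?l) c ?\<chi> = hcat (lin_comb m d1 ?k c \<phi>) (lin_comb m d2 ?l (\<lambda>i. c (?k + i)) \<psi>)" for c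
  proof (rule eq_matI, goal_cases)
    case (1 a b)
    then have ab: "a < m" "b < d1 + d2"
      by simp_all
    have "(\<Sum>i<?k. c i * ?\<chi> i $$ (a, b)) = (if b < d1 then \<Sum>i<?k. c i * \<phi> i $$ (a, b) else 0)"
      using ab dims by (auto intro!: sum.cong sum.neutral)
    moreover have "(\<Sum>i<?l. c (?k + i) * ?\<chi> (?k + i) $$ (a, b)) =
        (if b < d1 then 0 else \<Sum>i<?l. c (?k + i) * \<psi> i $$ (a, b - d1))"
      using ab dims by (auto intro!: sum.cong sum.neutral)
    ultimately show ?case
      using ab by (simp add: split)
  qed simp_all
  have "is_basis m (d1 + d2) {hcat A B |A B. A \<in> S \<and> B \<in> T} (?k + ?l) ?\<chi>"
    unfolding is_basis_def
  proof (intro conjI allI impI ballI)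
    show "?\<chi> i \<in> {hcat A B |A B. A \<in> S \<and> B \<in> T}" if "i < ?k + ?l" for i
    proof (cases "i < ?k")
      case True
      then show ?thesis
        using \<phi>S mat_subspaceD(2)[OF T] by auto
    next
      case False
      then have "\<psi> (i - ?k) \<in> T"
        using that by (intro \<psi>T) simp
      then show ?thesis
        using False mat_subspaceD(2)[OF S] by auto
    qed
    show "\<exists>c. C = lin_comb m (d1 + d2) (?k + ?l) c ?\<chi>" if "C \<in> {hcat A B |A B. A \<in> S \<and> B \<in> T}" for C
    proof -
      from that obtain A B where AB: "A \<in> S" "B \<in> T" "C = hcat A B"
        by auto
      obtain c where c: "A = lin_comb m d1 ?k c \<phi>"
        using \<phi> AB(1) by (auto simp: is_basis_def)
      obtain c' where c': "B = lin_comb m d2 ?l c' \<psi>"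
        using \<psi> AB(2) by (auto simp: is_basis_def)
      have "lin_comb m d1 ?k (\<lambda>i. if i < ?k then c i else c' (i - ?k)) \<phi> = lin_comb m d1 ?k c \<phi>"
        by (rule eq_matI) auto
      then have "C = lin_comb m (d1 + d2) (?k + ?l) (\<lambda>i. if i < ?k then c i else c' (i - ?k)) ?\<chi>"
        unfolding lc AB(3) c c' by simp
      then show ?thesis
        by (rule exI[of _ "\<lambda>i. if i < ?k then c i else c' (i - ?k)"])
    qed
    fix c i assume c: "lin_comb m (d1 + d2) (?k + ?l) c ?\<chi> = 0\<^sub>m m (d1 + d2)" and i: "i < ?k + ?l"
    from c have "hcat (lin_comb m d1 ?k c \<phi>) (lin_comb m d2 ?l (\<lambda>i. c (?k + i)) \<psi>) = hcat (0\<^sub>m m d1) (0\<^sub>m m d2)"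
      by (simp only: lc hcat_zero)
    then have "lin_comb m d1 ?k c \<phi> = 0\<^sub>m m d1" "lin_comb m d2 ?l (\<lambda>i. c (?k + i)) \<psi> = 0\<^sub>m m d2"
      using hcat_inject[of "lin_comb m d1 ?k c \<phi>" m d1 "lin_comb m d2 ?l (\<lambda>i. c (?k + i)) \<psi>" d2] by simp_all
    note zero = this
    have "\<forall>i<?k. c i = 0"
      using \<phi> zero(1) by (simp add: is_basis_def)
    have "\<forall>c. lin_comb m d2 ?l c \<psi> = 0\<^sub>m m d2 \<longrightarrow> (\<forall>i<?l. c i = 0)"
      using \<psi> by (simp add: is_basis_def)
    from mp[OF spec[OF this, of "\<lambda>i. c (?k + i)"] zero(2)] have "\<forall>i<?l. c (?k + i) = 0" .
    show "c i = 0"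
    proof (cases "i < ?k")
      case False
      then have "i - ?k < ?l"
        using i by simp
      from \<open>\<forall>i<?l. c (?k + i) = 0\<close>[rule_format, OF this] have "c (?k + (i - ?k)) = 0" .
      then show ?thesis
        using False by simp
    qed (use \<open>\<forall>i<?k. c i = 0\<close> in simp)
  qed
  then show ?thesis
    by (rule sdim_eq[OF mat_subspace_hcat[OF S T]])
qed

section \<open>Homomorphisms\<close>

lemma mat_tuples_nth: "\<rho> \<in> mat_tuples N d \<Longrightarrow> j < N \<Longrightarrow> \<rho> ! j \<in> carrier_mat d d"
  by (auto simp: mat_tuples_def)

lemma mat_tuples_length: "\<rho> \<in> mat_tuples N d \<Longrightarrow> length \<rho> = N"
  by (auto simp: mat_tuples_def)

lemma minus_mat_eq_0_iff:
  fixes A B :: "'k::field mat"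
  assumes "A \<in> carrier_mat m d" "B \<in> carrier_mat m d"
  shows "A - B = 0\<^sub>m m d \<longleftrightarrow> A = B"
  using assms by (auto simp: mat_eq_iff)

lemma hom_space_iff:
  assumes "\<rho> \<in> mat_tuples N d" "\<tau> \<in> mat_tuples N m"
  shows "\<phi> \<in> hom_space N d m \<rho> \<tau> \<longleftrightarrow> \<phi> \<in> carrier_mat m d \<and> (\<forall>j<N. \<phi> * \<rho> ! j = \<tau> ! j * \<phi>)"
proof -
  have "\<phi> * \<rho> ! j - \<tau> ! j * \<phi> = 0\<^sub>m m d \<longleftrightarrow> \<phi> * \<rho> ! j = \<tau> ! j * \<phi>" if "j < N" "\<phi> \<in> carrier_mat m d" for j
    using that minus_mat_eq_0_iff[OF mult_carrier_mat[OF that(2) mat_tuples_nth[OF assms(1)]]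
      mult_carrier_mat[OF mat_tuples_nth[OF assms(2)] that(2)]] by simp
  then show ?thesis
    unfolding hom_space_def by auto
qed

lemma hom_spaceD:
  assumes "\<phi> \<in> hom_space N d m \<rho> \<tau>" "\<rho> \<in> mat_tuples N d" "\<tau> \<in> mat_tuples N m"
  shows "\<phi> \<in> carrier_mat m d" "j < N \<Longrightarrow> \<phi> * \<rho> ! j = \<tau> ! j * \<phi>"
  using assms hom_space_iff[OF assms(2,3)] by auto

lemma hom_comp:
  assumes \<rho>: "\<rho> \<in> mat_tuples N d" and \<sigma>: "\<sigma> \<in> mat_tuples N e" and \<tau>: "\<tau> \<in> mat_tuples N m"
    and \<phi>: "\<phi> \<in> hom_space N d e \<rho> \<sigma>" and \<psi>: "\<psi> \<in> hom_space N e m \<sigma> \<tau>"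
  shows "\<psi> * \<phi> \<in> hom_space N d m \<rho> \<tau>"
  unfolding hom_space_iff[OF \<rho> \<tau>]
proof (intro conjI allI impI)
  note \<phi> = hom_spaceD[OF \<phi> \<rho> \<sigma>] and \<psi> = hom_spaceD[OF \<psi> \<sigma> \<tau>]
  show "\<psi> * \<phi> \<in> carrier_mat m d"
    using \<phi>(1) \<psi>(1) by simp
  fix j assume j: "j < N"
  note c = \<phi>(1) \<psi>(1) mat_tuples_nth[OF \<rho> j] mat_tuples_nth[OF \<sigma> j] mat_tuples_nth[OF \<tau> j]
  have "\<psi> * \<phi> * \<rho> ! j = \<psi> * (\<phi> * \<rho> ! j)"
    by (rule assoc_mult_mat[OF c(2,1,3)])
  also have "\<dots> = \<psi> * \<sigma> ! j * \<phi>"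
    unfolding \<phi>(2)[OF j] by (rule assoc_mult_mat[OF c(2,4,1), symmetric])
  also have "\<dots> = \<tau> ! j * (\<psi> * \<phi>)"
    unfolding \<psi>(2)[OF j] by (rule assoc_mult_mat[OF c(5,2,1)])
  finally show "\<psi> * \<phi> * \<rho> ! j = \<tau> ! j * (\<psi> * \<phi>)" .
qed

lemma mat_subspace_hom:
  assumes \<rho>: "\<rho> \<in> mat_tuples N d" and \<tau>: "\<tau> \<in> mat_tuples N m"
  shows "mat_subspace m d (hom_space N d m \<rho> \<tau>)"
  unfolding mat_subspace_def
proof (intro conjI ballI allI)
  note hs = hom_space_iff[OF \<rho> \<tau>] and \<rho> = mat_tuples_nth[OF \<rho>] and \<tau> = mat_tuples_nth[OF \<tau>]
  show "hom_space N d m \<rho> \<tau> \<subseteq> carrier_mat m d"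
    by (auto simp: hom_space_def)
  show "0\<^sub>m m d \<in> hom_space N d m \<rho> \<tau>"
    using left_mult_zero_mat[OF \<rho>] right_mult_zero_mat[OF \<tau>] by (simp add: hs)
  fix A c assume A: "A \<in> hom_space N d m \<rho> \<tau>"
  have "c \<cdot>\<^sub>m A * \<rho> ! j = \<tau> ! j * (c \<cdot>\<^sub>m A)" if j: "j < N" for j
    using A j mult_smult_assoc_mat[of A m d "\<rho> ! j" d c] mult_smult_distrib[of "\<tau> ! j" m m A d c] \<rho> \<tau>
    by (simp add: hs)
  then show "c \<cdot>\<^sub>m A \<in> hom_space N d m \<rho> \<tau>"
    using A by (simp add: hs)
  fix B assume B: "B \<in> hom_space N d m \<rho> \<tau>"
  have "(A + B) * \<rho> ! j = \<tau> ! j * (A + B)" if j: "j < N" for j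
    using A B j add_mult_distrib_mat[of A m d B "\<rho> ! j" d] mult_add_distrib_mat[of "\<tau> ! j" m m A d B] \<rho> \<tau>
    by (simp add: hs)
  then show "A + B \<in> hom_space N d m \<rho> \<tau>"
    using A B by (simp add: hs)
qed

lemmas hom_zero = mat_subspaceD(2)[OF mat_subspace_hom]
  and hom_add = mat_subspaceD(3)[OF mat_subspace_hom]
  and hom_smult = mat_subspaceD(4)[OF mat_subspace_hom]

lemma hom_one: "\<rho> \<in> mat_tuples N d \<Longrightarrow> 1\<^sub>m d \<in> hom_space N d d \<rho> \<rho>"
  by (auto simp: hom_space_iff left_mult_one_mat[OF mat_tuples_nth] right_mult_one_mat[OF mat_tuples_nth])

lemma hom_power:
  assumes "\<rho> \<in> mat_tuples N d" "a \<in> hom_space N d d \<rho> \<rho>"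
  shows "a ^\<^sub>m k \<in> hom_space N d d \<rho> \<rho>"
proof (induction k)
  case 0
  then show ?case
    using hom_one[OF assms(1)] hom_spaceD(1)[OF assms(2,1,1)] by simp
next
  case (Suc k)
  then show ?case
    using hom_comp[OF assms(1,1,1) assms(2)] by simp
qed

lemma hom_dim_eq_sdim: "hom_dim N d m \<rho> \<tau> = sdim m d (hom_space N d m \<rho> \<tau>)"
  by (simp add: hom_dim_def sdim_def)

section \<open>Conjugation by invertible matrices\<close>

definition inverse_pair :: "nat \<Rightarrow> 'k::field mat \<Rightarrow> 'k mat \<Rightarrow> bool" where
  "inverse_pair d g h \<longleftrightarrow> g \<in> carrier_mat d d \<and> h \<in> carrier_mat d d \<and> g * h = 1\<^sub>m d \<and> h * g = 1\<^sub>m d"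

lemma inverse_pair_sym: "inverse_pair d g h \<Longrightarrow> inverse_pair d h g"
  by (auto simp: inverse_pair_def)

lemma inverse_pair_one: "inverse_pair d (1\<^sub>m d) (1\<^sub>m d)"
  by (simp add: inverse_pair_def)

lemma cancel_left:
  assumes "inverse_pair d g h" "A \<in> carrier_mat d m"
  shows "g * (h * A) = A" "h * (g * A) = A"
  using assms assoc_mult_mat[of g d d h d A m] assoc_mult_mat[of h d d g d A m]
  by (simp_all add: inverse_pair_def)

lemma cancel_right:
  assumes "inverse_pair d g h" "A \<in> carrier_mat m d"
  shows "A * g * h = A" "A * h * g = A"
  using assms assoc_mult_mat[of A m d g d h d] assoc_mult_mat[of A m d h d g d]
  by (simp_all add: inverse_pair_def)

lemma inverse_pair_mult:
  assumes g: "inverse_pair d g h" and g': "inverse_pair d g' h'"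
  shows "inverse_pair d (g * g') (h' * h)"
proof -
  have c: "g \<in> carrier_mat d d" "h \<in> carrier_mat d d" "g' \<in> carrier_mat d d" "h' \<in> carrier_mat d d"
    using assms by (auto simp: inverse_pair_def)
  have "g * g' * (h' * h) = g * (g' * (h' * h))" "h' * h * (g * g') = h' * (h * (g * g'))"
    using c by (auto intro!: assoc_mult_mat)
  moreover have "g' * (h' * h) = h" "h * (g * g') = g'"
    using cancel_left[OF g' c(2)] cancel_left[OF g c(3)] by auto
  ultimately show ?thesis
    using assms c by (simp add: inverse_pair_def)
qed

lemma inverse_pair_exists:
  assumes g: "g \<in> carrier_mat d d" and det: "det g \<noteq> (0 :: 'k::field)"
  shows "\<exists>h. inverse_pair d g h"
proof -
  note adj = adj_mat[OF g]
  have "inverse_pair d g (inverse (det g) \<cdot>\<^sub>m adj_mat g)"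
    using adj g det mult_smult_distrib[OF g adj(1), of "inverse (det g)"] mult_smult_assoc_mat[OF adj(1) g, of "inverse (det g)"]
    by (auto simp: inverse_pair_def intro!: eq_matI)
  then show ?thesis ..
qed

lemma inverse_pair_det:
  assumes "inverse_pair d g h"
  shows "det g \<noteq> 0" "det h \<noteq> 0"
proof -
  have "det g * det h = 1"
    using assms det_mult[of g d h] by (simp add: inverse_pair_def)
  then show "det g \<noteq> 0" "det h \<noteq> 0"
    by auto
qed

lemma hom_inverse:
  assumes \<rho>: "\<rho> \<in> mat_tuples N d" and c: "c \<in> hom_space N d d \<rho> \<rho>" and inv: "inverse_pair d c c'"
  shows "c' \<in> hom_space N d d \<rho> \<rho>"
  unfolding hom_space_iff[OF \<rho> \<rho>]
proof (intro conjI allI impI)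
  show c': "c' \<in> carrier_mat d d"
    using inv by (simp add: inverse_pair_def)
  fix j assume j: "j < N"
  note \<rho>j = mat_tuples_nth[OF \<rho> j] and c = hom_spaceD[OF c \<rho> \<rho>]
  have "c' * \<rho> ! j = c' * (\<rho> ! j * c * c')"
    using cancel_right[OF inv \<rho>j] by simp
  also have "\<dots> = c' * (c * (\<rho> ! j * c'))"
    using c c' \<rho>j assoc_mult_mat[OF c(1) \<rho>j c'] by (simp flip: c(2)[OF j])
  also have "\<dots> = \<rho> ! j * c'"
    by (rule cancel_left(2)[OF inv mult_carrier_mat[OF \<rho>j c']])
  finally show "c' * \<rho> ! j = \<rho> ! j * c'" .
qed

definition conj_tuple :: "'k::field mat \<Rightarrow> 'k mat \<Rightarrow> 'k mat list \<Rightarrow> 'k mat list" where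
  "conj_tuple g h \<rho> = map (\<lambda>A. g * A * h) \<rho>"

lemma conj_tuple_mat_tuples:
  "inverse_pair d g h \<Longrightarrow> \<rho> \<in> mat_tuples N d \<Longrightarrow> conj_tuple g h \<rho> \<in> mat_tuples N d"
  by (auto simp: conj_tuple_def mat_tuples_def inverse_pair_def)

lemma conj_tuple_comp:
  assumes g: "inverse_pair d g h" and g': "inverse_pair d g' h'" and \<rho>: "\<rho> \<in> mat_tuples N d"
  shows "conj_tuple g h (conj_tuple g' h' \<rho>) = conj_tuple (g * g') (h' * h) \<rho>"
  unfolding conj_tuple_def map_map o_def
proof (rule map_cong[OF refl])
  fix A assume "A \<in> set \<rho>"
  then have A: "A \<in> carrier_mat d d"
    using \<rho> by (auto simp: mat_tuples_def)
  have c: "g \<in> carrier_mat d d" "h \<in> carrier_mat d d" "g' \<in> carrier_mat d d" "h' \<in> carrier_mat d d"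
    using assms by (auto simp: inverse_pair_def)
  have "g * (g' * A * h') * h = g * (g' * A) * h' * h"
    using c A assoc_mult_mat[of g d d "g' * A" d h' d] by simp
  also have "\<dots> = g * g' * A * (h' * h)"
    using c A assoc_mult_mat[of g d d g' d A d] assoc_mult_mat[of "g * g' * A" d d h' d h d] by simp
  finally show "g * (g' * A * h') * h = g * g' * A * (h' * h)" .
qed

lemma conj_tuple_one: "\<rho> \<in> mat_tuples N d \<Longrightarrow> conj_tuple (1\<^sub>m d) (1\<^sub>m d) \<rho> = \<rho>"
  unfolding conj_tuple_def by (rule map_idI) (auto simp: mat_tuples_def)

lemma conj_tuple_inverse:
  assumes "inverse_pair d g h" "\<rho> \<in> mat_tuples N d"
  shows "conj_tuple h g (conj_tuple g h \<rho>) = \<rho>"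
  using conj_tuple_comp[OF inverse_pair_sym[OF assms(1)] assms] conj_tuple_one[OF assms(2)] assms(1)
  by (simp add: inverse_pair_def)

text \<open>\<open>g\<close> and \<open>h\<close> are the mutually inverse isomorphisms between a
  module and its conjugate; the invariance of dimensions under conjugation is composition with
  them.\<close>

lemma hom_conj:
  assumes g: "inverse_pair d g h" and \<rho>: "\<rho> \<in> mat_tuples N d"
  shows "g \<in> hom_space N d d \<rho> (conj_tuple g h \<rho>)" "h \<in> hom_space N d d (conj_tuple g h \<rho>) \<rho>"
proof -
  have c: "g \<in> carrier_mat d d" "h \<in> carrier_mat d d"
    using g by (auto simp: inverse_pair_def)
  have nth: "conj_tuple g h \<rho> ! j = g * \<rho> ! j * h" if "j < N" for j
    using that mat_tuples_length[OF \<rho>] by (simp add: conj_tuple_def)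
  have "g * \<rho> ! j = g * \<rho> ! j * h * g" "h * (g * \<rho> ! j * h) = \<rho> ! j * h" if "j < N" for j
  proof -
    note \<rho>j = mat_tuples_nth[OF \<rho> that]
    show "g * \<rho> ! j = g * \<rho> ! j * h * g"
      using cancel_right(2)[OF g, of "g * \<rho> ! j" d] c \<rho>j by simp
    show "h * (g * \<rho> ! j * h) = \<rho> ! j * h"
      using cancel_left(2)[OF g, of "\<rho> ! j * h" d] c \<rho>j assoc_mult_mat[OF c(1) \<rho>j c(2)] by simp
  qed
  then show "g \<in> hom_space N d d \<rho> (conj_tuple g h \<rho>)" "h \<in> hom_space N d d (conj_tuple g h \<rho>) \<rho>"
    using c nth by (simp_all add: hom_space_iff \<rho> conj_tuple_mat_tuples[OF g \<rho>])
qed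

lemma lin_comb_mult_right:
  assumes h: "h \<in> carrier_mat d e" and \<phi>: "\<And>i. i < k \<Longrightarrow> \<phi> i \<in> carrier_mat m d"
  shows "lin_comb m d k c \<phi> * h = lin_comb m e k c (\<lambda>i. \<phi> i * h)"
proof (rule eq_matI)
  fix a b assume "a < dim_row (lin_comb m e k c (\<lambda>i. \<phi> i * h))" "b < dim_col (lin_comb m e k c (\<lambda>i. \<phi> i * h))"
  then have ab: "a < m" "b < e"
    by simp_all
  have "(lin_comb m d k c \<phi> * h) $$ (a, b) = (\<Sum>x\<in>{0..<d}. (\<Sum>i<k. c i * \<phi> i $$ (a, x)) * h $$ (x, b))"
    using ab h by (simp add: scalar_prod_def)
  also have "\<dots> = (\<Sum>i<k. \<Sum>x\<in>{0..<d}. c i * \<phi> i $$ (a, x) * h $$ (x, b))"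
    unfolding sum_distrib_right by (rule sum.swap)
  also have "\<dots> = (\<Sum>i<k. c i * (\<phi> i * h) $$ (a, b))"
  proof (rule sum.cong[OF refl])
    fix i assume "i \<in> {..<k}"
    then have "\<phi> i \<in> carrier_mat m d"
      using \<phi> by simp
    then show "(\<Sum>x\<in>{0..<d}. c i * \<phi> i $$ (a, x) * h $$ (x, b)) = c i * (\<phi> i * h) $$ (a, b)"
      using ab h by (simp add: scalar_prod_def sum_distrib_left mult.assoc)
  qed
  finally show "(lin_comb m d k c \<phi> * h) $$ (a, b) = lin_comb m e k c (\<lambda>i. \<phi> i * h) $$ (a, b)"
    using ab by simp
qed (use h in auto)

text \<open>Dimension formulas are needed both for \<open>Hom(-, M)\<close> and for its radical subfunctor; both
  transform under an isomorphism by right multiplication.\<close>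

lemma sdim_mult_right:
  assumes S: "mat_subspace m d S" and T: "mat_subspace m d T" and g: "inverse_pair d g h"
    and TS: "\<And>A. A \<in> S \<Longrightarrow> A * h \<in> T" and ST: "\<And>A. A \<in> T \<Longrightarrow> A * g \<in> S"
  shows "sdim m d T = sdim m d S"
proof -
  have img: "T = (\<lambda>A. A * h) ` S"
  proof
    show "T \<subseteq> (\<lambda>A. A * h) ` S"
    proof
      fix A assume "A \<in> T"
      then show "A \<in> (\<lambda>A. A * h) ` S"
        using ST cancel_right(1)[OF g mat_subspaceD(1)[OF T \<open>A \<in> T\<close>]] by (intro image_eqI[of _ _ "A * g"]) auto
    qed
  qed (use TS in auto)
  show ?thesis
    unfolding img
  proof (rule sdim_image[OF S])
    show "mat_subspace m d ((\<lambda>A. A * h) ` S)"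
      using T img by simp
    show "lin_comb m d k c \<phi> * h = lin_comb m d k c (\<lambda>i. \<phi> i * h)" if "\<And>i. i < k \<Longrightarrow> \<phi> i \<in> S" for k c \<phi>
      using g mat_subspaceD(1)[OF S that] by (intro lin_comb_mult_right) (auto simp: inverse_pair_def)
    show "A = 0\<^sub>m m d" if "A \<in> S" "A * h = 0\<^sub>m m d" for A
      using cancel_right(2)[OF g mat_subspaceD(1)[OF S that(1)]] that(2) g
        left_mult_zero_mat[of g d d m]
      by (simp add: inverse_pair_def)
  qed
qed

lemma hom_dim_conj:
  assumes g: "inverse_pair d g h" and \<rho>: "\<rho> \<in> mat_tuples N d" and \<tau>: "\<tau> \<in> mat_tuples N m"
  shows "hom_dim N d m (conj_tuple g h \<rho>) \<tau> = hom_dim N d m \<rho> \<tau>"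
proof -
  note \<rho>' = conj_tuple_mat_tuples[OF g \<rho>]
  show ?thesis
    unfolding hom_dim_eq_sdim
    by (rule sdim_mult_right[OF mat_subspace_hom[OF \<rho> \<tau>] mat_subspace_hom[OF \<rho>' \<tau>] g])
      (use hom_comp[OF \<rho>' \<rho> \<tau> hom_conj(2)[OF g \<rho>]] hom_comp[OF \<rho> \<rho>' \<tau> hom_conj(1)[OF g \<rho>]] in auto)
qed

section \<open>Direct sums of two representations\<close>

definition dsum :: "nat \<Rightarrow> nat \<Rightarrow> nat \<Rightarrow> 'k::field mat list \<Rightarrow> 'k mat list \<Rightarrow> 'k mat list" where
  "dsum N d e \<rho> \<sigma> = map (\<lambda>j. four_block_mat (\<rho> ! j) (0\<^sub>m d e) (0\<^sub>m e d) (\<sigma> ! j)) [0..<N]"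

lemma dsum_nth: "j < N \<Longrightarrow> dsum N d e \<rho> \<sigma> ! j = four_block_mat (\<rho> ! j) (0\<^sub>m d e) (0\<^sub>m e d) (\<sigma> ! j)"
  by (simp add: dsum_def)

lemma dsum_mat_tuples:
  "\<rho> \<in> mat_tuples N d \<Longrightarrow> \<sigma> \<in> mat_tuples N e \<Longrightarrow> dsum N d e \<rho> \<sigma> \<in> mat_tuples N (d + e)"
  by (auto simp: mat_tuples_def[of N "d + e"] dsum_def mat_tuples_nth)

definition vcat :: "'k::zero mat \<Rightarrow> 'k mat \<Rightarrow> 'k mat" where
  "vcat A B = four_block_mat A (0\<^sub>m (dim_row A) 0) B (0\<^sub>m (dim_row B) 0)"

lemma vcat_carrier [simp]:
  "A \<in> carrier_mat d m \<Longrightarrow> B \<in> carrier_mat e m \<Longrightarrow> vcat A B \<in> carrier_mat (d + e) m"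
  by (auto simp: vcat_def)

lemma hcat_mult_block:
  assumes "A \<in> carrier_mat m d" "B \<in> carrier_mat m e" "P \<in> carrier_mat d d" "Q \<in> carrier_mat e (e :: nat)"
  shows "hcat A B * four_block_mat P (0\<^sub>m d e) (0\<^sub>m e d) Q = hcat (A * P) (B * (Q :: 'k::field mat))"
proof -
  have "four_block_mat A B (0\<^sub>m 0 d) (0\<^sub>m 0 e) * four_block_mat P (0\<^sub>m d e) (0\<^sub>m e d) Q =
      four_block_mat (A * P + B * 0\<^sub>m e d) (A * 0\<^sub>m d e + B * Q)
        (0\<^sub>m 0 d * P + 0\<^sub>m 0 e * 0\<^sub>m e d) (0\<^sub>m 0 d * 0\<^sub>m d e + 0\<^sub>m 0 e * Q)"
    by (rule mult_four_block_mat[of _ m d _ e _ 0 _ _ d _ e]) (use assms in auto)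
  then show ?thesis
    using assms by (simp add: hcat_def)
qed

lemma mult_hcat:
  assumes "C \<in> carrier_mat l m" "A \<in> carrier_mat m d" "B \<in> carrier_mat m e"
  shows "C * hcat A B = hcat (C * A) (C * (B :: 'k::field mat))"
proof (rule eq_matI)
  fix a b assume ab: "a < dim_row (hcat (C * A) (C * B))" "b < dim_col (hcat (C * A) (C * B))"
  then have ab: "a < l" "b < d + e"
    using assms by auto
  have "col (hcat A B) b = (if b < d then col A b else col B (b - d))"
    using ab assms by (intro eq_vecI) auto
  then show "(C * hcat A B) $$ (a, b) = hcat (C * A) (C * B) $$ (a, b)"
    using ab assms by (auto simp: hcat_def)
qed (use assms in auto)

lemma block_mult_vcat:
  assumes "A \<in> carrier_mat d m" "B \<in> carrier_mat e m" "P \<in> carrier_mat d d" "Q \<in> carrier_mat e (e :: nat)"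
  shows "four_block_mat P (0\<^sub>m d e) (0\<^sub>m e d) Q * vcat A B = vcat (P * A) (Q * (B :: 'k::field mat))"
proof -
  have "four_block_mat P (0\<^sub>m d e) (0\<^sub>m e d) Q * four_block_mat A (0\<^sub>m d 0) B (0\<^sub>m e 0) =
      four_block_mat (P * A + 0\<^sub>m d e * B) (P * 0\<^sub>m d 0 + 0\<^sub>m d e * 0\<^sub>m e 0)
        (0\<^sub>m e d * A + Q * B) (0\<^sub>m e d * 0\<^sub>m d 0 + Q * 0\<^sub>m e 0)"
    by (rule mult_four_block_mat[of _ d d _ e _ e _ _ m _ 0]) (use assms in auto)
  then show ?thesis
    using assms by (simp add: vcat_def)
qed

lemma vcat_mult:
  assumes "C \<in> carrier_mat m l" "A \<in> carrier_mat d m" "B \<in> carrier_mat e m"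
  shows "vcat A B * C = vcat (A * C) (B * (C :: 'k::field mat))"
proof (rule eq_matI)
  fix a b assume ab: "a < dim_row (vcat (A * C) (B * C))" "b < dim_col (vcat (A * C) (B * C))"
  then have ab: "a < d + e" "b < l"
    using assms by (auto simp: vcat_def)
  have "row (vcat A B) a = (if a < d then row A a else row B (a - d))"
    using ab assms by (intro eq_vecI) (auto simp: vcat_def)
  then show "(vcat A B * C) $$ (a, b) = vcat (A * C) (B * C) $$ (a, b)"
    using ab assms by (auto simp: vcat_def)
qed (use assms in \<open>auto simp: vcat_def\<close>)

lemma hcat_mult_vcat:
  assumes "A \<in> carrier_mat m d" "B \<in> carrier_mat m e" "C \<in> carrier_mat d l" "D \<in> carrier_mat e l"
  shows "hcat A B * vcat C D = A * C + B * (D :: 'k::field mat)"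
proof -
  have "four_block_mat A B (0\<^sub>m 0 d) (0\<^sub>m 0 e) * four_block_mat C (0\<^sub>m d 0) D (0\<^sub>m e 0) =
      four_block_mat (A * C + B * D) (A * 0\<^sub>m d 0 + B * 0\<^sub>m e 0)
        (0\<^sub>m 0 d * C + 0\<^sub>m 0 e * D) (0\<^sub>m 0 d * 0\<^sub>m d 0 + 0\<^sub>m 0 e * 0\<^sub>m e 0)"
    by (rule mult_four_block_mat[of _ m d _ e _ 0 _ _ l _ 0]) (use assms in auto)
  also have "\<dots> = A * C + B * D"
    using assms by (intro eq_matI) auto
  finally show ?thesis
    using assms by (simp add: hcat_def vcat_def)
qed

lemma vcat_inject:
  assumes "A \<in> carrier_mat d m" "B \<in> carrier_mat e m" "A' \<in> carrier_mat d m" "B' \<in> carrier_mat e m"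
  shows "vcat A B = vcat A' B' \<longleftrightarrow> A = A' \<and> B = B'"
proof
  assume eq: "vcat A B = vcat A' B'"
  have "A $$ (a, b) = A' $$ (a, b)" if "a < d" "b < m" for a b
    using arg_cong[OF eq, of "\<lambda>C. C $$ (a, b)"] that assms by (simp add: vcat_def)
  moreover have "B $$ (a, b) = B' $$ (a, b)" if "a < e" "b < m" for a b
    using arg_cong[OF eq, of "\<lambda>C. C $$ (d + a, b)"] that assms by (simp add: vcat_def)
  ultimately show "A = A' \<and> B = B'"
    using assms by (auto intro!: eq_matI)
qed simp

lemma vcat_split:
  assumes "C \<in> carrier_mat (d + e) m"
  shows "\<exists>A\<in>carrier_mat d m. \<exists>B\<in>carrier_mat e m. C = vcat A B"
  using assms by (intro bexI[of _ "mat d m (\<lambda>(a, b). C $$ (a, b))"] bexI[of _ "mat e m (\<lambda>(a, b). C $$ (d + a, b))"] eq_matI)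
    (auto simp: vcat_def)

lemma hom_from_dsum:
  assumes \<rho>: "\<rho> \<in> mat_tuples N d" and \<sigma>: "\<sigma> \<in> mat_tuples N e" and \<tau>: "\<tau> \<in> mat_tuples N m"
    and A: "A \<in> carrier_mat m d" and B: "B \<in> carrier_mat m e"
  shows "hcat A B \<in> hom_space N (d + e) m (dsum N d e \<rho> \<sigma>) \<tau> \<longleftrightarrow>
    A \<in> hom_space N d m \<rho> \<tau> \<and> B \<in> hom_space N e m \<sigma> \<tau>"
proof -
  have "hcat A B * dsum N d e \<rho> \<sigma> ! j = \<tau> ! j * hcat A B \<longleftrightarrow>
      A * \<rho> ! j = \<tau> ! j * A \<and> B * \<sigma> ! j = \<tau> ! j * B" if j: "j < N" for j
  proof -
    note c = mat_tuples_nth[OF \<rho> j] mat_tuples_nth[OF \<sigma> j] mat_tuples_nth[OF \<tau> j]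
    show ?thesis
      unfolding dsum_nth[OF j] hcat_mult_block[OF A B c(1,2)] mult_hcat[OF c(3) A B]
      by (rule hcat_inject[of _ m d _ e]) (use A B c in auto)
  qed
  then show ?thesis
    using A B by (auto simp: hom_space_iff \<rho> \<sigma> \<tau> dsum_mat_tuples)
qed

lemma hom_to_dsum:
  assumes \<rho>: "\<rho> \<in> mat_tuples N d" and \<sigma>: "\<sigma> \<in> mat_tuples N e" and \<tau>: "\<tau> \<in> mat_tuples N m"
    and A: "A \<in> carrier_mat d m" and B: "B \<in> carrier_mat e m"
  shows "vcat A B \<in> hom_space N m (d + e) \<tau> (dsum N d e \<rho> \<sigma>) \<longleftrightarrow>
    A \<in> hom_space N m d \<tau> \<rho> \<and> B \<in> hom_space N m e \<tau> \<sigma>"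
proof -
  have "vcat A B * \<tau> ! j = dsum N d e \<rho> \<sigma> ! j * vcat A B \<longleftrightarrow>
      A * \<tau> ! j = \<rho> ! j * A \<and> B * \<tau> ! j = \<sigma> ! j * B" if j: "j < N" for j
  proof -
    note c = mat_tuples_nth[OF \<rho> j] mat_tuples_nth[OF \<sigma> j] mat_tuples_nth[OF \<tau> j]
    show ?thesis
      unfolding dsum_nth[OF j] block_mult_vcat[OF A B c(1,2)] vcat_mult[OF c(3) A B]
      by (rule vcat_inject[of _ d m _ e]) (use A B c in auto)
  qed
  then show ?thesis
    using A B by (auto simp: hom_space_iff \<rho> \<sigma> \<tau> dsum_mat_tuples)
qed

text \<open>With \<open>sdim_hcat\<close> this makes \<open>hom_dim\<close> additive, which is why
  the second index of the strata adds up under direct sums.\<close>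

lemma hom_space_dsum:
  assumes \<rho>: "\<rho> \<in> mat_tuples N d" and \<sigma>: "\<sigma> \<in> mat_tuples N e" and \<tau>: "\<tau> \<in> mat_tuples N m"
  shows "hom_space N (d + e) m (dsum N d e \<rho> \<sigma>) \<tau> =
    {hcat A B |A B. A \<in> hom_space N d m \<rho> \<tau> \<and> B \<in> hom_space N e m \<sigma> \<tau>}" (is "?L = ?R")
proof
  show "?L \<subseteq> ?R"
  proof
    fix C assume C: "C \<in> ?L"
    then have "C \<in> carrier_mat m (d + e)"
      by (simp add: hom_space_def)
    then obtain A B where "A \<in> carrier_mat m d" "B \<in> carrier_mat m e" "C = hcat A B"
      using hcat_split by blast
    then show "C \<in> ?R"
      using C hom_from_dsum[OF \<rho> \<sigma> \<tau>] by auto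
  qed
  show "?R \<subseteq> ?L"
    using hom_from_dsum[OF \<rho> \<sigma> \<tau>] hom_spaceD(1)[OF _ \<rho> \<tau>] hom_spaceD(1)[OF _ \<sigma> \<tau>] by auto
qed

lemma hom_dim_dsum:
  assumes \<rho>: "\<rho> \<in> mat_tuples N d" and \<sigma>: "\<sigma> \<in> mat_tuples N e" and \<tau>: "\<tau> \<in> mat_tuples N m"
  shows "hom_dim N (d + e) m (dsum N d e \<rho> \<sigma>) \<tau> = hom_dim N d m \<rho> \<tau> + hom_dim N e m \<sigma> \<tau>"
  unfolding hom_dim_eq_sdim hom_space_dsum[OF assms]
  by (rule sdim_hcat) (simp_all add: mat_subspace_hom assms)

section \<open>Evaluation of noncommutative polynomials and the defining relations\<close>

lemma eval_word_carrier:
  assumes \<rho>: "\<rho> \<in> mat_tuples N d" and "set (letters w) \<subseteq> {..<N}"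
  shows "eval_word d \<rho> w \<in> carrier_mat d d"
proof -
  have "foldr (\<lambda>j A. \<rho> ! j * A) l (1\<^sub>m d) \<in> carrier_mat d d" if "set l \<subseteq> {..<N}" for l
    using that by (induction l) (auto intro!: mult_carrier_mat[OF mat_tuples_nth[OF \<rho>]])
  then show ?thesis
    using assms(2) by (simp add: eval_word_def)
qed

lemma eval_nc_carrier [simp]: "eval_nc d \<rho> h \<in> carrier_mat d d"
  by (simp add: eval_nc_def)

lemma hom_eval_word:
  assumes \<rho>: "\<rho> \<in> mat_tuples N d" and \<tau>: "\<tau> \<in> mat_tuples N m" and \<phi>: "\<phi> \<in> hom_space N d m \<rho> \<tau>"
    and w: "set (letters w) \<subseteq> {..<N}"
  shows "\<phi> * eval_word d \<rho> w = eval_word m \<tau> w * \<phi>"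
proof -
  note \<phi> = hom_spaceD[OF \<phi> \<rho> \<tau>]
  have "\<phi> * foldr (\<lambda>j A. \<rho> ! j * A) l (1\<^sub>m d) = foldr (\<lambda>j A. \<tau> ! j * A) l (1\<^sub>m m) * \<phi>"
    if "set l \<subseteq> {..<N}" for l
    using that
  proof (induction l)
    case Nil
    then show ?case
      using \<phi>(1) by simp
  next
    case (Cons j l)
    let ?A = "foldr (\<lambda>j A. \<rho> ! j * A) l (1\<^sub>m d)" and ?B = "foldr (\<lambda>j A. \<tau> ! j * A) l (1\<^sub>m m)"
    have j: "j < N" and l: "set l \<subseteq> {..<N}"
      using Cons.prems by auto
    have c: "?A \<in> carrier_mat d d" "?B \<in> carrier_mat m m"
      using eval_word_carrier[OF \<rho>, of "Word l"] eval_word_carrier[OF \<tau>, of "Word l"] l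
      by (simp_all add: eval_word_def)
    note cj = mat_tuples_nth[OF \<rho> j] mat_tuples_nth[OF \<tau> j]
    have "\<phi> * (\<rho> ! j * ?A) = \<phi> * \<rho> ! j * ?A"
      by (rule assoc_mult_mat[OF \<phi>(1) cj(1) c(1), symmetric])
    also have "\<dots> = \<tau> ! j * (\<phi> * ?A)"
      unfolding \<phi>(2)[OF j] by (rule assoc_mult_mat[OF cj(2) \<phi>(1) c(1)])
    also have "\<dots> = \<tau> ! j * ?B * \<phi>"
      unfolding Cons.IH[OF l] by (rule assoc_mult_mat[OF cj(2) c(2) \<phi>(1), symmetric])
    finally show ?case
      by simp
  qed
  then show ?thesis
    using w by (simp add: eval_word_def)
qed

lemma hom_eval_nc:
  assumes \<rho>: "\<rho> \<in> mat_tuples N d" and \<tau>: "\<tau> \<in> mat_tuples N m" and \<phi>: "\<phi> \<in> hom_space N d m \<rho> \<tau>"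
    and h: "h \<in> free_alg N"
  shows "\<phi> * eval_nc d \<rho> h = eval_nc m \<tau> h * \<phi>"
proof (rule eq_matI)
  note \<phi>c = hom_spaceD(1)[OF \<phi> \<rho> \<tau>]
  let ?K = "Poly_Mapping.keys h" and ?c = "Poly_Mapping.lookup h"
  have w: "set (letters w) \<subseteq> {..<N}" if "w \<in> ?K" for w
    using h that by (auto simp: free_alg_def)
  fix a b assume "a < dim_row (eval_nc m \<tau> h * \<phi>)" "b < dim_col (eval_nc m \<tau> h * \<phi>)"
  then have ab: "a < m" "b < d"
    using \<phi>c by (auto simp: eval_nc_def)
  have "(\<phi> * eval_nc d \<rho> h) $$ (a, b) = (\<Sum>x\<in>{0..<d}. \<Sum>w\<in>?K. \<phi> $$ (a, x) * (?c w * eval_word d \<rho> w $$ (x, b)))"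
    using ab \<phi>c by (simp add: scalar_prod_def eval_nc_def sum_distrib_left)
  also have "\<dots> = (\<Sum>w\<in>?K. \<Sum>x\<in>{0..<d}. \<phi> $$ (a, x) * (?c w * eval_word d \<rho> w $$ (x, b)))"
    by (rule sum.swap)
  also have "\<dots> = (\<Sum>w\<in>?K. ?c w * (\<phi> * eval_word d \<rho> w) $$ (a, b))"
  proof (rule sum.cong[OF refl])
    fix x assume "x \<in> ?K"
    from eval_word_carrier[OF \<rho> w[OF this]]
    show "(\<Sum>xa = 0..<d. \<phi> $$ (a, xa) * (?c x * eval_word d \<rho> x $$ (xa, b))) = ?c x * (\<phi> * eval_word d \<rho> x) $$ (a, b)"
      using ab \<phi>c by (simp add: scalar_prod_def sum_distrib_left mult_ac)
  qed
  also have "\<dots> = (\<Sum>w\<in>?K. ?c w * (eval_word m \<tau> w * \<phi>) $$ (a, b))"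
    using hom_eval_word[OF \<rho> \<tau> \<phi> w] by simp
  also have "\<dots> = (\<Sum>w\<in>?K. \<Sum>x\<in>{0..<m}. ?c w * eval_word m \<tau> w $$ (a, x) * \<phi> $$ (x, b))"
  proof (rule sum.cong[OF refl])
    fix x assume "x \<in> ?K"
    from eval_word_carrier[OF \<tau> w[OF this]]
    show "?c x * (eval_word m \<tau> x * \<phi>) $$ (a, b) = (\<Sum>xa = 0..<m. ?c x * eval_word m \<tau> x $$ (a, xa) * \<phi> $$ (xa, b))"
      using ab \<phi>c by (simp add: scalar_prod_def sum_distrib_left mult_ac)
  qed
  also have "\<dots> = (\<Sum>x\<in>{0..<m}. \<Sum>w\<in>?K. ?c w * eval_word m \<tau> w $$ (a, x) * \<phi> $$ (x, b))"
    by (rule sum.swap)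
  also have "\<dots> = (eval_nc m \<tau> h * \<phi>) $$ (a, b)"
    using ab \<phi>c by (simp add: scalar_prod_def eval_nc_def sum_distrib_right)
  finally show "(\<phi> * eval_nc d \<rho> h) $$ (a, b) = (eval_nc m \<tau> h * \<phi>) $$ (a, b)" .
qed (use hom_spaceD(1)[OF \<phi> \<rho> \<tau>] in \<open>auto simp: eval_nc_def\<close>)

text \<open>If \<open>\<rho>\<close> is a retract of \<open>\<sigma>\<close>, then h(\<rho>) =
  \<psi> h(\<sigma>) \<phi>, so relations of \<open>\<sigma>\<close> hold for \<open>\<rho>\<close>.
  Conjugates and direct summands are both instances.\<close>

lemma rep_retract:
  assumes I: "two_sided_ideal N I" and \<rho>: "\<rho> \<in> mat_tuples N d" and \<sigma>: "\<sigma> \<in> rep N I e"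
    and \<phi>: "\<phi> \<in> hom_space N d e \<rho> \<sigma>" and \<psi>: "\<psi> \<in> hom_space N e d \<sigma> \<rho>" and one: "\<psi> * \<phi> = 1\<^sub>m d"
  shows "\<rho> \<in> rep N I d"
proof -
  have \<sigma>t: "\<sigma> \<in> mat_tuples N e" and \<sigma>0: "\<And>h. h \<in> I \<Longrightarrow> eval_nc e \<sigma> h = 0\<^sub>m e e"
    using \<sigma> by (auto simp: rep_def)
  note c = hom_spaceD(1)[OF \<phi> \<rho> \<sigma>t] hom_spaceD(1)[OF \<psi> \<sigma>t \<rho>]
  have "eval_nc d \<rho> h = 0\<^sub>m d d" if "h \<in> I" for h
  proof -
    have h: "h \<in> free_alg N"
      using that I by (auto simp: two_sided_ideal_def)
    have "eval_nc d \<rho> h = \<psi> * \<phi> * eval_nc d \<rho> h"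
      unfolding one by (simp add: left_mult_one_mat[OF eval_nc_carrier])
    also have "\<dots> = \<psi> * (eval_nc e \<sigma> h * \<phi>)"
      unfolding hom_eval_nc[OF \<rho> \<sigma>t \<phi> h, symmetric] by (rule assoc_mult_mat[OF c(2,1) eval_nc_carrier])
    also have "\<dots> = 0\<^sub>m d d"
      using c by (simp add: \<sigma>0[OF that])
    finally show ?thesis .
  qed
  then show ?thesis
    using \<rho> by (simp add: rep_def)
qed

lemma rep_conj:
  assumes I: "two_sided_ideal N I" and g: "inverse_pair d g h" and \<rho>: "\<rho> \<in> rep N I d"
  shows "conj_tuple g h \<rho> \<in> rep N I d"
proof -
  have \<rho>t: "\<rho> \<in> mat_tuples N d"
    using \<rho> by (simp add: rep_def)
  show ?thesis
    by (rule rep_retract[OF I conj_tuple_mat_tuples[OF g \<rho>t] \<rho> hom_conj(2)[OF g \<rho>t] hom_conj(1)[OF g \<rho>t]])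
      (use g in \<open>simp add: inverse_pair_def\<close>)
qed

lemma hom_dsum_inj_proj:
  assumes \<rho>: "\<rho> \<in> mat_tuples N d" and \<sigma>: "\<sigma> \<in> mat_tuples N e"
  shows "vcat (1\<^sub>m d) (0\<^sub>m e d) \<in> hom_space N d (d + e) \<rho> (dsum N d e \<rho> \<sigma>)"
    "vcat (0\<^sub>m d e) (1\<^sub>m e) \<in> hom_space N e (d + e) \<sigma> (dsum N d e \<rho> \<sigma>)"
    "hcat (1\<^sub>m d) (0\<^sub>m d e) \<in> hom_space N (d + e) d (dsum N d e \<rho> \<sigma>) \<rho>"
    "hcat (0\<^sub>m e d) (1\<^sub>m e) \<in> hom_space N (d + e) e (dsum N d e \<rho> \<sigma>) \<sigma>"
  using assms by (simp_all add: hom_to_dsum hom_from_dsum hom_one hom_zero)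

lemma rep_dsum_iff:
  assumes I: "two_sided_ideal N I" and \<rho>: "\<rho> \<in> mat_tuples N d" and \<sigma>: "\<sigma> \<in> mat_tuples N e"
  shows "dsum N d e \<rho> \<sigma> \<in> rep N I (d + e) \<longleftrightarrow> \<rho> \<in> rep N I d \<and> \<sigma> \<in> rep N I e"
proof
  note ip = hom_dsum_inj_proj[OF \<rho> \<sigma>]
  assume "dsum N d e \<rho> \<sigma> \<in> rep N I (d + e)"
  then show "\<rho> \<in> rep N I d \<and> \<sigma> \<in> rep N I e"
    using rep_retract[OF I \<rho> _ ip(1,3)] rep_retract[OF I \<sigma> _ ip(2,4)]
    by (simp add: hcat_mult_vcat[of _ d d _ e _ d] hcat_mult_vcat[of _ e d _ e _ e])
next
  note ip = hom_dsum_inj_proj[OF \<rho> \<sigma>]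
  note \<mu> = dsum_mat_tuples[OF \<rho> \<sigma>]
  assume rep: "\<rho> \<in> rep N I d \<and> \<sigma> \<in> rep N I e"
  have "eval_nc (d + e) (dsum N d e \<rho> \<sigma>) h = 0\<^sub>m (d + e) (d + e)" if "h \<in> I" for h
  proof -
    have h: "h \<in> free_alg N"
      using that I by (auto simp: two_sided_ideal_def)
    \<comment> \<open>The value of \<open>h\<close> is determined by its two block rows; the
      projections commute with evaluation, so both rows factor through values at the
      summands.\<close>
    let ?E = "eval_nc (d + e) (dsum N d e \<rho> \<sigma>) h"
    obtain E1 E2 where E: "E1 \<in> carrier_mat d (d + e)" "E2 \<in> carrier_mat e (d + e)" "?E = vcat E1 E2"
      using vcat_split[of ?E d e "d + e"] by auto
    have "hcat (1\<^sub>m d) (0\<^sub>m d e) * ?E = eval_nc d \<rho> h * hcat (1\<^sub>m d) (0\<^sub>m d e)"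
      by (rule hom_eval_nc[OF \<mu> \<rho> ip(3) h])
    also have "\<dots> = 0\<^sub>m d (d + e)"
      using rep that by (simp add: rep_def)
    finally have "E1 = 0\<^sub>m d (d + e)"
      using E by (simp add: hcat_mult_vcat[of _ d d _ e _ "d + e"])
    have "hcat (0\<^sub>m e d) (1\<^sub>m e) * ?E = eval_nc e \<sigma> h * hcat (0\<^sub>m e d) (1\<^sub>m e)"
      by (rule hom_eval_nc[OF \<mu> \<sigma> ip(4) h])
    also have "\<dots> = 0\<^sub>m e (d + e)"
      using rep that by (simp add: rep_def)
    finally have "E2 = 0\<^sub>m e (d + e)"
      using E by (simp add: hcat_mult_vcat[of _ e d _ e _ "d + e"])
    then show ?thesis
      unfolding E(3) \<open>E1 = _\<close> by (auto simp: vcat_def)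
  qed
  then show "dsum N d e \<rho> \<sigma> \<in> rep N I (d + e)"
    using \<mu> by (simp add: rep_def)
qed

section \<open>The Krull-Schmidt theorem\<close>

lemma pow_mat_comm:
  assumes s: "s \<in> carrier_mat d d" and a: "a \<in> carrier_mat d (d :: nat)" and comm: "s * a = a * (s :: 'k::field mat)"
  shows "s * a ^\<^sub>m k = a ^\<^sub>m k * s"
proof (induction k)
  case (Suc k)
  note c = pow_carrier_mat[OF a, of k]
  have "s * (a ^\<^sub>m k * a) = a ^\<^sub>m k * s * a"
    unfolding Suc.IH[symmetric] by (rule assoc_mult_mat[OF s c a, symmetric])
  also have "\<dots> = a ^\<^sub>m k * (a * s)"
    unfolding comm[symmetric] by (rule assoc_mult_mat[OF c s a])
  also have "\<dots> = a ^\<^sub>m k * a * s"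
    by (rule assoc_mult_mat[OF c a s, symmetric])
  finally show ?case
    by simp
qed (use s a in auto)

lemma pow_mat_mult:
  assumes s: "s \<in> carrier_mat d d" and a: "a \<in> carrier_mat d (d :: nat)" and comm: "s * a = a * (s :: 'k::field mat)"
  shows "(s * a) ^\<^sub>m k = s ^\<^sub>m k * a ^\<^sub>m k"
proof (induction k)
  case (Suc k)
  note ca = pow_carrier_mat[OF a, of k] and cs = pow_carrier_mat[OF s, of k]
  have "s ^\<^sub>m k * a ^\<^sub>m k * (s * a) = s ^\<^sub>m k * (a ^\<^sub>m k * s * a)"
    using assoc_mult_mat[OF cs ca mult_carrier_mat[OF s a]] assoc_mult_mat[OF ca s a] by simp
  also have "\<dots> = s ^\<^sub>m k * (s * (a ^\<^sub>m k * a))"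
    unfolding pow_mat_comm[OF s a comm, symmetric] using assoc_mult_mat[OF s ca a] by simp
  also have "\<dots> = s ^\<^sub>m k * s * (a ^\<^sub>m k * a)"
    by (rule assoc_mult_mat[OF cs s mult_carrier_mat[OF ca a], symmetric])
  finally show ?case
    using Suc.IH by simp
qed (use s a in auto)

lemma lin_comb_powers_Suc:
  fixes a :: "'k::field mat"
  assumes a: "a \<in> carrier_mat d d"
  shows "lin_comb d d (Suc k) c (\<lambda>i. a ^\<^sub>m i) =
    c 0 \<cdot>\<^sub>m 1\<^sub>m d + lin_comb d d k (\<lambda>i. c (Suc i)) (\<lambda>i. a ^\<^sub>m i) * a"
proof -
  have "lin_comb d d k (\<lambda>i. c (Suc i)) (\<lambda>i. a ^\<^sub>m i) * a = lin_comb d d k (\<lambda>i. c (Suc i)) (\<lambda>i. a ^\<^sub>m i * a)"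
    by (rule lin_comb_mult_right[OF a]) (use a in simp)
  then show ?thesis
    using a by (intro eq_matI) (simp_all add: sum.lessThan_Suc_shift del: sum.lessThan_Suc)
qed

text \<open>A polynomial in \<open>a\<close> with a nonzero coefficient: the lowest such term is
  split off, leaving a nonzero constant \<open>e\<close> plus a multiple of
  \<open>a\<close>.\<close>

lemma lin_comb_powers_factor:
  fixes a :: "'k::field mat"
  assumes a: "a \<in> carrier_mat d d" and "\<exists>i<k. c i \<noteq> 0"
  shows "\<exists>j e n c'. e \<noteq> 0 \<and> lin_comb d d k c (\<lambda>i. a ^\<^sub>m i) =
    (e \<cdot>\<^sub>m 1\<^sub>m d + lin_comb d d n c' (\<lambda>i. a ^\<^sub>m i) * a) * a ^\<^sub>m j"
  using assms(2)
proof (induction k arbitrary: c)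
  case (Suc k)
  let ?L = "\<lambda>k c. lin_comb d d k c (\<lambda>i. a ^\<^sub>m i)"
  show ?case
  proof (cases "c 0 = 0")
    case False
    have "?L (Suc k) c = (c 0 \<cdot>\<^sub>m 1\<^sub>m d + ?L k (\<lambda>i. c (Suc i)) * a) * a ^\<^sub>m 0"
      unfolding lin_comb_powers_Suc[OF a] using a by (simp add: right_mult_one_mat[of _ d d])
    then show ?thesis
      using False by (intro exI[of _ 0] exI[of _ "c 0"] exI[of _ k] exI[of _ "\<lambda>i. c (Suc i)"]) simp
  next
    case True
    then have "\<exists>i<k. c (Suc i) \<noteq> 0"
      using Suc.prems by (metis less_Suc_eq_0_disj)
    from Suc.IH[of "\<lambda>i. c (Suc i)", OF this] obtain j e n c'
      where IH: "e \<noteq> 0 \<and> ?L k (\<lambda>i. c (Suc i)) = (e \<cdot>\<^sub>m 1\<^sub>m d + ?L n c' * a) * a ^\<^sub>m j"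
      by (elim exE)
    have "?L (Suc k) c = ?L k (\<lambda>i. c (Suc i)) * a"
      unfolding lin_comb_powers_Suc[OF a] using True a by (intro eq_matI) auto
    also have "\<dots> = (e \<cdot>\<^sub>m 1\<^sub>m d + ?L n c' * a) * (a ^\<^sub>m j * a)"
      unfolding conjunct2[OF IH]
      by (rule assoc_mult_mat[OF _ pow_carrier_mat[OF a] a, of _ d]) (use a in auto)
    finally show ?thesis
      using IH by (intro exI[of _ "Suc j"] exI[of _ e] exI[of _ n] exI[of _ c']) simp
  qed
qed simp

text \<open>The d * d + 1 powers of \<open>a\<close> up to exponent d * d are dependent. Writing the
  relation as (e + q(a) a) a^j = 0 with e nonzero suggests \<open>s\<close> = - q(a) / e. Being a
  polynomial in \<open>a\<close>, it lies in every endomorphism ring that contains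
  \<open>a\<close>.\<close>

lemma power_absorb:
  fixes a :: "'k::field mat"
  assumes a: "a \<in> carrier_mat d d"
  shows "\<exists>j s. s \<in> carrier_mat d d \<and> a ^\<^sub>m j = s * a * a ^\<^sub>m j \<and> s * a = a * s \<and>
    (\<forall>N \<rho>. \<rho> \<in> mat_tuples N d \<longrightarrow> a \<in> hom_space N d d \<rho> \<rho> \<longrightarrow> s \<in> hom_space N d d \<rho> \<rho>)"
proof -
  let ?L = "\<lambda>k c. lin_comb d d k c (\<lambda>i. a ^\<^sub>m i)"
  obtain c where c: "?L (Suc (d * d)) c = 0\<^sub>m d d \<and> (\<exists>i<Suc (d * d). c i \<noteq> 0)"
    using lin_comb_dependent[of d d "Suc (d * d)" "\<lambda>i. a ^\<^sub>m i"] by auto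
  from lin_comb_powers_factor[OF a conjunct2[OF c]] obtain j e n c'
    where e: "e \<noteq> 0 \<and> ?L (Suc (d * d)) c = (e \<cdot>\<^sub>m 1\<^sub>m d + ?L n c' * a) * a ^\<^sub>m j"
    by (elim exE)
  define s where "s = (- inverse e) \<cdot>\<^sub>m ?L n c'"
  have s: "s \<in> carrier_mat d d"
    by (simp add: s_def)
  have hom: "s \<in> hom_space N d d \<rho> \<rho>" if "\<rho> \<in> mat_tuples N d" "a \<in> hom_space N d d \<rho> \<rho>" for N \<rho>
    unfolding s_def using that
    by (intro hom_smult[OF that(1,1)] lin_comb_in_subspace[OF mat_subspace_hom[OF that(1,1)]] hom_power)
  \<comment> \<open>\<open>a\<close> is an endomorphism of the one-generator representation given by
    \<open>a\<close> itself; there, being an endomorphism means commuting with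
    \<open>a\<close>.\<close>
  have "[a] \<in> mat_tuples 1 d"
    using a by (simp add: mat_tuples_def)
  moreover from this have "a \<in> hom_space 1 d d [a] [a]"
    using a by (simp add: hom_space_iff)
  ultimately have "s * [a] ! 0 = [a] ! 0 * s"
    using hom_spaceD(2)[OF hom, of "[a]" 1 0] by simp
  then have comm: "s * a = a * s"
    by simp
  note p = pow_carrier_mat[OF a, of j]
  have "0\<^sub>m d d = e \<cdot>\<^sub>m a ^\<^sub>m j + ?L n c' * a * a ^\<^sub>m j"
  proof -
    have "0\<^sub>m d d = (e \<cdot>\<^sub>m 1\<^sub>m d + ?L n c' * a) * a ^\<^sub>m j"
      using c e by simp
    also have "\<dots> = e \<cdot>\<^sub>m 1\<^sub>m d * a ^\<^sub>m j + ?L n c' * a * a ^\<^sub>m j"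
      by (rule add_mult_distrib_mat[of _ d d]) (use a p in auto)
    also have "e \<cdot>\<^sub>m 1\<^sub>m d * a ^\<^sub>m j = e \<cdot>\<^sub>m a ^\<^sub>m j"
      using mult_smult_assoc_mat[OF one_carrier_mat p, of e] left_mult_one_mat[OF p] by simp
    finally show ?thesis .
  qed
  note zero = this
  have eq: "e * (a ^\<^sub>m j) $$ (x, y) + (?L n c' * a * a ^\<^sub>m j) $$ (x, y) = 0" if "x < d" "y < d" for x y
  proof -
    have "(e \<cdot>\<^sub>m a ^\<^sub>m j + ?L n c' * a * a ^\<^sub>m j) $$ (x, y) = 0"
      using that by (simp flip: zero)
    moreover have "(e \<cdot>\<^sub>m a ^\<^sub>m j + ?L n c' * a * a ^\<^sub>m j) $$ (x, y) =
        (e \<cdot>\<^sub>m a ^\<^sub>m j) $$ (x, y) + (?L n c' * a * a ^\<^sub>m j) $$ (x, y)"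
      by (rule index_add_mat(1)) (use that a p in simp_all)
    moreover have "(e \<cdot>\<^sub>m a ^\<^sub>m j) $$ (x, y) = e * (a ^\<^sub>m j) $$ (x, y)"
      by (rule index_smult_mat(1)) (use that a p in simp_all)
    ultimately show ?thesis
      by simp
  qed
  have "s * a * a ^\<^sub>m j = (- inverse e) \<cdot>\<^sub>m (?L n c' * a * a ^\<^sub>m j)"
    unfolding s_def using mult_smult_assoc_mat[OF lin_comb_carrier(1) a]
      mult_smult_assoc_mat[OF mult_carrier_mat[OF lin_comb_carrier(1) a] p] by simp
  also have "\<dots> = a ^\<^sub>m j"
  proof (rule eq_matI)
    fix x y assume "x < dim_row (a ^\<^sub>m j)" "y < dim_col (a ^\<^sub>m j)"
    then have xy: "x < d" "y < d"
      using p by auto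
    have "(?L n c' * a * a ^\<^sub>m j) $$ (x, y) = - e * (a ^\<^sub>m j) $$ (x, y)"
      using eq[OF xy] by (simp add: add_eq_0_iff)
    then show "((- inverse e) \<cdot>\<^sub>m (?L n c' * a * a ^\<^sub>m j)) $$ (x, y) = (a ^\<^sub>m j) $$ (x, y)"
      using xy p a e by simp
  qed (use a p in auto)
  finally show ?thesis
    using s comm hom by (intro exI[of _ j] exI[of _ s]) simp
qed

text \<open>Fitting's lemma; the idempotent projects onto the image of a high power of \<open>a\<close>.\<close>

lemma fitting_idempotent:
  fixes a :: "'k::field mat"
  assumes \<rho>: "\<rho> \<in> mat_tuples N d" and a: "a \<in> hom_space N d d \<rho> \<rho>"
  shows "\<exists>e. e \<in> hom_space N d d \<rho> \<rho> \<and> e * e = e \<and> (e = 1\<^sub>m d \<longrightarrow> det a \<noteq> 0) \<and>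
    (e = 0\<^sub>m d d \<longrightarrow> (\<exists>k. a ^\<^sub>m k = 0\<^sub>m d d))"
proof -
  note ac = hom_spaceD(1)[OF a \<rho> \<rho>]
  from power_absorb[OF ac] obtain j s where "s \<in> carrier_mat d d \<and> a ^\<^sub>m j = s * a * a ^\<^sub>m j \<and> s * a = a * s \<and>
    (\<forall>N \<rho>. \<rho> \<in> mat_tuples N d \<longrightarrow> a \<in> hom_space N d d \<rho> \<rho> \<longrightarrow> s \<in> hom_space N d d \<rho> \<rho>)"
    by (elim exE)
  then have s: "s \<in> carrier_mat d d" and absorb: "a ^\<^sub>m j = s * a * a ^\<^sub>m j" and comm: "s * a = a * s"
    and sh: "s \<in> hom_space N d d \<rho> \<rho>"
    using \<rho> a by auto
  define t where "t = s * a"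
  have t: "t \<in> carrier_mat d d" "t \<in> hom_space N d d \<rho> \<rho>"
    using s ac hom_comp[OF \<rho> \<rho> \<rho> a sh] by (simp_all add: t_def)
  note p = pow_carrier_mat[OF ac, of j] pow_carrier_mat[OF s, of j] pow_carrier_mat[OF t(1), of j]
  have abs: "t ^\<^sub>m k * a ^\<^sub>m j = a ^\<^sub>m j" for k
  proof (induction k)
    case (Suc k)
    have "t ^\<^sub>m k * t * a ^\<^sub>m j = t ^\<^sub>m k * (t * a ^\<^sub>m j)"
      by (rule assoc_mult_mat[OF pow_carrier_mat[OF t(1)] t(1) p(1)])
    then show ?case
      using Suc.IH absorb by (simp add: t_def)
  qed (use t left_mult_one_mat[OF p(1)] in simp)
  \<comment> \<open>\<open>t\<close> acts as the identity on the image of a^j, and t^j = s^j a^j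
    with commuting factors, so t^j is idempotent.\<close>
  define e where "e = t ^\<^sub>m j"
  have st: "s * t = t * s"
    using assoc_mult_mat[OF s ac s] by (simp add: t_def comm)
  have e: "e = s ^\<^sub>m j * a ^\<^sub>m j"
    unfolding e_def t_def by (rule pow_mat_mult[OF s ac comm])
  have "t ^\<^sub>m j * s = s * t ^\<^sub>m j"
    by (rule pow_mat_comm[OF s t(1) st, symmetric])
  from pow_mat_comm[OF p(3) s this] have "t ^\<^sub>m j * s ^\<^sub>m j = s ^\<^sub>m j * t ^\<^sub>m j" .
  note ts = this
  have "e * e = t ^\<^sub>m j * e"
    by (simp only: e_def)
  also have "\<dots> = t ^\<^sub>m j * (s ^\<^sub>m j * a ^\<^sub>m j)"
    by (simp only: e)
  also have "\<dots> = s ^\<^sub>m j * t ^\<^sub>m j * a ^\<^sub>m j"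
    by (simp only: assoc_mult_mat[OF p(3,2,1), symmetric] ts)
  also have "\<dots> = e"
    by (simp only: assoc_mult_mat[OF p(2,3,1)] abs e)
  finally have "e * e = e" .
  moreover have "det a \<noteq> 0" if "e = 1\<^sub>m d"
  proof -
    have "\<exists>x\<in>carrier_mat d d. x * a = 1\<^sub>m d"
    \<comment> \<open>For j = 0 the absorption relation itself reads 1 = s a; otherwise the product
      t^j = 1 ends in the factor \<open>a\<close>.\<close>
    proof (cases j)
      case 0
      then have "s * a = 1\<^sub>m d"
        using absorb ac s by (simp add: right_mult_one_mat[of _ d d])
      then show ?thesis
        using s by auto
    next
      case (Suc i)
      have "t ^\<^sub>m i * (s * a) = 1\<^sub>m d"
        using that Suc by (simp add: e_def t_def)
      then have "t ^\<^sub>m i * s * a = 1\<^sub>m d"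
        using assoc_mult_mat[OF pow_carrier_mat[OF t(1)] s ac] by simp
      then show ?thesis
        using mult_carrier_mat[OF pow_carrier_mat[OF t(1)] s] by auto
    qed
    then obtain x where "x \<in> carrier_mat d d" "x * a = 1\<^sub>m d" ..
    then have "det x * det a = 1"
      using det_mult[of x d a] ac by simp
    then show ?thesis
      by auto
  qed
  moreover have "\<exists>k. a ^\<^sub>m k = 0\<^sub>m d d" if "e = 0\<^sub>m d d"
    using abs[of j] that left_mult_zero_mat[OF p(1), of d] by (intro exI[of _ j]) (simp add: e_def)
  ultimately show ?thesis
    using hom_power[OF \<rho> t(2), of j] by (intro exI[of _ e]) (auto simp: e_def)
qed

section \<open>Endomorphism rings of indecomposable modules\<close>

lemma eq_mat_by_vec:
  fixes A B :: "'k::field mat"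
  assumes A: "A \<in> carrier_mat m d" and B: "B \<in> carrier_mat m d"
    and eq: "\<And>v. v \<in> carrier_vec d \<Longrightarrow> A *\<^sub>v v = B *\<^sub>v v"
  shows "A = B"
proof (rule eq_matI)
  fix a b assume "a < dim_row B" "b < dim_col B"
  then have ab: "a < m" "b < d"
    using B by auto
  have "(A *\<^sub>v unit_vec d b) $ a = (B *\<^sub>v unit_vec d b) $ a"
    using eq[of "unit_vec d b"] by simp
  then show "A $$ (a, b) = B $$ (a, b)"
    using ab A B by (simp add: scalar_prod_right_unit)
qed (use A B in auto)

lemma mult_mat_zero_vec: "A \<in> carrier_mat m d \<Longrightarrow> A *\<^sub>v 0\<^sub>v d = (0\<^sub>v m :: 'k::field vec)"
  by (intro eq_vecI) auto

lemma zero_mat_mult_vec: "v \<in> carrier_vec d \<Longrightarrow> 0\<^sub>m m d *\<^sub>v v = (0\<^sub>v m :: 'k::field vec)"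
  by (intro eq_vecI) (auto simp: scalar_prod_def)

text \<open>Kernel and fixed space of an idempotent endomorphism are complementary submodules, by v
  = (v - e v) + e v; one of them must vanish.\<close>

lemma indecomposable_idempotent:
  assumes ind: "indecomposable N d \<rho>" and \<rho>: "\<rho> \<in> mat_tuples N d"
    and e: "e \<in> hom_space N d d \<rho> \<rho>" and idem: "e * e = e"
  shows "e = 0\<^sub>m d d \<or> e = 1\<^sub>m d"
proof -
  note ec = hom_spaceD(1)[OF e \<rho> \<rho>]
  define V where "V = {v \<in> carrier_vec d. e *\<^sub>v v = 0\<^sub>v d}"
  define W where "W = {v \<in> carrier_vec d. e *\<^sub>v v = v}"
  have eval: "e *\<^sub>v (eval_nc d \<rho> h *\<^sub>v w) = eval_nc d \<rho> h *\<^sub>v (e *\<^sub>v w)" if "h \<in> free_alg N" "w \<in> carrier_vec d" for h w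
  proof -
    have "e *\<^sub>v (eval_nc d \<rho> h *\<^sub>v w) = (e * eval_nc d \<rho> h) *\<^sub>v w"
      by (rule assoc_mult_mat_vec[OF ec eval_nc_carrier that(2), symmetric])
    also have "\<dots> = eval_nc d \<rho> h *\<^sub>v (e *\<^sub>v w)"
      unfolding hom_eval_nc[OF \<rho> \<rho> e that(1)] by (rule assoc_mult_mat_vec[OF eval_nc_carrier ec that(2)])
    finally show ?thesis .
  qed
  have V: "rep_submodule N d \<rho> V"
    unfolding rep_submodule_def
  proof (intro conjI ballI)
    show "eval_nc d \<rho> h *\<^sub>v w \<in> V" if "h \<in> free_alg N" "w \<in> V" for h w
      using that eval[of h w] mult_mat_vec_carrier[OF eval_nc_carrier, of w] mult_mat_zero_vec[OF eval_nc_carrier, of d \<rho> h]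
      by (auto simp: V_def)
    show "v + w \<in> V" if "v \<in> V" "w \<in> V" for v w
      using that ec mult_add_distrib_mat_vec[OF ec, of v w] by (auto simp: V_def)
  qed (use ec in \<open>auto simp: V_def\<close>)
  have W: "rep_submodule N d \<rho> W"
    unfolding rep_submodule_def
  proof (intro conjI ballI)
    show "eval_nc d \<rho> h *\<^sub>v w \<in> W" if "h \<in> free_alg N" "w \<in> W" for h w
      using that eval[of h w] mult_mat_vec_carrier[OF eval_nc_carrier, of w] by (auto simp: W_def)
    show "v + w \<in> W" if "v \<in> W" "w \<in> W" for v w
      using that ec mult_add_distrib_mat_vec[OF ec, of v w] by (auto simp: W_def)
  qed (use ec in \<open>auto simp: W_def\<close>)
  have eW: "e *\<^sub>v v \<in> W" and eV: "v - e *\<^sub>v v \<in> V" if v: "v \<in> carrier_vec d" for v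
  proof -
    have ee: "e *\<^sub>v (e *\<^sub>v v) = e *\<^sub>v v"
      using assoc_mult_mat_vec[OF ec ec v] idem by simp
    then show "e *\<^sub>v v \<in> W"
      using ec v by (simp add: W_def)
    show "v - e *\<^sub>v v \<in> V"
      using ee ec v mult_minus_distrib_mat_vec[OF ec v, of "e *\<^sub>v v"] by (simp add: V_def)
  qed
  have "V \<inter> W = {0\<^sub>v d}"
    using ec by (auto simp: V_def W_def)
  moreover have "{v + w |v w. v \<in> V \<and> w \<in> W} = carrier_vec d"
  proof
    show "{v + w |v w. v \<in> V \<and> w \<in> W} \<subseteq> carrier_vec d"
      by (auto simp: V_def W_def)
    show "carrier_vec d \<subseteq> {v + w |v w. v \<in> V \<and> w \<in> W}"
    proof
      fix v :: "'a vec" assume v: "v \<in> carrier_vec d"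
      have "v = (v - e *\<^sub>v v) + e *\<^sub>v v"
        using v ec by (intro eq_vecI) auto
      then show "v \<in> {v + w |v w. v \<in> V \<and> w \<in> W}"
        using eW[OF v] eV[OF v] by blast
    qed
  qed
  ultimately have "V = {0\<^sub>v d} \<or> W = {0\<^sub>v d}"
    using ind V W unfolding indecomposable_def by blast
  then show ?thesis
  proof
    assume V0: "V = {0\<^sub>v d}"
    have "e *\<^sub>v v = 1\<^sub>m d *\<^sub>v v" if v: "v \<in> carrier_vec d" for v
    proof -
      have zero: "v - e *\<^sub>v v = 0\<^sub>v d"
        using eV[OF v] V0 by simp
      have "v $ i = (e *\<^sub>v v) $ i" if "i < d" for i
        using arg_cong[OF zero, of "\<lambda>u. u $ i"] that v ec by simp
      then show ?thesis
        using v ec by (intro eq_vecI) auto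
    qed
    then have "e = 1\<^sub>m d"
      using ec by (intro eq_mat_by_vec[of _ d d]) auto
    then show ?thesis ..
  next
    assume W0: "W = {0\<^sub>v d}"
    have "e *\<^sub>v v = 0\<^sub>m d d *\<^sub>v v" if v: "v \<in> carrier_vec d" for v
      using eW[OF v] W0 zero_mat_mult_vec[OF v] by simp
    then have "e = 0\<^sub>m d d"
      using ec by (intro eq_mat_by_vec[of _ d d]) auto
    then show ?thesis ..
  qed
qed

text \<open>Fitting's idempotent is 0 or 1, and 1 is excluded by the vanishing determinant.\<close>

lemma indecomposable_nilpotent:
  assumes ind: "indecomposable N d \<rho>" and \<rho>: "\<rho> \<in> mat_tuples N d"
    and a: "a \<in> hom_space N d d \<rho> \<rho>" and "det a = 0"
  shows "\<exists>k. a ^\<^sub>m k = 0\<^sub>m d d"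
proof -
  from fitting_idempotent[OF \<rho> a] obtain e where e: "e \<in> hom_space N d d \<rho> \<rho> \<and> e * e = e \<and> (e = 1\<^sub>m d \<longrightarrow> det a \<noteq> 0) \<and>
      (e = 0\<^sub>m d d \<longrightarrow> (\<exists>k. a ^\<^sub>m k = 0\<^sub>m d d))" ..
  then have "e = 0\<^sub>m d d \<or> e = 1\<^sub>m d"
    using indecomposable_idempotent[OF ind \<rho>] by blast
  then show ?thesis
    using e \<open>det a = 0\<close> by auto
qed

text \<open>The endomorphism ring is local. After scaling by the inverse \<open>c\<close> of the
  sum, c a + c b = 1 with both terms singular; a kernel vector of c b is fixed by c a, contradicting
  the nilpotency of c a.\<close>

lemma indecomposable_det_add:
  assumes ind: "indecomposable N d \<rho>" and \<rho>: "\<rho> \<in> mat_tuples N d"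
    and a: "a \<in> hom_space N d d \<rho> \<rho>" and b: "b \<in> hom_space N d d \<rho> \<rho>" and "det a = 0" "det b = 0"
  shows "det (a + b) = 0"
proof (rule ccontr)
  assume det: "det (a + b) \<noteq> 0"
  note ac = hom_spaceD(1)[OF a \<rho> \<rho>] and bc = hom_spaceD(1)[OF b \<rho> \<rho>]
  have cc: "a + b \<in> carrier_mat d d"
    using ac bc by simp
  from inverse_pair_exists[OF cc det] obtain c where c: "inverse_pair d (a + b) c" ..
  have ch: "c \<in> hom_space N d d \<rho> \<rho>"
    by (rule hom_inverse[OF \<rho> hom_add[OF \<rho> \<rho> a b] c])
  note c' = hom_spaceD(1)[OF ch \<rho> \<rho>]
  have sum: "c * a + c * b = 1\<^sub>m d"
    using c mult_add_distrib_mat[OF c' ac bc] by (simp add: inverse_pair_def)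
  have "det (c * a) = 0" "det (c * b) = 0"
    using det_mult[OF c' ac] det_mult[OF c' bc] assms by simp_all
  from indecomposable_nilpotent[OF ind \<rho> hom_comp[OF \<rho> \<rho> \<rho> a ch] this(1)]
  obtain k where k: "(c * a) ^\<^sub>m k = 0\<^sub>m d d" ..
  note cac = mult_carrier_mat[OF c' ac] and cbc = mult_carrier_mat[OF c' bc]
  obtain v where v: "v \<in> carrier_vec d" "v \<noteq> 0\<^sub>v d" "(c * b) *\<^sub>v v = 0\<^sub>v d"
    using \<open>det (c * b) = 0\<close> det_0_iff_vec_prod_zero_field[OF cbc] by auto
  have av: "(c * a) *\<^sub>v v = v"
  proof -
    have "v = (c * a + c * b) *\<^sub>v v"
      using v(1) by (simp add: sum)
    also have "\<dots> = (c * a) *\<^sub>v v + (c * b) *\<^sub>v v"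
      by (rule add_mult_distrib_mat_vec[OF cac cbc v(1)])
    also have "\<dots> = (c * a) *\<^sub>v v"
      using v mult_mat_vec_carrier[OF cac v(1)] by (simp only: v(3) right_zero_vec)
    finally show ?thesis ..
  qed
  have "(c * a) ^\<^sub>m i *\<^sub>v v = v" for i
  proof (induction i)
    case 0
    then show ?case
      using v(1) c' by simp
  next
    case (Suc i)
    have "((c * a) ^\<^sub>m i * (c * a)) *\<^sub>v v = (c * a) ^\<^sub>m i *\<^sub>v ((c * a) *\<^sub>v v)"
      by (rule assoc_mult_mat_vec[OF pow_carrier_mat[OF cac] cac v(1)])
    then show ?case
      using Suc.IH by (simp only: av pow_mat.simps)
  qed
  from this[of k] have "v = 0\<^sub>v d"
    using v(1) by (simp add: k zero_mat_mult_vec)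
  then show False
    using v(2) by simp
qed

text \<open>Applied to an indecomposable module, this identifies the residue field of its
  endomorphism ring with the base field: every endomorphism is a scalar plus a singular one.\<close>

lemma ex_eigenvalue:
  fixes a :: "'k::alg_closed_field mat"
  assumes a: "a \<in> carrier_mat d d" and "d > 0"
  shows "\<exists>l. det (a + l \<cdot>\<^sub>m 1\<^sub>m d) = 0"
proof -
  have "degree (char_poly a) > 0"
    using degree_monic_char_poly[OF a] \<open>d > 0\<close> by simp
  then obtain x where "poly (char_poly a) x = 0"
    using alg_closed_imp_poly_has_root by blast
  then have "det (char_matrix a x) = 0"
    using eigenvalue_root_char_poly[OF a] eigenvalue_det[OF a] by simp
  then show ?thesis
    using a by (intro exI[of _ "- x"]) (simp add: char_matrix_def)
qed

text \<open>The radical \<open>rad(M\<^sub>\<rho>, M\<^sub>\<zeta>)\<close> for indecomposable \<open>M\<^sub>\<zeta>\<close>. The multiplicity of \<open>M\<^sub>\<zeta>\<close> as a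
  direct summand of \<open>M\<^sub>\<rho>\<close> is the dimension of \<open>Hom(M\<^sub>\<rho>, M\<^sub>\<zeta>) / rad(M\<^sub>\<rho>, M\<^sub>\<zeta>)\<close>, because
  \<open>End(M\<^sub>\<zeta>)\<close> is local with residue field \<open>K\<close>; this description is additive in \<open>M\<^sub>\<rho>\<close>.\<close>

definition rad :: "nat \<Rightarrow> nat \<Rightarrow> 'k::field mat list \<Rightarrow> nat \<Rightarrow> 'k mat list \<Rightarrow> 'k mat set" where
  "rad N z \<zeta> d \<rho> = {\<phi> \<in> hom_space N d z \<rho> \<zeta>. \<forall>\<psi>\<in>hom_space N z d \<zeta> \<rho>. det (\<phi> * \<psi>) = 0}"

definition summand_mult :: "nat \<Rightarrow> nat \<Rightarrow> 'k::field mat list \<Rightarrow> nat \<Rightarrow> 'k mat list \<Rightarrow> int" where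
  "summand_mult N z \<zeta> d \<rho> = int (sdim z d (hom_space N d z \<rho> \<zeta>)) - int (sdim z d (rad N z \<zeta> d \<rho>))"

context
  fixes N z :: nat and \<zeta> :: "'k::alg_closed_field mat list"
  assumes \<zeta>: "\<zeta> \<in> mat_tuples N z" and ind: "indecomposable N z \<zeta>"
begin

lemma z_pos: "z > 0"
  using ind by (simp add: indecomposable_def)

text \<open>Closure under addition is where locality enters, by
  \<open>indecomposable_det_add\<close>; z > 0 makes the zero map singular.\<close>

lemma mat_subspace_rad:
  assumes \<rho>: "\<rho> \<in> mat_tuples N d"
  shows "mat_subspace z d (rad N z \<zeta> d \<rho>)"
  unfolding mat_subspace_def
proof (intro conjI ballI allI)
  show "rad N z \<zeta> d \<rho> \<subseteq> carrier_mat z d"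
    by (auto simp: rad_def hom_space_def)
  have "det (0\<^sub>m z d * \<psi>) = 0" if "\<psi> \<in> hom_space N z d \<zeta> \<rho>" for \<psi>
    using left_mult_zero_mat[OF hom_spaceD(1)[OF that \<zeta> \<rho>], of z] z_pos by simp
  then show "0\<^sub>m z d \<in> rad N z \<zeta> d \<rho>"
    by (simp add: rad_def hom_zero \<rho> \<zeta>)
  fix A assume A: "A \<in> rad N z \<zeta> d \<rho>"
  then have Ah: "A \<in> hom_space N d z \<rho> \<zeta>"
    by (simp add: rad_def)
  note Ac = hom_spaceD(1)[OF Ah \<rho> \<zeta>]
  fix c
  have "det (c \<cdot>\<^sub>m A * \<psi>) = 0" if "\<psi> \<in> hom_space N z d \<zeta> \<rho>" for \<psi>
    using A that mult_smult_assoc_mat[OF Ac hom_spaceD(1)[OF that \<zeta> \<rho>], of c] by (simp add: rad_def)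
  then show "c \<cdot>\<^sub>m A \<in> rad N z \<zeta> d \<rho>"
    by (simp add: rad_def hom_smult \<rho> \<zeta> Ah)
  fix B assume B: "B \<in> rad N z \<zeta> d \<rho>"
  then have Bh: "B \<in> hom_space N d z \<rho> \<zeta>"
    by (simp add: rad_def)
  note Bc = hom_spaceD(1)[OF Bh \<rho> \<zeta>]
  have "det ((A + B) * \<psi>) = 0" if \<psi>: "\<psi> \<in> hom_space N z d \<zeta> \<rho>" for \<psi>
  proof -
    have "det (A * \<psi> + B * \<psi>) = 0"
      by (rule indecomposable_det_add[OF ind \<zeta> hom_comp[OF \<zeta> \<rho> \<zeta> \<psi> Ah] hom_comp[OF \<zeta> \<rho> \<zeta> \<psi> Bh]])
        (use A B \<psi> in \<open>auto simp: rad_def\<close>)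
    then show ?thesis
      by (simp add: add_mult_distrib_mat[OF Ac Bc hom_spaceD(1)[OF \<psi> \<zeta> \<rho>]])
  qed
  then show "A + B \<in> rad N z \<zeta> d \<rho>"
    by (simp add: rad_def hom_add \<rho> \<zeta> Ah Bh)
qed

lemma rad_comp:
  assumes \<rho>: "\<rho> \<in> mat_tuples N d" and \<sigma>: "\<sigma> \<in> mat_tuples N e"
    and A: "A \<in> rad N z \<zeta> d \<rho>" and h: "h \<in> hom_space N e d \<sigma> \<rho>"
  shows "A * h \<in> rad N z \<zeta> e \<sigma>"
proof -
  have Ah: "A \<in> hom_space N d z \<rho> \<zeta>"
    using A by (simp add: rad_def)
  have "det (A * h * \<psi>) = 0" if \<psi>: "\<psi> \<in> hom_space N z e \<zeta> \<sigma>" for \<psi>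
  proof -
    have "A * h * \<psi> = A * (h * \<psi>)"
      by (rule assoc_mult_mat[OF hom_spaceD(1)[OF Ah \<rho> \<zeta>] hom_spaceD(1)[OF h \<sigma> \<rho>] hom_spaceD(1)[OF \<psi> \<zeta> \<sigma>]])
    then show ?thesis
      using A hom_comp[OF \<zeta> \<sigma> \<rho> \<psi> h] by (simp add: rad_def)
  qed
  then show ?thesis
    using hom_comp[OF \<sigma> \<rho> \<zeta> h Ah] by (simp add: rad_def)
qed

lemma summand_mult_conj:
  assumes g: "inverse_pair d g h" and \<rho>: "\<rho> \<in> mat_tuples N d"
  shows "summand_mult N z \<zeta> d (conj_tuple g h \<rho>) = summand_mult N z \<zeta> d \<rho>"
proof -
  note \<rho>' = conj_tuple_mat_tuples[OF g \<rho>]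
  have "sdim z d (rad N z \<zeta> d (conj_tuple g h \<rho>)) = sdim z d (rad N z \<zeta> d \<rho>)"
    by (rule sdim_mult_right[OF mat_subspace_rad[OF \<rho>] mat_subspace_rad[OF \<rho>'] g])
      (use rad_comp[OF \<rho> \<rho>' _ hom_conj(2)[OF g \<rho>]] rad_comp[OF \<rho>' \<rho> _ hom_conj(1)[OF g \<rho>]] in auto)
  then show ?thesis
    using hom_dim_conj[OF g \<rho> \<zeta>] by (simp add: summand_mult_def hom_dim_eq_sdim)
qed

text \<open>A subfunctor of an additive functor is additive: the components are obtained by
  composing with the inclusions, and a pair is reassembled with the projections.\<close>

lemma rad_dsum:
  assumes \<rho>: "\<rho> \<in> mat_tuples N d" and \<sigma>: "\<sigma> \<in> mat_tuples N e"
  shows "rad N z \<zeta> (d + e) (dsum N d e \<rho> \<sigma>) = {hcat A B |A B. A \<in> rad N z \<zeta> d \<rho> \<and> B \<in> rad N z \<zeta> e \<sigma>}"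
    (is "?L = ?R")
proof
  note \<mu> = dsum_mat_tuples[OF \<rho> \<sigma>] and ip = hom_dsum_inj_proj[OF \<rho> \<sigma>]
  show "?L \<subseteq> ?R"
  proof
    fix C assume C: "C \<in> ?L"
    then obtain A B where AB: "A \<in> hom_space N d z \<rho> \<zeta>" "B \<in> hom_space N e z \<sigma> \<zeta>" "C = hcat A B"
      unfolding rad_def hom_space_dsum[OF \<rho> \<sigma> \<zeta>] by auto
    note c = hom_spaceD(1)[OF AB(1) \<rho> \<zeta>] hom_spaceD(1)[OF AB(2) \<sigma> \<zeta>]
    have "C * vcat (1\<^sub>m d) (0\<^sub>m e d) = A" "C * vcat (0\<^sub>m d e) (1\<^sub>m e) = B"
      using c by (simp_all add: AB(3) hcat_mult_vcat[of _ z d _ e _ d] hcat_mult_vcat[of _ z d _ e _ e])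
    then show "C \<in> ?R"
      using rad_comp[OF \<mu> \<rho> C ip(1)] rad_comp[OF \<mu> \<sigma> C ip(2)] AB(3) by auto
  qed
  show "?R \<subseteq> ?L"
  proof
    fix C assume "C \<in> ?R"
    then obtain A B where AB: "A \<in> rad N z \<zeta> d \<rho>" "B \<in> rad N z \<zeta> e \<sigma>" "C = hcat A B"
      by auto
    then have h: "A \<in> hom_space N d z \<rho> \<zeta>" "B \<in> hom_space N e z \<sigma> \<zeta>"
      by (auto simp: rad_def)
    note c = hom_spaceD(1)[OF h(1) \<rho> \<zeta>] hom_spaceD(1)[OF h(2) \<sigma> \<zeta>]
    have "A * hcat (1\<^sub>m d) (0\<^sub>m d e) + B * hcat (0\<^sub>m e d) (1\<^sub>m e) = C"
      using c AB(3) by (intro eq_matI) (auto simp: mult_hcat[of _ z _ _ d _ e])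
    then show "C \<in> ?L"
      using mat_subspaceD(3)[OF mat_subspace_rad[OF \<mu>] rad_comp[OF \<rho> \<mu> AB(1) ip(3)] rad_comp[OF \<sigma> \<mu> AB(2) ip(4)]]
      by simp
  qed
qed

lemma summand_mult_dsum:
  assumes \<rho>: "\<rho> \<in> mat_tuples N d" and \<sigma>: "\<sigma> \<in> mat_tuples N e"
  shows "summand_mult N z \<zeta> (d + e) (dsum N d e \<rho> \<sigma>) = summand_mult N z \<zeta> d \<rho> + summand_mult N z \<zeta> e \<sigma>"
  unfolding summand_mult_def hom_space_dsum[OF \<rho> \<sigma> \<zeta>] rad_dsum[OF \<rho> \<sigma>]
    sdim_hcat[OF mat_subspace_hom[OF \<rho> \<zeta>] mat_subspace_hom[OF \<sigma> \<zeta>]]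
    sdim_hcat[OF mat_subspace_rad[OF \<rho>] mat_subspace_rad[OF \<sigma>]]
  by simp

text \<open>End(\<zeta>) is the direct sum of its singular elements and the scalars, so a basis of
  the radical becomes a basis of the whole ring by appending the identity.\<close>

lemma summand_mult_self: "summand_mult N z \<zeta> z \<zeta> = 1"
proof -
  let ?R = "rad N z \<zeta> z \<zeta>" and ?E = "hom_space N z z \<zeta> \<zeta>"
  have R: "A \<in> ?R \<longleftrightarrow> A \<in> ?E \<and> det A = 0" for A
  proof
    assume A: "A \<in> ?R"
    then have "det (A * 1\<^sub>m z) = 0"
      using hom_one[OF \<zeta>] by (auto simp: rad_def)
    then show "A \<in> ?E \<and> det A = 0"
      using A right_mult_one_mat[of A z z] by (auto simp: rad_def dest: hom_spaceD(1)[OF _ \<zeta> \<zeta>])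
  next
    assume A: "A \<in> ?E \<and> det A = 0"
    then have "det (A * \<psi>) = 0" if "\<psi> \<in> ?E" for \<psi>
      using det_mult[of A z \<psi>] that by (auto dest: hom_spaceD(1)[OF _ \<zeta> \<zeta>])
    then show "A \<in> ?R"
      using A by (simp add: rad_def)
  qed
  obtain \<phi> where \<phi>: "is_basis z z ?R (sdim z z ?R) \<phi>"
    by (rule sdim_basis[OF mat_subspace_rad[OF \<zeta>]])
  let ?k = "sdim z z ?R"
  let ?\<phi> = "\<phi>(?k := 1\<^sub>m z)"
  have \<phi>R: "\<And>i. i < ?k \<Longrightarrow> \<phi> i \<in> ?R"
    using \<phi> by (simp add: is_basis_def)
  have lc: "lin_comb z z (Suc ?k) c ?\<phi> = lin_comb z z ?k c \<phi> + c ?k \<cdot>\<^sub>m 1\<^sub>m z" for c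
    by (rule eq_matI) simp_all
  have "is_basis z z ?E (Suc ?k) ?\<phi>"
    unfolding is_basis_def
  proof (intro conjI allI impI ballI)
    show "?\<phi> i \<in> ?E" if "i < Suc ?k" for i
      using that \<phi>R hom_one[OF \<zeta>] by (auto simp: R less_Suc_eq)
    show "\<exists>c. A = lin_comb z z (Suc ?k) c ?\<phi>" if A: "A \<in> ?E" for A
    proof -
      note Ac = hom_spaceD(1)[OF A \<zeta> \<zeta>]
      obtain l where l: "det (A + l \<cdot>\<^sub>m 1\<^sub>m z) = 0"
        using ex_eigenvalue[OF Ac z_pos] by auto
      then have "A + l \<cdot>\<^sub>m 1\<^sub>m z \<in> ?R"
        using hom_add[OF \<zeta> \<zeta> A hom_smult[OF \<zeta> \<zeta> hom_one[OF \<zeta>]]] by (simp add: R)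
      then obtain c where c: "A + l \<cdot>\<^sub>m 1\<^sub>m z = lin_comb z z ?k c \<phi>"
        using \<phi> by (auto simp: is_basis_def)
      have "lin_comb z z ?k (c(?k := - l)) \<phi> = lin_comb z z ?k c \<phi>"
        by (rule eq_matI) auto
      then have "A = lin_comb z z (Suc ?k) (c(?k := - l)) ?\<phi>"
        unfolding lc using Ac by (intro eq_matI) (auto simp flip: c)
      then show ?thesis
        by (rule exI[of _ "c(?k := - l)"])
    qed
    fix c i assume c: "lin_comb z z (Suc ?k) c ?\<phi> = 0\<^sub>m z z" and i: "i < Suc ?k"
    have L: "lin_comb z z ?k c \<phi> \<in> ?R"
      by (rule lin_comb_in_subspace[OF mat_subspace_rad[OF \<zeta>] \<phi>R])
    have eq: "lin_comb z z ?k c \<phi> = (- c ?k) \<cdot>\<^sub>m 1\<^sub>m z"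
    proof (rule eq_matI)
      fix a b assume "a < dim_row ((- c ?k) \<cdot>\<^sub>m 1\<^sub>m z)" "b < dim_col ((- c ?k) \<cdot>\<^sub>m 1\<^sub>m z)"
      then have "a < z" "b < z"
        by simp_all
      then show "lin_comb z z ?k c \<phi> $$ (a, b) = ((- c ?k) \<cdot>\<^sub>m 1\<^sub>m z) $$ (a, b)"
        using arg_cong[OF c, of "\<lambda>A. A $$ (a, b)"] unfolding lc by (simp add: add_eq_0_iff)
    qed simp_all
    have ck: "c ?k = 0"
      using L by (simp add: R eq)
    have "lin_comb z z ?k c \<phi> = 0\<^sub>m z z"
      unfolding eq ck by (rule eq_matI) auto
    then have "\<forall>i<?k. c i = 0"
      using \<phi> by (simp add: is_basis_def)
    then show "c i = 0"
      using ck i by (auto simp: less_Suc_eq)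
  qed
  from sdim_eq[OF mat_subspace_hom[OF \<zeta> \<zeta>] this] show ?thesis
    by (simp add: summand_mult_def)
qed

end

text \<open>The dimension is part of the data because the empty list, for N = 0, carries none. The
  relation is reflexive exactly on pairs whose tuple has the stated size, hence only a partial
  equivalence.\<close>

definition rep_iso :: "nat \<Rightarrow> nat \<times> 'k::field mat list \<Rightarrow> nat \<times> 'k mat list \<Rightarrow> bool" where
  "rep_iso N x y \<longleftrightarrow> fst x = fst y \<and> snd x \<in> mat_tuples N (fst x) \<and>
     (\<exists>g h. inverse_pair (fst x) g h \<and> snd y = conj_tuple g h (snd x))"

lemma rep_iso_refl: "\<rho> \<in> mat_tuples N d \<Longrightarrow> rep_iso N (d, \<rho>) (d, \<rho>)"
  unfolding rep_iso_def
  by (intro conjI exI[of _ "1\<^sub>m d"]) (simp_all add: inverse_pair_one conj_tuple_one)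

lemma rep_iso_sym:
  assumes "rep_iso N x y"
  shows "rep_iso N y x"
proof -
  obtain g h where g: "inverse_pair (fst x) g h" "snd y = conj_tuple g h (snd x)"
    and x: "snd x \<in> mat_tuples N (fst x)" "fst x = fst y"
    using assms by (auto simp: rep_iso_def)
  have "inverse_pair (fst y) h g \<and> snd x = conj_tuple h g (snd y)"
    using conj_tuple_inverse[OF g(1) x(1)] inverse_pair_sym[OF g(1)] g x by simp
  then show ?thesis
    using conj_tuple_mat_tuples[OF g(1) x(1)] g x unfolding rep_iso_def
    by (intro conjI exI[of _ h] exI[of _ g]) simp_all
qed

lemma rep_iso_trans:
  assumes "rep_iso N x y" "rep_iso N y w"
  shows "rep_iso N x w"
proof -
  obtain g h where g: "inverse_pair (fst x) g h" "snd y = conj_tuple g h (snd x)"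
    and x: "snd x \<in> mat_tuples N (fst x)" "fst x = fst y"
    using assms(1) by (auto simp: rep_iso_def)
  obtain g' h' where "inverse_pair (fst y) g' h'" "snd w = conj_tuple g' h' (snd y)" "fst y = fst w"
    using assms(2) by (auto simp: rep_iso_def)
  then have g': "inverse_pair (fst x) g' h'" "snd w = conj_tuple g' h' (snd y)" "fst w = fst x"
    using x(2) by simp_all
  have "inverse_pair (fst x) (g' * g) (h * h') \<and> snd w = conj_tuple (g' * g) (h * h') (snd x)"
    using conj_tuple_comp[OF g'(1) g(1) x(1)] inverse_pair_mult[OF g'(1) g(1)] g(2) g'(2) by simp
  then show ?thesis
    using g'(3) x unfolding rep_iso_def by (intro conjI exI[of _ "g' * g"] exI[of _ "h * h'"]) simp_all
qed

text \<open>Otherwise \<open>B\<close> has a nonzero kernel vector, which \<open>A * B\<close> would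
  kill.\<close>

lemma left_inverse_dim_le:
  assumes A: "A \<in> carrier_mat d z" and B: "B \<in> carrier_mat z d" and AB: "A * B = (1\<^sub>m d :: 'k::field mat)"
  shows "d \<le> z"
proof (rule ccontr)
  assume "\<not> d \<le> z"
  then obtain v where v: "v \<in> carrier_vec d" "v \<noteq> 0\<^sub>v d" "B *\<^sub>v v = 0\<^sub>v z"
    using wide_mat_kernel[OF B] by auto
  have "v = (A * B) *\<^sub>v v"
    using v(1) by (simp add: AB)
  also have "\<dots> = A *\<^sub>v (B *\<^sub>v v)"
    by (rule assoc_mult_mat_vec[OF A B v(1)])
  also have "\<dots> = 0\<^sub>v d"
    unfolding v(3) by (rule mult_mat_zero_vec[OF A])
  finally show False
    using v(2) by simp
qed

text \<open>After correction by the inverse \<open>c\<close> of \<phi> \<psi>,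
  \<open>\<zeta>\<close> becomes a retract of \<open>\<rho>\<close>. The idempotent \<psi> \<chi> of
  \<open>\<rho>\<close> is not zero because \<chi> \<psi> = 1 on a nonzero space, so it is
  1.\<close>

lemma rep_iso_if_det_nonzero:
  assumes \<zeta>: "\<zeta> \<in> mat_tuples N z" and \<zeta>i: "indecomposable N z \<zeta>"
    and \<rho>: "\<rho> \<in> mat_tuples N d" and \<rho>i: "indecomposable N d \<rho>"
    and \<phi>: "\<phi> \<in> hom_space N d z \<rho> \<zeta>" and \<psi>: "\<psi> \<in> hom_space N z d \<zeta> \<rho>" and det: "det (\<phi> * \<psi>) \<noteq> 0"
  shows "rep_iso N (z, \<zeta>) (d, \<rho>)"
proof -
  note \<phi>c = hom_spaceD(1)[OF \<phi> \<rho> \<zeta>] and \<psi>c = hom_spaceD(1)[OF \<psi> \<zeta> \<rho>]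
  from inverse_pair_exists[OF mult_carrier_mat[OF \<phi>c \<psi>c] det] obtain c where c: "inverse_pair z (\<phi> * \<psi>) c" ..
  have ch: "c \<in> hom_space N z z \<zeta> \<zeta>"
    by (rule hom_inverse[OF \<zeta> hom_comp[OF \<zeta> \<rho> \<zeta> \<psi> \<phi>] c])
  note cc = hom_spaceD(1)[OF ch \<zeta> \<zeta>]
  define \<chi> where "\<chi> = c * \<phi>"
  have \<chi>: "\<chi> \<in> hom_space N d z \<rho> \<zeta>"
    unfolding \<chi>_def by (rule hom_comp[OF \<rho> \<zeta> \<zeta> \<phi> ch])
  note \<chi>c = hom_spaceD(1)[OF \<chi> \<rho> \<zeta>]
  have \<chi>\<psi>: "\<chi> * \<psi> = 1\<^sub>m z"
    using c assoc_mult_mat[OF cc \<phi>c \<psi>c] by (simp add: \<chi>_def inverse_pair_def)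
  have "\<psi> * \<chi> * (\<psi> * \<chi>) = \<psi> * (\<chi> * (\<psi> * \<chi>))"
    by (rule assoc_mult_mat[OF \<psi>c \<chi>c mult_carrier_mat[OF \<psi>c \<chi>c]])
  also have "\<chi> * (\<psi> * \<chi>) = \<chi>"
    using assoc_mult_mat[OF \<chi>c \<psi>c \<chi>c] left_mult_one_mat[OF \<chi>c] by (simp add: \<chi>\<psi>)
  finally have "\<psi> * \<chi> = 0\<^sub>m d d \<or> \<psi> * \<chi> = 1\<^sub>m d"
    by (intro indecomposable_idempotent[OF \<rho>i \<rho> hom_comp[OF \<rho> \<zeta> \<rho> \<chi> \<psi>]])
  moreover have "\<psi> * \<chi> \<noteq> 0\<^sub>m d d"
  proof
    assume zero: "\<psi> * \<chi> = 0\<^sub>m d d"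
    have "\<chi> * (\<psi> * \<chi>) * \<psi> = \<chi> * \<psi> * (\<chi> * \<psi>)"
      using assoc_mult_mat[OF \<chi>c \<psi>c \<chi>c] assoc_mult_mat[OF mult_carrier_mat[OF \<chi>c \<psi>c] \<chi>c \<psi>c] by simp
    then have "(1\<^sub>m z :: 'a mat) = 0\<^sub>m z z"
      using \<chi>c \<psi>c by (simp add: zero \<chi>\<psi>)
    then have "(1\<^sub>m z :: 'a mat) $$ (0, 0) = 0\<^sub>m z z $$ (0, 0)"
      by (rule arg_cong)
    then show False
      using \<zeta>i by (simp add: indecomposable_def)
  qed
  ultimately have \<psi>\<chi>: "\<psi> * \<chi> = 1\<^sub>m d"
    by simp
  have dz: "d = z"
    using left_inverse_dim_le[OF \<psi>c \<chi>c \<psi>\<chi>] left_inverse_dim_le[OF \<chi>c \<psi>c \<chi>\<psi>] by simp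
  have pair: "inverse_pair z \<psi> \<chi>"
    using \<psi>c \<chi>c \<chi>\<psi> \<psi>\<chi> by (simp add: inverse_pair_def dz)
  have "\<rho> = conj_tuple \<psi> \<chi> \<zeta>"
  proof (rule nth_equalityI)
    show "length \<rho> = length (conj_tuple \<psi> \<chi> \<zeta>)"
      by (simp add: conj_tuple_def mat_tuples_length[OF \<rho>] mat_tuples_length[OF \<zeta>])
    fix j assume "j < length \<rho>"
    then have j: "j < N"
      by (simp add: mat_tuples_length[OF \<rho>])
    have "\<rho> ! j = \<rho> ! j * \<psi> * \<chi>"
      using cancel_right(1)[OF pair, of "\<rho> ! j" d] mat_tuples_nth[OF \<rho> j] dz by simp
    then show "\<rho> ! j = conj_tuple \<psi> \<chi> \<zeta> ! j"
      using j mat_tuples_length[OF \<zeta>] by (simp add: conj_tuple_def hom_spaceD(2)[OF \<psi> \<zeta> \<rho> j])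
  qed
  then show ?thesis
    using pair \<zeta> dz unfolding rep_iso_def by auto
qed

text \<open>Between nonisomorphic indecomposables every morphism is radical; in the isomorphic case
  the count is that of \<open>summand_mult_self\<close>.\<close>

lemma summand_mult_indecomposable:
  fixes \<zeta> :: "'k::alg_closed_field mat list"
  assumes \<zeta>: "\<zeta> \<in> mat_tuples N z" and \<zeta>i: "indecomposable N z \<zeta>"
    and \<rho>: "\<rho> \<in> mat_tuples N d" and \<rho>i: "indecomposable N d \<rho>"
  shows "summand_mult N z \<zeta> d \<rho> = (if rep_iso N (z, \<zeta>) (d, \<rho>) then 1 else 0)"
proof (cases "rep_iso N (z, \<zeta>) (d, \<rho>)")
  case True
  note iso = True[unfolded rep_iso_def fst_conv snd_conv]
  then have "z = d"
    by (rule conjunct1)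
  from iso[THEN conjunct2, THEN conjunct2] obtain g h where "inverse_pair z g h" "\<rho> = conj_tuple g h \<zeta>"
    by (elim exE conjE)
  then show ?thesis
    using \<open>z = d\<close> True summand_mult_conj[OF \<zeta> \<zeta>i _ \<zeta>] summand_mult_self[OF \<zeta> \<zeta>i] by simp
next
  case False
  then have "det (\<phi> * \<psi>) = 0" if "\<phi> \<in> hom_space N d z \<rho> \<zeta>" "\<psi> \<in> hom_space N z d \<zeta> \<rho>" for \<phi> \<psi>
    using rep_iso_if_det_nonzero[OF \<zeta> \<zeta>i \<rho> \<rho>i that] by metis
  then have "rad N z \<zeta> d \<rho> = hom_space N d z \<rho> \<zeta>"
    by (auto simp: rad_def)
  then show ?thesis
    using False by (simp add: summand_mult_def)
qed

lemma rep_sum_Cons: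
  assumes "\<rho> \<in> mat_tuples N d" and "rep_sum N \<rho>s \<in> mat_tuples N e"
  shows "rep_sum N (\<rho> # \<rho>s) = dsum N d e \<rho> (rep_sum N \<rho>s)"
  unfolding rep_sum_def dsum_def
proof (rule map_cong[OF refl])
  fix j assume "j \<in> set [0..<N]"
  then have j: "j < N"
    by simp
  have nth: "diag_block_mat (map (\<lambda>\<rho>. \<rho> ! j) \<rho>s) = rep_sum N \<rho>s ! j"
    using j by (simp add: rep_sum_def)
  show "diag_block_mat (map (\<lambda>\<rho>. \<rho> ! j) (\<rho> # \<rho>s)) = four_block_mat (\<rho> ! j) (0\<^sub>m d e) (0\<^sub>m e d)
      (map (\<lambda>j. diag_block_mat (map (\<lambda>\<rho>. \<rho> ! j) \<rho>s)) [0..<N] ! j)"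
    using mat_tuples_nth[OF assms(1) j] mat_tuples_nth[OF assms(2) j] j by (simp add: Let_def nth)
qed

lemma rep_sum_Nil: "rep_sum N [] \<in> mat_tuples N 0"
  by (auto simp: rep_sum_def mat_tuples_def)

lemma rep_sum_mat_tuples:
  assumes "\<forall>(d, \<rho>)\<in>set xs. \<rho> \<in> mat_tuples N d"
  shows "rep_sum N (map snd xs) \<in> mat_tuples N (sum_list (map fst xs))"
  using assms by (induction xs) (auto simp: rep_sum_Nil rep_sum_Cons dsum_mat_tuples)

lemma summand_mult_rep_sum:
  fixes \<zeta> :: "'k::alg_closed_field mat list"
  assumes \<zeta>: "\<zeta> \<in> mat_tuples N z" and \<zeta>i: "indecomposable N z \<zeta>"
    and "\<forall>(d, \<rho>)\<in>set xs. \<rho> \<in> mat_tuples N d \<and> indecomposable N d \<rho>"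
  shows "summand_mult N z \<zeta> (sum_list (map fst xs)) (rep_sum N (map snd xs)) =
    int (length (filter (rep_iso N (z, \<zeta>)) xs))"
  using assms(3)
proof (induction xs)
  case Nil
  \<comment> \<open>A map through the zero module is zero, hence singular as z > 0, so the empty sum
    contributes nothing.\<close>
  have "rad N z \<zeta> 0 (rep_sum N []) = hom_space N 0 z (rep_sum N []) \<zeta>"
  proof -
    have "det (\<phi> * \<psi>) = 0" if "\<phi> \<in> carrier_mat z 0" "\<psi> \<in> carrier_mat 0 z" for \<phi> \<psi> :: "'k mat"
    proof -
      have "\<phi> * \<psi> = 0\<^sub>m z z"
        using that by (intro eq_matI) (auto simp: scalar_prod_def)
      then show ?thesis
        using \<zeta>i by (simp add: indecomposable_def)
    qed
    then show ?thesis
      by (auto simp: rad_def hom_space_def)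
  qed
  then show ?case
    by (simp add: summand_mult_def)
next
  case (Cons x xs)
  obtain d \<rho> where x: "x = (d, \<rho>)"
    by (cases x)
  have "\<forall>(d, \<rho>)\<in>set xs. \<rho> \<in> mat_tuples N d"
    using Cons.prems by auto
  note r = rep_sum_mat_tuples[OF this]
  have \<rho>: "\<rho> \<in> mat_tuples N d" "indecomposable N d \<rho>"
    using Cons.prems x by auto
  show ?case
    using Cons summand_mult_dsum[OF \<zeta> \<zeta>i \<rho>(1) r] summand_mult_indecomposable[OF \<zeta> \<zeta>i \<rho>]
    by (simp add: x rep_sum_Cons[OF \<rho>(1) r])
qed

text \<open>Counting: the number of summands isomorphic to a given indecomposable is
  \<open>summand_mult\<close> of the sum, an isomorphism invariant. The multisets of classes are
  compared one class at a time.\<close>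

theorem krull_schmidt:
  fixes xs ys :: "(nat \<times> 'k::alg_closed_field mat list) list"
  assumes xs: "\<forall>(d, \<rho>)\<in>set xs. \<rho> \<in> mat_tuples N d \<and> indecomposable N d \<rho>"
    and ys: "\<forall>(d, \<rho>)\<in>set ys. \<rho> \<in> mat_tuples N d \<and> indecomposable N d \<rho>"
    and iso: "rep_iso N (sum_list (map fst xs), rep_sum N (map snd xs)) (sum_list (map fst ys), rep_sum N (map snd ys))"
  shows "image_mset (\<lambda>x. {y. rep_iso N x y}) (mset xs) = image_mset (\<lambda>x. {y. rep_iso N x y}) (mset ys)"
proof (rule multiset_eqI)
  let ?cls = "\<lambda>x. {y. rep_iso N x y}"
  fix C :: "(nat \<times> 'k mat list) set"
  have count: "count (image_mset ?cls (mset xs)) C = length (filter (\<lambda>x. ?cls x = C) xs)"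
    for xs :: "(nat \<times> 'k mat list) list"
    by (induction xs) auto
  have cls_eq: "?cls x = ?cls z \<longleftrightarrow> rep_iso N z x" if "rep_iso N x x"
    for x z :: "nat \<times> 'k mat list"
    using that rep_iso_sym rep_iso_trans by blast
  have "length (filter (\<lambda>x. ?cls x = C) xs) = length (filter (\<lambda>x. ?cls x = C) ys)"
  \<comment> \<open>Only classes that occur in one of the two lists can have a nonzero
    count.\<close>
  proof (cases "\<exists>z\<in>set xs \<union> set ys. ?cls z = C")
    case True
    then obtain z where z: "z \<in> set xs \<union> set ys" "?cls z = C" ..
    obtain e \<zeta> where e: "z = (e, \<zeta>)"
      by (cases z)
    have \<zeta>: "\<zeta> \<in> mat_tuples N e" "indecomposable N e \<zeta>"
      using z e xs ys by auto
    have cls_C: "?cls x = C \<longleftrightarrow> rep_iso N (e, \<zeta>) x" if x: "x \<in> set xs \<union> set ys" for x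
    proof -
      obtain d \<rho> where "x = (d, \<rho>)"
        by (cases x)
      then have "rep_iso N x x"
        using x xs ys by (auto intro!: rep_iso_refl)
      from cls_eq[OF this, of z, unfolded z(2)] show ?thesis
        unfolding e .
    qed
    have filters: "filter (\<lambda>x. ?cls x = C) xs = filter (rep_iso N (e, \<zeta>)) xs"
      "filter (\<lambda>x. ?cls x = C) ys = filter (rep_iso N (e, \<zeta>)) ys"
      using cls_C by (auto intro!: filter_cong[OF refl])
    note iso' = iso[unfolded rep_iso_def fst_conv snd_conv]
    note dims = iso'[THEN conjunct1] and r = iso'[THEN conjunct2, THEN conjunct1]
    from iso'[THEN conjunct2, THEN conjunct2] obtain g h where
      g: "inverse_pair (sum_list (map fst xs)) g h \<and> rep_sum N (map snd ys) = conj_tuple g h (rep_sum N (map snd xs))"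
      by (elim exE)
    have "summand_mult N e \<zeta> (sum_list (map fst xs)) (rep_sum N (map snd xs)) =
        summand_mult N e \<zeta> (sum_list (map fst ys)) (rep_sum N (map snd ys))"
      unfolding dims[symmetric] g[THEN conjunct2]
      by (rule summand_mult_conj[OF \<zeta> g[THEN conjunct1] r, symmetric])
    then have "length (filter (rep_iso N (e, \<zeta>)) xs) = length (filter (rep_iso N (e, \<zeta>)) ys)"
      using summand_mult_rep_sum[OF \<zeta> xs] summand_mult_rep_sum[OF \<zeta> ys] by simp
    then show ?thesis
      by (simp add: filters)
  next
    case False
    then have "filter (\<lambda>x. ?cls x = C) xs = []" "filter (\<lambda>x. ?cls x = C) ys = []"
      by (auto simp: filter_empty_conv)
    then show ?thesis
      by simp
  qed
  then show "count (image_mset ?cls (mset xs)) C = count (image_mset ?cls (mset ys)) C"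
    by (simp add: count)
qed

section \<open>Direct sum decompositions in coordinates\<close>

text \<open>Vectors become matrices with one column, so \<open>sdim_basis\<close> applies, and the
  basis is collected as the columns of \<open>B\<close>. The factorisation clauses are what turns
  invariance of a submodule into a matrix equation.\<close>

lemma vec_subspace_basis:
  fixes V :: "'k::field vec set"
  assumes V: "V \<subseteq> carrier_vec d" and zero: "0\<^sub>v d \<in> V"
    and add: "\<forall>v\<in>V. \<forall>w\<in>V. v + w \<in> V" and smult: "\<forall>c. \<forall>v\<in>V. c \<cdot>\<^sub>v v \<in> V"
  shows "\<exists>k B. B \<in> carrier_mat d k \<and>
    (\<forall>l C i. C \<in> carrier_mat k l \<longrightarrow> i < l \<longrightarrow> col (B * C) i \<in> V) \<and>
    (\<forall>l A. A \<in> carrier_mat d l \<longrightarrow> (\<forall>i<l. col A i \<in> V) \<longrightarrow> (\<exists>C\<in>carrier_mat k l. A = B * C)) \<and>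
    (\<forall>C. C \<in> carrier_mat k 1 \<longrightarrow> B * C = 0\<^sub>m d 1 \<longrightarrow> C = 0\<^sub>m k 1)"
proof -
  define S where "S = {A \<in> carrier_mat d 1. col A 0 \<in> V}"
  have S: "mat_subspace d 1 S"
    unfolding mat_subspace_def
  proof (intro conjI ballI allI)
    show "S \<subseteq> carrier_mat d 1"
      by (auto simp: S_def)
    show "0\<^sub>m d 1 \<in> S"
      using zero by (simp add: S_def)
    fix A B c assume A: "A \<in> S"
    have "col (c \<cdot>\<^sub>m A) 0 = c \<cdot>\<^sub>v col A 0"
      using A by (intro eq_vecI) (auto simp: S_def)
    then show "c \<cdot>\<^sub>m A \<in> S"
      using A smult by (simp add: S_def)
    assume B: "B \<in> S"
    have "col (A + B) 0 = col A 0 + col B 0"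
      using A B by (intro eq_vecI) (auto simp: S_def)
    then show "A + B \<in> S"
      using A B add by (simp add: S_def)
  qed
  obtain \<phi> where \<phi>: "is_basis d 1 S (sdim d 1 S) \<phi>"
    by (rule sdim_basis[OF S])
  define k where "k = sdim d 1 S"
  have \<phi>S: "\<And>i. i < k \<Longrightarrow> \<phi> i \<in> S" and span: "\<And>A. A \<in> S \<Longrightarrow> \<exists>c. A = lin_comb d 1 k c \<phi>"
    and indep: "\<And>c. lin_comb d 1 k c \<phi> = 0\<^sub>m d 1 \<Longrightarrow> \<forall>i<k. c i = 0"
    using \<phi> by (simp_all add: is_basis_def k_def)
  define B where "B = mat d k (\<lambda>(a, i). \<phi> i $$ (a, 0))"
  have B: "B \<in> carrier_mat d k"
    by (simp add: B_def)
  have BC: "(B * C) $$ (a, i) = lin_comb d 1 k (\<lambda>j. C $$ (j, i)) \<phi> $$ (a, 0)"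
    if "C \<in> carrier_mat k l" "i < l" "a < d" for C :: "'k mat" and l i a
    using that by (simp add: B_def scalar_prod_def mult.commute lessThan_atLeast0)
  show ?thesis
  proof (intro exI[of _ k] exI[of _ B] conjI allI impI)
    show "B \<in> carrier_mat d k"
      by (rule B)
  next
    fix l i and C :: "'k mat" assume C: "C \<in> carrier_mat k l" "i < l"
    have "col (B * C) i = col (lin_comb d 1 k (\<lambda>j. C $$ (j, i)) \<phi>) 0"
      using B C BC[OF C] by (intro eq_vecI) auto
    moreover have "lin_comb d 1 k (\<lambda>j. C $$ (j, i)) \<phi> \<in> S"
      by (rule lin_comb_in_subspace[OF S \<phi>S])
    ultimately show "col (B * C) i \<in> V"
      by (simp add: S_def)
  next
    fix l and A :: "'k mat" assume A: "A \<in> carrier_mat d l" "\<forall>i<l. col A i \<in> V"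
    have "\<exists>c. \<forall>a<d. A $$ (a, i) = lin_comb d 1 k c \<phi> $$ (a, 0)" if "i < l" for i
    proof -
      define A' where "A' = mat d 1 (\<lambda>(a, _). A $$ (a, i))"
      have "col A' 0 = col A i"
        using A(1) that by (intro eq_vecI) (auto simp: A'_def)
      then have "A' \<in> S"
        using A(2) that by (simp add: S_def A'_def)
      from span[OF this] obtain c where "A' = lin_comb d 1 k c \<phi>" ..
      then have "A' $$ (a, 0) = lin_comb d 1 k c \<phi> $$ (a, 0)" for a
        by simp
      moreover have "A' $$ (a, 0) = A $$ (a, i)" if "a < d" for a
        using that by (simp add: A'_def)
      ultimately show ?thesis
        by (intro exI[of _ c]) simp
    qed
    then have "\<forall>i. \<exists>c. i < l \<longrightarrow> (\<forall>a<d. A $$ (a, i) = lin_comb d 1 k c \<phi> $$ (a, 0))"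
      by auto
    from choice[OF this] obtain c where c: "\<forall>i. i < l \<longrightarrow> (\<forall>a<d. A $$ (a, i) = lin_comb d 1 k (c i) \<phi> $$ (a, 0))" ..
    define C where "C = mat k l (\<lambda>(j, i). c i j)"
    have C: "C \<in> carrier_mat k l"
      by (simp add: C_def)
    have "A = B * C"
    proof (rule eq_matI)
      fix a i assume "a < dim_row (B * C)" "i < dim_col (B * C)"
      then have ai: "a < d" "i < l"
        using B C by auto
      have "lin_comb d 1 k (\<lambda>j. C $$ (j, i)) \<phi> = lin_comb d 1 k (c i) \<phi>"
        using ai by (intro eq_matI) (auto simp: C_def)
      then show "A $$ (a, i) = (B * C) $$ (a, i)"
        using c ai BC[OF C ai(2,1)] by simp
    qed (use A(1) B C in auto)
    then show "\<exists>C\<in>carrier_mat k l. A = B * C"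
      using C by auto
  next
    fix C :: "'k mat" assume C: "C \<in> carrier_mat k 1" "B * C = 0\<^sub>m d 1"
    have "lin_comb d 1 k (\<lambda>j. C $$ (j, 0)) \<phi> = 0\<^sub>m d 1"
      using BC[OF C(1), of 0] C(2) by (intro eq_matI) auto
    from indep[OF this] show "C = 0\<^sub>m k 1"
      using C(1) by (intro eq_matI) auto
  qed
qed

text \<open>Scalars act as multiples of the empty word.\<close>

lemma rep_submodule_smult:
  assumes "rep_submodule N d \<rho> V" and v: "v \<in> V"
  shows "c \<cdot>\<^sub>v v \<in> V"
proof -
  have vc: "v \<in> carrier_vec d"
    using assms by (auto simp: rep_submodule_def)
  let ?h = "Poly_Mapping.single (Word []) c"
  have "?h \<in> free_alg N"
    by (auto simp: free_alg_def)
  moreover have "eval_nc d \<rho> ?h *\<^sub>v v = c \<cdot>\<^sub>v v"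
  proof -
    have "eval_nc d \<rho> ?h = c \<cdot>\<^sub>m 1\<^sub>m d"
      by (rule eq_matI) (auto simp: eval_nc_def eval_word_def)
    then show ?thesis
      using vc by (intro eq_vecI) auto
  qed
  ultimately show ?thesis
    using assms unfolding rep_submodule_def by metis
qed

lemma rep_submodule_mult:
  assumes sub: "rep_submodule N d \<rho> V" and v: "v \<in> V" and \<rho>: "\<rho> \<in> mat_tuples N d" and j: "j < N"
  shows "\<rho> ! j *\<^sub>v v \<in> V"
proof -
  let ?h = "Poly_Mapping.single (Word [j]) 1"
  have "?h \<in> free_alg N"
    using j by (auto simp: free_alg_def)
  moreover have "eval_nc d \<rho> ?h = \<rho> ! j"
    using mat_tuples_nth[OF \<rho> j] by (intro eq_matI) (auto simp: eval_nc_def eval_word_def)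
  ultimately show ?thesis
    using sub v unfolding rep_submodule_def by metis
qed

definition block_diag :: "nat \<Rightarrow> nat \<Rightarrow> 'k::zero mat \<Rightarrow> 'k mat \<Rightarrow> 'k mat" where
  "block_diag d e A B = four_block_mat A (0\<^sub>m d e) (0\<^sub>m e d) B"

lemma block_diag_mult:
  assumes "A \<in> carrier_mat d d" "A' \<in> carrier_mat d d" "B \<in> carrier_mat e e" "B' \<in> carrier_mat e e"
  shows "block_diag d e A B * block_diag d e A' B' = block_diag d e (A * A') (B * (B' :: 'k::field mat))"
  unfolding block_diag_def
  using mult_four_block_mat[of A d d "0\<^sub>m d e" e "0\<^sub>m e d" e B A' d "0\<^sub>m d e" e "0\<^sub>m e d" B'] assms
  by simp

lemma inverse_pair_block_diag:
  assumes "inverse_pair d g h" "inverse_pair e g' h'"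
  shows "inverse_pair (d + e) (block_diag d e g g') (block_diag d e h h')"
  using assms by (simp add: inverse_pair_def block_diag_mult) (simp add: block_diag_def)

lemma dsum_conj:
  assumes g: "inverse_pair d g h" and g': "inverse_pair e g' h'"
    and \<rho>: "\<rho> \<in> mat_tuples N d" and \<sigma>: "\<sigma> \<in> mat_tuples N e"
  shows "dsum N d e (conj_tuple g h \<rho>) (conj_tuple g' h' \<sigma>) =
    conj_tuple (block_diag d e g g') (block_diag d e h h') (dsum N d e \<rho> \<sigma>)"
proof (rule nth_equalityI)
  fix j assume "j < length (dsum N d e (conj_tuple g h \<rho>) (conj_tuple g' h' \<sigma>))"
  then have j: "j < N"
    by (simp add: dsum_def)
  have c: "g \<in> carrier_mat d d" "h \<in> carrier_mat d d" "g' \<in> carrier_mat e e" "h' \<in> carrier_mat e e"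
    using assms by (auto simp: inverse_pair_def)
  note cj = mat_tuples_nth[OF \<rho> j] mat_tuples_nth[OF \<sigma> j]
  have "block_diag d e g g' * block_diag d e (\<rho> ! j) (\<sigma> ! j) * block_diag d e h h' =
      block_diag d e (g * \<rho> ! j * h) (g' * \<sigma> ! j * h')"
    using block_diag_mult[OF c(1) cj(1) c(3) cj(2)]
      block_diag_mult[OF mult_carrier_mat[OF c(1) cj(1)] c(2) mult_carrier_mat[OF c(3) cj(2)] c(4)] by simp
  then show "dsum N d e (conj_tuple g h \<rho>) (conj_tuple g' h' \<sigma>) ! j =
      conj_tuple (block_diag d e g g') (block_diag d e h h') (dsum N d e \<rho> \<sigma>) ! j"
    using j mat_tuples_length[OF \<rho>] mat_tuples_length[OF \<sigma>]
    by (simp add: dsum_def conj_tuple_def block_diag_def)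
qed (simp add: dsum_def conj_tuple_def)

lemma rep_sum_append:
  assumes "rep_sum N \<rho>s \<in> mat_tuples N d" and "rep_sum N \<sigma>s \<in> mat_tuples N e"
  shows "rep_sum N (\<rho>s @ \<sigma>s) = dsum N d e (rep_sum N \<rho>s) (rep_sum N \<sigma>s)"
proof (rule nth_equalityI)
  fix j assume "j < length (rep_sum N (\<rho>s @ \<sigma>s))"
  then have j: "j < N"
    by (simp add: rep_sum_def)
  have nth: "diag_block_mat (map (\<lambda>\<rho>. \<rho> ! j) \<rho>s) = rep_sum N \<rho>s ! j" for \<rho>s :: "'a mat list list"
    using j by (simp add: rep_sum_def)
  show "rep_sum N (\<rho>s @ \<sigma>s) ! j = dsum N d e (rep_sum N \<rho>s) (rep_sum N \<sigma>s) ! j"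
    using mat_tuples_nth[OF assms(1) j] mat_tuples_nth[OF assms(2) j]
    by (simp add: nth[symmetric] dsum_nth[OF j] diag_block_mat_append Let_def flip: map_append)
      (simp add: nth diag_block_mat_append Let_def)
qed (simp add: rep_sum_def dsum_def)

text \<open>Bases of two complementary submodules are the columns of \<open>B\<close> and
  \<open>B'\<close>. Invariance gives \<rho> B = B \<sigma> and \<rho> B' = B' \<sigma>', so the
  block row G = [B B'] conjugates the block sum into \<open>\<rho>\<close> once it is known to be
  square and invertible.\<close>

lemma decomposable_conj_dsum:
  fixes \<rho> :: "'k::field mat list"
  assumes \<rho>: "\<rho> \<in> mat_tuples N d" and "d > 0" and "\<not> indecomposable N d \<rho>"
  shows "\<exists>d1 d2 \<sigma>1 \<sigma>2 g h. 0 < d1 \<and> 0 < d2 \<and> d = d1 + d2 \<and> \<sigma>1 \<in> mat_tuples N d1 \<and> \<sigma>2 \<in> mat_tuples N d2 \<and>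
    inverse_pair d g h \<and> \<rho> = conj_tuple g h (dsum N d1 d2 \<sigma>1 \<sigma>2)"
proof -
  have "\<exists>V W. rep_submodule N d \<rho> V \<and> rep_submodule N d \<rho> W \<and> V \<inter> W = {0\<^sub>v d} \<and>
    {v + w |v w. v \<in> V \<and> w \<in> W} = carrier_vec d \<and> V \<noteq> {0\<^sub>v d} \<and> W \<noteq> {0\<^sub>v d}"
    using assms(2,3) unfolding indecomposable_def by simp
  then obtain V W where VW: "rep_submodule N d \<rho> V" "rep_submodule N d \<rho> W" "V \<inter> W = {0\<^sub>v d}"
    "{v + w |v w. v \<in> V \<and> w \<in> W} = carrier_vec d" "V \<noteq> {0\<^sub>v d}" "W \<noteq> {0\<^sub>v d}"
    by (elim exE conjE)
  have basis: "\<exists>k B. 0 < k \<and> B \<in> carrier_mat d k \<and>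
    (\<forall>l C i. C \<in> carrier_mat k l \<longrightarrow> i < l \<longrightarrow> col (B * C) i \<in> U) \<and>
    (\<forall>l A. A \<in> carrier_mat d l \<longrightarrow> (\<forall>i<l. col A i \<in> U) \<longrightarrow> (\<exists>C\<in>carrier_mat k l. A = B * C)) \<and>
    (\<forall>C. C \<in> carrier_mat k 1 \<longrightarrow> B * C = 0\<^sub>m d 1 \<longrightarrow> C = 0\<^sub>m k 1) \<and>
    (\<exists>\<sigma>\<in>mat_tuples N k. \<forall>j<N. \<rho> ! j * B = B * \<sigma> ! j)"
    if U: "rep_submodule N d \<rho> U" "U \<noteq> {0\<^sub>v d}" for U
  proof -
    have Uc: "U \<subseteq> carrier_vec d" "0\<^sub>v d \<in> U" and Ua: "\<forall>v\<in>U. \<forall>w\<in>U. v + w \<in> U"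
      using U(1) by (auto simp: rep_submodule_def)
    have Us: "\<forall>c. \<forall>v\<in>U. c \<cdot>\<^sub>v v \<in> U"
      using rep_submodule_smult[OF U(1)] by simp
    from vec_subspace_basis[OF Uc Ua Us]
    obtain k B where B: "B \<in> carrier_mat d k"
      and BU: "\<forall>l C i. C \<in> carrier_mat k l \<longrightarrow> i < l \<longrightarrow> col (B * C) i \<in> U"
      and UB: "\<forall>l A. A \<in> carrier_mat d l \<longrightarrow> (\<forall>i<l. col A i \<in> U) \<longrightarrow> (\<exists>C\<in>carrier_mat k l. A = B * C)"
      and Binj: "\<forall>C. C \<in> carrier_mat k 1 \<longrightarrow> B * C = 0\<^sub>m d 1 \<longrightarrow> C = 0\<^sub>m k 1"
      by (elim exE conjE)
    have "0 < k"
    proof (rule ccontr)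
      assume "\<not> 0 < k"
      obtain v where v: "v \<in> U" "v \<noteq> 0\<^sub>v d"
        using U(2) Uc(2) by auto
      have vc: "v \<in> carrier_vec d"
        using v Uc by auto
      define A where "A = mat d 1 (\<lambda>(a, _). v $ a)"
      have "col A 0 = v"
        using vc by (intro eq_vecI) (auto simp: A_def)
      then obtain C where "C \<in> carrier_mat k 1" "A = B * C"
        using UB[rule_format, of A 1] v(1) by (auto simp: A_def)
      then have "A = 0\<^sub>m d 1"
        using B \<open>\<not> 0 < k\<close> by (intro eq_matI) (auto simp: scalar_prod_def)
      then have "col A 0 = 0\<^sub>v d"
        by simp
      then show False
        using \<open>col A 0 = v\<close> v(2) by simp
    qed
    moreover have "\<exists>\<sigma>\<in>mat_tuples N k. \<forall>j<N. \<rho> ! j * B = B * \<sigma> ! j"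
    proof -
      have "\<exists>C\<in>carrier_mat k k. \<rho> ! j * B = B * C" if j: "j < N" for j
      proof (rule UB[rule_format])
        note \<rho>j = mat_tuples_nth[OF \<rho> j]
        show "\<rho> ! j * B \<in> carrier_mat d k"
          by (rule mult_carrier_mat[OF \<rho>j B])
        fix i assume i: "i < k"
        have "col B i = col (B * 1\<^sub>m k) i"
          using right_mult_one_mat[OF B] by simp
        then have "col B i \<in> U"
          using BU[rule_format, of "1\<^sub>m k" k i] i by simp
        then have "\<rho> ! j *\<^sub>v col B i \<in> U"
          by (rule rep_submodule_mult[OF U(1) _ \<rho> j])
        then show "col (\<rho> ! j * B) i \<in> U"
          using col_mult2[OF \<rho>j B i] by simp
      qed
      then have "\<forall>j. \<exists>C. j < N \<longrightarrow> C \<in> carrier_mat k k \<and> \<rho> ! j * B = B * C"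
        by blast
      from choice[OF this] obtain \<sigma> where \<sigma>: "\<forall>j. j < N \<longrightarrow> \<sigma> j \<in> carrier_mat k k \<and> \<rho> ! j * B = B * \<sigma> j" ..
      then show ?thesis
        by (intro bexI[of _ "map \<sigma> [0..<N]"]) (auto simp: mat_tuples_def)
    qed
    ultimately show ?thesis
      using B BU UB Binj by (intro exI[of _ k] exI[of _ B] conjI)
  qed
  from basis[OF VW(1,5)] obtain k B where k: "0 < k" and B: "B \<in> carrier_mat d k"
    and BV: "\<forall>l C i. C \<in> carrier_mat k l \<longrightarrow> i < l \<longrightarrow> col (B * C) i \<in> V"
    and VB: "\<forall>l A. A \<in> carrier_mat d l \<longrightarrow> (\<forall>i<l. col A i \<in> V) \<longrightarrow> (\<exists>C\<in>carrier_mat k l. A = B * C)"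
    and Binj: "\<forall>C. C \<in> carrier_mat k 1 \<longrightarrow> B * C = 0\<^sub>m d 1 \<longrightarrow> C = 0\<^sub>m k 1"
    and \<sigma>: "\<exists>\<sigma>\<in>mat_tuples N k. \<forall>j<N. \<rho> ! j * B = B * \<sigma> ! j"
    by (elim exE conjE)
  from basis[OF VW(2,6)] obtain k' B' where k': "0 < k'" and B': "B' \<in> carrier_mat d k'"
    and BV': "\<forall>l C i. C \<in> carrier_mat k' l \<longrightarrow> i < l \<longrightarrow> col (B' * C) i \<in> W"
    and VB': "\<forall>l A. A \<in> carrier_mat d l \<longrightarrow> (\<forall>i<l. col A i \<in> W) \<longrightarrow> (\<exists>C\<in>carrier_mat k' l. A = B' * C)"
    and Binj': "\<forall>C. C \<in> carrier_mat k' 1 \<longrightarrow> B' * C = 0\<^sub>m d 1 \<longrightarrow> C = 0\<^sub>m k' 1"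
    and \<sigma>': "\<exists>\<sigma>\<in>mat_tuples N k'. \<forall>j<N. \<rho> ! j * B' = B' * \<sigma> ! j"
    by (elim exE conjE)
  from \<sigma> obtain \<sigma> where \<sigma>: "\<sigma> \<in> mat_tuples N k" "\<forall>j<N. \<rho> ! j * B = B * \<sigma> ! j" ..
  from \<sigma>' obtain \<sigma>' where \<sigma>': "\<sigma>' \<in> mat_tuples N k'" "\<forall>j<N. \<rho> ! j * B' = B' * \<sigma>' ! j" ..
  define G where "G = hcat B B'"
  have G: "G \<in> carrier_mat d (k + k')"
    using B B' by (simp add: G_def)
  \<comment> \<open>V + W is everything: decomposing the unit vectors gives a right inverse of
    \<open>G\<close>.\<close>
  have "\<forall>i. \<exists>vw. i < d \<longrightarrow> fst vw \<in> V \<and> snd vw \<in> W \<and> unit_vec d i = fst vw + snd vw"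
  proof
    fix i
    have "(unit_vec d i :: 'k vec) \<in> {v + w |v w. v \<in> V \<and> w \<in> W}"
      unfolding VW(4) by simp
    then obtain v w where "unit_vec d i = v + w" "v \<in> V" "w \<in> W"
      by auto
    then show "\<exists>vw. i < d \<longrightarrow> fst vw \<in> V \<and> snd vw \<in> W \<and> unit_vec d i = fst vw + snd vw"
      by (intro exI[of _ "(v, w)"]) simp
  qed
  from choice[OF this] obtain vw
    where vw: "\<forall>i. i < d \<longrightarrow> fst (vw i) \<in> V \<and> snd (vw i) \<in> W \<and> unit_vec d i = fst (vw i) + snd (vw i)" ..
  have vwc: "fst (vw i) \<in> carrier_vec d" "snd (vw i) \<in> carrier_vec d" if "i < d" for i
    using vw that VW(1,2) by (auto simp: rep_submodule_def)
  define A where "A = mat d d (\<lambda>(a, i). fst (vw i) $ a)"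
  define A' where "A' = mat d d (\<lambda>(a, i). snd (vw i) $ a)"
  have cols: "col A i = fst (vw i)" "col A' i = snd (vw i)" if "i < d" for i
    using vwc[OF that] that by (auto simp: A_def A'_def intro!: eq_vecI)
  obtain C where C: "C \<in> carrier_mat k d" "A = B * C"
    using VB[rule_format, of A d] cols vw by (auto simp: A_def)
  obtain C' where C': "C' \<in> carrier_mat k' d" "A' = B' * C'"
    using VB'[rule_format, of A' d] cols vw by (auto simp: A'_def)
  have "A + A' = 1\<^sub>m d"
  proof (rule eq_matI)
    fix a i assume "a < dim_row (1\<^sub>m d :: 'k mat)" "i < dim_col (1\<^sub>m d :: 'k mat)"
    then have ai: "a < d" "i < d"
      by simp_all
    have "(unit_vec d i :: 'k vec) $ a = (fst (vw i) + snd (vw i)) $ a"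
      using vw ai(2) by simp
    then show "(A + A') $$ (a, i) = 1\<^sub>m d $$ (a, i)"
      using ai vwc[OF ai(2)] by (simp add: A_def A'_def unit_vec_def)
  qed (simp_all add: A_def A'_def)
  then have GC: "G * vcat C C' = 1\<^sub>m d"
    unfolding G_def hcat_mult_vcat[OF B B' C(1) C'(1)] by (simp add: C(2) C'(2))
  have "d \<le> k + k'"
    by (rule left_inverse_dim_le[OF G _ GC]) (use C C' in simp)
  \<comment> \<open>V and W meet in 0: a kernel vector of \<open>G\<close> would give B Y = - B' Y',
    an element of both.\<close>
  moreover have "k + k' \<le> d"
  proof (rule ccontr)
    assume "\<not> k + k' \<le> d"
    then obtain v where v: "v \<in> carrier_vec (k + k')" "v \<noteq> 0\<^sub>v (k + k')" "G *\<^sub>v v = 0\<^sub>v d"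
      using wide_mat_kernel[OF G] by auto
    define X where "X = mat (k + k') 1 (\<lambda>(a, _). v $ a)"
    have colX: "col X 0 = v"
      using v(1) by (intro eq_vecI) (auto simp: X_def)
    have "G * X = 0\<^sub>m d 1"
    proof (rule eq_matI)
      fix a b assume "a < dim_row (0\<^sub>m d 1 :: 'k mat)" "b < dim_col (0\<^sub>m d 1 :: 'k mat)"
      then have ab: "a < d" "b = 0"
        by simp_all
      have "(G * X) $$ (a, 0) = (G *\<^sub>v v) $ a"
        using G ab colX by (simp add: X_def)
      then show "(G * X) $$ (a, b) = 0\<^sub>m d 1 $$ (a, b)"
        using v(3) ab by simp
    qed (use G in \<open>auto simp: X_def\<close>)
    moreover obtain Y Y' where Y: "Y \<in> carrier_mat k 1" "Y' \<in> carrier_mat k' 1" "X = vcat Y Y'"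
      using vcat_split[of X k k' 1] by (auto simp: X_def)
    ultimately have sum: "B * Y + B' * Y' = 0\<^sub>m d 1"
      using hcat_mult_vcat[OF B B' Y(1,2)] by (simp add: G_def)
    have BY: "B * Y \<in> carrier_mat d 1" "B' * Y' \<in> carrier_mat d 1"
      using B B' Y by auto
    have "col (B * Y) 0 = (- 1) \<cdot>\<^sub>v col (B' * Y') 0"
    proof (rule eq_vecI)
      fix a assume "a < dim_vec ((- 1) \<cdot>\<^sub>v col (B' * Y') 0)"
      then have a: "a < d"
        using B' by simp
      have "(B * Y + B' * Y') $$ (a, 0) = 0"
        using a by (simp add: sum)
      moreover have "(B * Y + B' * Y') $$ (a, 0) = (B * Y) $$ (a, 0) + (B' * Y') $$ (a, 0)"
        by (rule index_add_mat(1)) (use a BY(2) in \<open>simp_all only: carrier_matD zero_less_one\<close>)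
      ultimately have "(B * Y) $$ (a, 0) + (B' * Y') $$ (a, 0) = 0"
        by simp
      then show "col (B * Y) 0 $ a = ((- 1) \<cdot>\<^sub>v col (B' * Y') 0) $ a"
        using a BY by (simp add: add_eq_0_iff2 del: index_mult_mat)
    qed (use B B' in simp)
    then have "col (B * Y) 0 \<in> V \<inter> W"
      using BV[rule_format, OF Y(1), of 0] rep_submodule_smult[OF VW(2) BV'[rule_format, OF Y(2), of 0], of "- 1"] by simp
    then have c0: "col (B * Y) 0 = 0\<^sub>v d"
      using VW(3) by simp
    have BY0: "B * Y = 0\<^sub>m d 1"
    proof (rule eq_matI)
      fix a b assume "a < dim_row (0\<^sub>m d 1 :: 'k mat)" "b < dim_col (0\<^sub>m d 1 :: 'k mat)"
      then show "(B * Y) $$ (a, b) = 0\<^sub>m d 1 $$ (a, b)"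
        using arg_cong[OF c0, of "\<lambda>u. u $ a"] BY by (simp del: index_mult_mat)
    qed (use BY in auto)
    then have "B' * Y' = 0\<^sub>m d 1"
      using sum BY(2) by simp
    then have "Y = 0\<^sub>m k 1" "Y' = 0\<^sub>m k' 1"
      using BY0 Binj Binj' Y by auto
    then have "X = 0\<^sub>m (k + k') 1"
      unfolding Y(3) by (auto simp: vcat_def)
    then show False
      using colX v(2) by simp
  qed
  ultimately have d: "d = k + k'"
    by simp
  have Gd: "G \<in> carrier_mat d d"
    using G d by simp
  have "det G * det (vcat C C') = 1"
    using det_mult[of G d "vcat C C'"] GC Gd vcat_carrier[OF C(1) C'(1)] d by simp
  then have "det G \<noteq> 0"
    by auto
  from inverse_pair_exists[OF Gd this] obtain H where H: "inverse_pair d G H" ..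
  have "\<rho> = conj_tuple G H (dsum N k k' \<sigma> \<sigma>')"
  proof (rule nth_equalityI)
    show "length \<rho> = length (conj_tuple G H (dsum N k k' \<sigma> \<sigma>'))"
      by (simp add: conj_tuple_def dsum_def mat_tuples_length[OF \<rho>])
    fix j assume "j < length \<rho>"
    then have j: "j < N"
      by (simp add: mat_tuples_length[OF \<rho>])
    note \<rho>j = mat_tuples_nth[OF \<rho> j] and \<sigma>j = mat_tuples_nth[OF \<sigma>(1) j] mat_tuples_nth[OF \<sigma>'(1) j]
    have "\<rho> ! j * G = G * dsum N k k' \<sigma> \<sigma>' ! j"
      unfolding G_def mult_hcat[OF \<rho>j B B'] dsum_nth[OF j] hcat_mult_block[OF B B' \<sigma>j]
      using \<sigma>(2) \<sigma>'(2) j by simp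
    then have "\<rho> ! j = G * dsum N k k' \<sigma> \<sigma>' ! j * H"
      using cancel_right(1)[OF H \<rho>j] by simp
    then show "\<rho> ! j = conj_tuple G H (dsum N k k' \<sigma> \<sigma>') ! j"
      using j by (simp add: conj_tuple_def dsum_def)
  qed
  then show ?thesis
    using k k' d \<sigma>(1) \<sigma>'(1) H
    by (intro exI[of _ k] exI[of _ k'] exI[of _ \<sigma>] exI[of _ \<sigma>'] exI[of _ G] exI[of _ H]) simp
qed

section \<open>The action of the general linear group\<close>

lemma reg_mat_entry:
  "j < k \<Longrightarrow> a < m \<Longrightarrow> b < d \<Longrightarrow> (\<lambda>l. l ! j $$ (a, b)) \<in> reg (mat_space k m d)"
  by (rule reg.gen) (auto simp: mat_space_def)

lemma morphism_mat_space:
  assumes "\<And>p. p \<in> pts S \<Longrightarrow> \<phi> p \<in> pts (mat_space k m d)"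
    and "\<And>j a b. j < k \<Longrightarrow> a < m \<Longrightarrow> b < d \<Longrightarrow> (\<lambda>p. \<phi> p ! j $$ (a, b)) \<in> reg S"
  shows "morphism S (mat_space k m d) \<phi>"
  using assms by (auto simp: morphism_def mat_space_def)

definition reg_mat :: "('p, 'k::field) space \<Rightarrow> nat \<Rightarrow> nat \<Rightarrow> ('p \<Rightarrow> 'k mat) \<Rightarrow> bool" where
  "reg_mat S m d M \<longleftrightarrow> (\<forall>p\<in>pts S. M p \<in> carrier_mat m d) \<and> (\<forall>a<m. \<forall>b<d. (\<lambda>p. M p $$ (a, b)) \<in> reg S)"

lemma reg_mat_mult:
  assumes A: "reg_mat S m n A" and B: "reg_mat S n d B"
  shows "reg_mat S m d (\<lambda>p. A p * B p)"
  unfolding reg_mat_def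
proof (intro conjI ballI allI impI)
  show "A p * B p \<in> carrier_mat m d" if "p \<in> pts S" for p
    using assms that by (auto simp: reg_mat_def)
  fix a b assume ab: "a < m" "b < d"
  have "(\<lambda>p. \<Sum>i\<in>{0..<n}. A p $$ (a, i) * B p $$ (i, b)) \<in> reg S"
    using assms ab by (intro reg_sum reg.mult) (auto simp: reg_mat_def)
  then show "(\<lambda>p. (A p * B p) $$ (a, b)) \<in> reg S"
  proof (rule reg.cong)
    fix p assume "p \<in> pts S"
    then have "A p \<in> carrier_mat m n" "B p \<in> carrier_mat n d"
      using assms by (auto simp: reg_mat_def)
    then show "(A p * B p) $$ (a, b) = (\<Sum>i\<in>{0..<n}. A p $$ (a, i) * B p $$ (i, b))"
      using ab by (simp add: scalar_prod_def)
  qed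
qed

lemma reg_mat_nth: "j < k \<Longrightarrow> reg_mat (mat_space k m d) m d (\<lambda>l. l ! j)"
  by (auto simp: reg_mat_def dom_mat_space reg_mat_entry)

lemma reg_mat_comp:
  assumes "morphism S T \<phi>" "reg_mat T m d M"
  shows "reg_mat S m d (\<lambda>p. M (\<phi> p))"
  unfolding reg_mat_def
proof (intro conjI ballI allI impI)
  show "M (\<phi> p) \<in> carrier_mat m d" if "p \<in> pts S" for p
    using assms(2) morphism_pts[OF assms(1) that] by (simp add: reg_mat_def)
  show "(\<lambda>p. M (\<phi> p) $$ (a, b)) \<in> reg S" if "a < m" "b < d" for a b
    by (rule morphism_reg[OF assms(1)]) (use assms(2) that in \<open>simp add: reg_mat_def\<close>)
qed

lemma reg_mat_const: "A \<in> carrier_mat m d \<Longrightarrow> reg_mat S m d (\<lambda>_. A)"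
  by (auto simp: reg_mat_def intro: reg.const)

lemma pts_mat_space: "pts (mat_space N d d) = mat_tuples N d"
  by (auto simp: mat_space_def mat_tuples_def)

abbreviation rep_space :: "nat \<Rightarrow> nat \<Rightarrow> ('k mat list, 'k::field) space" where
  "rep_space N d \<equiv> mat_space N d d"

text \<open>Each group element is stored with its inverse, which makes the group a closed set of
  pairs of matrices and the conjugation map polynomial.\<close>

definition GL :: "nat \<Rightarrow> 'k::field mat list set" where
  "GL d = {[g, h] |g h. inverse_pair d g h}"

lemma morphism_conj:
  "morphism (mat_space 2 d d \<otimes>\<^sub>s rep_space N d) (rep_space N d)
     (\<lambda>z. conj_tuple (fst z ! 0) (fst z ! 1) (snd z))"
proof (rule morphism_mat_space)
  let ?S = "mat_space 2 d d \<otimes>\<^sub>s rep_space N d :: ('a mat list \<times> 'a mat list, 'a) space"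
  have mat: "reg_mat ?S d d (\<lambda>z. fst z ! 0 * snd z ! j * fst z ! 1)" if "j < N" for j
    by (intro reg_mat_mult[of _ d d _ d] reg_mat_comp[OF morphism_fst reg_mat_nth] reg_mat_comp[OF morphism_snd reg_mat_nth])
      (use that in auto)
  show "conj_tuple (fst p ! 0) (fst p ! 1) (snd p) \<in> pts (rep_space N d)" if p: "p \<in> pts ?S" for p
  proof -
    have "snd p \<in> pts (rep_space N d)"
      using p by auto
    then have "length (snd p) = N"
      by (simp add: dom_mat_space)
    moreover have "fst p ! 0 * snd p ! j * fst p ! 1 \<in> carrier_mat d d" if "j < N" for j
      using mat[OF that] p unfolding reg_mat_def by blast
    ultimately show ?thesis
      by (simp add: dom_mat_space conj_tuple_def)
  qed
  show "(\<lambda>p. conj_tuple (fst p ! 0) (fst p ! 1) (snd p) ! j $$ (a, b)) \<in> reg ?S"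
    if "j < N" "a < d" "b < d" for j a b
  proof (rule reg.cong)
    show "(\<lambda>z. (fst z ! 0 * snd z ! j * fst z ! 1) $$ (a, b)) \<in> reg ?S"
      using mat[OF that(1)] that(2,3) by (simp add: reg_mat_def)
    fix p :: "'a mat list \<times> 'a mat list" assume "p \<in> pts ?S"
    then have "snd p \<in> pts (rep_space N d)"
      by auto
    then show "conj_tuple (fst p ! 0) (fst p ! 1) (snd p) ! j $$ (a, b) = (fst p ! 0 * snd p ! j * fst p ! 1) $$ (a, b)"
      using that(1) by (simp add: dom_mat_space conj_tuple_def)
  qed
qed

lemma morphism_dsum:
  "morphism (rep_space N d \<otimes>\<^sub>s rep_space N e) (rep_space N (d + e)) (\<lambda>z. dsum N d e (fst z) (snd z))"
proof (rule morphism_mat_space)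
  let ?S = "rep_space N d \<otimes>\<^sub>s rep_space N e :: ('a mat list \<times> 'a mat list, 'a) space"
  show "dsum N d e (fst p) (snd p) \<in> pts (rep_space N (d + e))" if "p \<in> pts ?S" for p
    using that dsum_mat_tuples[of "fst p" N d "snd p" e] by (auto simp: pts_mat_space)
  show "(\<lambda>p. dsum N d e (fst p) (snd p) ! j $$ (a, b)) \<in> reg ?S" if j: "j < N" "a < d + e" "b < d + e" for j a b
  proof (rule reg.cong)
    show "(if a < d then if b < d then (\<lambda>z. fst z ! j $$ (a, b)) else (\<lambda>_. 0)
        else if b < d then (\<lambda>_. 0) else (\<lambda>z. snd z ! j $$ (a - d, b - d))) \<in> reg ?S"
      using j by (auto intro: reg.const reg_fst[OF reg_mat_entry] reg_snd[OF reg_mat_entry])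
    fix p :: "'a mat list \<times> 'a mat list" assume "p \<in> pts ?S"
    then have "fst p ! j \<in> carrier_mat d d" "snd p ! j \<in> carrier_mat e e"
      using j(1) by (auto simp: dom_mat_space)
    then show "dsum N d e (fst p) (snd p) ! j $$ (a, b) = (if a < d then if b < d then (\<lambda>z. fst z ! j $$ (a, b)) else (\<lambda>_. 0)
        else if b < d then (\<lambda>_. 0) else (\<lambda>z. snd z ! j $$ (a - d, b - d))) p"
      using j by (simp add: dsum_nth)
  qed
qed

lemma poly_nonroot_exists:
  fixes P :: "'k::alg_closed_field poly"
  assumes "P \<noteq> 0"
  shows "\<exists>x. poly P x \<noteq> 0"
proof -
  have "finite {x. poly P x = 0}"
    by (rule poly_roots_finite[OF assms])
  from ex_new_if_finite[OF infinite_UNIV_alg_closed this] show ?thesis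
    by simp
qed

text \<open>Two invertible matrices lie on a line, along which regular functions on \<open>GL d\<close> restrict to
  rational functions of one variable with denominator a power of the determinant.\<close>

lemma irr_GL: "irr (mat_space 2 d d) (GL d :: 'k::alg_closed_field mat list set)"
  unfolding irr_def
proof (intro conjI ballI impI)
  let ?S = "mat_space 2 d d :: ('k mat list, 'k) space"
  show "GL d \<subseteq> pts ?S"
    by (auto simp: GL_def dom_mat_space inverse_pair_def nth_Cons' less_2_cases_iff)
  show "GL d \<noteq> ({} :: 'k mat list set)"
    using inverse_pair_one by (auto simp: GL_def)
  fix f f' assume f: "f \<in> reg ?S" and f': "f' \<in> reg ?S"
    and "\<exists>p\<in>GL d. f p \<noteq> 0" "\<exists>p\<in>GL d. f' p \<noteq> 0"
  then obtain g0 h0 g1 h1 where g0: "inverse_pair d g0 h0" "f [g0, h0] \<noteq> 0"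
    and g1: "inverse_pair d g1 h1" "f' [g1, h1] \<noteq> 0"
    by (auto simp: GL_def)
  have c: "g0 \<in> carrier_mat d d" "g1 \<in> carrier_mat d d"
    using g0 g1 by (auto simp: inverse_pair_def)
  \<comment> \<open>The line through \<open>g0\<close> and \<open>g1\<close> as one matrix over the
    polynomial ring; \<open>D\<close> is its determinant.\<close>
  define M where "M = mat d d (\<lambda>(a, b). [:g0 $$ (a, b), g1 $$ (a, b) - g0 $$ (a, b):])"
  define D where "D = det M"
  have M: "M \<in> carrier_mat d d"
    by (simp add: M_def)
  note adj = adj_mat[OF M]
  define g where "g t = map_mat (\<lambda>p. poly p t) M" for t
  \<comment> \<open>The inverse along the line, by the adjugate; it is meaningful where
    \<open>D\<close> does not vanish.\<close>
  define h where "h t = inverse (poly D t) \<cdot>\<^sub>m map_mat (\<lambda>p. poly p t) (adj_mat M)" for t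
  have gh: "inverse_pair d (g t) (h t)" if "poly D t \<noteq> 0" for t
  proof -
    have hom: "semiring_hom (\<lambda>p. poly p t)"
      by unfold_locales auto
    have gc: "g t \<in> carrier_mat d d" "map_mat (\<lambda>p. poly p t) (adj_mat M) \<in> carrier_mat d d"
      using M adj(1) by (simp_all add: g_def)
    have one: "map_mat (\<lambda>p. poly p t) (D \<cdot>\<^sub>m 1\<^sub>m d) = poly D t \<cdot>\<^sub>m 1\<^sub>m d"
      by (rule eq_matI) auto
    have "g t * map_mat (\<lambda>p. poly p t) (adj_mat M) = poly D t \<cdot>\<^sub>m 1\<^sub>m d"
      "map_mat (\<lambda>p. poly p t) (adj_mat M) * g t = poly D t \<cdot>\<^sub>m 1\<^sub>m d"
      using semiring_hom.mat_hom_mult[OF hom M adj(1)] semiring_hom.mat_hom_mult[OF hom adj(1) M] one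
      by (simp_all add: g_def adj D_def)
    then show ?thesis
      using gc that mult_smult_distrib[OF gc, of "inverse (poly D t)"] mult_smult_assoc_mat[OF gc(2,1), of "inverse (poly D t)"]
      by (auto simp: inverse_pair_def h_def intro!: eq_matI)
  qed
  have pt: "[g t, h t] \<in> pts ?S" if "poly D t \<noteq> 0" for t
    using gh[OF that] by (auto simp: dom_mat_space inverse_pair_def less_2_cases_iff)
  \<comment> \<open>Clearing denominators by a power of \<open>D\<close> turns a regular function
    along the line into a polynomial in t.\<close>
  have rational: "\<exists>P k. \<forall>t. poly D t \<noteq> 0 \<longrightarrow> f [g t, h t] * poly D t ^ k = poly P t" if "f \<in> reg ?S" for f
    using that
  proof induction
    case (const c)
    show ?case
      by (intro exI[of _ "[:c:]"] exI[of _ 0]) simp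
  next
    case (gen x)
    then obtain j a b where x: "x = (\<lambda>l. l ! j $$ (a, b))" "j < 2" "a < d" "b < d"
      by (auto simp: mat_space_def)
    show ?case
    proof (cases "j = 0")
      case True
      then show ?thesis
        using x M by (intro exI[of _ "M $$ (a, b)"] exI[of _ 0]) (simp add: g_def)
    next
      case False
      then have "j = 1"
        using x(2) by simp
      then show ?thesis
        using x adj(1) by (intro exI[of _ "adj_mat M $$ (a, b)"] exI[of _ 1]) (simp add: h_def)
    qed
  next
    case (add f f')
    then obtain P k P' k' where "\<forall>t. poly D t \<noteq> 0 \<longrightarrow> f [g t, h t] * poly D t ^ k = poly P t"
      "\<forall>t. poly D t \<noteq> 0 \<longrightarrow> f' [g t, h t] * poly D t ^ k' = poly P' t"
      by (elim exE)
    then show ?case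
      by (intro exI[of _ "P * D ^ k' + P' * D ^ k"] exI[of _ "k + k'"])
        (simp add: algebra_simps power_add)
  next
    case (mult f f')
    then obtain P k P' k' where "\<forall>t. poly D t \<noteq> 0 \<longrightarrow> f [g t, h t] * poly D t ^ k = poly P t"
      "\<forall>t. poly D t \<noteq> 0 \<longrightarrow> f' [g t, h t] * poly D t ^ k' = poly P' t"
      by (elim exE)
    note P = this
    show ?case
    proof (intro exI[of _ "P * P'"] exI[of _ "k + k'"] allI impI)
      fix t assume t: "poly D t \<noteq> 0"
      have "f [g t, h t] * f' [g t, h t] * poly D t ^ (k + k') =
          (f [g t, h t] * poly D t ^ k) * (f' [g t, h t] * poly D t ^ k')"
        by (simp add: power_add algebra_simps)
      then show "f [g t, h t] * f' [g t, h t] * poly D t ^ (k + k') = poly (P * P') t"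
        using P t by simp
    qed
  next
    case (cong f f')
    then show ?case
      using pt by simp
  qed
  obtain P k where P: "\<forall>t. poly D t \<noteq> 0 \<longrightarrow> f [g t, h t] * poly D t ^ k = poly P t"
    using rational[OF f] by (elim exE)
  obtain P' k' where P': "\<forall>t. poly D t \<noteq> 0 \<longrightarrow> f' [g t, h t] * poly D t ^ k' = poly P' t"
    using rational[OF f'] by (elim exE)
  have end_points: "g 0 = g0" "g 1 = g1"
    using c by (auto simp: g_def M_def intro!: eq_matI)
  have D: "poly D t = det (g t)" for t
  proof -
    have "comm_ring_hom (\<lambda>p. poly p t)"
      by unfold_locales auto
    from comm_ring_hom.hom_det[OF this] show ?thesis
      by (simp add: D_def g_def)
  qed
  \<comment> \<open>Inverses are unique, so the end points of the line are the given pairs and not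
    just pairs with the same first component.\<close>
  have uniq: "h t = h'" if "inverse_pair d (g t) h'" "poly D t \<noteq> 0" for t h'
  proof -
    have "h t = h' * (g t * h t)"
      using cancel_left(2)[OF that(1), of "h t" d] gh[OF that(2)] by (simp add: inverse_pair_def)
    then show ?thesis
      using gh[OF that(2)] that(1) right_mult_one_mat[of h' d d] by (simp add: inverse_pair_def)
  qed
  have D0: "poly D 0 \<noteq> 0" and D1: "poly D 1 \<noteq> 0"
    using inverse_pair_det[OF g0(1)] inverse_pair_det[OF g1(1)] by (simp_all add: D end_points)
  have "h 0 = h0" "h 1 = h1"
    using uniq[OF _ D0] uniq[OF _ D1] g0(1) g1(1) by (simp_all add: end_points)
  then have "f [g0, h0] * poly D 0 ^ k = poly P 0" "f' [g1, h1] * poly D 1 ^ k' = poly P' 1"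
    using P[rule_format, OF D0] P'[rule_format, OF D1] end_points by simp_all
  then have "poly P 0 \<noteq> 0" "poly P' 1 \<noteq> 0"
    using D0 D1 g0(2) g1(2) by (metis mult_eq_0_iff power_not_zero)+
  \<comment> \<open>\<open>D\<close> is kept as a factor so that the chosen parameter also yields an
    invertible matrix.\<close>
  then have "P * P' * D \<noteq> 0"
    using D0 by auto
  from poly_nonroot_exists[OF this] obtain t where "poly (P * P' * D) t \<noteq> 0" ..
  then have t: "poly P t \<noteq> 0" "poly P' t \<noteq> 0" "poly D t \<noteq> 0"
    by auto
  then have "f [g t, h t] \<noteq> 0" "f' [g t, h t] \<noteq> 0"
    using P P' by auto
  moreover have "[g t, h t] \<in> GL d"
    using gh[OF t(3)] by (auto simp: GL_def)
  ultimately show "\<exists>p\<in>GL d. f p \<noteq> 0 \<and> f' p \<noteq> 0"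
    by (intro bexI[of _ "[g t, h t]"]) simp_all
qed

section \<open>The Zariski topology\<close>

lemma poly_funs_reg: "f \<in> poly_funs N d \<Longrightarrow> f \<in> reg (rep_space N d)"
  by (induction rule: poly_funs.induct) (auto intro: reg.const reg_mat_entry reg.add reg.mult)

lemma reg_poly_funs:
  assumes "f \<in> reg (rep_space N d)"
  shows "\<exists>g\<in>poly_funs N d. \<forall>\<rho>\<in>mat_tuples N d. g \<rho> = f \<rho>"
  using assms
proof induction
  case (const c)
  show ?case
    by (intro bexI[of _ "\<lambda>_. c"] poly_funs.const) simp
next
  case (gen x)
  then obtain j a b where "x = (\<lambda>l. l ! j $$ (a, b))" "j < N" "a < d" "b < d"
    by (auto simp: mat_space_def)
  then show ?case
    by (intro bexI[of _ x]) (auto intro: poly_funs.coord)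
next
  case (add f g)
  from add.IH obtain f' where f': "f' \<in> poly_funs N d" "\<forall>\<rho>\<in>mat_tuples N d. f' \<rho> = f \<rho>"
    by (elim bexE)
  from add.IH obtain g' where g': "g' \<in> poly_funs N d" "\<forall>\<rho>\<in>mat_tuples N d. g' \<rho> = g \<rho>"
    by (elim bexE)
  show ?case
    using f' g' by (intro bexI[of _ "\<lambda>\<rho>. f' \<rho> + g' \<rho>"] poly_funs.add) simp_all
next
  case (mult f g)
  from mult.IH obtain f' where f': "f' \<in> poly_funs N d" "\<forall>\<rho>\<in>mat_tuples N d. f' \<rho> = f \<rho>"
    by (elim bexE)
  from mult.IH obtain g' where g': "g' \<in> poly_funs N d" "\<forall>\<rho>\<in>mat_tuples N d. g' \<rho> = g \<rho>"
    by (elim bexE)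
  show ?case
    using f' g' by (intro bexI[of _ "\<lambda>\<rho>. f' \<rho> * g' \<rho>"] poly_funs.mult) simp_all
next
  case (cong f g)
  from cong.IH obtain f' where "f' \<in> poly_funs N d" "\<forall>\<rho>\<in>mat_tuples N d. f' \<rho> = f \<rho>"
    by (elim bexE)
  then show ?case
    using cong.hyps(2) by (intro bexI[of _ f']) (simp_all add: pts_mat_space)
qed

lemma zariski_closed_iff:
  "zariski_closed N d C \<longleftrightarrow> (\<exists>F\<subseteq>reg (rep_space N d). C = zeros (rep_space N d) F)"
proof
  assume "zariski_closed N d C"
  then obtain F where F: "F \<subseteq> poly_funs N d" "C = {\<rho> \<in> mat_tuples N d. \<forall>f\<in>F. f \<rho> = 0}"
    unfolding zariski_closed_def by (elim exE conjE)
  then show "\<exists>F\<subseteq>reg (rep_space N d). C = zeros (rep_space N d) F"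
    using poly_funs_reg by (intro exI[of _ F]) (auto simp: zeros_def pts_mat_space)
next
  assume "\<exists>F\<subseteq>reg (rep_space N d). C = zeros (rep_space N d) F"
  then obtain F where F: "F \<subseteq> reg (rep_space N d)" "C = zeros (rep_space N d) F"
    by (elim exE conjE)
  have "\<forall>f\<in>F. \<exists>g. g \<in> poly_funs N d \<and> (\<forall>\<rho>\<in>mat_tuples N d. g \<rho> = f \<rho>)"
  proof
    fix f assume "f \<in> F"
    then have "f \<in> reg (rep_space N d)"
      using F(1) by (rule subsetD[rotated])
    from reg_poly_funs[OF this] show "\<exists>g. g \<in> poly_funs N d \<and> (\<forall>\<rho>\<in>mat_tuples N d. g \<rho> = f \<rho>)"
      by (simp add: Bex_def)
  qed
  from bchoice[OF this] obtain G where G: "\<forall>f\<in>F. G f \<in> poly_funs N d \<and> (\<forall>\<rho>\<in>mat_tuples N d. G f \<rho> = f \<rho>)" ..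
  then have "C = {\<rho> \<in> mat_tuples N d. \<forall>g\<in>G ` F. g \<rho> = 0}"
    unfolding F(2) by (simp add: zeros_def pts_mat_space cong: conj_cong)
  moreover have "G ` F \<subseteq> poly_funs N d"
    using G by auto
  ultimately show "zariski_closed N d C"
    unfolding zariski_closed_def by (intro exI[of _ "G ` F"] conjI)
qed

lemma openin_zariski:
  "openin (zariski N d) U \<longleftrightarrow> U \<subseteq> mat_tuples N d \<and> zariski_closed N d (mat_tuples N d - U)"
  unfolding zariski_def by (subst topology_inverse'[OF istopology_zariski]) (rule refl)

lemma topspace_zariski [simp]: "topspace (zariski N d) = (mat_tuples N d :: 'k::field mat list set)"
proof
  have "zariski_closed N d ({} :: 'k mat list set)"
    unfolding zariski_closed_def by (intro exI[of _ "{\<lambda>_. 1}"]) (auto intro: poly_funs.const)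
  then have "openin (zariski N d) (mat_tuples N d :: 'k mat list set)"
    by (simp add: openin_zariski)
  then show "mat_tuples N d \<subseteq> topspace (zariski N d :: 'k mat list topology)"
    by (rule openin_subset)
  show "topspace (zariski N d) \<subseteq> (mat_tuples N d :: 'k mat list set)"
    using iffD1[OF openin_zariski openin_topspace] by (rule conjunct1)
qed

lemma closedin_zariski:
  "closedin (zariski N d) C \<longleftrightarrow> (\<exists>F\<subseteq>reg (rep_space N d). C = zeros (rep_space N d) F)"
proof -
  have "mat_tuples N d - (mat_tuples N d - C) = C" if "C \<subseteq> mat_tuples N d"
    using that by auto
  moreover have "C \<subseteq> mat_tuples N d" if "zariski_closed N d C"
    using that by (auto simp: zariski_closed_def)
  ultimately show ?thesis
    unfolding closedin_def openin_zariski zariski_closed_iff[symmetric] by (auto simp: double_diff)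
qed

section \<open>Closed sets, closures and components of a subspace\<close>

abbreviation sub_zariski :: "nat \<Rightarrow> nat \<Rightarrow> 'k::field mat list set \<Rightarrow> 'k mat list topology" where
  "sub_zariski N d P \<equiv> subtopology (zariski N d) P"

lemma closedin_sub_zariski:
  "closedin (sub_zariski N d P) C \<longleftrightarrow> (\<exists>F\<subseteq>reg (rep_space N d). C = zeros (rep_space N d) F \<inter> P)"
  unfolding closedin_subtopology closedin_zariski by blast

text \<open>A point outside a closed set is witnessed by a single function, so covers by two closed
  sets reduce to two functions whose product vanishes.\<close>

lemma irreducible_in_iff:
  assumes P: "P \<subseteq> mat_tuples N d"
  shows "irreducible_in (sub_zariski N d P) S \<longleftrightarrow> irr (rep_space N d) S \<and> S \<subseteq> P"
proof
  assume S: "irreducible_in (sub_zariski N d P) S"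
  have SP: "S \<subseteq> P" "S \<noteq> {}" and split: "\<And>A B. closedin (sub_zariski N d P) A \<Longrightarrow> closedin (sub_zariski N d P) B \<Longrightarrow>
      S \<subseteq> A \<union> B \<Longrightarrow> S \<subseteq> A \<or> S \<subseteq> B"
    using S by (simp_all add: irreducible_in_def)
  have "\<exists>p\<in>S. f p \<noteq> 0 \<and> g p \<noteq> 0" if f: "f \<in> reg (rep_space N d)" "\<exists>p\<in>S. f p \<noteq> 0"
    and g: "g \<in> reg (rep_space N d)" "\<exists>p\<in>S. g p \<noteq> 0" for f g
  proof (rule ccontr)
    assume neg: "\<not> (\<exists>p\<in>S. f p \<noteq> 0 \<and> g p \<noteq> 0)"
    let ?A = "zeros (rep_space N d) {f} \<inter> P" and ?B = "zeros (rep_space N d) {g} \<inter> P"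
    have "S \<subseteq> ?A \<union> ?B"
    proof
      fix p assume "p \<in> S"
      then show "p \<in> ?A \<union> ?B"
        using neg SP(1) P by (auto simp: zeros_def pts_mat_space)
    qed
    moreover have "closedin (sub_zariski N d P) ?A"
      unfolding closedin_sub_zariski by (rule exI[of _ "{f}"]) (simp add: f(1))
    moreover have "closedin (sub_zariski N d P) ?B"
      unfolding closedin_sub_zariski by (rule exI[of _ "{g}"]) (simp add: g(1))
    ultimately have "S \<subseteq> ?A \<or> S \<subseteq> ?B"
      by (intro split)
    then have "(\<forall>p\<in>S. f p = 0) \<or> (\<forall>p\<in>S. g p = 0)"
      by (auto simp: zeros_def)
    then show False
    proof
      assume zero: "\<forall>p\<in>S. f p = 0"
      from f(2) obtain p where "p \<in> S" "f p \<noteq> 0"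
        by (rule bexE)
      with zero show False
        by simp
    next
      assume zero: "\<forall>p\<in>S. g p = 0"
      from g(2) obtain p where "p \<in> S" "g p \<noteq> 0"
        by (rule bexE)
      with zero show False
        by simp
    qed
  qed
  then show "irr (rep_space N d) S \<and> S \<subseteq> P"
    using SP P by (simp add: irr_def pts_mat_space)
next
  assume S: "irr (rep_space N d) S \<and> S \<subseteq> P"
  show "irreducible_in (sub_zariski N d P) S"
    unfolding irreducible_in_def
  proof (intro conjI allI impI)
    show "S \<subseteq> topspace (sub_zariski N d P)" "S \<noteq> {}"
      using S P by (auto simp: irr_def)
    fix A B assume "closedin (sub_zariski N d P) A" "closedin (sub_zariski N d P) B"
    then obtain F G where F: "F \<subseteq> reg (rep_space N d)" "A = zeros (rep_space N d) F \<inter> P"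
      and G: "G \<subseteq> reg (rep_space N d)" "B = zeros (rep_space N d) G \<inter> P"
      unfolding closedin_sub_zariski by (elim exE conjE)
    assume AB: "S \<subseteq> A \<union> B"
    have ex: "\<exists>f\<in>F. \<exists>p\<in>S. f p \<noteq> 0" if "\<not> S \<subseteq> zeros (rep_space N d) F \<inter> P" for F
    proof -
      from that obtain p where p: "p \<in> S" "p \<notin> zeros (rep_space N d) F \<inter> P"
        by blast
      have "p \<in> pts (rep_space N d)" "p \<in> P"
        using p(1) S by (auto simp: irr_def)
      then have "\<not> (\<forall>f\<in>F. f p = 0)"
        using p(2) by (simp add: zeros_def)
      then obtain f where "f \<in> F" "f p \<noteq> 0"
        by (simp add: Bex_def) (elim exE conjE)
      then show ?thesis
        using p(1) by (intro bexI[of _ f] bexI[of _ p])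
    qed
    show "S \<subseteq> A \<or> S \<subseteq> B"
    proof (rule ccontr)
      assume neg: "\<not> (S \<subseteq> A \<or> S \<subseteq> B)"
      from neg have "\<exists>f\<in>F. \<exists>p\<in>S. f p \<noteq> 0" "\<exists>f\<in>G. \<exists>p\<in>S. f p \<noteq> 0"
        using ex[of F] ex[of G] F(2) G(2) by simp_all
      then obtain f g where f: "f \<in> F" "\<exists>p\<in>S. f p \<noteq> 0" and g: "g \<in> G" "\<exists>p\<in>S. g p \<noteq> 0"
        by (elim bexE[of F] bexE[of G])
      have "f \<in> reg (rep_space N d)" "g \<in> reg (rep_space N d)"
        using f(1) F(1) g(1) G(1) by (simp_all add: subsetD)
      then have "\<exists>p\<in>S. f p \<noteq> 0 \<and> g p \<noteq> 0"
        using S f(2) g(2) by (simp add: irr_def)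
      then obtain p where p: "p \<in> S" "f p \<noteq> 0" "g p \<noteq> 0"
        by (elim bexE conjE)
      then have "p \<in> A \<or> p \<in> B"
        using AB by auto
      then show False
        using p f(1) g(1) F(2) G(2) by (auto simp: zeros_def)
    qed
  qed
qed

text \<open>The relative closure of \<open>C\<close> in \<open>P\<close>, as the zeros of the
  vanishing ideal of \<open>C\<close>; \<open>closure_of_eq_vcl\<close> identifies it with the
  topological closure.\<close>

definition vcl :: "('p, 'k::field) space \<Rightarrow> 'p set \<Rightarrow> 'p set \<Rightarrow> 'p set" where
  "vcl S P C = zeros S {f \<in> reg S. \<forall>p\<in>C. f p = 0} \<inter> P"

lemma vcl_superset: "C \<subseteq> P \<Longrightarrow> P \<subseteq> pts S \<Longrightarrow> C \<subseteq> vcl S P C"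
  by (auto simp: vcl_def zeros_def)

lemma vcl_subset: "vcl S P C \<subseteq> P"
  by (simp add: vcl_def)

lemma dense_in_vcl:
  assumes "C \<subseteq> P" "P \<subseteq> pts S"
  shows "dense_in S C (vcl S P C)"
  unfolding dense_in_def
proof (intro conjI ballI impI)
  show "C \<subseteq> vcl S P C"
    by (rule vcl_superset[OF assms])
  show "vcl S P C \<subseteq> pts S"
    by (auto simp: vcl_def zeros_def)
  fix f assume f: "f \<in> reg S" and ex: "\<exists>p\<in>vcl S P C. f p \<noteq> 0"
  show "\<exists>p\<in>C. f p \<noteq> 0"
  proof (rule ccontr)
    assume "\<not> (\<exists>p\<in>C. f p \<noteq> 0)"
    then have "\<forall>p\<in>vcl S P C. f p = 0"
      using f by (simp add: vcl_def zeros_def)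
    then show False
      using ex by simp
  qed
qed

lemma dense_in_subset_vcl:
  assumes "dense_in S A X" "A \<subseteq> C" "X \<subseteq> P"
  shows "X \<subseteq> vcl S P C"
proof
  fix x assume x: "x \<in> X"
  have "f x = 0" if "f \<in> reg S" "\<forall>p\<in>C. f p = 0" for f
  proof (rule ccontr)
    assume "f x \<noteq> 0"
    from dense_inD[OF assms(1) that(1) x this] obtain p where "p \<in> A" "f p \<noteq> 0" ..
    then show False
      using that(2) assms(2) by auto
  qed
  moreover have "x \<in> pts S"
    using x assms(1) by (auto simp: dense_in_def)
  ultimately show "x \<in> vcl S P C"
    using x assms(3) by (auto simp: vcl_def zeros_def)
qed

lemma closure_of_eq_vcl:
  assumes P: "P \<subseteq> mat_tuples N d" and C: "C \<subseteq> P"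
  shows "(sub_zariski N d P) closure_of C = vcl (rep_space N d) P C"
proof
  have "closedin (sub_zariski N d P) (vcl (rep_space N d) P C)"
    unfolding closedin_sub_zariski vcl_def
    by (rule exI[of _ "{f \<in> reg (rep_space N d). \<forall>p\<in>C. f p = 0}"]) simp
  then show "(sub_zariski N d P) closure_of C \<subseteq> vcl (rep_space N d) P C"
    by (intro closure_of_minimal vcl_superset[OF C]) (simp_all add: P pts_mat_space)
  have "closedin (sub_zariski N d P) ((sub_zariski N d P) closure_of C)"
    by simp
  then obtain F where F: "F \<subseteq> reg (rep_space N d)" "(sub_zariski N d P) closure_of C = zeros (rep_space N d) F \<inter> P"
    unfolding closedin_sub_zariski by (elim exE conjE)
  have "C \<subseteq> (sub_zariski N d P) closure_of C"
    by (rule closure_of_subset) (use P C in auto)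
  then have "\<forall>f\<in>F. \<forall>p\<in>C. f p = 0"
    unfolding F(2) by (auto simp: zeros_def)
  then have "F \<subseteq> {f \<in> reg (rep_space N d). \<forall>p\<in>C. f p = 0}"
    using F(1) by auto
  then show "vcl (rep_space N d) P C \<subseteq> (sub_zariski N d P) closure_of C"
    unfolding F(2) vcl_def by (auto simp: zeros_def)
qed

text \<open>An open set contains a principal open set around each of its points, and on an
  irreducible set nonempty open sets are dense.\<close>

lemma generically_indecomposable_iff:
  assumes X: "irr (rep_space N d) X"
  shows "generically_indecomposable N d X \<longleftrightarrow>
    (\<exists>f\<in>reg (rep_space N d). (\<exists>p\<in>X. f p \<noteq> 0) \<and> (\<forall>p\<in>X. f p \<noteq> 0 \<longrightarrow> indecomposable N d p))"
proof -
  have Xt: "X \<subseteq> mat_tuples N d" "X \<noteq> {}"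
    using X by (simp_all add: irr_def pts_mat_space)
  have top: "topspace (sub_zariski N d X) = X"
    using Xt(1) by auto
  show ?thesis
  proof
    assume "generically_indecomposable N d X"
    then obtain U where U: "openin (sub_zariski N d X) U" "(sub_zariski N d X) closure_of U = X"
      "\<forall>\<rho>\<in>U. indecomposable N d \<rho>"
      unfolding generically_indecomposable_def by (elim exE conjE)
    have UX: "U \<subseteq> X"
      using openin_subset[OF U(1)] top by simp
    have "U \<noteq> {}"
      using U(2) Xt(2) by auto
    then obtain p where p: "p \<in> U"
      by auto
    have "closedin (sub_zariski N d X) (X - U)"
      using closedin_diff[OF closedin_topspace U(1)] top by simp
    then obtain F where F: "F \<subseteq> reg (rep_space N d)" "X - U = zeros (rep_space N d) F \<inter> X"
      unfolding closedin_sub_zariski by (elim exE conjE)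
    have "p \<notin> zeros (rep_space N d) F" "p \<in> pts (rep_space N d)" "p \<in> X"
      using F(2) p UX Xt(1) by (auto simp: pts_mat_space)
    then have "\<not> (\<forall>f\<in>F. f p = 0)"
      by (simp add: zeros_def)
    then obtain f where f: "f \<in> F" "f p \<noteq> 0"
      by (simp add: Bex_def) (elim exE conjE)
    have "q \<in> U" if "q \<in> X" "f q \<noteq> 0" for q
    proof (rule ccontr)
      assume "q \<notin> U"
      then have "q \<in> zeros (rep_space N d) F"
        using F(2) that(1) by auto
      then show False
        using f(1) that(2) by (simp add: zeros_def)
    qed
    then show "\<exists>f\<in>reg (rep_space N d). (\<exists>p\<in>X. f p \<noteq> 0) \<and> (\<forall>p\<in>X. f p \<noteq> 0 \<longrightarrow> indecomposable N d p)"
      using f F(1) \<open>p \<in> X\<close> U(3) by (intro bexI[of _ f] conjI bexI[of _ p]) auto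
  next
    assume "\<exists>f\<in>reg (rep_space N d). (\<exists>p\<in>X. f p \<noteq> 0) \<and> (\<forall>p\<in>X. f p \<noteq> 0 \<longrightarrow> indecomposable N d p)"
    then obtain f where f: "f \<in> reg (rep_space N d)" "\<exists>p\<in>X. f p \<noteq> 0" "\<forall>p\<in>X. f p \<noteq> 0 \<longrightarrow> indecomposable N d p"
      unfolding Bex_def[of "reg (rep_space N d)"] by (elim exE conjE)
    define U where "U = {p \<in> X. f p \<noteq> 0}"
    have "X - U = zeros (rep_space N d) {f} \<inter> X"
      using Xt(1) by (auto simp: U_def zeros_def pts_mat_space)
    then have "closedin (sub_zariski N d X) (X - U)"
      unfolding closedin_sub_zariski using f(1) by (intro exI[of _ "{f}"]) simp
    then have "openin (sub_zariski N d X) U"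
      using top by (simp add: openin_closedin_eq U_def)
    moreover have "(sub_zariski N d X) closure_of U = X"
    proof -
      have UX: "U \<subseteq> X"
        by (auto simp: U_def)
      have "dense_in (rep_space N d) U X"
        unfolding U_def by (rule dense_in_open[OF X f(1,2)])
      from dense_in_subset_vcl[OF this order_refl order_refl] show ?thesis
        unfolding closure_of_eq_vcl[OF Xt(1) UX] using vcl_subset by (intro subset_antisym)
    qed
    ultimately show "generically_indecomposable N d X"
      unfolding generically_indecomposable_def using f(3) by (intro exI[of _ U]) (auto simp: U_def)
  qed
qed

lemma irreducible_components_iff:
  assumes P: "P \<subseteq> mat_tuples N d"
  shows "X \<in> irreducible_components (sub_zariski N d P) \<longleftrightarrow> irr (rep_space N d) X \<and> X \<subseteq> P \<and>
    (\<forall>S. irr (rep_space N d) S \<longrightarrow> S \<subseteq> P \<longrightarrow> X \<subseteq> S \<longrightarrow> S = X)"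
  unfolding irreducible_components_def by (simp add: irreducible_in_iff[OF P]) blast

text \<open>Closures of irreducible sets are irreducible, so maximality of the component turns the
  inclusion into an equality.\<close>

lemma component_eq_vcl:
  assumes P: "P \<subseteq> mat_tuples N d" and X: "X \<in> irreducible_components (sub_zariski N d P)"
    and C: "irr (rep_space N d) C" "C \<subseteq> P" and sub: "X \<subseteq> vcl (rep_space N d) P C"
  shows "vcl (rep_space N d) P C = X"
proof -
  have "irr (rep_space N d) (vcl (rep_space N d) P C)"
    by (rule irr_dense_superset[OF C(1) dense_in_vcl[OF C(2)]]) (simp add: P pts_mat_space)
  then show ?thesis
    using X sub vcl_subset[of "rep_space N d" P C] unfolding irreducible_components_iff[OF P] by blast
qed

lemma finite_gens_mat_space: "finite (fst (mat_space k m d :: ('k mat list, 'k::field) space))"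
proof -
  have "fst (mat_space k m d :: ('k mat list, 'k) space) = (\<lambda>(j, a, b) l. l ! j $$ (a, b)) ` ({..<k} \<times> {..<m} \<times> {..<d})"
    by (force simp: mat_space_def)
  moreover have "finite \<dots>"
    by (intro finite_imageI finite_cartesian_product finite_lessThan)
  ultimately show ?thesis
    by (simp only:)
qed

text \<open>Every component occurs in the finite cover of \<open>finite_irr_cover\<close>, and the
  maximal members of that cover are components.\<close>

lemma finite_components:
  assumes P: "P \<subseteq> mat_tuples N d"
  shows "finite (irreducible_components (sub_zariski N d P))"
    and "irr (rep_space N d) Y \<Longrightarrow> Y \<subseteq> P \<Longrightarrow> \<exists>C\<in>irreducible_components (sub_zariski N d P). Y \<subseteq> C"
proof -
  have "P \<subseteq> pts (rep_space N d)"
    by (simp add: P pts_mat_space)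
  from finite_irr_cover[OF finite_gens_mat_space this] obtain \<Z>
    where Z: "finite \<Z>" "\<forall>Z\<in>\<Z>. irr (rep_space N d) Z \<and> Z \<subseteq> P"
      "\<forall>Y. irr (rep_space N d) Y \<longrightarrow> Y \<subseteq> P \<longrightarrow> (\<exists>Z\<in>\<Z>. Y \<subseteq> Z)"
    by (elim exE conjE)
  have "irreducible_components (sub_zariski N d P) \<subseteq> \<Z>"
  proof
    fix C assume C: "C \<in> irreducible_components (sub_zariski N d P)"
    note C' = C[unfolded irreducible_components_iff[OF P]]
    then obtain Z where "Z \<in> \<Z>" "C \<subseteq> Z"
      using Z(3)[rule_format, of C] by auto
    then show "C \<in> \<Z>"
      using C' Z(2) by metis
  qed
  then show "finite (irreducible_components (sub_zariski N d P))"
    using Z(1) by (rule finite_subset)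
  assume Y: "irr (rep_space N d) Y" "Y \<subseteq> P"
  from Z(3)[rule_format, OF Y] obtain Z0 where Z0: "Z0 \<in> \<Z>" "Y \<subseteq> Z0" ..
  from finite_has_maximal2[OF Z(1) Z0(1)] obtain Z1
    where Z1: "Z1 \<in> \<Z>" "Z0 \<subseteq> Z1" "\<forall>Z\<in>\<Z>. Z1 \<subseteq> Z \<longrightarrow> Z1 = Z"
    by auto
  have "S = Z1" if S: "irr (rep_space N d) S" "S \<subseteq> P" "Z1 \<subseteq> S" for S
  proof -
    from Z(3)[rule_format, OF S(1,2)] obtain Z2 where "Z2 \<in> \<Z>" "S \<subseteq> Z2" ..
    then show ?thesis
      using Z1(3) S(3) by blast
  qed
  then have "Z1 \<in> irreducible_components (sub_zariski N d P)"
    unfolding irreducible_components_iff[OF P] using Z(2) Z1(1) by simp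
  then show "\<exists>C\<in>irreducible_components (sub_zariski N d P). Y \<subseteq> C"
    using Z0(2) Z1(2) by (intro bexI[of _ Z1]) auto
qed

section \<open>Constructibility of the strata\<close>

lemma constr_mat_eq:
  assumes A: "reg_mat S m d A" and B: "reg_mat S m d B"
  shows "{p \<in> pts S. A p = B p} \<in> constr S"
proof -
  have "A p = B p \<longleftrightarrow> (\<forall>a\<in>{..<m}. \<forall>b\<in>{..<d}. A p $$ (a, b) = B p $$ (a, b))" if "p \<in> pts S" for p
  proof -
    have "A p \<in> carrier_mat m d" "B p \<in> carrier_mat m d"
      using A B that by (simp_all add: reg_mat_def)
    then show ?thesis
      by (auto simp: mat_eq_iff)
  qed
  then have "{p \<in> pts S. A p = B p} = {p \<in> pts S. \<forall>a\<in>{..<m}. \<forall>b\<in>{..<d}. A p $$ (a, b) = B p $$ (a, b)}"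
    by (simp cong: conj_cong)
  also have "\<dots> \<in> constr S"
    by (intro constr_ball constr_eq) (use A B in \<open>simp_all add: reg_mat_def\<close>)
  finally show ?thesis .
qed

lemma reg_mat_morphism: "morphism S (mat_space k m d) \<phi> \<Longrightarrow> j < k \<Longrightarrow> reg_mat S m d (\<lambda>p. \<phi> p ! j)"
  by (rule reg_mat_comp[OF _ reg_mat_nth])

lemma constr_tuple_eq:
  assumes \<phi>: "morphism S (mat_space k m d) \<phi>" and \<psi>: "morphism S (mat_space k m d) \<psi>"
  shows "{p \<in> pts S. \<phi> p = \<psi> p} \<in> constr S"
proof -
  have "\<phi> p = \<psi> p \<longleftrightarrow> (\<forall>j\<in>{..<k}. \<phi> p ! j = \<psi> p ! j)" if "p \<in> pts S" for p
    using morphism_pts[OF \<phi> that] morphism_pts[OF \<psi> that] by (auto simp: dom_mat_space list_eq_iff_nth_eq)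
  then have "{p \<in> pts S. \<phi> p = \<psi> p} = {p \<in> pts S. \<forall>j\<in>{..<k}. \<phi> p ! j = \<psi> p ! j}"
    by (simp cong: conj_cong)
  also have "\<dots> \<in> constr S"
    by (intro constr_ball constr_mat_eq[of S m d, OF reg_mat_morphism[OF \<phi>] reg_mat_morphism[OF \<psi>]]) simp_all
  finally show ?thesis .
qed

lemma constr_hom:
  assumes \<rho>: "morphism S (rep_space N d) \<rho>" and \<tau>: "\<tau> \<in> mat_tuples N m" and \<phi>: "reg_mat S m d \<phi>"
  shows "{p \<in> pts S. \<phi> p \<in> hom_space N d m (\<rho> p) \<tau>} \<in> constr S"
proof -
  have "\<phi> p \<in> hom_space N d m (\<rho> p) \<tau> \<longleftrightarrow> (\<forall>j\<in>{..<N}. \<phi> p * \<rho> p ! j = \<tau> ! j * \<phi> p)" if "p \<in> pts S" for p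
  proof -
    have "\<rho> p \<in> mat_tuples N d" "\<phi> p \<in> carrier_mat m d"
      using morphism_pts[OF \<rho> that] \<phi> that by (simp_all add: pts_mat_space reg_mat_def)
    then show ?thesis
      using \<tau> by (auto simp: hom_space_iff)
  qed
  then have "{p \<in> pts S. \<phi> p \<in> hom_space N d m (\<rho> p) \<tau>} = {p \<in> pts S. \<forall>j\<in>{..<N}. \<phi> p * \<rho> p ! j = \<tau> ! j * \<phi> p}"
    by (simp cong: conj_cong)
  also have "\<dots> \<in> constr S"
  proof (intro constr_ball constr_mat_eq)
    fix j assume "j \<in> {..<N}"
    then have j: "j < N"
      by simp
    show "reg_mat S m d (\<lambda>p. \<phi> p * \<rho> p ! j)"
      by (rule reg_mat_mult[OF \<phi> reg_mat_morphism[OF \<rho> j]])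
    show "reg_mat S m d (\<lambda>p. \<tau> ! j * \<phi> p)"
      by (rule reg_mat_mult[OF reg_mat_const[OF mat_tuples_nth[OF \<tau> j]] \<phi>])
  qed simp
  finally show ?thesis .
qed

lemma reg_mat_lin_comb:
  assumes "\<And>i. i < k \<Longrightarrow> (\<lambda>p. c p i) \<in> reg S" and "\<And>i. i < k \<Longrightarrow> reg_mat S m d (\<lambda>p. \<phi> p i)"
  shows "reg_mat S m d (\<lambda>p. lin_comb m d k (c p) (\<phi> p))"
  unfolding reg_mat_def
proof (intro conjI ballI allI impI)
  fix a b assume ab: "a < m" "b < d"
  have "(\<lambda>p. \<Sum>i<k. c p i * \<phi> p i $$ (a, b)) \<in> reg S"
    using assms ab by (intro reg_sum reg.mult) (auto simp: reg_mat_def)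
  then show "(\<lambda>p. lin_comb m d k (c p) (\<phi> p) $$ (a, b)) \<in> reg S"
    using ab by simp
qed simp

lemma lin_comb_cong: "(\<And>i. i < k \<Longrightarrow> c i = c' i) \<Longrightarrow> lin_comb m d k c \<phi> = lin_comb m d k c' \<phi>"
  by (intro eq_matI) auto

text \<open>Only the values below \<open>k\<close> matter, so a quantifier over all coefficient
  functions becomes one over rows of length \<open>k\<close>, to which \<open>constr_ex_mats\<close>
  applies.\<close>

lemma coefficients_as_matrix:
  "(\<exists>c. P c) \<longleftrightarrow> (\<exists>l\<in>pts (mat_space 1 1 k). P (\<lambda>i. l ! 0 $$ (0, i)))"
  "(\<forall>c. P c) \<longleftrightarrow> (\<forall>l\<in>pts (mat_space 1 1 k). P (\<lambda>i. l ! 0 $$ (0, i)))"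
  if P: "\<And>c c'. (\<And>i. i < k \<Longrightarrow> c i = c' i) \<Longrightarrow> P c = P c'" for P :: "(nat \<Rightarrow> 'k::field) \<Rightarrow> bool"
proof -
  have *: "\<exists>l\<in>pts (mat_space 1 1 k). P c = P (\<lambda>i. l ! 0 $$ (0, i))" for c
    by (intro bexI[of _ "[mat 1 k (\<lambda>(_, i). c i)]"] P) (auto simp: dom_mat_space)
  show "(\<exists>c. P c) \<longleftrightarrow> (\<exists>l\<in>pts (mat_space 1 1 k). P (\<lambda>i. l ! 0 $$ (0, i)))"
  proof
    assume "\<exists>c. P c"
    then obtain c where "P c" ..
    then show "\<exists>l\<in>pts (mat_space 1 1 k). P (\<lambda>i. l ! 0 $$ (0, i))"
      using *[of c] by simp
  qed auto
  show "(\<forall>c. P c) \<longleftrightarrow> (\<forall>l\<in>pts (mat_space 1 1 k). P (\<lambda>i. l ! 0 $$ (0, i)))"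
  proof
    assume all: "\<forall>l\<in>pts (mat_space 1 1 k). P (\<lambda>i. l ! 0 $$ (0, i))"
    show "\<forall>c. P c"
    proof
      fix c
      from *[of c] obtain l where "l \<in> pts (mat_space 1 1 k)" "P c = P (\<lambda>i. l ! 0 $$ (0, i))" ..
      then show "P c"
        using all by simp
    qed
  qed auto
qed

text \<open>The definition is rewritten with quantifiers over matrices only: \<open>l'\<close> runs
  over elements of the Hom space, \<open>l\<close> over rows of coefficients.\<close>

lemma constr_is_basis:
  fixes \<rho> :: "'p \<Rightarrow> 'k::alg_closed_field mat list"
  assumes \<rho>: "morphism S (rep_space N d) \<rho>" and \<tau>: "\<tau> \<in> mat_tuples N m" and \<phi>: "morphism S (mat_space k m d) \<phi>"
  shows "{p \<in> pts S. is_basis m d (hom_space N d m (\<rho> p) \<tau>) k (\<lambda>i. \<phi> p ! i)} \<in> constr S"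
proof -
  let ?H = "\<lambda>p. hom_space N d m (\<rho> p) \<tau>" and ?C = "mat_space 1 1 k :: ('k mat list, 'k) space"
  let ?c = "\<lambda>l :: 'k mat list. \<lambda>i. l ! 0 $$ (0, i)" and ?\<phi> = "\<lambda>p i. \<phi> p ! i"
  have basis: "is_basis m d (?H p) k (?\<phi> p) \<longleftrightarrow> (\<forall>i\<in>{..<k}. \<phi> p ! i \<in> ?H p) \<and>
      (\<forall>l'\<in>pts (mat_space 1 m d). l' ! 0 \<in> ?H p \<longrightarrow> (\<exists>l\<in>pts ?C. l' ! 0 = lin_comb m d k (?c l) (?\<phi> p))) \<and>
      (\<forall>l\<in>pts ?C. lin_comb m d k (?c l) (?\<phi> p) = 0\<^sub>m m d \<longrightarrow> (\<forall>i\<in>{..<k}. ?c l i = 0))" for p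
  proof -
    have "(\<exists>c. A = lin_comb m d k c (?\<phi> p)) \<longleftrightarrow> (\<exists>l\<in>pts ?C. A = lin_comb m d k (?c l) (?\<phi> p))" for A
      by (rule coefficients_as_matrix(1)) (simp cong: lin_comb_cong)
    moreover have "(\<forall>c. lin_comb m d k c (?\<phi> p) = 0\<^sub>m m d \<longrightarrow> (\<forall>i\<in>{..<k}. c i = 0)) \<longleftrightarrow>
        (\<forall>l\<in>pts ?C. lin_comb m d k (?c l) (?\<phi> p) = 0\<^sub>m m d \<longrightarrow> (\<forall>i\<in>{..<k}. ?c l i = 0))"
      by (rule coefficients_as_matrix(2)) (simp cong: lin_comb_cong)
    moreover have "(\<forall>A\<in>?H p. Q A) \<longleftrightarrow> (\<forall>l'\<in>pts (mat_space 1 m d). l' ! 0 \<in> ?H p \<longrightarrow> Q (l' ! 0))" for Q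
    proof
      assume all: "\<forall>l'\<in>pts (mat_space 1 m d). l' ! 0 \<in> ?H p \<longrightarrow> Q (l' ! 0)"
      show "\<forall>A\<in>?H p. Q A"
      proof
        fix A assume A: "A \<in> ?H p"
        then have "[A] \<in> pts (mat_space 1 m d)"
          by (simp add: dom_mat_space hom_space_def)
        then show "Q A"
          using all A by force
      qed
    qed simp
    ultimately show ?thesis
      by (simp add: is_basis_def Ball_def)
  qed
  have c: "(\<lambda>l. ?c l i) \<in> reg ?C" if "i < k" for i
    by (rule reg_mat_entry) (use that in simp_all)
  have "{p \<in> pts S. \<forall>i\<in>{..<k}. \<phi> p ! i \<in> ?H p} \<in> constr S"
    by (intro constr_ball constr_hom[OF \<rho> \<tau> reg_mat_morphism[OF \<phi>]]) simp_all
  moreover have "{p \<in> pts S. \<forall>l'\<in>pts (mat_space 1 m d). l' ! 0 \<in> ?H p \<longrightarrow>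
      (\<exists>l\<in>pts ?C. l' ! 0 = lin_comb m d k (?c l) (?\<phi> p))} \<in> constr S"
  proof (rule constr_all_mats, rule constr_imp)
    let ?S = "S \<otimes>\<^sub>s mat_space 1 m d"
    show "{z \<in> pts ?S. snd z ! 0 \<in> ?H (fst z)} \<in> constr ?S"
      by (rule constr_hom[OF morphism_comp[OF morphism_fst \<rho>] \<tau> reg_mat_comp[OF morphism_snd reg_mat_nth]]) simp
    show "{z \<in> pts ?S. \<exists>l\<in>pts ?C. snd z ! 0 = lin_comb m d k (?c l) (?\<phi> (fst z))} \<in> constr ?S"
    proof (rule constr_ex_mats, rule constr_mat_eq)
      show "reg_mat (?S \<otimes>\<^sub>s ?C) m d (\<lambda>z. snd (fst z) ! 0)"
        by (rule reg_mat_comp[OF morphism_comp[OF morphism_fst morphism_snd] reg_mat_nth]) simp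
      show "reg_mat (?S \<otimes>\<^sub>s ?C) m d (\<lambda>z. lin_comb m d k (?c (snd z)) (?\<phi> (fst (fst z))))"
      proof (rule reg_mat_lin_comb)
        fix i assume i: "i < k"
        show "(\<lambda>z. ?c (snd z) i) \<in> reg (?S \<otimes>\<^sub>s ?C)"
          by (rule reg_snd[OF c[OF i]])
        show "reg_mat (?S \<otimes>\<^sub>s ?C) m d (\<lambda>z. ?\<phi> (fst (fst z)) i)"
          by (rule reg_mat_morphism[OF morphism_comp[OF morphism_comp[OF morphism_fst morphism_fst] \<phi>] i])
      qed
    qed
  qed
  moreover have "{p \<in> pts S. \<forall>l\<in>pts ?C. lin_comb m d k (?c l) (?\<phi> p) = 0\<^sub>m m d \<longrightarrow> (\<forall>i\<in>{..<k}. ?c l i = 0)} \<in> constr S"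
  proof (rule constr_all_mats, rule constr_imp)
    show "{z \<in> pts (S \<otimes>\<^sub>s ?C). lin_comb m d k (?c (snd z)) (?\<phi> (fst z)) = 0\<^sub>m m d} \<in> constr (S \<otimes>\<^sub>s ?C)"
    proof (rule constr_mat_eq)
      show "reg_mat (S \<otimes>\<^sub>s ?C) m d (\<lambda>z. lin_comb m d k (?c (snd z)) (?\<phi> (fst z)))"
      proof (rule reg_mat_lin_comb)
        fix i assume i: "i < k"
        show "(\<lambda>z. ?c (snd z) i) \<in> reg (S \<otimes>\<^sub>s ?C)"
          by (rule reg_snd[OF c[OF i]])
        show "reg_mat (S \<otimes>\<^sub>s ?C) m d (\<lambda>z. ?\<phi> (fst z) i)"
          by (rule reg_mat_morphism[OF morphism_comp[OF morphism_fst \<phi>] i])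
      qed
    qed (simp add: reg_mat_const)
    show "{z \<in> pts (S \<otimes>\<^sub>s ?C). \<forall>i\<in>{..<k}. ?c (snd z) i = 0} \<in> constr (S \<otimes>\<^sub>s ?C)"
      by (intro constr_ball constr.zero reg_snd[OF c]) simp_all
  qed
  ultimately show ?thesis
    unfolding basis by (intro constr_conj)
qed

text \<open>Having dimension \<open>u\<close> means possessing a basis of length \<open>u\<close>,
  an existential statement over tuples of matrices. It takes the place of conditions on
  minors.\<close>

lemma constr_hom_dim:
  fixes \<tau> :: "'k::alg_closed_field mat list"
  assumes \<tau>: "\<tau> \<in> mat_tuples N m"
  shows "{\<rho> \<in> mat_tuples N d. hom_dim N d m \<rho> \<tau> = u} \<in> constr (rep_space N d)"
proof -
  have "hom_dim N d m \<rho> \<tau> = u \<longleftrightarrow> (\<exists>l\<in>pts (mat_space u m d). is_basis m d (hom_space N d m \<rho> \<tau>) u (\<lambda>i. l ! i))"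
    if \<rho>: "\<rho> \<in> mat_tuples N d" for \<rho>
  proof
    assume "hom_dim N d m \<rho> \<tau> = u"
    then obtain \<phi> where \<phi>: "is_basis m d (hom_space N d m \<rho> \<tau>) u \<phi>"
      unfolding hom_dim_eq_sdim using sdim_eq_iff[OF mat_subspace_hom[OF \<rho> \<tau>]] by auto
    let ?l = "map \<phi> [0..<u]"
    have "lin_comb m d u c (\<lambda>i. ?l ! i) = lin_comb m d u c \<phi>" for c
      by (rule eq_matI) auto
    then have "is_basis m d (hom_space N d m \<rho> \<tau>) u (\<lambda>i. ?l ! i)"
      using \<phi> by (simp add: is_basis_def)
    moreover have "?l \<in> pts (mat_space u m d)"
      using \<phi> by (auto simp: dom_mat_space is_basis_def hom_space_def)
    ultimately show "\<exists>l\<in>pts (mat_space u m d). is_basis m d (hom_space N d m \<rho> \<tau>) u (\<lambda>i. l ! i)"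
      by (rule bexI)
  next
    assume "\<exists>l\<in>pts (mat_space u m d). is_basis m d (hom_space N d m \<rho> \<tau>) u (\<lambda>i. l ! i)"
    then show "hom_dim N d m \<rho> \<tau> = u"
      unfolding hom_dim_eq_sdim using sdim_eq[OF mat_subspace_hom[OF \<rho> \<tau>]] by auto
  qed
  then have "{\<rho> \<in> mat_tuples N d. hom_dim N d m \<rho> \<tau> = u} =
      {\<rho> \<in> pts (rep_space N d). \<exists>l\<in>pts (mat_space u m d). is_basis m d (hom_space N d m \<rho> \<tau>) u (\<lambda>i. l ! i)}"
    by (simp add: pts_mat_space cong: conj_cong)
  also have "\<dots> \<in> constr (rep_space N d)"
    by (rule constr_ex_mats, rule constr_is_basis[OF morphism_fst \<tau> morphism_snd])
  finally show ?thesis .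
qed

lemma reg_mat_eval_word:
  assumes "set (letters w) \<subseteq> {..<N}"
  shows "reg_mat (rep_space N d) d d (\<lambda>\<rho>. eval_word d \<rho> w)"
proof -
  have "reg_mat (rep_space N d) d d (\<lambda>\<rho>. foldr (\<lambda>j A. \<rho> ! j * A) l (1\<^sub>m d))" if "set l \<subseteq> {..<N}" for l
    using that by (induction l) (simp_all add: reg_mat_const reg_mat_mult[OF reg_mat_nth])
  then show ?thesis
    using assms by (simp add: eval_word_def)
qed

text \<open>The ideal may be infinite and need not be finitely generated;
  \<open>constr_zeros\<close> reduces the vanishing of all its values to finitely many
  equations.\<close>

lemma constr_rep:
  fixes I :: "'k::field nc_poly set"
  assumes I: "two_sided_ideal N I"
  shows "rep N I d \<in> constr (rep_space N d)"
proof -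
  define F where "F = {\<lambda>\<rho>. eval_nc d \<rho> h $$ (a, b) |h a b. h \<in> I \<and> a < d \<and> b < d}"
  have "(\<lambda>\<rho>. eval_nc d \<rho> h $$ (a, b)) \<in> reg (rep_space N d)" if h: "h \<in> I" and ab: "a < d" "b < d" for h a b
  proof -
    have "(\<lambda>\<rho>. eval_word d \<rho> w $$ (a, b)) \<in> reg (rep_space N d)" if "w \<in> Poly_Mapping.keys h" for w
    proof -
      have "h \<in> free_alg N"
        using h I by (auto simp: two_sided_ideal_def)
      then have "set (letters w) \<subseteq> {..<N}"
        using that by (simp add: free_alg_def)
      from reg_mat_eval_word[OF this, of d] show ?thesis
        using ab unfolding reg_mat_def by blast
    qed
    then have "(\<lambda>\<rho>. \<Sum>w\<in>Poly_Mapping.keys h. Poly_Mapping.lookup h w * eval_word d \<rho> w $$ (a, b)) \<in> reg (rep_space N d)"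
      by (intro reg_sum reg_cmult)
    then show ?thesis
      using ab by (simp add: eval_nc_def)
  qed
  then have "F \<subseteq> reg (rep_space N d)"
    by (auto simp: F_def)
  moreover have "rep N I d = zeros (rep_space N d) F"
  proof -
    have "eval_nc d \<rho> h = 0\<^sub>m d d \<longleftrightarrow> (\<forall>a<d. \<forall>b<d. eval_nc d \<rho> h $$ (a, b) = 0)"
      for \<rho> :: "'k mat list" and h
      using carrier_matD[OF eval_nc_carrier[of d \<rho> h]] by (simp add: mat_eq_iff)
    moreover have "(\<forall>f\<in>F. f \<rho> = 0) \<longleftrightarrow> (\<forall>h\<in>I. \<forall>a<d. \<forall>b<d. eval_nc d \<rho> h $$ (a, b) = 0)" for \<rho>
      unfolding F_def by force
    ultimately show ?thesis
      by (simp add: rep_def zeros_def pts_mat_space)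
  qed
  ultimately show ?thesis
    using constr_zeros[OF finite_gens_mat_space] by simp
qed

lemma constr_X_points:
  fixes \<tau> :: "'k::alg_closed_field mat list"
  assumes "two_sided_ideal N I" and "\<tau> \<in> mat_tuples N m"
  shows "X_points N I m \<tau> d u \<in> constr (rep_space N d)"
proof -
  have "X_points N I m \<tau> d u = rep N I d \<inter> {\<rho> \<in> mat_tuples N d. hom_dim N d m \<rho> \<tau> = u}"
    by (auto simp: X_points_def rep_def)
  then show ?thesis
    using constr.inter[OF constr_rep[OF assms(1)] constr_hom_dim[OF assms(2)]] by simp
qed

section \<open>Direct sums of sets of representations\<close>

text \<open>The image of the product before the group acts; being built by repeated
  \<open>dsum\<close>, it allows induction on the list.\<close>

definition sum_set :: "nat \<Rightarrow> 'k::field mat list set list \<Rightarrow> 'k mat list set" where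
  "sum_set N Cs = rep_sum N ` listset Cs"

lemma listset_iff: "xs \<in> listset Cs \<longleftrightarrow> list_all2 (\<in>) xs Cs"
proof (induction Cs arbitrary: xs)
  case (Cons C Cs)
  then show ?case
    by (cases xs) (auto simp: set_Cons_def)
qed simp

lemma rep_sum_single: "\<rho> \<in> mat_tuples N d \<Longrightarrow> rep_sum N [\<rho>] = \<rho>"
  unfolding rep_sum_def list.map diag_block_mat_singleton using map_nth[of \<rho>] by (simp add: mat_tuples_length)

lemma sum_set_Nil: "sum_set N [] = {rep_sum N []}"
  by (simp add: sum_set_def)

lemma sum_set_Cons:
  assumes "C \<subseteq> mat_tuples N d" and "sum_set N Cs \<subseteq> mat_tuples N e"
  shows "sum_set N (C # Cs) = (\<lambda>z. dsum N d e (fst z) (snd z)) ` (C \<times> sum_set N Cs)"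
proof
  have eq: "rep_sum N (\<rho> # \<rho>s) = dsum N d e \<rho> (rep_sum N \<rho>s)" if "\<rho> \<in> C" "\<rho>s \<in> listset Cs" for \<rho> \<rho>s
    by (rule rep_sum_Cons) (use assms that in \<open>auto simp: sum_set_def\<close>)
  show "sum_set N (C # Cs) \<subseteq> (\<lambda>z. dsum N d e (fst z) (snd z)) ` (C \<times> sum_set N Cs)"
  proof
    fix p assume "p \<in> sum_set N (C # Cs)"
    then obtain \<rho> \<rho>s where \<rho>: "\<rho> \<in> C" "\<rho>s \<in> listset Cs" "p = rep_sum N (\<rho> # \<rho>s)"
      by (auto simp: sum_set_def set_Cons_def)
    then show "p \<in> (\<lambda>z. dsum N d e (fst z) (snd z)) ` (C \<times> sum_set N Cs)"
      using eq[OF \<rho>(1,2)] by (intro image_eqI[of _ _ "(\<rho>, rep_sum N \<rho>s)"]) (auto simp: sum_set_def)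
  qed
  show "(\<lambda>z. dsum N d e (fst z) (snd z)) ` (C \<times> sum_set N Cs) \<subseteq> sum_set N (C # Cs)"
  proof
    fix p assume "p \<in> (\<lambda>z. dsum N d e (fst z) (snd z)) ` (C \<times> sum_set N Cs)"
    then obtain \<rho> \<rho>s where \<rho>: "\<rho> \<in> C" "\<rho>s \<in> listset Cs" "p = dsum N d e \<rho> (rep_sum N \<rho>s)"
      by (auto simp: sum_set_def)
    then show "p \<in> sum_set N (C # Cs)"
      unfolding \<rho>(3) eq[OF \<rho>(1,2), symmetric] sum_set_def by (auto simp: set_Cons_def)
  qed
qed

lemma irr_subset: "irr (rep_space N d) C \<Longrightarrow> C \<subseteq> mat_tuples N d"
  by (simp add: irr_def pts_mat_space)

lemma dense_in_subset: "dense_in (rep_space N d) C' C \<Longrightarrow> C' \<subseteq> mat_tuples N d" "dense_in (rep_space N d) C' C \<Longrightarrow> C \<subseteq> mat_tuples N d"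
  by (auto simp: dense_in_def pts_mat_space)

lemma irr_sum_set:
  assumes "\<forall>(d, C)\<in>set xs. irr (rep_space N d) C"
  shows "irr (rep_space N (sum_list (map fst xs))) (sum_set N (map snd xs))"
  using assms
proof (induction xs)
  case Nil
  then show ?case
    by (simp add: sum_set_Nil irr_singleton pts_mat_space rep_sum_Nil)
next
  case (Cons x xs)
  obtain d C where x: "x = (d, C)"
    by (cases x)
  have C: "irr (rep_space N d) C" and IH: "irr (rep_space N (sum_list (map fst xs))) (sum_set N (map snd xs))"
    using Cons by (auto simp: x)
  show ?case
    using irr_image[OF irr_prod[OF C IH] morphism_dsum]
    by (simp add: x sum_set_Cons[OF irr_subset[OF C] irr_subset[OF IH]])
qed

lemma dense_in_sum_set:
  assumes "\<forall>(d, C, C')\<in>set xs. dense_in (rep_space N d) C C'"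
  shows "dense_in (rep_space N (sum_list (map fst xs))) (sum_set N (map (fst \<circ> snd) xs)) (sum_set N (map (snd \<circ> snd) xs))"
  using assms
proof (induction xs)
  case Nil
  then show ?case
    by (simp add: sum_set_Nil dense_in_refl pts_mat_space rep_sum_Nil)
next
  case (Cons x xs)
  obtain d C C' where x: "x = (d, C, C')"
    by (cases x)
  have C: "dense_in (rep_space N d) C C'"
    and IH: "dense_in (rep_space N (sum_list (map fst xs))) (sum_set N (map (fst \<circ> snd) xs)) (sum_set N (map (snd \<circ> snd) xs))"
    by (use Cons.prems x in simp, rule Cons.IH, use Cons.prems in simp)
  have m: "map (fst \<circ> snd) (x # xs) = C # map (fst \<circ> snd) xs" "map (snd \<circ> snd) (x # xs) = C' # map (snd \<circ> snd) xs"
    "sum_list (map fst (x # xs)) = d + sum_list (map fst xs)"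
    by (simp_all add: x)
  show ?case
    unfolding m sum_set_Cons[OF dense_in_subset(1)[OF C] dense_in_subset(1)[OF IH]]
      sum_set_Cons[OF dense_in_subset(2)[OF C] dense_in_subset(2)[OF IH]]
    by (rule dense_in_image[OF dense_in_prod[OF C IH] morphism_dsum])
qed

text \<open>The image is written with two quantifiers over tuples of matrices, so
  \<open>constr_ex_mats\<close> applies twice.\<close>

lemma constr_image_pair:
  fixes \<phi> :: "'k mat list \<times> 'k mat list \<Rightarrow> 'k::alg_closed_field mat list"
  assumes \<phi>: "morphism (mat_space k m d \<otimes>\<^sub>s mat_space k' m' d') (mat_space l r s) \<phi>"
    and C: "C \<in> constr (mat_space k m d)" and D: "D \<in> constr (mat_space k' m' d')"
  shows "\<phi> ` (C \<times> D) \<in> constr (mat_space l r s)"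
proof -
  let ?T = "mat_space l r s :: ('k mat list, 'k) space" and ?S = "mat_space k m d :: ('k mat list, 'k) space"
    and ?S' = "mat_space k' m' d' :: ('k mat list, 'k) space"
  have "\<phi> ` (C \<times> D) = {p \<in> pts ?T. \<exists>a\<in>pts ?S. \<exists>b\<in>pts ?S'. a \<in> C \<and> b \<in> D \<and> \<phi> (a, b) = p}"
  proof
    show "\<phi> ` (C \<times> D) \<subseteq> {p \<in> pts ?T. \<exists>a\<in>pts ?S. \<exists>b\<in>pts ?S'. a \<in> C \<and> b \<in> D \<and> \<phi> (a, b) = p}"
    proof
      fix p assume "p \<in> \<phi> ` (C \<times> D)"
      then obtain a b where ab: "a \<in> C" "b \<in> D" "p = \<phi> (a, b)"
        by auto
      then have "a \<in> pts ?S" "b \<in> pts ?S'"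
        using constr_subset[OF C] constr_subset[OF D] by auto
      then show "p \<in> {p \<in> pts ?T. \<exists>a\<in>pts ?S. \<exists>b\<in>pts ?S'. a \<in> C \<and> b \<in> D \<and> \<phi> (a, b) = p}"
        using ab morphism_pts[OF \<phi>, of "(a, b)"] by auto
    qed
  qed auto
  also have "\<dots> \<in> constr ?T"
  proof (rule constr_ex_mats, rule constr_ex_mats, intro constr_conj)
    let ?U = "(?T \<otimes>\<^sub>s ?S) \<otimes>\<^sub>s ?S'"
    note a = morphism_comp[OF morphism_fst morphism_snd, of ?T ?S ?S'] and b = morphism_snd[of "?T \<otimes>\<^sub>s ?S" ?S']
    show "{z \<in> pts ?U. snd (fst z) \<in> C} \<in> constr ?U"
      by (rule constr_preimage[OF a C])
    show "{z \<in> pts ?U. snd z \<in> D} \<in> constr ?U"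
      by (rule constr_preimage[OF b D])
    show "{z \<in> pts ?U. \<phi> (snd (fst z), snd z) = fst (fst z)} \<in> constr ?U"
      by (rule constr_tuple_eq[OF morphism_comp[OF morphism_Pair[OF a b] \<phi>] morphism_comp[OF morphism_fst morphism_fst]])
  qed
  finally show ?thesis .
qed

lemma constr_sum_set:
  fixes xs :: "(nat \<times> 'k::alg_closed_field mat list set) list"
  assumes "\<forall>(d, C)\<in>set xs. C \<in> constr (rep_space N d)"
  shows "sum_set N (map snd xs) \<in> constr (rep_space N (sum_list (map fst xs)))"
  using assms
proof (induction xs)
  case Nil
  have "{rep_sum N []} = {p \<in> pts (rep_space N 0). p = (rep_sum N [] :: 'k mat list)}"
    using rep_sum_Nil by (auto simp: pts_mat_space)
  also have "\<dots> \<in> constr (rep_space N 0)"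
    by (rule constr_tuple_eq[OF morphism_id morphism_const]) (simp add: pts_mat_space rep_sum_Nil)
  finally show ?case
    by (simp add: sum_set_Nil)
next
  case (Cons x xs)
  obtain d C where x: "x = (d, C)"
    by (cases x)
  have C: "C \<in> constr (rep_space N d)" and IH: "sum_set N (map snd xs) \<in> constr (rep_space N (sum_list (map fst xs)))"
    using Cons by (auto simp: x)
  have "C \<subseteq> mat_tuples N d" "sum_set N (map snd xs) \<subseteq> mat_tuples N (sum_list (map fst xs))"
    using constr_subset[OF C] constr_subset[OF IH] by (simp_all add: pts_mat_space)
  from sum_set_Cons[OF this] show ?case
    using constr_image_pair[OF morphism_dsum C IH] by (simp add: x)
qed

section \<open>The group action on direct sums\<close>

definition act :: "'k::field mat list \<times> 'k mat list \<Rightarrow> 'k mat list" where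
  "act z = conj_tuple (fst z ! 0) (fst z ! 1) (snd z)"

lemma morphism_act: "morphism (mat_space 2 d d \<otimes>\<^sub>s rep_space N d) (rep_space N d) act"
  using morphism_conj by (simp add: act_def[abs_def])

text \<open>Factoring the image through block sums and the action lets irreducibility, density and
  constructibility be transported along known morphisms.\<close>

lemma sum_image_eq: "sum_image N d Cs = act ` (GL d \<times> sum_set N Cs)"
proof -
  have "sum_image N d Cs = {conj_tuple g h (rep_sum N \<rho>s) |g h \<rho>s. inverse_pair d g h \<and> \<rho>s \<in> listset Cs}"
    unfolding sum_image_def conj_tuple_def inverse_pair_def by blast
  also have "\<dots> = act ` (GL d \<times> sum_set N Cs)"
  proof
    show "{conj_tuple g h (rep_sum N \<rho>s) |g h \<rho>s. inverse_pair d g h \<and> \<rho>s \<in> listset Cs} \<subseteq> act ` (GL d \<times> sum_set N Cs)"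
    proof
      fix p assume "p \<in> {conj_tuple g h (rep_sum N \<rho>s) |g h \<rho>s. inverse_pair d g h \<and> \<rho>s \<in> listset Cs}"
      then obtain g h \<rho>s where "p = conj_tuple g h (rep_sum N \<rho>s)" "inverse_pair d g h" "\<rho>s \<in> listset Cs"
        by auto
      then show "p \<in> act ` (GL d \<times> sum_set N Cs)"
        by (intro image_eqI[of _ _ "([g, h], rep_sum N \<rho>s)"]) (auto simp: act_def GL_def sum_set_def)
    qed
    show "act ` (GL d \<times> sum_set N Cs) \<subseteq> {conj_tuple g h (rep_sum N \<rho>s) |g h \<rho>s. inverse_pair d g h \<and> \<rho>s \<in> listset Cs}"
    proof
      fix p assume "p \<in> act ` (GL d \<times> sum_set N Cs)"
      then obtain g h \<rho>s where "p = conj_tuple g h (rep_sum N \<rho>s)" "inverse_pair d g h" "\<rho>s \<in> listset Cs"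
        by (auto simp: act_def GL_def sum_set_def)
      then show "p \<in> {conj_tuple g h (rep_sum N \<rho>s) |g h \<rho>s. inverse_pair d g h \<and> \<rho>s \<in> listset Cs}"
        by blast
    qed
  qed
  finally show ?thesis .
qed

lemma sum_imageE:
  assumes "p \<in> sum_image N d Cs"
  obtains g h \<rho>s where "inverse_pair d g h" "\<rho>s \<in> listset Cs" "p = conj_tuple g h (rep_sum N \<rho>s)"
  using assms unfolding sum_image_def conj_tuple_def inverse_pair_def by auto

lemma sum_imageI:
  "inverse_pair d g h \<Longrightarrow> \<rho>s \<in> listset Cs \<Longrightarrow> conj_tuple g h (rep_sum N \<rho>s) \<in> sum_image N d Cs"
  unfolding sum_image_def conj_tuple_def inverse_pair_def by blast

lemma irr_sum_image:
  fixes xs :: "(nat \<times> 'k::alg_closed_field mat list set) list"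
  assumes "\<forall>(d, C)\<in>set xs. irr (rep_space N d) C"
  shows "irr (rep_space N (sum_list (map fst xs))) (sum_image N (sum_list (map fst xs)) (map snd xs))"
  unfolding sum_image_eq by (rule irr_image[OF irr_prod[OF irr_GL irr_sum_set[OF assms]] morphism_act])

lemma GL_subset: "GL d \<subseteq> pts (mat_space 2 d d :: ('k::alg_closed_field mat list, 'k) space)"
  by (rule irr_GL[unfolded irr_def, THEN conjunct1])

lemma dense_in_sum_image:
  fixes xs :: "(nat \<times> 'k::alg_closed_field mat list set \<times> 'k mat list set) list"
  assumes "\<forall>(d, C, C')\<in>set xs. dense_in (rep_space N d) C C'"
  shows "dense_in (rep_space N (sum_list (map fst xs))) (sum_image N (sum_list (map fst xs)) (map (fst \<circ> snd) xs))
    (sum_image N (sum_list (map fst xs)) (map (snd \<circ> snd) xs))"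
  unfolding sum_image_eq
  by (rule dense_in_image[OF dense_in_prod[OF dense_in_refl[OF GL_subset] dense_in_sum_set[OF assms]] morphism_act])

lemma constr_GL: "GL d \<in> constr (mat_space 2 d d :: ('k::alg_closed_field mat list, 'k) space)"
proof -
  let ?S = "mat_space 2 d d :: ('k mat list, 'k) space"
  have "GL d = {l \<in> pts ?S. l ! 0 * l ! 1 = 1\<^sub>m d \<and> l ! 1 * l ! 0 = 1\<^sub>m d}"
  proof
    show "GL d \<subseteq> {l \<in> pts ?S. l ! 0 * l ! 1 = 1\<^sub>m d \<and> l ! 1 * l ! 0 = 1\<^sub>m d}"
      using GL_subset by (auto simp: GL_def inverse_pair_def)
    show "{l \<in> pts ?S. l ! 0 * l ! 1 = 1\<^sub>m d \<and> l ! 1 * l ! 0 = 1\<^sub>m d} \<subseteq> GL d"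
    proof
      fix l assume l: "l \<in> {l \<in> pts ?S. l ! 0 * l ! 1 = 1\<^sub>m d \<and> l ! 1 * l ! 0 = 1\<^sub>m d}"
      then have "length l = 2" "\<forall>j<2. l ! j \<in> carrier_mat d d"
        by (auto simp: dom_mat_space)
      then have "l = [l ! 0, l ! 1]" "inverse_pair d (l ! 0) (l ! 1)"
        using l by (auto simp: inverse_pair_def list_eq_iff_nth_eq less_2_cases_iff)
      then show "l \<in> GL d"
        unfolding GL_def by blast
    qed
  qed
  also have "\<dots> \<in> constr ?S"
    by (intro constr_conj constr_mat_eq[of _ d d] reg_mat_mult[of _ d d _ d] reg_mat_nth reg_mat_const) simp_all
  finally show ?thesis .
qed

lemma constr_sum_image:
  fixes xs :: "(nat \<times> 'k::alg_closed_field mat list set) list"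
  assumes "\<forall>(d, C)\<in>set xs. C \<in> constr (rep_space N d)"
  shows "sum_image N (sum_list (map fst xs)) (map snd xs) \<in> constr (rep_space N (sum_list (map fst xs)))"
  unfolding sum_image_eq by (rule constr_image_pair[OF morphism_act constr_GL constr_sum_set[OF assms]])

lemma listset_append: "xs \<in> listset Cs \<Longrightarrow> ys \<in> listset Ds \<Longrightarrow> xs @ ys \<in> listset (Cs @ Ds)"
  unfolding listset_iff by (rule list_all2_appendI)

text \<open>Conjugating the two blocks separately amounts to conjugating their sum by a block
  diagonal matrix, which is absorbed into the outer conjugation.\<close>

lemma sum_image_nested:
  assumes C: "sum_set N Cs \<subseteq> mat_tuples N d" and D: "sum_set N Ds \<subseteq> mat_tuples N e"
  shows "sum_image N (d + e) [sum_image N d Cs, sum_image N e Ds] \<subseteq> sum_image N (d + e) (Cs @ Ds)"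
proof
  fix p assume "p \<in> sum_image N (d + e) [sum_image N d Cs, sum_image N e Ds]"
  then obtain g h \<rho>s where g: "inverse_pair (d + e) g h" and \<rho>s: "\<rho>s \<in> listset [sum_image N d Cs, sum_image N e Ds]"
    and p: "p = conj_tuple g h (rep_sum N \<rho>s)"
    by (rule sum_imageE)
  from \<rho>s obtain \<rho> \<sigma> where "\<rho>s = [\<rho>, \<sigma>]" "\<rho> \<in> sum_image N d Cs" "\<sigma> \<in> sum_image N e Ds"
    by (auto simp: set_Cons_def)
  then obtain g1 h1 \<rho>s1 g2 h2 \<rho>s2 where g1: "inverse_pair d g1 h1" "\<rho>s1 \<in> listset Cs" "\<rho> = conj_tuple g1 h1 (rep_sum N \<rho>s1)"
    and g2: "inverse_pair e g2 h2" "\<rho>s2 \<in> listset Ds" "\<sigma> = conj_tuple g2 h2 (rep_sum N \<rho>s2)"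
    by (elim sum_imageE)
  have t: "rep_sum N \<rho>s1 \<in> mat_tuples N d" "rep_sum N \<rho>s2 \<in> mat_tuples N e"
    using g1(2) g2(2) C D by (auto simp: sum_set_def)
  have c: "\<rho> \<in> mat_tuples N d" "\<sigma> \<in> mat_tuples N e"
    unfolding g1(3) g2(3) by (rule conj_tuple_mat_tuples[OF g1(1) t(1)], rule conj_tuple_mat_tuples[OF g2(1) t(2)])
  note single = rep_sum_single[OF c(2)]
  have "rep_sum N \<rho>s = dsum N d e \<rho> \<sigma>"
    using rep_sum_Cons[of \<rho> N d "[\<sigma>]" e] c by (simp add: \<open>\<rho>s = [\<rho>, \<sigma>]\<close> single)
  also have "\<dots> = conj_tuple (block_diag d e g1 g2) (block_diag d e h1 h2) (rep_sum N (\<rho>s1 @ \<rho>s2))"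
    unfolding g1(3) g2(3) dsum_conj[OF g1(1) g2(1) t] rep_sum_append[OF t] ..
  finally have "p = conj_tuple g h (conj_tuple (block_diag d e g1 g2) (block_diag d e h1 h2) (rep_sum N (\<rho>s1 @ \<rho>s2)))"
    by (simp add: p)
  also have "\<dots> = conj_tuple (g * block_diag d e g1 g2) (block_diag d e h1 h2 * h) (rep_sum N (\<rho>s1 @ \<rho>s2))"
    by (rule conj_tuple_comp[OF g inverse_pair_block_diag[OF g1(1) g2(1)]])
      (unfold rep_sum_append[OF t], rule dsum_mat_tuples[OF t])
  also have "\<dots> \<in> sum_image N (d + e) (Cs @ Ds)"
    by (rule sum_imageI[OF inverse_pair_mult[OF g inverse_pair_block_diag[OF g1(1) g2(1)]] listset_append[OF g1(2) g2(2)]])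
  finally show "p \<in> sum_image N (d + e) (Cs @ Ds)" .
qed

text \<open>Irreducibility for any finite number of functions; the empty product uses that
  \<open>C\<close> is nonempty.\<close>

lemma irr_finite_common_nonzero:
  assumes C: "irr S C" and "finite J" and "\<forall>j\<in>J. f j \<in> reg S \<and> (\<exists>p\<in>C. f j p \<noteq> 0)"
  shows "(\<lambda>p. \<Prod>j\<in>J. f j p) \<in> reg S \<and> (\<exists>p\<in>C. (\<Prod>j\<in>J. f j p) \<noteq> 0)"
  using assms(2,3)
proof (induction rule: finite_induct)
  case empty
  then show ?case
    using C by (auto simp: irr_def intro: reg.const)
next
  case (insert j J)
  have IH: "(\<lambda>p. \<Prod>j\<in>J. f j p) \<in> reg S" "\<exists>p\<in>C. (\<Prod>j\<in>J. f j p) \<noteq> 0"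
    and f: "f j \<in> reg S" "\<exists>p\<in>C. f j p \<noteq> 0"
    using insert by simp_all
  have "\<exists>p\<in>C. f j p \<noteq> 0 \<and> (\<Prod>j\<in>J. f j p) \<noteq> 0"
    using C IH f by (simp add: irr_def)
  then show ?case
    using insert.hyps IH(1) f(1) by (simp add: reg.mult)
qed

section \<open>Decomposition of components\<close>

context
  fixes N m :: nat and I :: "'k::alg_closed_field nc_poly set" and \<tau> :: "'k mat list"
  assumes I: "two_sided_ideal N I" and \<tau>_rep: "\<tau> \<in> rep N I m"
begin

section \<open>Strata, their components and direct sums\<close>

abbreviation (input) strat :: "nat \<Rightarrow> nat \<Rightarrow> 'k mat list set" where
  "strat d u \<equiv> X_points N I m \<tau> d u"

abbreviation (input) comps :: "nat \<Rightarrow> nat \<Rightarrow> 'k mat list set set" where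
  "comps d u \<equiv> irreducible_components (X_space N I m \<tau> d u)"

lemma \<tau>: "\<tau> \<in> mat_tuples N m"
  using \<tau>_rep by (simp add: rep_def)

lemma strat_subset: "strat d u \<subseteq> mat_tuples N d"
  by (auto simp: X_points_def rep_def)

lemma strat_subset_pts: "strat d u \<subseteq> pts (rep_space N d)"
  using strat_subset by (simp add: pts_mat_space)

lemma comps_iff:
  "X \<in> comps d u \<longleftrightarrow> irr (rep_space N d) X \<and> X \<subseteq> strat d u \<and>
    (\<forall>S. irr (rep_space N d) S \<longrightarrow> S \<subseteq> strat d u \<longrightarrow> X \<subseteq> S \<longrightarrow> S = X)"
  unfolding X_space_def by (rule irreducible_components_iff[OF strat_subset])

lemma compsD:
  assumes "X \<in> comps d u"
  shows "irr (rep_space N d) X" "X \<subseteq> strat d u" "X \<subseteq> mat_tuples N d"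
    "irr (rep_space N d) S \<Longrightarrow> S \<subseteq> strat d u \<Longrightarrow> X \<subseteq> S \<Longrightarrow> S = X"
proof -
  note X = assms[unfolded comps_iff]
  show "irr (rep_space N d) X" "X \<subseteq> strat d u"
    using X by simp_all
  then show "X \<subseteq> mat_tuples N d"
    using strat_subset[of d u] by simp
  show "irr (rep_space N d) S \<Longrightarrow> S \<subseteq> strat d u \<Longrightarrow> X \<subseteq> S \<Longrightarrow> S = X"
    using X by simp
qed

lemma closure_eq_vcl:
  "C \<subseteq> strat d u \<Longrightarrow> (X_space N I m \<tau> d u) closure_of C = vcl (rep_space N d) (strat d u) C"
  unfolding X_space_def by (rule closure_of_eq_vcl[OF strat_subset])

lemma comps_eq_vcl:
  assumes "X \<in> comps d u" "irr (rep_space N d) C" "C \<subseteq> strat d u" "X \<subseteq> vcl (rep_space N d) (strat d u) C"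
  shows "vcl (rep_space N d) (strat d u) C = X"
  using component_eq_vcl[OF strat_subset assms(1)[unfolded X_space_def] assms(2-4)] .

lemma comps_closed:
  assumes X: "X \<in> comps d u"
  shows "vcl (rep_space N d) (strat d u) X = X"
  by (rule comps_eq_vcl[OF X compsD(1,2)[OF X] vcl_superset[OF compsD(2)[OF X] strat_subset_pts]])

text \<open>A product of such functions later excludes finitely many sets \<open>S\<close> at
  once.\<close>

lemma ex_reg_separating:
  assumes X: "X \<in> comps d u" and neg: "\<not> X \<subseteq> vcl (rep_space N d) (strat d u) S"
  shows "\<exists>f. (f \<in> reg (rep_space N d) \<and> (\<exists>p\<in>X. f p \<noteq> 0)) \<and> (\<forall>p\<in>S. f p = 0)"
proof -
  obtain p where p: "p \<in> X" "p \<notin> vcl (rep_space N d) (strat d u) S"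
    using neg by blast
  have "p \<in> pts (rep_space N d)" "p \<in> strat d u"
    using p(1) compsD(2,3)[OF X] by (auto simp: pts_mat_space)
  then have "\<not> (\<forall>f\<in>{f \<in> reg (rep_space N d). \<forall>p\<in>S. f p = 0}. f p = 0)"
    using p(2) by (simp add: vcl_def zeros_def)
  then obtain f where "f \<in> {f \<in> reg (rep_space N d). \<forall>p\<in>S. f p = 0}" "f p \<noteq> 0"
    unfolding Ball_def not_all not_imp by (elim exE conjE)
  then show ?thesis
    using p(1) by (intro exI[of _ f] conjI bexI[of _ p]) simp_all
qed

lemma finite_comps: "finite (comps d u)"
  unfolding X_space_def by (rule finite_components(1)[OF strat_subset])

lemma ex_comps: "irr (rep_space N d) Y \<Longrightarrow> Y \<subseteq> strat d u \<Longrightarrow> \<exists>C\<in>comps d u. Y \<subseteq> C"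
  unfolding X_space_def by (rule finite_components(2)[OF strat_subset])

lemma strat_conj: "inverse_pair d g h \<Longrightarrow> \<rho> \<in> strat d u \<Longrightarrow> conj_tuple g h \<rho> \<in> strat d u"
  using rep_conj[OF I] hom_dim_conj[OF _ _ \<tau>] by (simp add: X_points_def) (simp add: rep_def)

lemma strat_dsum:
  assumes "\<rho> \<in> strat d u" "\<sigma> \<in> strat e v"
  shows "dsum N d e \<rho> \<sigma> \<in> strat (d + e) (u + v)"
proof -
  have t: "\<rho> \<in> mat_tuples N d" "\<sigma> \<in> mat_tuples N e"
    using assms strat_subset by auto
  show ?thesis
    using assms rep_dsum_iff[OF I t] hom_dim_dsum[OF t \<tau>] by (simp add: X_points_def)
qed

text \<open>The second indices are read off as the Hom dimensions of the two summands.\<close>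

lemma strat_dsum_parts:
  assumes t: "\<rho> \<in> mat_tuples N d" "\<sigma> \<in> mat_tuples N e" and "dsum N d e \<rho> \<sigma> \<in> strat (d + e) w"
  shows "\<exists>u v. w = u + v \<and> \<rho> \<in> strat d u \<and> \<sigma> \<in> strat e v"
  using assms(3) rep_dsum_iff[OF I t] hom_dim_dsum[OF t \<tau>]
  by (intro exI[of _ "hom_dim N d m \<rho> \<tau>"] exI[of _ "hom_dim N e m \<sigma> \<tau>"]) (simp add: X_points_def)

lemma hom_dim_0:
  assumes \<rho>: "\<rho> \<in> mat_tuples N 0"
  shows "hom_dim N 0 m \<rho> \<tau> = 0"
  unfolding hom_dim_eq_sdim
proof (rule sdim_eq[OF mat_subspace_hom[OF \<rho> \<tau>]])
  show "is_basis m 0 (hom_space N 0 m \<rho> \<tau>) 0 (\<lambda>_. 0\<^sub>m m 0)"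
    by (auto simp: is_basis_def hom_space_def intro!: eq_matI)
qed

lemma mat_tuples_0_eq:
  assumes "\<rho> \<in> mat_tuples N 0" "\<sigma> \<in> mat_tuples N 0"
  shows "\<rho> = (\<sigma> :: 'k mat list)"
proof (rule nth_equalityI)
  show "length \<rho> = length \<sigma>"
    using assms by (simp add: mat_tuples_length)
  fix j assume "j < length \<rho>"
  then have "\<rho> ! j \<in> carrier_mat 0 0" "\<sigma> ! j \<in> carrier_mat 0 0"
    using assms mat_tuples_nth by (auto simp: mat_tuples_length)
  then show "\<rho> ! j = \<sigma> ! j"
    by (intro eq_matI) auto
qed

lemma rep_sum_Nil_strat: "rep_sum N [] \<in> strat 0 0"
proof -
  have "eval_nc 0 \<rho> h = 0\<^sub>m 0 0" for \<rho> :: "'k mat list" and h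
    by (rule eq_matI) (auto simp: eval_nc_def)
  then show ?thesis
    using rep_sum_Nil[of N, where ?'a = 'k] hom_dim_0[OF rep_sum_Nil] by (simp add: X_points_def rep_def)
qed

lemma sum_set_strat:
  assumes "\<forall>(d, u, C)\<in>set Xs. C \<subseteq> strat d u"
  shows "sum_set N (map (\<lambda>(d, u, C). C) Xs) \<subseteq> strat (\<Sum>(d, u, C)\<leftarrow>Xs. d) (\<Sum>(d, u, C)\<leftarrow>Xs. u)"
  using assms
proof (induction Xs)
  case Nil
  then show ?case
    by (simp add: sum_set_Nil rep_sum_Nil_strat)
next
  case (Cons x Xs)
  obtain d u C where x: "x = (d, u, C)"
    by (cases x)
  let ?e = "\<Sum>(d, u, C)\<leftarrow>Xs. d" and ?v = "\<Sum>(d, u, C)\<leftarrow>Xs. u" and ?S = "sum_set N (map (\<lambda>(d, u, C). C) Xs)"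
  have C: "C \<subseteq> strat d u" and IH: "?S \<subseteq> strat ?e ?v"
    by (use Cons.prems in \<open>simp add: x\<close>, rule Cons.IH, use Cons.prems in simp)
  have t: "C \<subseteq> mat_tuples N d" "?S \<subseteq> mat_tuples N ?e"
    by (rule order_trans[OF C strat_subset], rule order_trans[OF IH strat_subset])
  have maps: "map (\<lambda>(d, u, C). C) (x # Xs) = C # map (\<lambda>(d, u, C). C) Xs"
    "(\<Sum>(d, u, C)\<leftarrow>x # Xs. d) = d + ?e" "(\<Sum>(d, u, C)\<leftarrow>x # Xs. u) = u + ?v"
    by (simp_all add: x)
  show ?case
    unfolding maps sum_set_Cons[OF t]
  proof (rule image_subsetI)
    fix z assume "z \<in> C \<times> ?S"
    then show "dsum N d ?e (fst z) (snd z) \<in> strat (d + ?e) (u + ?v)"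
      using C IH by (intro strat_dsum) auto
  qed
qed

lemma sum_image_strat:
  assumes "\<forall>(d, u, C)\<in>set Xs. C \<subseteq> strat d u" and d: "d = (\<Sum>(d, u, C)\<leftarrow>Xs. d)" and u: "u = (\<Sum>(d, u, C)\<leftarrow>Xs. u)"
  shows "sum_image N d (map (\<lambda>(d, u, C). C) Xs) \<subseteq> strat d u"
proof
  fix p assume "p \<in> sum_image N d (map (\<lambda>(d, u, C). C) Xs)"
  then obtain g h \<rho>s where g: "inverse_pair d g h" "\<rho>s \<in> listset (map (\<lambda>(d, u, C). C) Xs)" "p = conj_tuple g h (rep_sum N \<rho>s)"
    by (rule sum_imageE)
  then have "rep_sum N \<rho>s \<in> strat d u"
    using sum_set_strat[OF assms(1)] unfolding d u sum_set_def by auto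
  then show "p \<in> strat d u"
    unfolding g(3) by (rule strat_conj[OF g(1)])
qed

lemma irr_sum_image_comps:
  assumes "\<forall>(d, u, C)\<in>set Xs. C \<in> comps d u" and d: "d = (\<Sum>(d, u, C)\<leftarrow>Xs. d)"
  shows "irr (rep_space N d) (sum_image N d (map (\<lambda>(d, u, C). C) Xs))"
proof -
  let ?xs = "map (\<lambda>(d, u, C). (d, C)) Xs"
  have maps: "map fst ?xs = map (\<lambda>(d, u, C). d) Xs" "map snd ?xs = map (\<lambda>(d, u, C). C) Xs"
    by (simp_all add: case_prod_unfold)
  have "\<forall>(d, C)\<in>set ?xs. irr (rep_space N d) C"
    using assms(1) compsD(1) by fastforce
  from irr_sum_image[OF this] show ?thesis
    unfolding maps d .
qed

lemma single_mem_sum_image: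
  assumes "\<rho> \<in> C" "\<rho> \<in> mat_tuples N d"
  shows "\<rho> \<in> sum_image N d [C]"
  using sum_imageI[OF inverse_pair_one, of "[\<rho>]" "[C]" d N] assms
  by (simp add: rep_sum_single conj_tuple_one set_Cons_def)

text \<open>The orbit of a component is irreducible, stays in the stratum and contains the
  component, hence equals it by maximality.\<close>

lemma comps_sum_image_single:
  assumes C: "C \<in> comps d u"
  shows "sum_image N d [C] = C"
proof (rule compsD(4)[OF C])
  show "irr (rep_space N d) (sum_image N d [C])"
    using irr_sum_image_comps[of "[(d, u, C)]" d] C by simp
  show "sum_image N d [C] \<subseteq> strat d u"
    using sum_image_strat[of "[(d, u, C)]" d u] compsD(2)[OF C] by simp
  show "C \<subseteq> sum_image N d [C]"
    using single_mem_sum_image compsD(3)[OF C] by blast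
qed

text \<open>As \<open>GL d\<close> is irreducible, the orbit of an irreducible set is irreducible.\<close>

lemma comps_conj:
  assumes C: "C \<in> comps d u" and \<rho>: "\<rho> \<in> C" and g: "inverse_pair d g h"
  shows "conj_tuple g h \<rho> \<in> C"
proof -
  have "conj_tuple g h (rep_sum N [\<rho>]) \<in> sum_image N d [C]"
    by (rule sum_imageI[OF g]) (simp add: \<rho> set_Cons_def)
  moreover have "\<rho> \<in> mat_tuples N d"
    using compsD(3)[OF C] \<rho> by auto
  ultimately show ?thesis
    unfolding comps_sum_image_single[OF C] by (simp add: rep_sum_single)
qed

text \<open>Every decomposable point lies in the image of a pair of components of smaller dimension,
  and the pairs are finitely many. If no image had \<open>X\<close> in its closure, the product of
  the separating functions would be nonzero somewhere on \<open>X\<close> but vanish on all of the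
  dense set \<open>D\<close>.\<close>

lemma ex_comps_pair:
  assumes X: "X \<in> comps d u" and "d > 0" and dense: "dense_in (rep_space N d) D X"
    and D: "\<forall>\<rho>\<in>D. \<not> indecomposable N d \<rho>"
  shows "\<exists>d1 u1 C1 d2 u2 C2. C1 \<in> comps d1 u1 \<and> C2 \<in> comps d2 u2 \<and> d1 < d \<and> d2 < d \<and> d = d1 + d2 \<and> u = u1 + u2 \<and>
    X \<subseteq> vcl (rep_space N d) (strat d u) (sum_image N d [C1, C2])"
proof -
  \<comment> \<open>All candidate pairs. The range \<open>0 < d1 < d\<close> makes both dimensions
    smaller, and \<open>u1 \<le> u\<close> keeps the set finite.\<close>
  define J where "J = (SIGMA d1:{0<..<d}. SIGMA u1:{..u}. comps d1 u1 \<times> comps (d - d1) (u - u1))"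
  define S where "S j = (case j of (d1, u1, C1, C2) \<Rightarrow> sum_image N d [C1, C2])" for j :: "nat \<times> nat \<times> 'k mat list set \<times> 'k mat list set"
  have "finite J"
    unfolding J_def by (intro finite_SigmaI finite_cartesian_product finite_comps) simp_all
  have cover: "\<exists>j\<in>J. \<rho> \<in> S j" if \<rho>D: "\<rho> \<in> D" for \<rho>
  proof -
    have \<rho>X: "\<rho> \<in> strat d u"
      using \<rho>D dense compsD(2)[OF X] by (auto simp: dense_in_def)
    have \<rho>: "\<rho> \<in> mat_tuples N d"
      using \<rho>X strat_subset by auto
    from decomposable_conj_dsum[OF \<rho> \<open>d > 0\<close> D[rule_format, OF \<rho>D]]
    obtain d1 d2 \<sigma>1 \<sigma>2 g h where d: "0 < d1" "0 < d2" "d = d1 + d2"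
      and \<sigma>: "\<sigma>1 \<in> mat_tuples N d1" "\<sigma>2 \<in> mat_tuples N d2"
      and g: "inverse_pair d g h" and \<rho>_eq: "\<rho> = conj_tuple g h (dsum N d1 d2 \<sigma>1 \<sigma>2)"
      by (elim exE conjE)
    have t: "dsum N d1 d2 \<sigma>1 \<sigma>2 \<in> mat_tuples N d"
      unfolding d(3) by (rule dsum_mat_tuples[OF \<sigma>])
    have "dsum N d1 d2 \<sigma>1 \<sigma>2 \<in> strat (d1 + d2) u"
      using strat_conj[OF inverse_pair_sym[OF g] \<rho>X] conj_tuple_inverse[OF g t] unfolding \<rho>_eq d(3) by simp
    from strat_dsum_parts[OF \<sigma> this] obtain u1 u2 where u: "u = u1 + u2" "\<sigma>1 \<in> strat d1 u1" "\<sigma>2 \<in> strat d2 u2"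
      by (elim exE conjE)
    \<comment> \<open>A point is irreducible, hence contained in some component of its
      stratum.\<close>
    have "irr (rep_space N d1) {\<sigma>1}" "irr (rep_space N d2) {\<sigma>2}"
      using \<sigma> by (simp_all add: irr_singleton pts_mat_space)
    then obtain C1 C2 where C: "C1 \<in> comps d1 u1" "\<sigma>1 \<in> C1" "C2 \<in> comps d2 u2" "\<sigma>2 \<in> C2"
      using ex_comps[of d1 "{\<sigma>1}" u1] ex_comps[of d2 "{\<sigma>2}" u2] u(2,3) by auto
    have "conj_tuple g h (rep_sum N [\<sigma>1, \<sigma>2]) \<in> sum_image N d [C1, C2]"
      by (rule sum_imageI[OF g]) (simp add: C(2,4) set_Cons_def)
    then have "\<rho> \<in> S (d1, u1, C1, C2)"
      using rep_sum_Cons[of \<sigma>1 N d1 "[\<sigma>2]" d2] \<sigma> by (simp add: S_def \<rho>_eq rep_sum_single)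
    moreover have "(d1, u1, C1, C2) \<in> J"
      using d u(1) C by (simp add: J_def)
    ultimately show ?thesis
      by (rule bexI)
  qed
  have "\<exists>j\<in>J. X \<subseteq> vcl (rep_space N d) (strat d u) (S j)"
  proof (rule ccontr)
    assume neg: "\<not> (\<exists>j\<in>J. X \<subseteq> vcl (rep_space N d) (strat d u) (S j))"
    have "\<forall>j\<in>J. \<exists>f. (f \<in> reg (rep_space N d) \<and> (\<exists>p\<in>X. f p \<noteq> 0)) \<and> (\<forall>p\<in>S j. f p = 0)"
    proof
      fix j assume "j \<in> J"
      then have "\<not> X \<subseteq> vcl (rep_space N d) (strat d u) (S j)"
        using neg by simp
      then show "\<exists>f. (f \<in> reg (rep_space N d) \<and> (\<exists>p\<in>X. f p \<noteq> 0)) \<and> (\<forall>p\<in>S j. f p = 0)"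
        by (rule ex_reg_separating[OF X])
    qed
    from bchoice[OF this] obtain f where
      f: "\<forall>j\<in>J. (f j \<in> reg (rep_space N d) \<and> (\<exists>p\<in>X. f j p \<noteq> 0)) \<and> (\<forall>p\<in>S j. f j p = 0)" ..
    have "(\<lambda>p. \<Prod>j\<in>J. f j p) \<in> reg (rep_space N d) \<and> (\<exists>p\<in>X. (\<Prod>j\<in>J. f j p) \<noteq> 0)"
      by (rule irr_finite_common_nonzero[OF compsD(1)[OF X] \<open>finite J\<close>]) (use f in simp)
    then have "\<exists>p\<in>D. (\<Prod>j\<in>J. f j p) \<noteq> 0"
      using dense by (simp add: dense_in_def)
    then obtain p where p: "p \<in> D" "(\<Prod>j\<in>J. f j p) \<noteq> 0"
      by (rule bexE)
    from cover[OF p(1)] obtain j where "j \<in> J" "p \<in> S j" ..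
    then have "f j p = 0"
      using f by simp
    then show False
      using p(2) \<open>finite J\<close> \<open>j \<in> J\<close> by (auto simp: prod_zero_iff)
  qed
  then obtain d1 u1 C1 C2 where j: "(d1, u1, C1, C2) \<in> J" "X \<subseteq> vcl (rep_space N d) (strat d u) (S (d1, u1, C1, C2))"
    by (auto simp: Bex_def)
  then show ?thesis
    by (intro exI[of _ d1] exI[of _ u1] exI[of _ C1] exI[of _ "d - d1"] exI[of _ "u - u1"] exI[of _ C2])
      (auto simp: J_def S_def)
qed

section \<open>Decompositions and their existence\<close>

lemma decomposition_eq:
  assumes "\<forall>(d, u, C)\<in>set Xs. C \<in> comps d u" and d: "d = (\<Sum>(d, u, C)\<leftarrow>Xs. d)" and u: "u = (\<Sum>(d, u, C)\<leftarrow>Xs. u)"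
  shows "(X_space N I m \<tau> d u) closure_of (sum_image N d (map (\<lambda>(d, u, C). C) Xs)) =
      vcl (rep_space N d) (strat d u) (sum_image N d (map (\<lambda>(d, u, C). C) Xs))"
    and "sum_image N d (map (\<lambda>(d, u, C). C) Xs) \<subseteq> strat d u"
proof -
  have "\<forall>(d, u, C)\<in>set Xs. C \<subseteq> strat d u"
    using assms(1) compsD(2) by blast
  then show "sum_image N d (map (\<lambda>(d, u, C). C) Xs) \<subseteq> strat d u"
    by (rule sum_image_strat[OF _ d u])
  then show "(X_space N I m \<tau> d u) closure_of (sum_image N d (map (\<lambda>(d, u, C). C) Xs)) =
      vcl (rep_space N d) (strat d u) (sum_image N d (map (\<lambda>(d, u, C). C) Xs))"
    by (rule closure_eq_vcl)
qed

lemma decomposition_iff: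
  "component_decomposition N I m \<tau> d u X Xs \<longleftrightarrow>
    (\<forall>(d, u, C)\<in>set Xs. C \<in> comps d u) \<and> (\<forall>(d, u, C)\<in>set Xs. generically_indecomposable N d C) \<and>
    d = (\<Sum>(d, u, C)\<leftarrow>Xs. d) \<and> u = (\<Sum>(d, u, C)\<leftarrow>Xs. u) \<and>
    X = vcl (rep_space N d) (strat d u) (sum_image N d (map (\<lambda>(d, u, C). C) Xs))"
proof -
  have split: "(\<forall>(d, u, C)\<in>set Xs. C \<in> comps d u \<and> generically_indecomposable N d C) \<longleftrightarrow>
    (\<forall>(d, u, C)\<in>set Xs. C \<in> comps d u) \<and> (\<forall>(d, u, C)\<in>set Xs. generically_indecomposable N d C)"
    by (auto simp: case_prod_unfold)
  show ?thesis
    unfolding component_decomposition_def split using decomposition_eq(1)[of Xs d u] by (metis (no_types))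
qed

lemma decomposition_exists: "X \<in> comps d u \<Longrightarrow> \<exists>Xs. component_decomposition N I m \<tau> d u X Xs"
proof (induction d arbitrary: u X rule: less_induct)
  case (less d)
  note X = less.prems
  show ?case
  proof (cases "d = 0")
    case True
    \<comment> \<open>In dimension 0 there is a single point, of Hom dimension 0, and the empty list
      decomposes it.\<close>
    obtain \<rho> where \<rho>: "\<rho> \<in> X"
      using compsD(1)[OF X] by (auto simp: irr_def)
    have t: "p = rep_sum N []" if "p \<in> mat_tuples N 0" for p :: "'k mat list"
      by (rule mat_tuples_0_eq[OF that rep_sum_Nil])
    have "\<rho> \<in> strat 0 u"
      using \<rho> compsD(2)[OF X] True by auto
    then have u: "u = 0"
      using hom_dim_0 strat_subset by (auto simp: X_points_def rep_def)
    have X_eq: "X = {rep_sum N []}"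
      using \<rho> t compsD(3)[OF X] True by auto
    have "sum_image N 0 [] = {rep_sum N [] :: 'k mat list}"
    proof
      have "sum_image N 0 [] \<subseteq> strat 0 0"
        using sum_image_strat[of "[]" 0 0] by simp
      then show "sum_image N 0 [] \<subseteq> {rep_sum N [] :: 'k mat list}"
        using t strat_subset by blast
      have "conj_tuple (1\<^sub>m 0) (1\<^sub>m 0) (rep_sum N [] :: 'k mat list) \<in> sum_image N 0 []"
        by (rule sum_imageI[OF inverse_pair_one]) simp
      then show "{rep_sum N [] :: 'k mat list} \<subseteq> sum_image N 0 []"
        unfolding conj_tuple_one[OF rep_sum_Nil] by (rule insert_subsetI) simp
    qed
    then have "component_decomposition N I m \<tau> d u X []"
      unfolding decomposition_iff using comps_closed[OF X] True u X_eq by simp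
    then show ?thesis ..
  next
    case d: False
    show ?thesis
    proof (cases "generically_indecomposable N d X")
      case True
      then have "component_decomposition N I m \<tau> d u X [(d, u, X)]"
        unfolding decomposition_iff using X comps_closed[OF X] by (simp add: comps_sum_image_single[OF X])
      then show ?thesis ..
    next
      case False
      \<comment> \<open>A function nonzero somewhere on \<open>X\<close> but zero on
        \<open>D\<close> would exhibit an open set of indecomposable points.\<close>
      define D where "D = {\<rho> \<in> X. \<not> indecomposable N d \<rho>}"
      have "dense_in (rep_space N d) D X"
        unfolding dense_in_def
      proof (intro conjI ballI impI)
        show "D \<subseteq> X" "X \<subseteq> pts (rep_space N d)"
          using compsD(3)[OF X] by (auto simp: D_def pts_mat_space)
        fix f assume f: "f \<in> reg (rep_space N d)" "\<exists>p\<in>X. f p \<noteq> 0"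
        show "\<exists>p\<in>D. f p \<noteq> 0"
        proof (rule ccontr)
          assume neg: "\<not> (\<exists>p\<in>D. f p \<noteq> 0)"
          have "\<forall>p\<in>X. f p \<noteq> 0 \<longrightarrow> indecomposable N d p"
          proof (intro ballI impI, rule ccontr)
            fix p assume "p \<in> X" "f p \<noteq> 0" "\<not> indecomposable N d p"
            then have "p \<in> D"
              by (simp add: D_def)
            then show False
              using neg \<open>f p \<noteq> 0\<close> by simp
          qed
          then have "generically_indecomposable N d X"
            unfolding generically_indecomposable_iff[OF compsD(1)[OF X]] using f by (intro bexI[of _ f] conjI)
          then show False
            using False by simp
        qed
      qed
      from ex_comps_pair[OF X _ this] d obtain d1 u1 C1 d2 u2 C2 where C: "C1 \<in> comps d1 u1" "C2 \<in> comps d2 u2"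
        and lt: "d1 < d" "d2 < d" and d_eq: "d = d1 + d2" and u_eq: "u = u1 + u2"
        and X_sub: "X \<subseteq> vcl (rep_space N d) (strat d u) (sum_image N d [C1, C2])"
        by (auto simp: D_def)
      from less.IH[OF lt(1) C(1)] obtain Xs1 where Xs1: "component_decomposition N I m \<tau> d1 u1 C1 Xs1" ..
      from less.IH[OF lt(2) C(2)] obtain Xs2 where Xs2: "component_decomposition N I m \<tau> d2 u2 C2 Xs2" ..
      note Xs1 = Xs1[unfolded decomposition_iff] and Xs2 = Xs2[unfolded decomposition_iff]
      let ?proj = "map (\<lambda>(d, u, C). C)"
      let ?A1 = "sum_image N d1 (?proj Xs1)" and ?A2 = "sum_image N d2 (?proj Xs2)"
      have A1: "dense_in (rep_space N d1) ?A1 C1" "?A1 \<subseteq> strat d1 u1"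
      proof -
        show s: "?A1 \<subseteq> strat d1 u1"
          by (rule decomposition_eq(2)) (use Xs1 in auto)
        show "dense_in (rep_space N d1) ?A1 C1"
          using dense_in_vcl[OF s strat_subset_pts] Xs1 by simp
      qed
      have A2: "dense_in (rep_space N d2) ?A2 C2" "?A2 \<subseteq> strat d2 u2"
      proof -
        show s: "?A2 \<subseteq> strat d2 u2"
          by (rule decomposition_eq(2)) (use Xs2 in auto)
        show "dense_in (rep_space N d2) ?A2 C2"
          using dense_in_vcl[OF s strat_subset_pts] Xs2 by simp
      qed
      \<comment> \<open>Each inner image is dense in its component, so replacing the components by
        the inner images keeps the outer image dense; nesting then merges the two lists.\<close>
      have dense: "dense_in (rep_space N d) (sum_image N d [?A1, ?A2]) (sum_image N d [C1, C2])"
        using dense_in_sum_image[of "[(d1, ?A1, C1), (d2, ?A2, C2)]" N] A1(1) A2(1) by (simp add: d_eq)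
      have "X \<subseteq> vcl (rep_space N d) (strat d u) (sum_image N d (?proj (Xs1 @ Xs2)))"
      proof -
        have "sum_set N (?proj Xs1) \<subseteq> mat_tuples N d1" "sum_set N (?proj Xs2) \<subseteq> mat_tuples N d2"
        proof -
          have "sum_set N (?proj Xs1) \<subseteq> strat d1 u1"
            using sum_set_strat[of Xs1] Xs1 compsD(2) by blast
          then show "sum_set N (?proj Xs1) \<subseteq> mat_tuples N d1"
            using strat_subset by blast
          have "sum_set N (?proj Xs2) \<subseteq> strat d2 u2"
            using sum_set_strat[of Xs2] Xs2 compsD(2) by blast
          then show "sum_set N (?proj Xs2) \<subseteq> mat_tuples N d2"
            using strat_subset by blast
        qed
        from sum_image_nested[OF this] have nested: "sum_image N d [?A1, ?A2] \<subseteq> sum_image N d (?proj (Xs1 @ Xs2))"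
          by (simp add: d_eq)
        have S: "sum_image N d [C1, C2] \<subseteq> strat d u"
          using sum_image_strat[of "[(d1, u1, C1), (d2, u2, C2)]" d u] compsD(2)[OF C(1)] compsD(2)[OF C(2)] d_eq u_eq by simp
        have "dense_in (rep_space N d) (sum_image N d [C1, C2]) (vcl (rep_space N d) (strat d u) (sum_image N d [C1, C2]))"
          by (rule dense_in_vcl[OF S strat_subset_pts])
        from dense_in_subset_vcl[OF dense_in_trans[OF dense this] nested vcl_subset] show ?thesis
          using X_sub by (rule order_trans[rotated])
      qed
      moreover have comps12: "\<forall>(d, u, C)\<in>set (Xs1 @ Xs2). C \<in> comps d u"
        using Xs1 Xs2 by auto
      moreover have d12: "d = (\<Sum>(d, u, C)\<leftarrow>Xs1 @ Xs2. d)" and u12: "u = (\<Sum>(d, u, C)\<leftarrow>Xs1 @ Xs2. u)"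
        using Xs1 Xs2 d_eq u_eq by simp_all
      ultimately have "vcl (rep_space N d) (strat d u) (sum_image N d (?proj (Xs1 @ Xs2))) = X"
        using comps_eq_vcl[OF X irr_sum_image_comps[OF comps12 d12] decomposition_eq(2)[OF comps12 d12 u12]] by simp
      moreover have "\<forall>(d, u, C)\<in>set (Xs1 @ Xs2). generically_indecomposable N d C"
        using Xs1 Xs2 by auto
      ultimately have "component_decomposition N I m \<tau> d u X (Xs1 @ Xs2)"
        unfolding decomposition_iff using comps12 d12 u12 by simp
      then show ?thesis ..
    qed
  qed
qed

section \<open>Uniqueness of the decomposition\<close>

text \<open>
  A point of \<open>A\<close> determines the triple \<open>(d, u, C)\<close> among the members of \<open>\<T>\<close>, since \<open>u\<close> can be read off
  from the point.
\<close>

definition generic_part ::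
  "(nat \<times> nat \<times> 'k mat list set) set \<Rightarrow> nat \<times> nat \<times> 'k mat list set \<Rightarrow> 'k mat list set \<Rightarrow> bool" where
  "generic_part \<T> = (\<lambda>(d, u, C) A. dense_in (rep_space N d) A C \<and> A \<in> constr (rep_space N d) \<and>
     (\<forall>\<rho>\<in>A. indecomposable N d \<rho> \<and> (\<forall>C'. (d, u, C') \<in> \<T> \<longrightarrow> \<rho> \<in> C' \<longrightarrow> C' = C)))"

text \<open>Distinct components of one stratum do not contain each other, so each competitor yields
  a function that vanishes on it but not on all of \<open>C\<close>. Their product, times a function
  whose nonzero points on \<open>C\<close> are indecomposable, cuts out the required open
  part.\<close>

lemma ex_generic_part:
  assumes "finite \<T>" and comps: "\<forall>(d, u, C)\<in>\<T>. C \<in> comps d u"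
    and T: "(d, u, C) \<in> \<T>" and ind: "generically_indecomposable N d C"
  shows "\<exists>A. generic_part \<T> (d, u, C) A"
proof -
  define J where "J = {C'. (d, u, C') \<in> \<T> \<and> C' \<noteq> C}"
  have "J \<subseteq> (snd \<circ> snd) ` \<T>"
    by (force simp: J_def)
  then have "finite J"
    using assms(1) by (rule finite_subset[OF _ finite_imageI])
  have C: "C \<in> comps d u"
    using comps T by auto
  have "\<forall>C'\<in>J. \<exists>f. (f \<in> reg (rep_space N d) \<and> (\<exists>p\<in>C. f p \<noteq> 0)) \<and> (\<forall>p\<in>C'. f p = 0)"
  proof
    fix C' assume "C' \<in> J"
    then have C': "C' \<in> comps d u" "C' \<noteq> C"
      using comps by (auto simp: J_def)
    have "\<not> C \<subseteq> vcl (rep_space N d) (strat d u) C'"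
      unfolding comps_closed[OF C'(1)] using compsD(4)[OF C compsD(1,2)[OF C'(1)]] C'(2) by auto
    then show "\<exists>f. (f \<in> reg (rep_space N d) \<and> (\<exists>p\<in>C. f p \<noteq> 0)) \<and> (\<forall>p\<in>C'. f p = 0)"
      by (rule ex_reg_separating[OF C])
  qed
  from bchoice[OF this] obtain f where
    f: "\<forall>C'\<in>J. (f C' \<in> reg (rep_space N d) \<and> (\<exists>p\<in>C. f C' p \<noteq> 0)) \<and> (\<forall>p\<in>C'. f C' p = 0)" ..
  define F where "F = (\<lambda>p. \<Prod>C'\<in>J. f C' p)"
  have F: "F \<in> reg (rep_space N d) \<and> (\<exists>p\<in>C. F p \<noteq> 0)"
    unfolding F_def by (rule irr_finite_common_nonzero[OF compsD(1)[OF C] \<open>finite J\<close>]) (use f in simp)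
  have F0: "C' = C" if "(d, u, C') \<in> \<T>" "\<rho> \<in> C'" "F \<rho> \<noteq> 0" for C' \<rho>
  proof (rule ccontr)
    assume "C' \<noteq> C"
    then have "C' \<in> J"
      using that(1) by (simp add: J_def)
    then have "f C' \<rho> = 0"
      using f that(2) by simp
    then show False
      using that(3) \<open>finite J\<close> \<open>C' \<in> J\<close> by (auto simp: F_def prod_zero_iff)
  qed
  obtain h where h: "h \<in> reg (rep_space N d)"
    "(\<exists>p\<in>C. h p \<noteq> 0) \<and> (\<forall>p\<in>C. h p \<noteq> 0 \<longrightarrow> indecomposable N d p)"
    using ind unfolding generically_indecomposable_iff[OF compsD(1)[OF C]] by (rule bexE)
  let ?H = "\<lambda>p. F p * h p"
  have H: "?H \<in> reg (rep_space N d)"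
    using F h(1) by (simp add: reg.mult)
  have "\<exists>p\<in>C. ?H p \<noteq> 0"
    using compsD(1)[OF C] F h by (simp add: irr_def)
  then have dense: "dense_in (rep_space N d) {p \<in> C. ?H p \<noteq> 0} C"
    by (rule dense_in_open[OF compsD(1)[OF C] H])
  \<comment> \<open>A component is closed in its stratum and the stratum is constructible, so the
    component is constructible as well.\<close>
  have C_eq: "C = zeros (rep_space N d) {f \<in> reg (rep_space N d). \<forall>p\<in>C. f p = 0} \<inter> strat d u"
    using comps_closed[OF C] by (simp add: vcl_def)
  have "C \<in> constr (rep_space N d)"
    by (subst C_eq) (intro constr.inter constr_X_points[OF I \<tau>] constr_zeros[OF finite_gens_mat_space], simp)
  from constr.inter[OF this constr_neq[OF H]]
  have "C \<inter> {p \<in> pts (rep_space N d). ?H p \<noteq> 0} \<in> constr (rep_space N d)" .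
  also have "C \<inter> {p \<in> pts (rep_space N d). ?H p \<noteq> 0} = {p \<in> C. ?H p \<noteq> 0}"
    using compsD(3)[OF C] by (auto simp: pts_mat_space)
  finally have "{p \<in> C. ?H p \<noteq> 0} \<in> constr (rep_space N d)" .
  then have "generic_part \<T> (d, u, C) {p \<in> C. ?H p \<noteq> 0}"
    unfolding generic_part_def using dense F0 h(2) by simp
  then show ?thesis ..
qed

text \<open>The description is meaningful for classes of generic points only. It is stated on
  classes so that it can be applied to the multisets that Krull-Schmidt compares.\<close>

definition comp_of_class ::
  "(nat \<times> nat \<times> 'k mat list set) set \<Rightarrow> (nat \<times> 'k mat list) set \<Rightarrow> nat \<times> nat \<times> 'k mat list set" where
  "comp_of_class \<T> A = (THE T. T \<in> \<T> \<and> (\<exists>y\<in>A. fst T = fst y \<and> snd y \<in> snd (snd T)))"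

text \<open>If an isomorphic copy of \<open>\<rho>\<close> lies on a listed component, so does
  \<open>\<rho>\<close>, as components are stable under conjugation. The Hom dimension then fixes
  \<open>u\<close>, and genericity of \<open>\<rho>\<close> fixes the component.\<close>

lemma comp_of_class_eq:
  assumes comps: "\<forall>(d, u, C)\<in>\<T>. C \<in> comps d u" and T: "(d, u, C) \<in> \<T>"
    and A: "generic_part \<T> (d, u, C) A" and \<rho>: "\<rho> \<in> A"
  shows "comp_of_class \<T> {y. rep_iso N (d, \<rho>) y} = (d, u, C)"
proof -
  have C: "C \<in> comps d u"
    using comps T by auto
  have \<rho>C: "\<rho> \<in> C"
    using A \<rho> by (auto simp: generic_part_def dense_in_def)
  then have t: "\<rho> \<in> mat_tuples N d" "\<rho> \<in> strat d u"
    using compsD(2,3)[OF C] by auto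
  show ?thesis
    unfolding comp_of_class_def
  proof (rule the_equality)
    show "(d, u, C) \<in> \<T> \<and> (\<exists>y\<in>{y. rep_iso N (d, \<rho>) y}. fst (d, u, C) = fst y \<and> snd y \<in> snd (snd (d, u, C)))"
      using T \<rho>C rep_iso_refl[OF t(1)] by (intro conjI bexI[of _ "(d, \<rho>)"]) simp_all
    fix T' assume T': "T' \<in> \<T> \<and> (\<exists>y\<in>{y. rep_iso N (d, \<rho>) y}. fst T' = fst y \<and> snd y \<in> snd (snd T'))"
    then obtain y where y: "rep_iso N (d, \<rho>) y" "fst T' = fst y" "snd y \<in> snd (snd T')"
      by auto
    obtain e v C' where T'_eq: "T' = (e, v, C')"
      by (cases T')
    from y(1) obtain g h where g: "inverse_pair d g h" "snd y = conj_tuple g h \<rho>" and "e = d"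
      using y(2) by (auto simp: rep_iso_def T'_eq)
    have C': "C' \<in> comps d v" "(d, v, C') \<in> \<T>"
      using T' comps by (auto simp: T'_eq \<open>e = d\<close>)
    have "conj_tuple h g (snd y) \<in> C'"
      using y(3) by (intro comps_conj[OF C'(1) _ inverse_pair_sym[OF g(1)]]) (simp add: T'_eq)
    then have "\<rho> \<in> C'"
      unfolding g(2) conj_tuple_inverse[OF g(1) t(1)] .
    moreover from this have "v = u"
      using compsD(2)[OF C'(1)] t(2) by (auto simp: X_points_def)
    ultimately show "T' = (d, u, C)"
      using A \<rho> C'(2) by (auto simp: generic_part_def T'_eq \<open>e = d\<close>)
  qed
qed

text \<open>The third claim is the invariant behind uniqueness: the list is recovered, as a
  multiset, from the indecomposable summands of any single point of its generic image.\<close>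

lemma sum_image_generic:
  assumes comps: "\<forall>(d, u, C)\<in>\<T>. C \<in> comps d u" and G: "\<forall>T\<in>\<T>. generic_part \<T> T (G T)"
    and Zs: "set Zs \<subseteq> \<T>" and dec: "component_decomposition N I m \<tau> d u X Zs"
  shows "dense_in (rep_space N d) (sum_image N d (map G Zs)) X"
    and "sum_image N d (map G Zs) \<in> constr (rep_space N d)"
    and "p \<in> sum_image N d (map G Zs) \<Longrightarrow>
      \<exists>xs. (\<forall>(d, \<rho>)\<in>set xs. \<rho> \<in> mat_tuples N d \<and> indecomposable N d \<rho>) \<and>
        rep_iso N (sum_list (map fst xs), rep_sum N (map snd xs)) (d, p) \<and>
        image_mset (comp_of_class \<T>) (image_mset (\<lambda>x. {y. rep_iso N x y}) (mset xs)) = mset Zs"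
proof -
  note dec = dec[unfolded decomposition_iff]
  have d: "sum_list (map fst Zs) = d"
    using dec by (simp add: case_prod_unfold)
  have GZ: "generic_part \<T> z (G z)" if "z \<in> set Zs" for z
    using G Zs that by auto
  let ?tr = "map (\<lambda>(d, u, C). (d, G (d, u, C), C)) Zs"
  have maps: "map fst ?tr = map fst Zs" "map (fst \<circ> snd) ?tr = map G Zs"
    "map (snd \<circ> snd) ?tr = map (\<lambda>(d, u, C). C) Zs"
    by (simp_all add: case_prod_unfold)
  have "\<forall>(d, A, C)\<in>set ?tr. dense_in (rep_space N d) A C"
    using GZ by (auto simp: generic_part_def)
  from dense_in_sum_image[OF this]
  have "dense_in (rep_space N d) (sum_image N d (map G Zs)) (sum_image N d (map (\<lambda>(d, u, C). C) Zs))"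
    unfolding maps d .
  moreover have "dense_in (rep_space N d) (sum_image N d (map (\<lambda>(d, u, C). C) Zs)) X"
    using dense_in_vcl[OF decomposition_eq(2) strat_subset_pts, of Zs d u] dec by simp
  ultimately show "dense_in (rep_space N d) (sum_image N d (map G Zs)) X"
    by (rule dense_in_trans)
  let ?pr = "map (\<lambda>(d, u, C). (d, G (d, u, C))) Zs"
  have maps': "map fst ?pr = map fst Zs" "map snd ?pr = map G Zs"
    by (simp_all add: case_prod_unfold)
  have "\<forall>(d, A)\<in>set ?pr. A \<in> constr (rep_space N d)"
    using GZ by (auto simp: generic_part_def)
  from constr_sum_image[OF this] show "sum_image N d (map G Zs) \<in> constr (rep_space N d)"
    unfolding maps' d .
  assume "p \<in> sum_image N d (map G Zs)"
  then obtain g h \<rho>s where g: "inverse_pair d g h" and \<rho>s: "\<rho>s \<in> listset (map G Zs)" and p: "p = conj_tuple g h (rep_sum N \<rho>s)"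
    by (rule sum_imageE)
  have len: "length \<rho>s = length Zs" and nth: "\<And>i. i < length Zs \<Longrightarrow> \<rho>s ! i \<in> G (Zs ! i)"
    using \<rho>s by (auto simp: listset_iff list_all2_conv_all_nth)
  \<comment> \<open>The dimensions are supplied by \<open>Zs\<close>, the representations by the
    chosen summands.\<close>
  define xs where "xs = zip (map fst Zs) \<rho>s"
  have xs: "map fst xs = map fst Zs" "map snd xs = \<rho>s" "length xs = length Zs"
    using len by (simp_all add: xs_def)
  have step: "\<rho>s ! i \<in> mat_tuples N (fst (Zs ! i)) \<and> indecomposable N (fst (Zs ! i)) (\<rho>s ! i) \<and>
      comp_of_class \<T> {y. rep_iso N (fst (Zs ! i), \<rho>s ! i) y} = Zs ! i" if "i < length Zs" for i
  proof -
    obtain d u C where z: "Zs ! i = (d, u, C)"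
      by (cases "Zs ! i")
    have T: "(d, u, C) \<in> \<T>" and A: "generic_part \<T> (d, u, C) (G (d, u, C))"
      using nth_mem[OF that] Zs GZ by (auto simp: z)
    have \<rho>: "\<rho>s ! i \<in> G (d, u, C)"
      using nth[OF that] by (simp add: z)
    then have "indecomposable N d (\<rho>s ! i)" "\<rho>s ! i \<in> mat_tuples N d"
      using A by (auto simp: generic_part_def dense_in_def pts_mat_space)
    then show ?thesis
      using comp_of_class_eq[OF comps T A \<rho>] by (simp add: z)
  qed
  have xs_nth: "xs ! i = (fst (Zs ! i), \<rho>s ! i)" if "i < length Zs" for i
    using that len by (simp add: xs_def)
  have 1: "\<forall>(d, \<rho>)\<in>set xs. \<rho> \<in> mat_tuples N d \<and> indecomposable N d \<rho>"
  proof
    fix x assume "x \<in> set xs"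
    then obtain i where "i < length Zs" "x = xs ! i"
      using xs(3) by (auto simp: in_set_conv_nth)
    then show "case x of (d, \<rho>) \<Rightarrow> \<rho> \<in> mat_tuples N d \<and> indecomposable N d \<rho>"
      using step xs_nth by simp
  qed
  then have "rep_sum N (map snd xs) \<in> mat_tuples N (sum_list (map fst xs))"
    by (intro rep_sum_mat_tuples) auto
  then have 2: "rep_iso N (sum_list (map fst xs), rep_sum N (map snd xs)) (d, p)"
    using g p unfolding rep_iso_def xs(1,2) d by auto
  have "map (\<lambda>x. comp_of_class \<T> {y. rep_iso N x y}) xs = Zs"
    using step xs_nth xs(3) by (intro nth_equalityI) simp_all
  then have "image_mset (\<lambda>x. comp_of_class \<T> {y. rep_iso N x y}) (mset xs) = mset Zs"
    by (metis mset_map)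
  then have 3: "image_mset (comp_of_class \<T>) (image_mset (\<lambda>x. {y. rep_iso N x y}) (mset xs)) = mset Zs"
    by (simp add: image_mset.compositionality o_def)
  show "\<exists>xs. (\<forall>(d, \<rho>)\<in>set xs. \<rho> \<in> mat_tuples N d \<and> indecomposable N d \<rho>) \<and>
        rep_iso N (sum_list (map fst xs), rep_sum N (map snd xs)) (d, p) \<and>
        image_mset (comp_of_class \<T>) (image_mset (\<lambda>x. {y. rep_iso N x y}) (mset xs)) = mset Zs"
    using 1 2 3 by (intro exI[of _ xs] conjI)
qed

lemma decomposition_unique:
  assumes X: "X \<in> comps d u" and Xs: "component_decomposition N I m \<tau> d u X Xs"
    and Ys: "component_decomposition N I m \<tau> d u X Ys"
  shows "mset Xs = mset Ys"
proof -
  \<comment> \<open>Genericity is asked relative to the components of both lists together, so that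
    one function \<open>comp_of_class\<close> serves both.\<close>
  define \<T> where "\<T> = set Xs \<union> set Ys"
  have "finite \<T>"
    by (simp add: \<T>_def)
  have comps: "\<forall>(d, u, C)\<in>\<T>. C \<in> comps d u" and ind: "\<forall>(d, u, C)\<in>\<T>. generically_indecomposable N d C"
    using Xs Ys unfolding decomposition_iff \<T>_def by auto
  have "\<forall>T\<in>\<T>. \<exists>A. generic_part \<T> T A"
  proof
    fix T assume "T \<in> \<T>"
    moreover obtain e v C where T: "T = (e, v, C)"
      by (cases T)
    ultimately have "(e, v, C) \<in> \<T>" "generically_indecomposable N e C"
      using ind by auto
    then show "\<exists>A. generic_part \<T> T A"
      unfolding T by (rule ex_generic_part[OF \<open>finite \<T>\<close> comps])
  qed
  from bchoice[OF this] obtain G where G: "\<forall>T\<in>\<T>. generic_part \<T> T (G T)" ..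
  have sub: "set Xs \<subseteq> \<T>" "set Ys \<subseteq> \<T>"
    by (simp_all add: \<T>_def)
  note SX = sum_image_generic[OF comps G sub(1) Xs] and SY = sum_image_generic[OF comps G sub(2) Ys]
  \<comment> \<open>The image for \<open>Ys\<close> contains a nonempty open part of
    \<open>X\<close>, which the dense image for \<open>Xs\<close> must meet.\<close>
  from constr_dense_generic[OF compsD(1)[OF X] SY(1,2) order_refl]
  obtain f where f: "f \<in> reg (rep_space N d)" "(\<exists>p\<in>X. f p \<noteq> 0) \<and>
      (\<forall>p\<in>X. f p \<noteq> 0 \<longrightarrow> p \<in> sum_image N d (map G Ys))"
    by (rule bexE)
  then have "\<exists>p\<in>sum_image N d (map G Xs). f p \<noteq> 0"
    using SX(1) by (simp add: dense_in_def)
  then obtain p where p: "p \<in> sum_image N d (map G Xs)" "f p \<noteq> 0"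
    by (rule bexE)
  moreover have "p \<in> X"
    using SX(1) p(1) by (auto simp: dense_in_def)
  ultimately have p': "p \<in> sum_image N d (map G Ys)"
    using f(2) by simp
  from SX(3)[OF p(1)] obtain xs where
    xs: "\<forall>(d, \<rho>)\<in>set xs. \<rho> \<in> mat_tuples N d \<and> indecomposable N d \<rho>"
      "rep_iso N (sum_list (map fst xs), rep_sum N (map snd xs)) (d, p)"
      "image_mset (comp_of_class \<T>) (image_mset (\<lambda>x. {y. rep_iso N x y}) (mset xs)) = mset Xs"
    by (elim exE conjE)
  from SY(3)[OF p'] obtain ys where
    ys: "\<forall>(d, \<rho>)\<in>set ys. \<rho> \<in> mat_tuples N d \<and> indecomposable N d \<rho>"
      "rep_iso N (sum_list (map fst ys), rep_sum N (map snd ys)) (d, p)"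
      "image_mset (comp_of_class \<T>) (image_mset (\<lambda>x. {y. rep_iso N x y}) (mset ys)) = mset Ys"
    by (elim exE conjE)
  \<comment> \<open>Both multisets are images of the same multiset of isomorphism classes under the
    same map.\<close>
  show ?thesis
    unfolding xs(3)[symmetric] ys(3)[symmetric]
      krull_schmidt[OF xs(1) ys(1) rep_iso_trans[OF xs(2) rep_iso_sym[OF ys(2)]]] ..
qed

end

theorem theorem6p8:
  fixes I :: "'k::alg_closed_field nc_poly set"
    and \<tau> :: "'k mat list"
    and X :: "'k mat list set"
    and N m d u :: nat
  assumes "two_sided_ideal N I"
    and "\<tau> \<in> rep N I m"
    and "X \<in> irreducible_components (X_space N I m \<tau> d u)"
  shows "\<exists>Xs. component_decomposition N I m \<tau> d u X Xs \<and>
           (\<forall>Ys. component_decomposition N I m \<tau> d u X Ys \<longrightarrow> mset Ys = mset Xs)"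
proof -
  from decomposition_exists[OF assms] obtain Xs where Xs: "component_decomposition N I m \<tau> d u X Xs" ..
  show ?thesis
  proof (intro exI[of _ Xs] conjI allI impI)
    show "component_decomposition N I m \<tau> d u X Xs"
      by (rule Xs)
    show "mset Ys = mset Xs" if "component_decomposition N I m \<tau> d u X Ys" for Ys
      by (rule decomposition_unique[OF assms that Xs])
  qed
qed

end
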